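(* Let $(A,\mathfrak{m})$ be a hypersurface local ring of dimension $d=1$. Let $M$ be a maximal Cohen-Macaulay $A$-module having constant rank. Let $I$ be an ideal of $A$ which is locally a complete intersection, with $\operatorname{ht}(I)=0$ and $l(I)=1$. Then the following conditions are equivalent: (i) $\deg t_I^A(M,z)<0$; (ii) $M$ is a free $A$-module.
   Context: A hypersurface ring is a Noetherian local ring $(A,\mathfrak{m})$ whose $\mathfrak{m}$-adic completion is isomorphic to $S/(f)$ with $S$ a regular local ring and $f$ a nonzero element of the maximal ideal of $S$. $M$ has constant rank if there is an integer $r$ such that $M_P\cong A_P^r$ for every associated prime $P$ of $A$. $l(I)=\dim F(I)$, where $F(I)=\bigoplus_{n\ge0}I^n/\mathfrak{m}I^n$. "$I$ is locally a complete intersection" means that for every minimal prime $P$ of $I$ the ideal $I_P$ is generated by an $A_P$-regular sequence (of length $\operatorname{ht}P$; in particular $I_P=0$ if $\operatorname{ht}P=0$). Let $\ell$ denote length. Under the stated hypotheses $\ell(\operatorname{Tor}_1^A(M,A/I^{n+1}))<\infty$ for $n\gg0$, and (Kodiyalam) there is a polynomial $t_I^A(M,z)\in\mathbb{Q}[z]$ of degree at most $l(I)-1$ with $t_I^A(M,n)=\ell(\operatorname{Tor}_1^A(M,A/I^{n+1}))$ for all $n\gg0$. The degree of the zero polynomial is $-\infty$ (so condition (i) says that $t_I^A(M,z)$ is the zero polynomial). *)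

theory Defs
  imports
    "HOL-Algebra.Ring_Divisibility"
    "HOL-Algebra.Ideal_Product"
    "HOL-Algebra.QuotRing"
    "HOL-Algebra.Module"
    "HOL-Library.Extended_Nat"
    "HOL-Library.Extended_Real"
    "HOL-Computational_Algebra.Polynomial"
begin

hide_const (open) Polynomial.smult

section \<open>Modules\<close>

text \<open>The record type of modules extends that of rings, so it has fields for a multiplication and
  a unit. They play no role in the locale \<^locale>\<open>module\<close> and are left unspecified.\<close>

definition mk_module ::
    "'m set \<Rightarrow> 'm \<Rightarrow> ('m \<Rightarrow> 'm \<Rightarrow> 'm) \<Rightarrow> ('a \<Rightarrow> 'm \<Rightarrow> 'm) \<Rightarrow> ('a, 'm) module"
  where "mk_module C z p s =
    \<lparr>carrier = C, mult = (\<lambda>_ _. undefined), one = undefined, zero = z, add = p, smult = s\<rparr>"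

definition ring_module :: "('a, 'k) ring_scheme \<Rightarrow> ('a, 'a) module"
  where "ring_module R = mk_module (carrier R) \<zero>\<^bsub>R\<^esub> (add R) (mult R)"

definition quot_module :: "('a, 'm) module \<Rightarrow> 'm set \<Rightarrow> ('a, 'm set) module"
  where "quot_module M N = mk_module (a_rcosets\<^bsub>M\<^esub> N) N (set_add M)
    (\<lambda>a X. \<Union>x\<in>X. N +>\<^bsub>M\<^esub> (a \<odot>\<^bsub>M\<^esub> x))"

definition gen_submodule :: "('a, 'k) ring_scheme \<Rightarrow> ('a, 'm) module \<Rightarrow> 'm set \<Rightarrow> 'm set"
  where "gen_submodule R M X = \<Inter>{N. submodule N R M \<and> X \<subseteq> N}"

definition ideal_smult :: "('a, 'k) ring_scheme \<Rightarrow> 'a set \<Rightarrow> ('a, 'm) module \<Rightarrow> 'm set"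
  where "ideal_smult R J M = gen_submodule R M {a \<odot>\<^bsub>M\<^esub> x | a x. a \<in> J \<and> x \<in> carrier M}"

definition finitely_generated :: "('a, 'k) ring_scheme \<Rightarrow> ('a, 'm) module \<Rightarrow> bool"
  where "finitely_generated R M \<longleftrightarrow>
    (\<exists>X \<subseteq> carrier M. finite X \<and> gen_submodule R M X = carrier M)"

definition module_iso :: "('a, 'k) ring_scheme \<Rightarrow> ('a, 'm) module \<Rightarrow> ('a, 'n) module \<Rightarrow> bool"
  where "module_iso R M N \<longleftrightarrow> (\<exists>h. bij_betw h (carrier M) (carrier N) \<and>
    (\<forall>x\<in>carrier M. \<forall>y\<in>carrier M. h (x \<oplus>\<^bsub>M\<^esub> y) = h x \<oplus>\<^bsub>N\<^esub> h y) \<and>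
    (\<forall>a\<in>carrier R. \<forall>x\<in>carrier M. h (a \<odot>\<^bsub>M\<^esub> x) = a \<odot>\<^bsub>N\<^esub> h x))"

definition module_length :: "('a, 'k) ring_scheme \<Rightarrow> ('a, 'm) module \<Rightarrow> enat"
  where "module_length R M = Sup {enat n | n C.
    (\<forall>i\<le>n. submodule (C i) R M) \<and> (\<forall>i<n. C i \<subset> C (Suc i))}"

text \<open>The free module \<open>R\<^sup>(\<^sup>X\<^sup>)\<close> of finitely supported families \<open>X \<rightarrow> R\<close>, extended by zero outside
  \<open>X\<close>; in particular \<open>R\<^sup>r\<close> is \<open>free_module R {..<r}\<close>.\<close>

definition free_module :: "('a, 'k) ring_scheme \<Rightarrow> 'x set \<Rightarrow> ('a, 'x \<Rightarrow> 'a) module"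
  where "free_module R X = mk_module
    {f. (\<forall>x. f x \<in> carrier R) \<and> (\<forall>x. x \<notin> X \<longrightarrow> f x = \<zero>\<^bsub>R\<^esub>) \<and> finite {x. f x \<noteq> \<zero>\<^bsub>R\<^esub>}}
    (\<lambda>x. \<zero>\<^bsub>R\<^esub>) (\<lambda>f g x. f x \<oplus>\<^bsub>R\<^esub> g x) (\<lambda>a f x. a \<otimes>\<^bsub>R\<^esub> f x)"

definition lin_comb :: "('a, 'k) ring_scheme \<Rightarrow> ('a, 'm) module \<Rightarrow> ('m \<Rightarrow> 'a) \<Rightarrow> 'm"
  where "lin_comb R M f = (\<Oplus>\<^bsub>M\<^esub>x\<in>{x. f x \<noteq> \<zero>\<^bsub>R\<^esub>}. f x \<odot>\<^bsub>M\<^esub> x)"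

definition is_free_module :: "('a, 'k) ring_scheme \<Rightarrow> ('a, 'm) module \<Rightarrow> bool"
  where "is_free_module R M \<longleftrightarrow> module R M \<and>
    (\<exists>B \<subseteq> carrier M. bij_betw (lin_comb R M) (carrier (free_module R B)) (carrier M))"


section \<open>Tensor products and Tor\<close>

text \<open>\<open>M \<otimes>\<^sub>R N\<close> is the free module on \<open>M \<times> N\<close> modulo the bilinearity relations;
  \<open>tensor_gen\<close> gives the basis elements of that free module.\<close>

definition tensor_gen :: "('a, 'k) ring_scheme \<Rightarrow> 'm \<Rightarrow> 'n \<Rightarrow> 'm \<times> 'n \<Rightarrow> 'a"
  where "tensor_gen R x y = (\<lambda>q. if q = (x, y) then \<one>\<^bsub>R\<^esub> else \<zero>\<^bsub>R\<^esub>)"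

definition tensor_rel ::
    "('a, 'k) ring_scheme \<Rightarrow> ('a, 'm) module \<Rightarrow> ('a, 'n) module \<Rightarrow> ('m \<times> 'n \<Rightarrow> 'a) set"
  where "tensor_rel R M N =
    (let F = free_module R (carrier M \<times> carrier N); e = tensor_gen R in
      gen_submodule R F
       ({e (x \<oplus>\<^bsub>M\<^esub> x') y \<ominus>\<^bsub>F\<^esub> (e x y \<oplus>\<^bsub>F\<^esub> e x' y) | x x' y.
           x \<in> carrier M \<and> x' \<in> carrier M \<and> y \<in> carrier N} \<union>
        {e x (y \<oplus>\<^bsub>N\<^esub> y') \<ominus>\<^bsub>F\<^esub> (e x y \<oplus>\<^bsub>F\<^esub> e x y') | x y y'.
           x \<in> carrier M \<and> y \<in> carrier N \<and> y' \<in> carrier N} \<union>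
        {e (a \<odot>\<^bsub>M\<^esub> x) y \<ominus>\<^bsub>F\<^esub> (a \<odot>\<^bsub>F\<^esub> e x y) | a x y.
           a \<in> carrier R \<and> x \<in> carrier M \<and> y \<in> carrier N} \<union>
        {e x (a \<odot>\<^bsub>N\<^esub> y) \<ominus>\<^bsub>F\<^esub> (a \<odot>\<^bsub>F\<^esub> e x y) | a x y.
           a \<in> carrier R \<and> x \<in> carrier M \<and> y \<in> carrier N}))"

definition tensor ::
    "('a, 'k) ring_scheme \<Rightarrow> ('a, 'm) module \<Rightarrow> ('a, 'n) module \<Rightarrow> ('a, ('m \<times> 'n \<Rightarrow> 'a) set) module"
  where "tensor R M N =
    quot_module (free_module R (carrier M \<times> carrier N)) (tensor_rel R M N)"

text \<open>The map \<open>h \<otimes> N : M \<otimes> N \<rightarrow> M' \<otimes> N\<close> induced by \<open>h : M \<rightarrow> M'\<close>: the class of a formal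
  combination of pairs \<open>(x, y)\<close> goes to the class of the same combination of the \<open>(h x, y)\<close>.\<close>

definition tensor_map ::
    "('a, 'k) ring_scheme \<Rightarrow> ('a, 'm') module \<Rightarrow> ('a, 'n) module \<Rightarrow> ('m \<Rightarrow> 'm') \<Rightarrow>
      ('m \<times> 'n \<Rightarrow> 'a) set \<Rightarrow> ('m' \<times> 'n \<Rightarrow> 'a) set"
  where "tensor_map R M' N h C =
    (\<Union>f\<in>C. tensor_rel R M' N +>\<^bsub>free_module R (carrier M' \<times> carrier N)\<^esub>
      (\<lambda>(x', y). \<Oplus>\<^bsub>R\<^esub>x\<in>{x. f (x, y) \<noteq> \<zero>\<^bsub>R\<^esub> \<and> h x = x'}. f (x, y)))"

definition syzygy :: "('a, 'k) ring_scheme \<Rightarrow> ('a, 'm) module \<Rightarrow> ('a, 'm \<Rightarrow> 'a) module"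
  where "syzygy R M = (free_module R (carrier M))
    \<lparr>carrier := a_kernel (free_module R (carrier M)) M (lin_comb R M)\<rparr>"

text \<open>\<open>Tor\<^sub>1\<close> is the first homology of \<open>F\<^sub>2 \<otimes> N \<rightarrow> F\<^sub>1 \<otimes> N \<rightarrow> F\<^sub>0 \<otimes> N\<close>, where
  \<open>F\<^sub>2 \<rightarrow> F\<^sub>1 \<rightarrow> F\<^sub>0 \<rightarrow> M \<rightarrow> 0\<close> is the standard free resolution of \<open>M\<close>: \<open>F\<^sub>0\<close> is free on the elements
  of \<open>M\<close>, \<open>F\<^sub>1\<close> on those of the kernel of \<open>F\<^sub>0 \<rightarrow> M\<close>, and so on.\<close>

definition Tor1 ::
    "('a, 'k) ring_scheme \<Rightarrow> ('a, 'm) module \<Rightarrow> ('a, 'n) module \<Rightarrow>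
      ('a, ((('m \<Rightarrow> 'a) \<Rightarrow> 'a) \<times> 'n \<Rightarrow> 'a) set set) module"
  where "Tor1 R M N =
    (let M1 = syzygy R M; M2 = syzygy R M1;
         F0 = free_module R (carrier M);
         F1 = free_module R (carrier M1);
         F2 = free_module R (carrier M2);
         d1 = lin_comb R M1; d2 = lin_comb R M2
     in quot_module
          ((tensor R F1 N)
             \<lparr>carrier := a_kernel (tensor R F1 N) (tensor R F0 N) (tensor_map R F0 N d1)\<rparr>)
          (tensor_map R F1 N d2 ` carrier (tensor R F2 N)))"


section \<open>Dimension, regular sequences, depth\<close>

definition prime_chain :: "('a, 'k) ring_scheme \<Rightarrow> nat \<Rightarrow> (nat \<Rightarrow> 'a set) \<Rightarrow> bool"
  where "prime_chain R n C \<longleftrightarrow>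
    (\<forall>i\<le>n. primeideal (C i) R) \<and> (\<forall>i<n. C i \<subset> C (Suc i))"

definition krull_dim :: "('a, 'k) ring_scheme \<Rightarrow> enat"
  where "krull_dim R = Sup {enat n | n C. prime_chain R n C}"

definition prime_height :: "('a, 'k) ring_scheme \<Rightarrow> 'a set \<Rightarrow> enat"
  where "prime_height R P = Sup {enat n | n C. prime_chain R n C \<and> C n = P}"

text \<open>The unit ideal has height \<open>\<infinity>\<close>, as the infimum of the empty set.\<close>

definition ideal_height :: "('a, 'k) ring_scheme \<Rightarrow> 'a set \<Rightarrow> enat"
  where "ideal_height R I = Inf {prime_height R P | P. primeideal P R \<and> I \<subseteq> P}"

definition minimal_prime_over :: "('a, 'k) ring_scheme \<Rightarrow> 'a set \<Rightarrow> 'a set \<Rightarrow> bool"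
  where "minimal_prime_over R I P \<longleftrightarrow> primeideal P R \<and> I \<subseteq> P \<and>
    (\<forall>Q. primeideal Q R \<and> I \<subseteq> Q \<and> Q \<subseteq> P \<longrightarrow> Q = P)"

definition associated_prime :: "('a, 'k) ring_scheme \<Rightarrow> 'a set \<Rightarrow> bool"
  where "associated_prime R P \<longleftrightarrow> primeideal P R \<and>
    (\<exists>a\<in>carrier R. P = {x \<in> carrier R. x \<otimes>\<^bsub>R\<^esub> a = \<zero>\<^bsub>R\<^esub>})"

definition regular_sequence :: "('a, 'k) ring_scheme \<Rightarrow> ('a, 'm) module \<Rightarrow> 'a list \<Rightarrow> bool"
  where "regular_sequence R M xs \<longleftrightarrow> set xs \<subseteq> carrier R \<and>
    (\<forall>i<length xs.
       let Q = quot_module M (ideal_smult R (Idl\<^bsub>R\<^esub> (set (take i xs))) M)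
       in \<forall>y\<in>carrier Q. (xs ! i) \<odot>\<^bsub>Q\<^esub> y = \<zero>\<^bsub>Q\<^esub> \<longrightarrow> y = \<zero>\<^bsub>Q\<^esub>) \<and>
    ideal_smult R (Idl\<^bsub>R\<^esub> (set xs)) M \<noteq> carrier M"

definition depth :: "('a, 'k) ring_scheme \<Rightarrow> 'a set \<Rightarrow> ('a, 'm) module \<Rightarrow> enat"
  where "depth R m M = Sup {enat (length xs) | xs. set xs \<subseteq> m \<and> regular_sequence R M xs}"


section \<open>Local rings\<close>

definition noetherian_local_ring :: "('a, 'k) ring_scheme \<Rightarrow> 'a set \<Rightarrow> bool"
  where "noetherian_local_ring R m \<longleftrightarrow>
    cring R \<and> noetherian_ring R \<and> {J. maximalideal J R} = {m}"

definition regular_local_ring :: "('a, 'k) ring_scheme \<Rightarrow> 'a set \<Rightarrow> bool"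
  where "regular_local_ring R m \<longleftrightarrow> noetherian_local_ring R m \<and>
    (\<exists>X \<subseteq> carrier R. finite X \<and> enat (card X) = krull_dim R \<and> m = Idl\<^bsub>R\<^esub> X)"

abbreviation ideal_pow :: "('a, 'k) ring_scheme \<Rightarrow> 'a set \<Rightarrow> nat \<Rightarrow> 'a set"
  where "ideal_pow R I n \<equiv> I [^]\<^bsub>ideals_set R\<^esub> n"

text \<open>The inverse limit of the rings \<open>R/m\<^sup>n\<close>. The transition map \<open>R/m\<^sup>n\<^sup>+\<^sup>1 \<rightarrow> R/m\<^sup>n\<close> sends a coset
  to the unique coset of \<open>m\<^sup>n\<close> containing it.\<close>

definition adic_completion :: "('a, 'k) ring_scheme \<Rightarrow> 'a set \<Rightarrow> (nat \<Rightarrow> 'a set) ring"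
  where "adic_completion R m =
    \<lparr>carrier = {x. \<forall>n. x n \<in> carrier (R Quot (ideal_pow R m n)) \<and> x (Suc n) \<subseteq> x n},
     mult = (\<lambda>x y n. x n \<otimes>\<^bsub>R Quot (ideal_pow R m n)\<^esub> y n),
     one = (\<lambda>n. \<one>\<^bsub>R Quot (ideal_pow R m n)\<^esub>),
     zero = (\<lambda>n. \<zero>\<^bsub>R Quot (ideal_pow R m n)\<^esub>),
     add = (\<lambda>x y n. x n \<oplus>\<^bsub>R Quot (ideal_pow R m n)\<^esub> y n)\<rparr>"

text \<open>HOL cannot quantify existentially over types, so the type \<open>'s\<close> in which the regular local
  ring \<open>S\<close> lives is a parameter. A hypothesis \<open>hypersurface_ring TYPE('s) R m\<close> with \<open>'s\<close> free in a
  theorem is implicitly universally quantified over \<open>'s\<close> and hence puts no restriction on \<open>S\<close>.\<close>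

definition hypersurface_ring :: "'s itself \<Rightarrow> ('a, 'k) ring_scheme \<Rightarrow> 'a set \<Rightarrow> bool"
  where "hypersurface_ring TYPE('s) R m \<longleftrightarrow> noetherian_local_ring R m \<and>
    (\<exists>(S :: 's ring) n f. regular_local_ring S n \<and> f \<in> n \<and> f \<noteq> \<zero>\<^bsub>S\<^esub> \<and>
       adic_completion R m \<simeq> S Quot (PIdl\<^bsub>S\<^esub> f))"

definition maximal_cohen_macaulay :: "('a, 'k) ring_scheme \<Rightarrow> 'a set \<Rightarrow> ('a, 'm) module \<Rightarrow> bool"
  where "maximal_cohen_macaulay R m M \<longleftrightarrow> module R M \<and> finitely_generated R M \<and>
    carrier M \<noteq> {\<zero>\<^bsub>M\<^esub>} \<and> depth R m M = krull_dim R"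


section \<open>Localization at a prime\<close>

text \<open>\<open>frac R P M x s\<close> is the fraction \<open>x/s\<close> in \<open>M\<^sub>P\<close>, as an equivalence class of pairs.\<close>

definition frac ::
    "('a, 'k) ring_scheme \<Rightarrow> 'a set \<Rightarrow> ('a, 'm) module \<Rightarrow> 'm \<Rightarrow> 'a \<Rightarrow> ('m \<times> 'a) set"
  where "frac R P M x s = {(y, t). y \<in> carrier M \<and> t \<in> carrier R - P \<and>
    (\<exists>u\<in>carrier R - P. u \<odot>\<^bsub>M\<^esub> (t \<odot>\<^bsub>M\<^esub> x) = u \<odot>\<^bsub>M\<^esub> (s \<odot>\<^bsub>M\<^esub> y))}"

definition loc_module ::
    "('a, 'k) ring_scheme \<Rightarrow> 'a set \<Rightarrow> ('a, 'm) module \<Rightarrow> (('a \<times> 'a) set, ('m \<times> 'a) set) module"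
  where "loc_module R P M = mk_module
    {frac R P M x s | x s. x \<in> carrier M \<and> s \<in> carrier R - P}
    (frac R P M \<zero>\<^bsub>M\<^esub> \<one>\<^bsub>R\<^esub>)
    (\<lambda>X Y. \<Union>(x, s)\<in>X. \<Union>(y, t)\<in>Y. frac R P M (t \<odot>\<^bsub>M\<^esub> x \<oplus>\<^bsub>M\<^esub> s \<odot>\<^bsub>M\<^esub> y) (s \<otimes>\<^bsub>R\<^esub> t))
    (\<lambda>X Y. \<Union>(a, s)\<in>X. \<Union>(y, t)\<in>Y. frac R P M (a \<odot>\<^bsub>M\<^esub> y) (s \<otimes>\<^bsub>R\<^esub> t))"

definition loc_ring :: "('a, 'k) ring_scheme \<Rightarrow> 'a set \<Rightarrow> ('a \<times> 'a) set ring"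
  where "loc_ring R P = (let L = loc_module R P (ring_module R) in
    \<lparr>carrier = carrier L, mult = smult L, one = frac R P (ring_module R) \<one>\<^bsub>R\<^esub> \<one>\<^bsub>R\<^esub>,
     zero = zero L, add = add L\<rparr>)"

definition loc_ideal :: "('a, 'k) ring_scheme \<Rightarrow> 'a set \<Rightarrow> 'a set \<Rightarrow> ('a \<times> 'a) set set"
  where "loc_ideal R P I = {frac R P (ring_module R) a s | a s. a \<in> I \<and> s \<in> carrier R - P}"

definition constant_rank :: "('a, 'k) ring_scheme \<Rightarrow> ('a, 'm) module \<Rightarrow> bool"
  where "constant_rank R M \<longleftrightarrow> (\<exists>r::nat. \<forall>P. associated_prime R P \<longrightarrow>
    module_iso (loc_ring R P) (loc_module R P M) (free_module (loc_ring R P) {..<r}))"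

definition locally_complete_intersection :: "('a, 'k) ring_scheme \<Rightarrow> 'a set \<Rightarrow> bool"
  where "locally_complete_intersection R I \<longleftrightarrow> (\<forall>P. minimal_prime_over R I P \<longrightarrow>
    (\<exists>xs. regular_sequence (loc_ring R P) (ring_module (loc_ring R P)) xs \<and>
       enat (length xs) = prime_height R P \<and>
       loc_ideal R P I = Idl\<^bsub>loc_ring R P\<^esub> (set xs)))"


section \<open>Fiber cone and analytic spread\<close>

definition fiber_piece ::
    "('a, 'k) ring_scheme \<Rightarrow> 'a set \<Rightarrow> 'a set \<Rightarrow> nat \<Rightarrow> ('a, 'a set) module"
  where "fiber_piece R m I n =
    quot_module ((ring_module R)\<lparr>carrier := ideal_pow R I n\<rparr>) (m \<cdot>\<^bsub>R\<^esub> ideal_pow R I n)"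

text \<open>The direct sum of the \<open>I\<^sup>n/mI\<^sup>n\<close> as finitely supported families; the product is the
  convolution of the pairings \<open>I\<^sup>i/mI\<^sup>i \<times> I\<^sup>j/mI\<^sup>j \<rightarrow> I\<^sup>i\<^sup>+\<^sup>j/mI\<^sup>i\<^sup>+\<^sup>j\<close> induced by multiplication.\<close>

definition fiber_cone :: "('a, 'k) ring_scheme \<Rightarrow> 'a set \<Rightarrow> 'a set \<Rightarrow> (nat \<Rightarrow> 'a set) ring"
  where "fiber_cone R m I =
    \<lparr>carrier = {F. (\<forall>n. F n \<in> carrier (fiber_piece R m I n)) \<and>
                   finite {n. F n \<noteq> \<zero>\<^bsub>fiber_piece R m I n\<^esub>}},
     mult = (\<lambda>F G n. \<Oplus>\<^bsub>fiber_piece R m I n\<^esub>i\<in>{..n}.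
        \<Union>x\<in>F i. \<Union>y\<in>G (n - i). (m \<cdot>\<^bsub>R\<^esub> ideal_pow R I n) +>\<^bsub>R\<^esub> (x \<otimes>\<^bsub>R\<^esub> y)),
     one = (\<lambda>n. if n = 0 then (m \<cdot>\<^bsub>R\<^esub> ideal_pow R I 0) +>\<^bsub>R\<^esub> \<one>\<^bsub>R\<^esub>
                 else \<zero>\<^bsub>fiber_piece R m I n\<^esub>),
     zero = (\<lambda>n. \<zero>\<^bsub>fiber_piece R m I n\<^esub>),
     add = (\<lambda>F G n. F n \<oplus>\<^bsub>fiber_piece R m I n\<^esub> G n)\<rparr>"

definition analytic_spread :: "('a, 'k) ring_scheme \<Rightarrow> 'a set \<Rightarrow> 'a set \<Rightarrow> enat"
  where "analytic_spread R m I = krull_dim (fiber_cone R m I)"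


section \<open>The polynomial of the lengths of Tor\<close>

definition is_tor_polynomial ::
    "('a, 'k) ring_scheme \<Rightarrow> 'a set \<Rightarrow> ('a, 'm) module \<Rightarrow> rat poly \<Rightarrow> bool"
  where "is_tor_polynomial R I M t \<longleftrightarrow> (\<forall>\<^sub>F n in sequentially. \<exists>k::nat.
    module_length R (Tor1 R M (quot_module (ring_module R) (ideal_pow R I (n + 1)))) = enat k \<and>
    poly t (of_nat n) = of_nat k)"

text \<open>Uniqueness is clear, since a polynomial is determined by infinitely many values; existence
  is a theorem of Kodiyalam for \<open>R\<close> Noetherian local and \<open>M\<close> finitely generated, provided that the
  lengths are eventually finite.\<close>

definition tor_polynomial ::
    "('a, 'k) ring_scheme \<Rightarrow> 'a set \<Rightarrow> ('a, 'm) module \<Rightarrow> rat poly"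
  where "tor_polynomial R I M = (THE t. is_tor_polynomial R I M t)"

text \<open>Unlike for \<^const>\<open>Polynomial.degree\<close>, the zero polynomial has degree \<open>-\<infinity>\<close>.\<close>

definition poly_deg :: "'c::zero poly \<Rightarrow> ereal"
  where "poly_deg p = (if p = 0 then -\<infinity> else ereal (real (Polynomial.degree p)))"

end

theory Submission imports Defs begin

text \<open>If \<open>K\<close> is the kernel of a surjection from a free module \<open>F\<close> onto \<open>M\<close>, the length of
 \<open>Tor\<^sub>1(M, A/J)\<close> is that of \<open>(K \<inter> JF)/JK\<close>. For \<open>J = I\<^sup>n\<close> these quotients are the pieces of a
 Noetherian graded module, so by Hilbert--Serre their length is eventually polynomial, and if that
 polynomial is \<open>0\<close> then \<open>Tor\<^sub>1(M, A/J) = 0\<close> for some power \<open>J\<close> of \<open>I\<close>.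

 A one-dimensional hypersurface ring has its maximal ideal generated by a parameter \<open>t\<close> and one
 more element \<open>y\<close>. Hence \<open>A/tA\<close> is uniserial with ideals \<open>E\<^sub>k = (y\<^sup>k, t)\<close>, \<open>0 \<le> k \<le> e\<close>, and \<open>M/tM\<close>
 is a direct sum of cyclic modules \<open>A/E\<^sub>a\<close> with \<open>a = a\<^sub>i\<close>. Since \<open>M\<close> has constant rank \<open>r\<close>, counting the
 lengths of \<open>M/tM\<close> and, using the vanishing of Tor, of \<open>JM/tJM\<close> shows that the \<open>a\<^sub>i\<close> sum to \<open>re\<close> and
 the \<open>\<delta>\<^sub>0 + \<dots> + \<delta>\<^sub>k\<close>, \<open>k = a\<^sub>i - 1\<close>, to \<open>r\<close> times the full sum, where \<open>\<delta>\<^sub>k\<close> is the length of \<open>JE\<^sub>k\<close> modulo the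
 next such ideal. The \<open>\<delta>\<^sub>k\<close> decrease, the first is positive and the last is \<open>0\<close> because \<open>J\<close> has a nonzero
 annihilator; by Chebyshev's inequality every \<open>a\<^sub>i\<close> is \<open>0\<close> or \<open>e\<close>. So \<open>M/tM\<close> is free over \<open>A/tA\<close>,
 and therefore \<open>M\<close> is free.\<close>

text \<open>The completion bounds the embedding dimension: a parameter of A lifts to an element of S
  that shares with f no prime but the maximal one, so Krull's principal ideal theorem gives dim S
  \<le> 2; regularity yields two generators of the maximal ideal of S, and these descend to A.
  Constant rank r is used through a free submodule of rank r whose cokernel is killed by a power of
  t. The length of X/tX does not change when X is replaced by a submodule of finite colength, which
  gives length(KM/tKM) = r length(K/tK) for every ideal K; the counts are the cases K = A and K = J.
  Since I is zero at every nonmaximal prime that contains it, some power of t is z + z' with z in I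
  and z' I = 0. This splitting makes the Tor lengths finite, keeps the powers of a nonzero I
  nonzero, and provides the annihilator z', which is nonzero because ht I = 0; l(I) = 1 enters by
  excluding I = 0. Vanishing of Tor is used in coordinates: if a relation of M has coefficients in
  J, its i-th coefficient lies in J times any ideal that contains the i-th coefficients of all
  relations. Applied to the ideals E_a this makes JM/tJM a direct sum of the J/J E_a.\<close>

lemma ideal_subset_carrier: "ideal J R ==> J <= carrier R"
 by (rule additive_subgroup.a_subset[OF ideal.axioms(1)])

section \<open>Arithmetic of submodules inside a fixed module\<close>

context module
begin

abbreviation smult_M (infixl "*\<^sub>M" 70) where "a *\<^sub>M x \<equiv> a \<odot>\<^bsub>M\<^esub> x"
abbreviation add_M (infixl "+\<^sub>M" 65) where "x +\<^sub>M y \<equiv> x \<oplus>\<^bsub>M\<^esub> y"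
abbreviation zero_M ("0\<^sub>M") where "0\<^sub>M \<equiv> \<zero>\<^bsub>M\<^esub>"
abbreviation set_add_M (infixl "<+>\<^sub>M" 60) where "X <+>\<^sub>M Y \<equiv> X <+>\<^bsub>M\<^esub> Y"

lemma submodule_carrier: "submodule X R M ==> x : X ==> x : carrier M"
 using submoduleE(1) by blast

lemma submodule_zero: "submodule X R M ==> 0\<^sub>M : X"
 using subgroup.one_closed[OF submodule.axioms(1)] by fastforce

lemma submodule_minus:
 "submodule X R M ==> x : X ==> y : X ==> x \<ominus>\<^bsub>M\<^esub> y : X"
 by (simp add: a_minus_def submoduleE(3) submoduleE(5))

lemma submodule_add_cancel:
 assumes "submodule X R M" "x +\<^sub>M y : X" "x : X" "y : carrier M"
 shows "y : X"
proof -
 have "\<ominus>\<^bsub>M\<^esub> x +\<^sub>M (x +\<^sub>M y) : X"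
  using assms by (simp add: submoduleE)
 then show ?thesis
  using assms submodule_carrier[OF assms(1,3)] by (simp add: M.r_neg1)
qed

lemma submodule_finsum:
 assumes "submodule X R M" "finite S" "!!i. i : S ==> f i : X"
 shows "finsum M f S : X"
 using assms(2,3)
proof (induction S)
 case empty
 then show ?case using assms(1) by (simp add: submodule_zero)
next
 case (insert i S)
 then have "f : S \<rightarrow> carrier M" "f i : carrier M"
  using assms(1) submodule_carrier by blast+
 then show ?case using insert assms(1) by (simp add: submoduleE)
qed

lemma submodule_inter:
 "submodule X R M ==> submodule Y R M ==> submodule (X \<inter> Y) R M"
 by (rule submoduleI) (auto simp: submodule_zero submoduleE submodule_carrier)

lemma submodule_singleton_zero: "submodule {0\<^sub>M} R M"
 by (rule submoduleI) auto

lemma mem_set_add: "x : X <+>\<^sub>M Y \<longleftrightarrow> (EX a:X. EX b:Y. x = a +\<^sub>M b)"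
 by (auto simp: set_add_def')

lemma submodule_set_add:
 assumes X: "submodule X R M" and Y: "submodule Y R M"
 shows "submodule (X <+>\<^sub>M Y) R M"
proof (rule submoduleI)
 note c = submodule_carrier[OF X] submodule_carrier[OF Y]
 show "X <+>\<^sub>M Y <= carrier M" using c by (auto simp: mem_set_add)
 show "0\<^sub>M : X <+>\<^sub>M Y"
  unfolding mem_set_add using submodule_zero[OF X] submodule_zero[OF Y] by force
next
 note c = submodule_carrier[OF X] submodule_carrier[OF Y]
 fix a assume "a : X <+>\<^sub>M Y"
 then obtain x y where xy: "x : X" "y : Y" "a = x +\<^sub>M y" by (auto simp: mem_set_add)
 have "\<ominus>\<^bsub>M\<^esub> a = \<ominus>\<^bsub>M\<^esub> x +\<^sub>M \<ominus>\<^bsub>M\<^esub> y" using xy c by (simp add: M.minus_add)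
 then show "\<ominus>\<^bsub>M\<^esub> a : X <+>\<^sub>M Y"
  unfolding mem_set_add using xy X Y submoduleE(3) by blast
 fix b assume "b : X <+>\<^sub>M Y"
 then obtain x' y' where xy': "x' : X" "y' : Y" "b = x' +\<^sub>M y'" by (auto simp: mem_set_add)
 have "a +\<^sub>M b = (x +\<^sub>M x') +\<^sub>M (y +\<^sub>M y')" using xy xy' c by (simp add: M.a_ac)
 then show "a +\<^sub>M b : X <+>\<^sub>M Y"
  unfolding mem_set_add using xy xy' X Y submoduleE(5) by blast
next
 note c = submodule_carrier[OF X] submodule_carrier[OF Y]
 fix r a assume r: "r : carrier R" and "a : X <+>\<^sub>M Y"
 then obtain x y where xy: "x : X" "y : Y" "a = x +\<^sub>M y" by (auto simp: mem_set_add)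
 then have "r *\<^sub>M a = r *\<^sub>M x +\<^sub>M r *\<^sub>M y" using r c by (simp add: smult_r_distr)
 then show "r *\<^sub>M a : X <+>\<^sub>M Y"
  unfolding mem_set_add using xy X Y r submoduleE(4) by blast
qed

lemma set_add_upper1:
 assumes "submodule X R M" "submodule Y R M" shows "X <= X <+>\<^sub>M Y"
proof
 fix x assume "x : X"
 then show "x : X <+>\<^sub>M Y"
  unfolding mem_set_add using assms
  by (intro bexI[of _ x] bexI[of _ "0\<^sub>M"]) (auto simp: submodule_zero submodule_carrier)
qed

lemma set_add_upper2:
 assumes "submodule X R M" "submodule Y R M" shows "Y <= X <+>\<^sub>M Y"
proof
 fix y assume "y : Y"
 then show "y : X <+>\<^sub>M Y"
  unfolding mem_set_add using assms
  by (intro bexI[of _ y] bexI[of _ "0\<^sub>M"]) (auto simp: submodule_zero submodule_carrier)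
qed

lemma set_add_least:
 assumes "submodule Z R M" "X <= Z" "Y <= Z" shows "X <+>\<^sub>M Y <= Z"
 using assms submoduleE(5)[OF assms(1)] by (auto simp: mem_set_add subset_iff)

lemma set_add_mono:
 "X <= X' ==> Y <= Y' ==> X <+>\<^sub>M Y <= X' <+>\<^sub>M Y'"
 unfolding subset_iff mem_set_add by blast

end

subsection \<open>Cyclic submodules and finite generation\<close>

definition cyc :: "('a, 'k) ring_scheme => ('a, 'm, 'l) module_scheme => 'm => 'm set"
 where "cyc R M g = (%a. a \<odot>\<^bsub>M\<^esub> g) ` carrier R"

definition colon :: "('a, 'k) ring_scheme => ('a, 'm, 'l) module_scheme => 'm set => 'm => 'a set"
 where "colon R M Y g = {a : carrier R. a \<odot>\<^bsub>M\<^esub> g : Y}"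

text \<open>Built by adjoining one generator at a time, so that Nakayama's lemma, the chain
  condition and finiteness of lengths become inductions on \<open>fg\<close>.\<close>

inductive fg :: "('a, 'k) ring_scheme => ('a, 'm, 'l) module_scheme => 'm set => bool" for R M where
 fg_zero: "fg R M {\<zero>\<^bsub>M\<^esub>}"
| fg_add: "fg R M X ==> g : carrier M ==> fg R M (X <+>\<^bsub>M\<^esub> cyc R M g)"

text \<open>The product \<open>J X\<close>. Only sums are generated: when \<open>J\<close> is an
  ideal, scalars and signs are absorbed by the coefficient, see
  \<open>submodule_smul\<close>.\<close>

inductive_set smul :: "('a, 'm, 'l) module_scheme => 'a set => 'm set => 'm set"
 for M J X where
 smul_zero: "\<zero>\<^bsub>M\<^esub> : smul M J X"
| smul_gen: "a : J ==> x : X ==> a \<odot>\<^bsub>M\<^esub> x : smul M J X"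
| smul_add: "x : smul M J X ==> y : smul M J X ==> x \<oplus>\<^bsub>M\<^esub> y : smul M J X"

context module
begin

lemma submodule_cyc: "g : carrier M ==> submodule (cyc R M g) R M"
proof (rule submoduleI)
 assume g: "g : carrier M"
 show "cyc R M g <= carrier M" using g by (auto simp: cyc_def)
 show "0\<^sub>M : cyc R M g" using g unfolding cyc_def by (intro image_eqI[of _ _ "\<zero>"]) auto
 fix a assume "a : cyc R M g"
 then obtain r where r: "r : carrier R" "a = r *\<^sub>M g" by (auto simp: cyc_def)
 show "\<ominus>\<^bsub>M\<^esub> a : cyc R M g"
  using r g unfolding cyc_def by (intro image_eqI[of _ _ "\<ominus> r"]) (auto simp: smult_l_minus)
 show "s *\<^sub>M a : cyc R M g" if "s : carrier R" for s
  using r g that unfolding cyc_def by (intro image_eqI[of _ _ "s \<otimes> r"]) (auto simp: smult_assoc1)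
 fix b assume "b : cyc R M g"
 then obtain s where s: "s : carrier R" "b = s *\<^sub>M g" by (auto simp: cyc_def)
 show "a +\<^sub>M b : cyc R M g"
  using r s g unfolding cyc_def by (intro image_eqI[of _ _ "r \<oplus> s"]) (auto simp: smult_l_distr)
qed

lemma cyc_self: "g : carrier M ==> g : cyc R M g"
 unfolding cyc_def by (intro image_eqI[of _ _ "\<one>"]) auto

lemma cyc_least: "submodule X R M ==> g : X ==> cyc R M g <= X"
 by (auto simp: cyc_def submoduleE)

lemma ideal_colon:
 assumes Y: "submodule Y R M" and g: "g : carrier M"
 shows "ideal (colon R M Y g) R"
proof (rule idealI)
 show "ring R" by (rule R.ring_axioms)
 show "subgroup (colon R M Y g) (add_monoid R)"
 proof (rule R.add.subgroupI)
  show "colon R M Y g <= carrier R" by (auto simp: colon_def)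
  show "colon R M Y g ~= {}"
   using g submodule_zero[OF Y] by (auto simp: colon_def intro!: exI[of _ "\<zero>"])
 next
  fix a assume "a : colon R M Y g"
  then show "\<ominus> a : colon R M Y g" using g submoduleE(3)[OF Y] by (auto simp: colon_def smult_l_minus)
 next
  fix a b assume "a : colon R M Y g" "b : colon R M Y g"
  then show "a \<oplus> b : colon R M Y g" using g submoduleE(5)[OF Y] by (auto simp: colon_def smult_l_distr)
 qed
 fix a x assume ax: "a : colon R M Y g" "x : carrier R"
 then show "x \<otimes> a : colon R M Y g"
  using g submoduleE(4)[OF Y] by (auto simp: colon_def smult_assoc1)
 then show "a \<otimes> x : colon R M Y g" using ax R.m_comm by (auto simp: colon_def)
qed

lemma fg_submodule: "fg R M X ==> submodule X R M"
 by (induction rule: fg.induct)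
   (auto simp: submodule_singleton_zero submodule_set_add submodule_cyc)

lemma smul_subset: "submodule X R M ==> J <= carrier R ==> smul M J X <= X"
proof
 fix x assume X: "submodule X R M" "J <= carrier R"
 assume "x : smul M J X"
 then show "x : X" by induction (use X in \<open>auto simp: submodule_zero submoduleE\<close>)
qed

lemma submodule_smul:
 assumes X: "X <= carrier M" and J: "ideal J R"
 shows "submodule (smul M J X) R M"
proof -
 have J': "J <= carrier R" by (rule ideal_subset_carrier[OF J])
 have c: "x : carrier M" if "x : smul M J X" for x
  using that
 proof induction
  case (smul_gen a x)
  then show ?case using X J' by (meson smult_closed subsetD)
 qed simp_all
 have m: "r *\<^sub>M x : smul M J X" if "r : carrier R" "x : smul M J X" for r x
  using that(2)
 proof induction
  case smul_zero then show ?case using that(1) by (simp add: smul.smul_zero)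
 next
  case (smul_gen a x)
  then have "r *\<^sub>M (a *\<^sub>M x) = (r \<otimes> a) *\<^sub>M x"
   using that(1) J' X by (simp add: smult_assoc1 subset_iff)
  then show ?case using smul.smul_gen[OF ideal.I_l_closed[OF J smul_gen(1) that(1)] smul_gen(2)] by simp
 next
  case (smul_add x y)
  then show ?case using that(1) c by (simp add: smult_r_distr smul.smul_add)
 qed
 show ?thesis
 proof (rule submoduleI)
  show "smul M J X <= carrier M" using c by blast
  show "0\<^sub>M : smul M J X" by (rule smul.smul_zero)
 next
  fix a assume a: "a : smul M J X"
  have "\<ominus>\<^bsub>M\<^esub> a = (\<ominus> \<one>) *\<^sub>M a" using c[OF a] by (simp add: smult_l_minus)
  then show "\<ominus>\<^bsub>M\<^esub> a : smul M J X" using m[OF _ a] by simp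
 next
  fix a b assume "a : smul M J X" "b : smul M J X"
  then show "a +\<^sub>M b : smul M J X" by (rule smul.smul_add)
 qed (rule m)
qed

lemma smul_least:
 assumes "submodule Z R M" "!!a x. a : J ==> x : X ==> a *\<^sub>M x : Z"
 shows "smul M J X <= Z"
proof
 fix x assume "x : smul M J X"
 then show "x : Z" by induction (use assms in \<open>auto simp: submodule_zero submoduleE\<close>)
qed

lemma smul_mono: "J <= J' ==> X <= X' ==> smul M J X <= smul M J' X'"
proof
 fix x assume s: "J <= J'" "X <= X'" "x : smul M J X"
 from s(3) show "x : smul M J' X'" by induction (use s in \<open>auto intro: smul.intros\<close>)
qed

text \<open>Splits off the newest generator with a coefficient still in \<open>J\<close>; the
  inductive step of Nakayama's lemma solves for that generator.\<close>

lemma smul_set_add_cyc: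
 assumes X: "submodule X R M" and g: "g : carrier M" and J: "ideal J R"
  and x: "x : smul M J (X <+>\<^sub>M cyc R M g)"
 shows "EX a:J. EX y:smul M J X. x = y +\<^sub>M a *\<^sub>M g"
proof -
 have J': "J <= carrier R" by (rule ideal_subset_carrier[OF J])
 have J0: "\<zero> : J" using J by (simp add: additive_subgroup.zero_closed ideal.axioms(1))
 have sX: "submodule (smul M J X) R M" by (rule submodule_smul[OF submoduleE(1)[OF X] J])
 show ?thesis
  using x
 proof induction
  case smul_zero
  have "0\<^sub>M = 0\<^sub>M +\<^sub>M \<zero> *\<^sub>M g" using g by simp
  then show ?case using J0 submodule_zero[OF sX] by blast
 next
  case (smul_gen a x)
  then obtain y r where y: "y : X" "r : carrier R" "x = y +\<^sub>M r *\<^sub>M g"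
   by (auto simp: mem_set_add cyc_def)
  have "a : carrier R" "y : carrier M" using J' smul_gen y submodule_carrier[OF X] by auto
  then have "a *\<^sub>M x = a *\<^sub>M y +\<^sub>M (a \<otimes> r) *\<^sub>M g"
   using y g by (simp add: smult_r_distr smult_assoc1)
  moreover have "a \<otimes> r : J" using J smul_gen y by (simp add: ideal.I_r_closed)
  moreover have "a *\<^sub>M y : smul M J X" using smul_gen y by (simp add: smul.smul_gen)
  ultimately show ?case by blast
 next
  case (smul_add x x')
  then obtain a y a' y' where e: "a : J" "y : smul M J X" "x = y +\<^sub>M a *\<^sub>M g"
    "a' : J" "y' : smul M J X" "x' = y' +\<^sub>M a' *\<^sub>M g" by blast
  have "a : carrier R" "a' : carrier R" "y : carrier M" "y' : carrier M"
   using e J' submodule_carrier[OF sX] by auto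
  then have "x +\<^sub>M x' = (y +\<^sub>M y') +\<^sub>M (a \<oplus> a') *\<^sub>M g"
   using e g by (simp add: smult_l_distr M.a_ac)
  moreover have "a \<oplus> a' : J" using e J by (simp add: additive_subgroup.a_closed ideal.axioms(1))
  moreover have "y +\<^sub>M y' : smul M J X" using e by (simp add: smul.smul_add)
  ultimately show ?case by blast
 qed
qed

end

subsection \<open>The ring as a module\<close>

lemma ring_module_simps [simp]:
 "carrier (ring_module R) = carrier R" "\<zero>\<^bsub>ring_module R\<^esub> = \<zero>\<^bsub>R\<^esub>"
 "add (ring_module R) = add R" "smult (ring_module R) = mult R"
 by (simp_all add: ring_module_def mk_module_def)

lemma mk_module_simps [simp]:
 "carrier (mk_module C z p s) = C" "\<zero>\<^bsub>mk_module C z p s\<^esub> = z"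
 "add (mk_module C z p s) = p" "smult (mk_module C z p s) = s"
 by (simp_all add: mk_module_def)

lemma abelian_groupI_ext:
 assumes "abelian_group G" "carrier H = carrier G" "add H = add G" "zero H = zero G"
 shows "abelian_group H"
proof -
 interpret G: abelian_group G by fact
 note e = assms(2-4)
 show ?thesis
 proof (rule abelian_groupI)
  fix x y z assume "x : carrier H" "y : carrier H" "z : carrier H"
  then show "x \<oplus>\<^bsub>H\<^esub> y \<oplus>\<^bsub>H\<^esub> z = x \<oplus>\<^bsub>H\<^esub> (y \<oplus>\<^bsub>H\<^esub> z)" unfolding e by (rule G.a_assoc)
 next
  fix x y assume "x : carrier H" "y : carrier H"
  then show "x \<oplus>\<^bsub>H\<^esub> y = y \<oplus>\<^bsub>H\<^esub> x" unfolding e by (rule G.a_comm)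
 next
  fix x assume "x : carrier H"
  then show "EX y:carrier H. y \<oplus>\<^bsub>H\<^esub> x = \<zero>\<^bsub>H\<^esub>" unfolding e using G.l_neg by blast
 qed (simp_all add: e)
qed

context cring
begin

lemma module_ring_module: "module R (ring_module R)"
proof (rule moduleI)
 show "abelian_group (ring_module R)"
  by (rule abelian_groupI_ext[of R]) (auto simp: is_abelian_group)
qed (auto simp: l_distr r_distr m_assoc is_cring)

sublocale RM: module R "ring_module R" by (rule module_ring_module)

abbreviation rm where "rm \<equiv> ring_module R"

text \<open>Through this equivalence ideals inherit sums, colons and lengths from the theory of
  submodules.\<close>

lemma ideal_iff_submodule: "submodule X R rm \<longleftrightarrow> ideal X R"
proof
 assume X: "submodule X R rm"
 show "ideal X R"
 proof (rule idealI)
  show "subgroup X (add_monoid R)"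
  proof (rule add.subgroupI)
   fix a assume a: "a : X"
   then have "(\<ominus> \<one>) \<otimes> a : X" using RM.submoduleE(4)[OF X] by simp
   moreover have "a : carrier R" using RM.submodule_carrier[OF X a] by simp
   ultimately show "\<ominus> a : X" by (simp add: l_minus)
  qed (use RM.submoduleE[OF X] in auto)
  fix a x assume ax: "a : X" "x : carrier R"
  show "x \<otimes> a : X" using ax RM.submoduleE(4)[OF X] by simp
  then show "a \<otimes> x : X" using ax RM.submodule_carrier[OF X] m_comm by simp
 qed (rule ring_axioms)
next
 assume X: "ideal X R"
 interpret X: ideal X R by fact
 show "submodule X R rm"
 proof (rule RM.submoduleI)
  fix a assume a: "a : X"
  have n: "\<ominus> \<one> \<otimes> a : X" using a by (simp add: X.I_l_closed)
  have "\<ominus>\<^bsub>rm\<^esub> a = \<ominus> \<one> \<otimes> a"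
   using RM.smult_l_minus[of "\<one>" a] X.Icarr[OF a] by simp
  then show "\<ominus>\<^bsub>rm\<^esub> a : X" using n by simp
 qed (use X.Icarr X.I_l_closed in auto)
qed

lemma ring_module_a_inv: "a : carrier R ==> \<ominus>\<^bsub>rm\<^esub> a = \<ominus> a"
 using RM.smult_l_minus[of "\<one>" a] by (simp add: l_minus)

lemma ring_module_minus:
 "a : carrier R ==> b : carrier R ==> a \<ominus>\<^bsub>rm\<^esub> b = a \<ominus> b"
 by (simp add: a_minus_def ring_module_a_inv)

lemma ring_module_set_add: "X <+>\<^bsub>rm\<^esub> Y = X <+> Y"
 by (simp add: set_add_def')

lemma smul_eq_ideal_prod:
 assumes "ideal I R" "ideal J R"
 shows "smul rm I J = I \<cdot> J"
proof
 have "submodule (I \<cdot> J) R rm"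
  using ideal_iff_submodule ideal_prod_is_ideal[OF assms] by simp
 then show "smul rm I J <= I \<cdot> J"
  by (rule RM.smul_least) (auto intro: ideal_prod.intros)
 show "I \<cdot> J <= smul rm I J"
 proof
  fix x assume "x : I \<cdot> J"
  then show "x : smul rm I J"
  proof induction
   case (prod i j)
   then show ?case using smul.smul_gen[of i I j J rm] by simp
  next
   case (sum a b)
   then show ?case using smul.smul_add[of a rm I J b] by simp
  qed
 qed
qed

lemma ideal_pow_0: "ideal_pow R I 0 = carrier R"
 by (simp add: ideals_set_def nat_pow_def)

lemma ideal_pow_Suc: "ideal_pow R I (Suc n) = ideal_pow R I n \<cdot> I"
 by (simp add: ideals_set_def nat_pow_def)

lemma ideal_pow_ideal: "ideal I R ==> ideal (ideal_pow R I n) R"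
 by (induction n)
   (simp_all only: ideal_pow_0 ideal_pow_Suc oneideal ideal_prod_is_ideal)

end

context abelian_group
begin

lemma minus_eqI: "b : carrier G ==> c : carrier G ==> a = b \<oplus> c ==> a \<ominus> b = c"
 using a_comm[of b c] by (simp add: a_minus_def a_assoc r_neg)

lemma minus_plus_cancel: "a : carrier G ==> b : carrier G ==> a \<ominus> b \<oplus> b = a"
 by (simp add: a_minus_def a_assoc l_neg)

lemma plus_minus_cancel: "a : carrier G ==> b : carrier G ==> b \<oplus> (a \<ominus> b) = a"
 using a_comm[of b "a \<ominus> b"] by (simp add: minus_plus_cancel minus_closed)

end

subsection \<open>Relative length\<close>

definition mchain ::
  "('a, 'k) ring_scheme => ('a, 'm, 'l) module_scheme => 'm set => 'm set => nat => (nat => 'm set) => bool"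
 where "mchain R M X Y n C \<longleftrightarrow>
  (ALL i<=n. submodule (C i) R M & Y <= C i & C i <= X) & (ALL i<n. C i \<subset> C (Suc i))"

text \<open>The length of \<open>X/Y\<close>, measured by chains between \<open>Y\<close> and
  \<open>X\<close>. No quotient has to be formed, and additivity becomes a statement about one
  lattice of submodules.\<close>

definition len ::
  "('a, 'k) ring_scheme => ('a, 'm, 'l) module_scheme => 'm set => 'm set => enat"
 where "len R M X Y = Sup {enat n | n C. mchain R M X Y n C}"

lemma mchainD:
 assumes "mchain R M X Y n C"
 shows "i <= n ==> submodule (C i) R M" "i <= n ==> Y <= C i" "i <= n ==> C i <= X"
  "i < n ==> C i \<subset> C (Suc i)"
 using assms unfolding mchain_def by blast+

lemma len_upper: "mchain R M X Y n C ==> enat n <= len R M X Y"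
 unfolding len_def by (rule Sup_upper) blast

lemma len_least: "(!!n C. mchain R M X Y n C ==> enat n <= l) ==> len R M X Y <= l"
 unfolding len_def by (rule Sup_least) blast

lemma len_mono: "X <= X' ==> Y' <= Y ==> len R M X Y <= len R M X' Y'"
proof (rule len_least)
 fix n C assume "X <= X'" "Y' <= Y" and C: "mchain R M X Y n C"
 then have "mchain R M X' Y' n C" unfolding mchain_def by (meson subset_trans)
 then show "enat n <= len R M X' Y'" by (rule len_upper)
qed

lemma le_lenD:
 assumes "submodule X R M" "Y <= X" "enat n <= len R M X Y"
 shows "EX C. mchain R M X Y n C"
proof (cases n)
 case 0
 then show ?thesis using assms by (intro exI[of _ "%_. X"]) (auto simp: mchain_def)
next
 case (Suc k)
 then have "enat k < len R M X Y" using assms(3) by (metis Suc_ile_eq)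
 then obtain n' C where C: "mchain R M X Y n' C" "enat k < enat n'"
  unfolding len_def less_Sup_iff by blast
 then have "mchain R M X Y n C" using Suc by (auto simp: mchain_def)
 then show ?thesis by blast
qed

lemma enat_le_eqI:
 fixes a b :: enat
 assumes "!!n. enat n <= a ==> enat n <= b"
 shows "a <= b"
proof (cases a)
 case infinity
 then have "enat n <= b" for n using assms by simp
 then have "b = \<infinity>" by (metis Suc_ile_eq enat_ord_simps(6) less_irrefl not_infinity_eq)
 then show ?thesis by simp
qed (use assms in auto)

lemma len_map_le:
 assumes "!!C. submodule C R M ==> Y <= C ==> C <= X ==>
   submodule (\<Phi> C) R N & Y' <= \<Phi> C & \<Phi> C <= X'"
  and "!!C D. submodule C R M ==> submodule D R M ==> Y <= C ==> C \<subset> D ==> D <= X ==> \<Phi> C \<subset> \<Phi> D"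
 shows "len R M X Y <= len R N X' Y'"
proof (rule len_least)
 fix n C assume C: "mchain R M X Y n C"
 have "mchain R N X' Y' n (%i. \<Phi> (C i))"
  unfolding mchain_def
 proof (intro conjI allI impI)
  fix i assume "i <= n"
  then show "submodule (\<Phi> (C i)) R N" "Y' <= \<Phi> (C i)" "\<Phi> (C i) <= X'"
   using C assms(1)[of "C i"] by (auto simp: mchain_def)
 next
  fix i assume "i < n"
  then show "\<Phi> (C i) \<subset> \<Phi> (C (Suc i))"
   using C by (intro assms(2)) (auto simp: mchain_def)
 qed
 then show "enat n <= len R N X' Y'" by (rule len_upper)
qed

lemma module_length_eq_len:
 assumes "module R M"
 shows "module_length R M = len R M (carrier M) {\<zero>\<^bsub>M\<^esub>}"
proof -
 interpret module R M by fact
 have "mchain R M (carrier M) {\<zero>\<^bsub>M\<^esub>} n C \<longleftrightarrow>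
   (ALL i<=n. submodule (C i) R M) & (ALL i<n. C i \<subset> C (Suc i))" for n C
  unfolding mchain_def using submodule_zero submoduleE(1) by blast
 then show ?thesis unfolding len_def module_length_def by simp
qed

context module
begin

lemma len_self: "len R M X X = 0"
proof -
 have "n = 0" if "mchain R M X X n C" for n C
 proof (rule ccontr)
  assume "n ~= 0"
  then have "C 0 \<subset> C (Suc 0)" "C (Suc 0) <= X" "X <= C 0"
   using that unfolding mchain_def by auto
  then show False by blast
 qed
 then have "len R M X X <= enat 0" by (intro len_least) auto
 then show ?thesis by (simp add: zero_enat_def[symmetric])
qed

lemma len_eq_0D:
 assumes "submodule X R M" "submodule Y R M" "Y <= X" "len R M X Y = 0"
 shows "X = Y"
proof (rule ccontr)
 assume "X ~= Y"
 then have "mchain R M X Y 1 (%i. if i = 0 then Y else X)"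
  using assms by (auto simp: mchain_def)
 from len_upper[OF this] assms(4) show False by (simp add: zero_enat_def)
qed

lemma len_strict:
 assumes X': "submodule X' R M" and X: "submodule X R M" and "Y <= X" "X \<subset> X'"
 shows "len R M X Y + 1 <= len R M X' Y"
proof (rule enat_le_eqI)
 fix n assume n: "enat n <= len R M X Y + 1"
 show "enat n <= len R M X' Y"
 proof (cases n)
  case 0 then show ?thesis by (simp add: zero_enat_def[symmetric])
 next
  case (Suc k)
  then have "enat k + 1 <= len R M X Y + 1" using n by (simp add: one_enat_def)
  then have "enat k <= len R M X Y" by (cases "len R M X Y") (auto simp: one_enat_def)
  then obtain C where C: "mchain R M X Y k C" using le_lenD[OF X assms(3)] by blast
  have "mchain R M X' Y n (%i. if i <= k then C i else X')"
   unfolding mchain_def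
  proof (intro conjI allI impI)
   fix i assume "i < n"
   then consider "i < k" | "i = k" using Suc by linarith
   then show "(if i <= k then C i else X') \<subset> (if Suc i <= k then C (Suc i) else X')"
    using C assms(4) by cases (auto simp: mchain_def)
  next
   fix i
   show "submodule (if i <= k then C i else X') R M" using mchainD(1)[OF C, of i] X' by simp
   show "Y <= (if i <= k then C i else X')" using mchainD(2)[OF C, of i] assms(3,4) by auto
   show "(if i <= k then C i else X') <= X'" using mchainD(3)[OF C, of i] assms(4) by auto
  qed
  then show ?thesis by (rule len_upper)
 qed
qed

text \<open>Subadditivity is the modular law: a strict step of a chain stays strict in
  \<open>C + Y\<close> or in \<open>C \<inter> Y\<close>. The other inequality concatenates a chain
  above \<open>Y\<close> with one below it.\<close>

lemma len_add:
 assumes X: "submodule X R M" and Y: "submodule Y R M" and Z: "submodule Z R M"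
  and ZY: "Z <= Y" and YX: "Y <= X"
 shows "len R M X Z = len R M X Y + len R M Y Z"
proof (rule antisym)
 show "len R M X Z <= len R M X Y + len R M Y Z"
 proof (rule len_least)
  fix n C assume C: "mchain R M X Z n C"
  have "enat i <= len R M (C i <+>\<^sub>M Y) Y + len R M (C i \<inter> Y) Z" if "i <= n" for i
   using that
  proof (induction i)
   case 0 then show ?case by (simp add: zero_enat_def[symmetric])
  next
   case (Suc i)
   have sC: "submodule (C i) R M" "submodule (C (Suc i)) R M" "Z <= C i" "C i \<subset> C (Suc i)"
    using mchainD[OF C, of i] mchainD[OF C, of "Suc i"] Suc.prems by simp_all
   have s1: "submodule (C i <+>\<^sub>M Y) R M" "submodule (C (Suc i) <+>\<^sub>M Y) R M"
    "submodule (C i \<inter> Y) R M" "submodule (C (Suc i) \<inter> Y) R M"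
    using sC(1,2) Y by (simp_all add: submodule_set_add submodule_inter)
   have m1: "C i <+>\<^sub>M Y <= C (Suc i) <+>\<^sub>M Y" "C i \<inter> Y <= C (Suc i) \<inter> Y"
    using sC(4) set_add_mono[of "C i" "C (Suc i)" Y Y] by blast+
   have le1: "len R M (C i <+>\<^sub>M Y) Y <= len R M (C (Suc i) <+>\<^sub>M Y) Y"
    "len R M (C i \<inter> Y) Z <= len R M (C (Suc i) \<inter> Y) Z"
    using m1 by (simp_all add: len_mono)
   obtain c where c: "c : C (Suc i)" "c ~: C i" using sC(4) by blast
   have cM: "c : carrier M" using c submodule_carrier[OF sC(2)] by simp
   have "C i <+>\<^sub>M Y \<subset> C (Suc i) <+>\<^sub>M Y | C i \<inter> Y \<subset> C (Suc i) \<inter> Y"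
   proof (rule ccontr)
    assume "~ ?thesis"
    then have e: "C i <+>\<^sub>M Y = C (Suc i) <+>\<^sub>M Y" "C i \<inter> Y = C (Suc i) \<inter> Y"
     using m1 by blast+
    have "c : C i <+>\<^sub>M Y" using c e(1) set_add_upper1[OF sC(2) Y] by blast
    then obtain a y where ay: "a : C i" "y : Y" "c = a +\<^sub>M y" by (auto simp: mem_set_add)
    have "y : C (Suc i)"
     by (rule submodule_add_cancel[OF sC(2), of a y])
       (use ay c(1) sC(4) submodule_carrier[OF Y] in blast)+
    then have "y : C i" using e(2) ay by blast
    then show False using ay c submoduleE(5)[OF sC(1)] by blast
   qed
   then have "len R M (C i <+>\<^sub>M Y) Y + len R M (C i \<inter> Y) Z + 1
     <= len R M (C (Suc i) <+>\<^sub>M Y) Y + len R M (C (Suc i) \<inter> Y) Z"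
   proof
    assume "C i <+>\<^sub>M Y \<subset> C (Suc i) <+>\<^sub>M Y"
    then have "len R M (C i <+>\<^sub>M Y) Y + 1 <= len R M (C (Suc i) <+>\<^sub>M Y) Y"
     using len_strict[OF s1(2,1) set_add_upper2[OF sC(1) Y]] by blast
    from add_mono[OF this le1(2)] show ?thesis by (simp add: ac_simps)
   next
    assume "C i \<inter> Y \<subset> C (Suc i) \<inter> Y"
    then have "len R M (C i \<inter> Y) Z + 1 <= len R M (C (Suc i) \<inter> Y) Z"
     using len_strict[OF s1(4,3)] sC(3) ZY by blast
    from add_mono[OF le1(1) this] show ?thesis by (simp add: ac_simps)
   qed
   moreover have "enat i + 1 <= len R M (C i <+>\<^sub>M Y) Y + len R M (C i \<inter> Y) Z + 1"
    using Suc by (intro add_right_mono) simp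
   ultimately have "enat i + 1 <= len R M (C (Suc i) <+>\<^sub>M Y) Y + len R M (C (Suc i) \<inter> Y) Z"
    by (meson order_trans)
   then show ?case by (simp add: one_enat_def)
  qed
  from this[OF order_refl] have "enat n <= len R M (C n <+>\<^sub>M Y) Y + len R M (C n \<inter> Y) Z" .
  also have "\<dots> <= len R M X Y + len R M Y Z"
  proof (rule add_mono; rule len_mono)
   show "C n <+>\<^sub>M Y <= X" using mchainD(3)[OF C, of n] YX by (intro set_add_least[OF X]) simp_all
  qed auto
  finally show "enat n <= len R M X Y + len R M Y Z" .
 qed
 show "len R M X Y + len R M Y Z <= len R M X Z"
 proof (rule enat_le_eqI)
  fix n assume n: "enat n <= len R M X Y + len R M Y Z"
  \<comment> \<open>Lengths may be infinite, so an arbitrary finite \<open>n\<close> below the sum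
    is split into two finite parts that chains can realise.\<close>
  have "EX a b. n = a + b & enat a <= len R M X Y & enat b <= len R M Y Z"
  proof (cases "len R M X Y")
   case (enat p)
   show ?thesis
   proof (cases "n <= p")
    case True then show ?thesis using enat
     by (intro exI[of _ n] exI[of _ 0]) (auto simp: zero_enat_def[symmetric])
   next
    case False
    then have "enat (n - p) <= len R M Y Z"
     using n enat by (cases "len R M Y Z") auto
    then show ?thesis using enat False by (intro exI[of _ p] exI[of _ "n - p"]) auto
   qed
  next
   case infinity
   then show ?thesis by (intro exI[of _ n] exI[of _ 0]) (auto simp: zero_enat_def[symmetric])
  qed
  then obtain a b where ab: "n = a + b" "enat a <= len R M X Y" "enat b <= len R M Y Z" by blast
  obtain C where C: "mchain R M X Y a C" using le_lenD[OF X YX ab(2)] by blast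
  obtain D where D: "mchain R M Y Z b D" using le_lenD[OF Y ZY ab(3)] by blast
  have "mchain R M X Z n (%i. if i <= b then D i else C (i - b))"
   unfolding mchain_def
  proof (intro conjI allI impI)
   fix i assume "i < n"
   then consider "i < b" | "i = b" "0 < a" | "b < i" using ab by linarith
   then show "(if i <= b then D i else C (i - b)) \<subset> (if Suc i <= b then D (Suc i) else C (Suc i - b))"
   proof cases
    case 1 then show ?thesis using mchainD(4)[OF D] by simp
   next
    case 2
    have "D b <= Y" "Y <= C 0" "C 0 \<subset> C (Suc 0)" 
     using mchainD(3)[OF D, of b] mchainD(2)[OF C, of 0] mchainD(4)[OF C, of 0] 2 by simp_all
    then have "D b \<subset> C (Suc 0)" by blast
    then show ?thesis using 2 by simp
   next
    case 3
    then have "Suc i - b = Suc (i - b)" "i - b < a" using \<open>i < n\<close> ab by auto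
    then show ?thesis using mchainD(4)[OF C, of "i - b"] 3 by simp
   qed
  next
   fix i assume i: "i <= n"
   show "submodule (if i <= b then D i else C (i - b)) R M"
    using i ab mchainD(1)[OF D, of i] mchainD(1)[OF C, of "i - b"] by simp
   show "Z <= (if i <= b then D i else C (i - b))"
    using i ab mchainD(2)[OF D, of i] subset_trans[OF ZY mchainD(2)[OF C, of "i - b"]] by simp
   show "(if i <= b then D i else C (i - b)) <= X"
    using i ab mchainD(3)[OF D, of i] mchainD(3)[OF C, of "i - b"] YX by auto
  qed
  then show "enat n <= len R M X Z" by (rule len_upper)
 qed
qed

end

subsection \<open>Linear maps\<close>

locale linear = M: module R M + N: module R N
 for R :: "('a, 'k) ring_scheme" (structure)
  and M :: "('a, 'm, 'l) module_scheme" and N :: "('a, 'n, 'l2) module_scheme" +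
 fixes h :: "'m => 'n"
 assumes h_closed [simp]: "x : carrier M ==> h x : carrier N"
  and h_add: "x : carrier M ==> y : carrier M ==> h (x \<oplus>\<^bsub>M\<^esub> y) = h x \<oplus>\<^bsub>N\<^esub> h y"
  and h_smult: "a : carrier R ==> x : carrier M ==> h (a \<odot>\<^bsub>M\<^esub> x) = a \<odot>\<^bsub>N\<^esub> h x"
begin

lemma h_zero [simp]: "h 0\<^sub>M = \<zero>\<^bsub>N\<^esub>"
 using h_smult[of "\<zero>" "0\<^sub>M"] by simp

lemma h_neg: "x : carrier M ==> h (\<ominus>\<^bsub>M\<^esub> x) = \<ominus>\<^bsub>N\<^esub> h x"
 using h_smult[of "\<ominus> \<one>" x] by (simp add: M.smult_l_minus N.smult_l_minus)

lemma h_minus: "x : carrier M ==> y : carrier M ==> h (x \<ominus>\<^bsub>M\<^esub> y) = h x \<ominus>\<^bsub>N\<^esub> h y"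
 by (simp add: a_minus_def h_add h_neg)

lemma h_finsum:
 "finite S ==> f : S \<rightarrow> carrier M ==> h (finsum M f S) = finsum N (%i. h (f i)) S"
 by (induction S rule: finite_induct) (auto simp: h_add Pi_iff)

lemma submodule_image: "submodule X R M ==> submodule (h ` X) R N"
proof (rule N.submoduleI)
 assume X: "submodule X R M"
 note c = M.submodule_carrier[OF X]
 show "h ` X <= carrier N" using c by auto
 show "\<zero>\<^bsub>N\<^esub> : h ` X" using M.submodule_zero[OF X] h_zero by (metis imageI)
 fix a assume "a : h ` X"
 then obtain x where x: "x : X" "a = h x" by blast
 show "\<ominus>\<^bsub>N\<^esub> a : h ` X"
  using x c M.submoduleE(3)[OF X] by (intro image_eqI[of _ _ "\<ominus>\<^bsub>M\<^esub> x"]) (auto simp: h_neg)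
 show "r \<odot>\<^bsub>N\<^esub> a : h ` X" if "r : carrier R" for r
  using x c that M.submoduleE(4)[OF X] by (intro image_eqI[of _ _ "r *\<^sub>M x"]) (auto simp: h_smult)
 fix b assume "b : h ` X"
 then obtain y where y: "y : X" "b = h y" by blast
 show "a \<oplus>\<^bsub>N\<^esub> b : h ` X"
  using x y c M.submoduleE(5)[OF X] by (intro image_eqI[of _ _ "x +\<^sub>M y"]) (auto simp: h_add)
qed

lemma submodule_preimage:
 assumes X: "submodule X R M" and Y: "submodule Y R N"
 shows "submodule {x : X. h x : Y} R M"
proof (rule M.submoduleI)
 note c = M.submodule_carrier[OF X]
 show "{x : X. h x : Y} <= carrier M" using c by blast
 show "0\<^sub>M : {x : X. h x : Y}" using M.submodule_zero[OF X] N.submodule_zero[OF Y] by simp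
next
 fix a assume "a : {x : X. h x : Y}"
 then show "\<ominus>\<^bsub>M\<^esub> a : {x : X. h x : Y}"
  using M.submodule_carrier[OF X] M.submoduleE(3)[OF X] N.submoduleE(3)[OF Y] by (simp add: h_neg)
next
 fix a b assume "a : {x : X. h x : Y}" "b : {x : X. h x : Y}"
 then show "a +\<^sub>M b : {x : X. h x : Y}"
  using M.submodule_carrier[OF X] M.submoduleE(5)[OF X] N.submoduleE(5)[OF Y] by (simp add: h_add)
next
 fix r a assume "r : carrier R" "a : {x : X. h x : Y}"
 then show "r *\<^sub>M a : {x : X. h x : Y}"
  using M.submodule_carrier[OF X] M.submoduleE(4)[OF X] N.submoduleE(4)[OF Y] by (simp add: h_smult)
qed

text \<open>\<open>h\<close> induces an isomorphism of \<open>X/Y\<close> onto \<open>X'/Y'\<close>: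
  image plus \<open>Y'\<close> and preimage are strictly monotone between the two intervals of
  submodules, so each length bounds the other.\<close>

lemma len_image:
 assumes X: "submodule X R M" and Y: "submodule Y R M" and YX: "Y <= X"
  and Y': "submodule Y' R N"
  and X'_eq: "X' = h ` X <+>\<^bsub>N\<^esub> Y'" and Y_eq: "Y = {x : X. h x : Y'}"
 shows "len R M X Y = len R N X' Y'"
proof (rule antisym)
 have X': "submodule X' R N"
  unfolding X'_eq by (intro N.submodule_set_add submodule_image X Y')
 have hX: "h x : X'" if "x : X" for x
  using that N.set_add_upper1[OF submodule_image[OF X] Y'] unfolding X'_eq by blast
 have Y'X': "Y' <= X'"
  unfolding X'_eq by (rule N.set_add_upper2[OF submodule_image[OF X] Y'])
 show "len R M X Y <= len R N X' Y'"
 proof (rule len_map_le[of R M Y X "%C. h ` C <+>\<^bsub>N\<^esub> Y'"])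
  fix C assume C: "submodule C R M" "Y <= C" "C <= X"
  have "h ` C <+>\<^bsub>N\<^esub> Y' <= X'"
   unfolding X'_eq using C by (intro N.set_add_mono) auto
  then show "submodule (h ` C <+>\<^bsub>N\<^esub> Y') R N & Y' <= h ` C <+>\<^bsub>N\<^esub> Y' & h ` C <+>\<^bsub>N\<^esub> Y' <= X'"
   using C N.set_add_upper2[OF submodule_image[OF C(1)] Y']
    N.submodule_set_add[OF submodule_image[OF C(1)] Y'] by blast
 next
  fix C D assume CD: "submodule C R M" "submodule D R M" "Y <= C" "C \<subset> D" "D <= X"
  obtain d where d: "d : D" "d ~: C" using CD(4) by blast
  have "h d ~: h ` C <+>\<^bsub>N\<^esub> Y'"
  proof
   assume "h d : h ` C <+>\<^bsub>N\<^esub> Y'"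
   then obtain c y where c: "c : C" "y : Y'" "h d = h c \<oplus>\<^bsub>N\<^esub> y" by (auto simp: N.mem_set_add)
   have cd: "c : carrier M" "d : carrier M" "c : X"
    using c d M.submodule_carrier[OF CD(1)] M.submodule_carrier[OF CD(2)] CD by auto
   have "d \<ominus>\<^bsub>M\<^esub> c : X" using cd d CD by (intro M.submodule_minus[OF X]) auto
   moreover have "h (d \<ominus>\<^bsub>M\<^esub> c) = y"
    using cd c N.submodule_carrier[OF Y' c(2)] by (simp add: h_minus N.M.minus_eqI)
   ultimately have "d \<ominus>\<^bsub>M\<^esub> c : Y" using c Y_eq by auto
   then have "d \<ominus>\<^bsub>M\<^esub> c +\<^sub>M c : C" using CD c M.submoduleE(5)[OF CD(1)] by blast
   moreover have "d \<ominus>\<^bsub>M\<^esub> c +\<^sub>M c = d" using cd by (simp add: M.M.minus_plus_cancel)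
   ultimately show False using d by simp
  qed
  moreover have "h d : h ` D <+>\<^bsub>N\<^esub> Y'"
   using d N.set_add_upper1[OF submodule_image[OF CD(2)] Y'] by blast
  moreover have "h ` C <+>\<^bsub>N\<^esub> Y' <= h ` D <+>\<^bsub>N\<^esub> Y'" using CD by (intro N.set_add_mono) auto
  ultimately show "h ` C <+>\<^bsub>N\<^esub> Y' \<subset> h ` D <+>\<^bsub>N\<^esub> Y'" by blast
 qed
 show "len R N X' Y' <= len R M X Y"
 proof (rule len_map_le[of R N Y' X' "%C. {x : X. h x : C}"])
  fix C assume C: "submodule C R N" "Y' <= C" "C <= X'"
  then show "submodule {x : X. h x : C} R M & Y <= {x : X. h x : C} & {x : X. h x : C} <= X"
   using submodule_preimage[OF X C(1)] Y_eq by auto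
 next
  fix C D assume CD: "submodule C R N" "submodule D R N" "Y' <= C" "C \<subset> D" "D <= X'"
  obtain d where d: "d : D" "d ~: C" using CD(4) by blast
  then have "d : h ` X <+>\<^bsub>N\<^esub> Y'" using CD X'_eq by blast
  then obtain x y where x: "x : X" "y : Y'" "d = h x \<oplus>\<^bsub>N\<^esub> y" by (auto simp: N.mem_set_add)
  have cc: "h x : carrier N" "y : carrier N"
   using x M.submodule_carrier[OF X] N.submodule_carrier[OF Y'] by auto
  have "y \<oplus>\<^bsub>N\<^esub> h x : D" using x d cc by (simp add: N.M.a_comm)
  then have "h x : D"
   using N.submodule_add_cancel[OF CD(2), of y "h x"] cc CD x by blast
  moreover have "h x ~: C" using x d CD N.submoduleE(5)[OF CD(1)] by blast
  ultimately show "{x : X. h x : C} \<subset> {x : X. h x : D}" using x CD by blast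
 qed
qed

end

subsection \<open>Ideals\<close>

context ring
begin

lemma ideal_zero: "ideal I R ==> \<zero> : I"
 by (simp add: additive_subgroup.zero_closed ideal.axioms(1))

lemma ideal_add: "ideal I R ==> a : I ==> b : I ==> a \<oplus> b : I"
 by (rule additive_subgroup.a_closed[OF ideal.axioms(1)])

lemma ideal_lmult: "ideal I R ==> a : carrier R ==> b : I ==> a \<otimes> b : I"
 by (rule ideal.I_l_closed)

lemma ideal_rmult: "ideal I R ==> b : carrier R ==> a : I ==> a \<otimes> b : I"
 by (rule ideal.I_r_closed)

lemma ideal_neg: "ideal I R ==> a : I ==> \<ominus> a : I"
 by (rule additive_subgroup.a_inv_closed[OF ideal.axioms(1)])

lemma ideal_minus: "ideal I R ==> a : I ==> b : I ==> a \<ominus> b : I"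
 by (simp add: a_minus_def ideal_add ideal_neg)

lemma ideal_carrier: "ideal I R ==> a : I ==> a : carrier R"
 by (rule ideal.Icarr)

lemma mem_set_add: "x : X <+> Y \<longleftrightarrow> (EX a:X. EX b:Y. x = a \<oplus> b)"
 by (auto simp: set_add_def')

lemma set_add_upper1: "ideal I R ==> ideal J R ==> x : I ==> x : I <+> J"
 unfolding mem_set_add using ideal_zero ideal_carrier r_zero by metis

lemma set_add_upper2: "ideal I R ==> ideal J R ==> x : J ==> x : I <+> J"
 unfolding mem_set_add using ideal_zero ideal_carrier l_zero by metis

end

context cring
begin

lemma idealI2:
 assumes "X <= carrier R" "\<zero> : X" "!!a b. a : X ==> b : X ==> a \<oplus> b : X"
  "!!r a. r : carrier R ==> a : X ==> r \<otimes> a : X"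
 shows "ideal X R"
proof -
 have "submodule X R rm"
 proof (rule RM.submoduleI)
  fix a assume a: "a : X"
  then have "a : carrier R" using assms(1) by blast
  then show "\<ominus>\<^bsub>rm\<^esub> a : X"
   using assms(4)[of "\<ominus> \<one>" a] a by (simp add: ring_module_a_inv l_minus)
 qed (use assms in simp_all)
 then show ?thesis by (simp add: ideal_iff_submodule)
qed

lemma mem_PIdl: "x : PIdl a \<longleftrightarrow> (EX r:carrier R. x = r \<otimes> a)"
 by (auto simp: cgenideal_def)

lemma ideal_set_add_PIdl: "ideal I R ==> a : carrier R ==> ideal (I <+> PIdl a) R"
 by (intro add_ideals cgenideal_ideal)

lemma mem_set_add_PIdl: "x : I <+> PIdl a \<longleftrightarrow> (EX i:I. EX r:carrier R. x = i \<oplus> r \<otimes> a)"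
 unfolding mem_set_add Bex_def mem_PIdl by blast

lemma prime_mult:
 "primeideal P R ==> a : carrier R ==> b : carrier R ==> a \<otimes> b : P ==> a : P | b : P"
 by (rule primeideal.I_prime)

lemma prime_mult_notin:
 "primeideal P R ==> a : carrier R - P ==> b : carrier R - P ==> a \<otimes> b : carrier R - P"
 using prime_mult by auto

lemma prime_ideal: "primeideal P R ==> ideal P R"
 by (rule primeideal.axioms(1))

lemma prime_one: "primeideal P R ==> \<one> ~: P"
 using ideal.one_imp_carrier primeideal.I_notcarr prime_ideal by metis

lemma prime_pow: "primeideal P R ==> a : carrier R ==> a [^] (n::nat) : P ==> a : P"
proof (induction n)
 case 0 then show ?case using prime_one by simp
next
 case (Suc n) then show ?case using prime_mult[of P "a [^] n" a] by auto
qed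

lemma pow_mem_ideal_pow:
 assumes "ideal I R" "a : I" shows "a [^] n : ideal_pow R I n"
proof (induction n)
 case 0 then show ?case by (simp only: ideal_pow_0 nat_pow_0 one_closed)
next
 case (Suc n) then show ?case
  unfolding ideal_pow_Suc nat_pow_Suc using assms(2) by (rule ideal_prod.prod)
qed

lemma ideal_pow_Suc_subset: "ideal I R ==> ideal_pow R I (Suc n) <= ideal_pow R I n"
 unfolding ideal_pow_Suc using ideal_prod_inter[OF ideal_pow_ideal] by blast

lemma ideal_pow_antimono: "ideal I R ==> m <= n ==> ideal_pow R I n <= ideal_pow R I m"
 by (rule lift_Suc_antimono_le[of "ideal_pow R I"]) (rule ideal_pow_Suc_subset)

lemma ideal_pow_subset: "ideal I R ==> 0 < n ==> ideal_pow R I n <= I"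
 using ideal_pow_antimono[of I 1 n] ideal_pow_Suc[of I 0] ideal_pow_0[of I] ideal_prod_one[of I]
  ideal_prod_commute[OF oneideal, of I] by simp

lemma ideal_pow_1: "ideal I R ==> ideal_pow R I (Suc 0) = I"
 using ideal_pow_Suc[of I 0] ideal_pow_0[of I] ideal_prod_one[of I]
  ideal_prod_commute[OF oneideal, of I] by simp

lemma ideal_pow_add:
 assumes "ideal I R" shows "ideal_pow R I m \<cdot> ideal_pow R I n = ideal_pow R I (m + n)"
proof (induction n)
 case 0
 then show ?case unfolding ideal_pow_0 using ideal_prod_one[OF ideal_pow_ideal[OF assms]] by simp
next
 case (Suc n)
 then show ?case
  unfolding ideal_pow_Suc add_Suc_right
  using ideal_prod_assoc[OF ideal_pow_ideal[OF assms] ideal_pow_ideal[OF assms] assms, of m n] by simp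
qed

lemma ideal_prod_least:
 "ideal K R ==> (!!a b. a : I ==> b : J ==> a \<otimes> b : K) ==> I \<cdot> J <= K"
proof
 fix x assume K: "ideal K R" "!!a b. a : I ==> b : J ==> a \<otimes> b : K" and "x : I \<cdot> J"
 from this(3) show "x : K" by induction (simp_all add: K ideal_add)
qed

end

subsection \<open>Finitely generated modules and Nakayama's lemma\<close>

context module
begin

lemma smult_left_commute:
 "a : carrier R ==> b : carrier R ==> x : carrier M ==> a *\<^sub>M (b *\<^sub>M x) = b *\<^sub>M (a *\<^sub>M x)"
 using smult_assoc1[of a b x] smult_assoc1[of b a x] R.m_comm[of a b] by simp

lemma set_add_zero: "submodule X R M ==> X <+>\<^sub>M {0\<^sub>M} = X"
 using submodule_carrier by (auto simp: mem_set_add)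

lemma set_add_assoc:
 assumes "submodule X R M" "submodule Y R M" "submodule Z R M"
 shows "X <+>\<^sub>M (Y <+>\<^sub>M Z) = (X <+>\<^sub>M Y) <+>\<^sub>M Z"
proof (rule antisym)
 note s = submodule_set_add[OF assms(1,2)] submodule_set_add[OF submodule_set_add[OF assms(1,2)] assms(3)]
 show "X <+>\<^sub>M (Y <+>\<^sub>M Z) <= (X <+>\<^sub>M Y) <+>\<^sub>M Z"
  using set_add_upper1[OF s(1) assms(3)] set_add_upper2[OF s(1) assms(3)]
   set_add_upper1[OF assms(1,2)] set_add_upper2[OF assms(1,2)]
  by (intro set_add_least s) blast+
 note s' = submodule_set_add[OF assms(2,3)] submodule_set_add[OF assms(1) submodule_set_add[OF assms(2,3)]]
 show "(X <+>\<^sub>M Y) <+>\<^sub>M Z <= X <+>\<^sub>M (Y <+>\<^sub>M Z)"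
  using set_add_upper1[OF assms(1) s'(1)] set_add_upper2[OF assms(1) s'(1)]
   set_add_upper1[OF assms(2,3)] set_add_upper2[OF assms(2,3)]
  by (intro set_add_least s') blast+
qed

lemma fg_set_add: "fg R M X ==> fg R M Y ==> fg R M (X <+>\<^sub>M Y)"
proof (rotate_tac, induction rule: fg.induct)
 case fg_zero
 then show ?case using set_add_zero[OF fg_submodule] by simp
next
 case (fg_add Y g)
 then have "fg R M ((X <+>\<^sub>M Y) <+>\<^sub>M cyc R M g)" by (intro fg.fg_add) auto
 then show ?case
  using set_add_assoc[OF fg_submodule fg_submodule submodule_cyc, of X Y g] fg_add by simp
qed

lemma finite_imp_fg:
 "finite A ==> A <= carrier M ==>
  EX X. fg R M X & A <= X & (ALL Z. submodule Z R M & A <= Z --> X <= Z)"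
proof (induction A rule: finite_induct)
 case empty
 show ?case
  by (intro exI[of _ "{0\<^sub>M}"]) (auto intro: fg.fg_zero simp: submodule_zero)
next
 case (insert g A)
 then obtain X where X: "fg R M X" "A <= X" "!!Z. submodule Z R M ==> A <= Z ==> X <= Z" by auto
 have g: "g : carrier M" using insert by simp
 note sX = fg_submodule[OF X(1)]
 have "fg R M (X <+>\<^sub>M cyc R M g)" using X g by (intro fg.fg_add)
 moreover have "insert g A <= X <+>\<^sub>M cyc R M g"
  using X(2) set_add_upper1[OF sX submodule_cyc[OF g]] set_add_upper2[OF sX submodule_cyc[OF g]]
   cyc_self[OF g] by blast
 moreover have "X <+>\<^sub>M cyc R M g <= Z" if "submodule Z R M" "insert g A <= Z" for Z
  using that X(3) cyc_least[of Z g] by (intro set_add_least) simp_all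
 ultimately show ?case by blast
qed

text \<open>Nakayama's lemma for the localization at \<open>Q\<close>, with the denominators written
  out: if \<open>N\<close> lies in \<open>QN + Y\<close> at \<open>Q\<close>, then it lies in
  \<open>Y\<close> at \<open>Q\<close>. The generators of \<open>N\<close> are eliminated one after
  another.\<close>

lemma nakayama_relative:
 assumes Q: "primeideal Q R" and Y: "submodule Y R M"
 shows "fg R M N ==> (!!x. x : N ==> EX u:carrier R - Q. u *\<^sub>M x : smul M Q N <+>\<^sub>M Y) ==>
  EX v:carrier R - Q. ALL x:N. v *\<^sub>M x : Y"
proof (induction rule: fg.induct)
 case fg_zero
 have "\<one> : carrier R - Q" using R.prime_one[OF Q] by simp
 then show ?case using submodule_zero[OF Y] by (intro bexI[of _ "\<one>"]) simp_all
next
 case (fg_add X g)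
 have X: "submodule X R M" using fg_submodule[OF fg_add(1)] .
 have g: "g : carrier M" by fact
 have Qi: "ideal Q R" using R.prime_ideal[OF Q] .
 have QX: "submodule (smul M Q X) R M" using submodule_smul[OF submoduleE(1)[OF X] Qi] .
 have QXX: "smul M Q X <= X" using smul_subset[OF X ideal_subset_carrier[OF Qi]] .
 let ?B = "smul M Q X <+>\<^sub>M Y"
 have B: "submodule ?B R M" using submodule_set_add[OF QX Y] .
 have YB: "Y <= ?B" and QXB: "smul M Q X <= ?B"
  using set_add_upper2[OF QX Y] set_add_upper1[OF QX Y] .
 have dec: "EX q:Q. EX b:?B. z = b +\<^sub>M q *\<^sub>M g"
  if z: "z : smul M Q (X <+>\<^sub>M cyc R M g) <+>\<^sub>M Y" for z
 proof -
  obtain w y where wy: "w : smul M Q (X <+>\<^sub>M cyc R M g)" "y : Y" "z = w +\<^sub>M y"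
   using z by (auto simp: mem_set_add)
  obtain q x where qx: "q : Q" "x : smul M Q X" "w = x +\<^sub>M q *\<^sub>M g"
   using smul_set_add_cyc[OF X g Qi wy(1)] by blast
  have c: "q : carrier R" "x : carrier M" "y : carrier M"
   using R.ideal_carrier[OF Qi qx(1)] submodule_carrier[OF QX qx(2)] submodule_carrier[OF Y wy(2)] .
  have "z = (x +\<^sub>M y) +\<^sub>M q *\<^sub>M g" using wy qx c g by (simp add: M.a_ac)
  moreover have "x +\<^sub>M y : ?B" unfolding mem_set_add using qx wy by blast
  ultimately show ?thesis using qx(1) by blast
 qed
 have "g : X <+>\<^sub>M cyc R M g"
  using set_add_upper2[OF X submodule_cyc[OF g]] cyc_self[OF g] by blast
 then obtain u q b where u: "u : carrier R - Q" "q : Q" "b : ?B" "u *\<^sub>M g = b +\<^sub>M q *\<^sub>M g"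
  using fg_add.prems dec by meson
 have qc: "q : carrier R" and uc: "u : carrier R" and bc: "b : carrier M"
  using R.ideal_carrier[OF Qi u(2)] u(1) submodule_carrier[OF B u(3)] by simp_all
 \<comment> \<open>The equation \<open>u g = b + q g\<close> is solved for \<open>g\<close> by the
   factor \<open>u - q\<close>, a unit at \<open>Q\<close> because \<open>u\<close> is outside and
   \<open>q\<close> inside \<open>Q\<close>.\<close>
 define v1 where "v1 = u \<ominus> q"
 have v1c: "v1 : carrier R" using qc uc by (simp add: v1_def)
 have "v1 ~: Q"
 proof
  assume "v1 : Q"
  then have "v1 \<oplus> q : Q" using R.ideal_add[OF Qi] u by blast
  then show False using u qc by (simp add: v1_def R.minus_plus_cancel)
 qed
 have "u = v1 \<oplus> q" using qc uc by (simp add: v1_def R.minus_plus_cancel)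
 then have "v1 *\<^sub>M g +\<^sub>M q *\<^sub>M g = b +\<^sub>M q *\<^sub>M g"
  using u(4) v1c qc g by (simp add: smult_l_distr)
 then have v1g: "v1 *\<^sub>M g : ?B" using v1c qc g bc u(3) by (simp add: M.add.r_cancel)
 \<comment> \<open>Multiplication by \<open>v1\<close> moves the contribution of \<open>g\<close>
   into \<open>QX + Y\<close>, so \<open>X\<close> satisfies the hypothesis of the induction without
   \<open>g\<close>.\<close>
 have "EX u:carrier R - Q. u *\<^sub>M x : ?B" if x: "x : X" for x
 proof -
  have xc: "x : carrier M" using submodule_carrier[OF X x] .
  have "x : X <+>\<^sub>M cyc R M g" using set_add_upper1[OF X submodule_cyc[OF g]] x by blast
  then obtain u' q' b' where u': "u' : carrier R - Q" "q' : Q" "b' : ?B"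
    "u' *\<^sub>M x = b' +\<^sub>M q' *\<^sub>M g"
   using fg_add.prems dec by meson
  have c': "q' : carrier R" "u' : carrier R" "b' : carrier M"
   using R.ideal_carrier[OF Qi u'(2)] u'(1) submodule_carrier[OF B u'(3)] by simp_all
  have "(v1 \<otimes> u') *\<^sub>M x = v1 *\<^sub>M b' +\<^sub>M q' *\<^sub>M (v1 *\<^sub>M g)"
   using c' v1c g xc u'(4) smult_left_commute[of v1 q' g] by (simp add: smult_assoc1 smult_r_distr)
  also have "\<dots> : ?B"
   using submoduleE(4,5)[OF B] v1g u'(3) v1c c' by simp
  finally show ?thesis using R.prime_mult_notin[OF Q, of v1 u'] v1c \<open>v1 ~: Q\<close> u'(1) by blast
 qed
 then obtain v2 where v2: "v2 : carrier R - Q" "ALL x:X. v2 *\<^sub>M x : Y" using fg_add.IH by blast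
 have v2B: "v2 *\<^sub>M z : Y" if "z : ?B" for z
 proof -
  obtain x y where xy: "x : smul M Q X" "y : Y" "z = x +\<^sub>M y" using \<open>z : ?B\<close> by (auto simp: mem_set_add)
  have "v2 *\<^sub>M z = v2 *\<^sub>M x +\<^sub>M v2 *\<^sub>M y"
   using xy v2 submodule_carrier[OF QX] submodule_carrier[OF Y] by (simp add: smult_r_distr)
  moreover have "v2 *\<^sub>M x : Y" using v2 xy QXX by blast
  moreover have "v2 *\<^sub>M y : Y" using v2 xy submoduleE(4)[OF Y] by simp
  ultimately show ?thesis using submoduleE(5)[OF Y] by simp
 qed
 have "(v2 \<otimes> v1) *\<^sub>M z : Y" if z: "z : X <+>\<^sub>M cyc R M g" for z
 proof -
  obtain x r where xr: "x : X" "r : carrier R" "z = x +\<^sub>M r *\<^sub>M g"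
   using z by (auto simp: mem_set_add cyc_def)
  have xc: "x : carrier M" and v2c: "v2 : carrier R" using submodule_carrier[OF X xr(1)] v2 by simp_all
  have "(v2 \<otimes> v1) *\<^sub>M z = v1 *\<^sub>M (v2 *\<^sub>M x) +\<^sub>M r *\<^sub>M (v2 *\<^sub>M (v1 *\<^sub>M g))"
   using xr xc v1c v2c g smult_left_commute[of v1 r g] smult_left_commute[of v2 r "v1 *\<^sub>M g"]
    smult_left_commute[of v2 v1 x]
   by (simp add: smult_r_distr smult_assoc1)
  then show ?thesis
   using v2B[OF v1g] v2(2) xr(1,2) v1c submoduleE(4,5)[OF Y] by simp
 qed
 moreover have "v2 \<otimes> v1 : carrier R - Q"
  using R.prime_mult_notin[OF Q, of v2 v1] v1c \<open>v1 ~: Q\<close> v2 by blast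
 ultimately show ?case by blast
qed

end

subsection \<open>Noetherian rings\<close>

locale noeth = cring R + noetherian_ring R for R (structure)

locale noeth_module = R?: noeth R + module R M for R (structure) and M (structure)

lemma (in noeth) noeth_module_ring_module: "noeth_module R rm"
 by (intro noeth_module.intro noeth_axioms module_ring_module)

context noeth
begin

lemma maximal_ideal_exists:
 assumes "S ~= {}" "!!J. J : S ==> ideal J R"
 shows "EX J:S. ALL K:S. J <= K --> K = J"
proof (rule subset_Zorn_nonempty[OF assms(1)])
 fix C assume C: "C ~= {}" "subset.chain S C"
 have CS: "C <= S" using C(2) by (simp add: subset_chain_def)
 then have "C <= {J. ideal J R}" using assms(2) by auto
 then have "subset.chain {J. ideal J R} C" using C(2) by (simp add: subset_chain_def)
 from ideal_chain_is_trivial[OF C(1) this] show "\<Union>C : S" using CS by (rule rev_subsetD)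
qed

lemma noeth_induct [consumes 1, case_names step]:
 assumes "ideal E R"
  and "!!E. ideal E R ==> (!!E'. ideal E' R ==> E \<subset> E' ==> P E') ==> P E"
 shows "P E"
proof (rule ccontr)
 assume "~ P E"
 then have "{J. ideal J R & ~ P J} ~= {}" using assms(1) by blast
 then obtain J where "ideal J R" "~ P J" "!!K. ideal K R ==> ~ P K ==> J <= K ==> K = J"
  using maximal_ideal_exists[of "{J. ideal J R & ~ P J}"] by blast
 then show False using assms(2)[of J] by blast
qed

text \<open>Noetherian induction: if \<open>a \<otimes> b : E\<close> with neither factor in
  \<open>E\<close>, a prime over \<open>E\<close> lies over \<open>E + (a)\<close> or over
  \<open>E + (b)\<close>. The set \<open>S\<close> may be redundant; what counts is that it is
  finite and meets the primes below each prime over \<open>E\<close>.\<close>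

lemma finite_minimal_primes:
 assumes "ideal E R"
 shows "EX S. finite S & (ALL P:S. primeideal P R & E <= P) &
  (ALL P. primeideal P R & E <= P --> (EX P':S. P' <= P))"
 using assms
proof (induction rule: noeth_induct)
 case (step E)
 show ?case
 proof (cases "primeideal E R | E = carrier R")
  case True
  then show ?thesis
  proof
   assume "primeideal E R" then show ?thesis by (intro exI[of _ "{E}"]) auto
  next
   assume E: "E = carrier R"
   have False if "primeideal P R" "E <= P" for P
    using prime_one[OF that(1)] that(2) E by auto
   then show ?thesis by (intro exI[of _ "{}"]) auto
  qed
 next
  case False
  then obtain a b where ab: "a : carrier R" "b : carrier R" "a \<otimes> b : E" "a ~: E" "b ~: E"
   using primeidealI[OF step.hyps is_cring] by blast
  have "EX S. finite S & (ALL P:S. primeideal P R & E <+>\<^bsub>R\<^esub> PIdl x <= P) &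
    (ALL P. primeideal P R & E <+>\<^bsub>R\<^esub> PIdl x <= P --> (EX P':S. P' <= P))"
   if x: "x : carrier R" "x ~: E" for x
  proof (rule step.IH)
   show i: "ideal (E <+>\<^bsub>R\<^esub> PIdl x) R" by (rule ideal_set_add_PIdl[OF step.hyps x(1)])
   show "E \<subset> E <+>\<^bsub>R\<^esub> PIdl x"
    using set_add_upper1[OF step.hyps cgenideal_ideal[OF x(1)]]
     set_add_upper2[OF step.hyps cgenideal_ideal[OF x(1)] cgenideal_self[OF x(1)]] x(2) by blast
  qed
  from this[OF ab(1,4)] this[OF ab(2,5)] obtain S T where
   S: "finite S" "!!P. P : S ==> primeideal P R & E <+>\<^bsub>R\<^esub> PIdl a <= P"
    "!!P. primeideal P R ==> E <+>\<^bsub>R\<^esub> PIdl a <= P ==> EX P':S. P' <= P" and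
   T: "finite T" "!!P. P : T ==> primeideal P R & E <+>\<^bsub>R\<^esub> PIdl b <= P"
    "!!P. primeideal P R ==> E <+>\<^bsub>R\<^esub> PIdl b <= P ==> EX P':T. P' <= P"
   by metis
  have up: "E <= E <+>\<^bsub>R\<^esub> PIdl x" if "x : carrier R" for x
   using set_add_upper1[OF step.hyps cgenideal_ideal[OF that]] by blast
  have le: "E <+>\<^bsub>R\<^esub> PIdl x <= P" if "primeideal P R" "E <= P" "x : P" for x P
  proof
   fix y assume "y : E <+>\<^bsub>R\<^esub> PIdl x"
   then obtain i r where "i : E" "r : carrier R" "y = i \<oplus> r \<otimes> x" unfolding mem_set_add_PIdl by blast
   then show "y : P"
    using that ideal_add[OF prime_ideal[OF that(1)]] ideal_lmult[OF prime_ideal[OF that(1)]] by blast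
  qed
  have "EX P':S \<union> T. P' <= P" if P: "primeideal P R" "E <= P" for P
  proof -
   have "a : P | b : P" using prime_mult[OF P(1) ab(1,2)] ab(3) P(2) by blast
   then show ?thesis using le[OF P] S(3)[OF P(1)] T(3)[OF P(1)] by blast
  qed
  moreover have "ALL P:S \<union> T. primeideal P R & E <= P"
   using S(2) T(2) up[OF ab(1)] up[OF ab(2)] by blast
  ultimately show ?thesis using S(1) T(1) by (intro exI[of _ "S \<union> T"]) simp
 qed
qed

lemma ideal_fg: assumes "ideal I R" shows "fg R rm I"
proof -
 obtain A where A: "A <= carrier R" "finite A" "I = Idl A" using finetely_gen[OF assms] by blast
 have "A <= carrier rm" using A by simp
 from RM.finite_imp_fg[OF A(2) this] obtain X where X: "fg R rm X" "A <= X"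
   "!!Z. submodule Z R rm ==> A <= Z ==> X <= Z" by blast
 have "ideal X R" using RM.fg_submodule[OF X(1)] by (simp add: ideal_iff_submodule)
 then have "I <= X" using A(3) X(2) genideal_minimal by simp
 moreover have "X <= I"
  using X(3)[of I] A assms genideal_self by (simp add: ideal_iff_submodule)
 ultimately show ?thesis using X(1) by simp
qed

end

context noeth_module
begin

text \<open>Existence of associated primes of \<open>M/Y\<close>: a colon ideal that is maximal
  among those of elements outside \<open>Y\<close> is prime, since passing from \<open>g\<close> to
  \<open>b g\<close> can only enlarge it. Starting from \<open>g0\<close> controls what the prime
  contains.\<close>

lemma prime_colon:
 assumes Y: "submodule Y R M" and g0: "g0 : carrier M" "g0 ~: Y"
 shows "EX g. g : carrier M & g ~: Y & primeideal (colon R M Y g) R & colon R M Y g0 <= colon R M Y g"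
proof -
 define S where "S = {colon R M Y g | g. g : carrier M & g ~: Y & colon R M Y g0 <= colon R M Y g}"
 have "S ~= {}" using g0 by (auto simp: S_def)
 moreover have "ideal J R" if "J : S" for J using that ideal_colon[OF Y] by (auto simp: S_def)
 ultimately have "EX J:S. ALL K:S. J <= K --> K = J" by (rule maximal_ideal_exists)
 then obtain g where g: "g : carrier M" "g ~: Y" "colon R M Y g0 <= colon R M Y g"
  and max: "!!K. K : S ==> colon R M Y g <= K ==> K = colon R M Y g"
  by (auto simp: S_def)
 have "primeideal (colon R M Y g) R"
 proof (rule primeidealI)
  show "ideal (colon R M Y g) R" by (rule ideal_colon[OF Y g(1)])
  show "cring R" by (rule R.is_cring)
  have "\<one> ~: colon R M Y g" using g by (simp add: colon_def)
  then show "carrier R ~= colon R M Y g" by (metis R.one_closed)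
  fix a b assume ab: "a : carrier R" "b : carrier R" "a \<otimes> b : colon R M Y g"
  show "a : colon R M Y g | b : colon R M Y g"
  proof (rule disjCI)
   assume nb: "b ~: colon R M Y g"
   then have bg: "b *\<^sub>M g : carrier M" "b *\<^sub>M g ~: Y" using ab g by (auto simp: colon_def)
   have sub: "colon R M Y g <= colon R M Y (b *\<^sub>M g)"
   proof
    fix r assume r: "r : colon R M Y g"
    then have "r *\<^sub>M (b *\<^sub>M g) = b *\<^sub>M (r *\<^sub>M g)"
     using ab g smult_left_commute by (auto simp: colon_def)
    then show "r : colon R M Y (b *\<^sub>M g)" using r ab submoduleE(4)[OF Y] by (auto simp: colon_def)
   qed
   have "colon R M Y (b *\<^sub>M g) : S" using bg sub g(3) by (auto simp: S_def)
   from max[OF this sub] have "colon R M Y (b *\<^sub>M g) = colon R M Y g" .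
   moreover have "a : colon R M Y (b *\<^sub>M g)"
    using ab g by (auto simp: colon_def smult_assoc1)
   ultimately show "a : colon R M Y g" by simp
  qed
 qed
 then show ?thesis using g by blast
qed

text \<open>In the step from \<open>N\<close> to \<open>N + Rg\<close>, the ideal
  \<open>(N + X : g)\<close> of coefficients of \<open>g\<close> is finitely generated. Lifts of its
  generators span some \<open>W\<close> inside \<open>X\<close> with
  \<open>X = (X \<inter> N) + W\<close>, and the induction hypothesis handles
  \<open>X \<inter> N\<close>.\<close>

lemma submodule_fg:
 "fg R M N ==> submodule X R M ==> X <= N ==> fg R M X"
proof (induction arbitrary: X rule: fg.induct)
 case fg_zero
 then have "X = {0\<^sub>M}" using submodule_zero[of X] by blast
 then show ?case by (simp add: fg.fg_zero)
next
 case (fg_add N g)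
 have N: "submodule N R M" using fg_submodule[OF fg_add(1)] .
 have g: "g : carrier M" and X: "submodule X R M" by fact+
 have NX: "submodule (N <+>\<^sub>M X) R M" by (rule submodule_set_add[OF N X])
 have "EX W. fg R M W & W <= X & E <= colon R M (N <+>\<^sub>M W) g"
  if "fg R rm E" "E <= colon R M (N <+>\<^sub>M X) g" for E
  using that
 proof (induction rule: fg.induct)
  case fg_zero
  have "\<zero> : colon R M (N <+>\<^sub>M {0\<^sub>M}) g"
   by (intro ideal_zero ideal_colon submodule_set_add N submodule_singleton_zero g)
  then show ?case using submodule_zero[OF X] by (intro exI[of _ "{0\<^sub>M}"]) (simp add: fg.fg_zero)
 next
  case (fg_add E e)
  have e: "e : carrier R" using fg_add by simp
  note E = RM.fg_submodule[OF fg_add(1)] and C = RM.submodule_cyc[OF fg_add(2)]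
  obtain W where W: "fg R M W" "W <= X" "E <= colon R M (N <+>\<^sub>M W) g"
   using fg_add.IH fg_add.prems RM.set_add_upper1[OF E C] by blast
  have "e *\<^sub>M g : N <+>\<^sub>M X"
   using RM.set_add_upper2[OF E C] RM.cyc_self[OF fg_add(2)] fg_add.prems by (auto simp: colon_def)
  then obtain n w where nw: "n : N" "w : X" "e *\<^sub>M g = n +\<^sub>M w" by (auto simp: mem_set_add)
  have w: "w : carrier M" using submodule_carrier[OF X nw(2)] .
  let ?W = "W <+>\<^sub>M cyc R M w"
  note Ws = fg_submodule[OF W(1)]
  have sW: "submodule ?W R M" and fgW: "fg R M ?W"
   using submodule_set_add[OF Ws submodule_cyc[OF w]] fg.fg_add[OF W(1) w] .
  have "N <+>\<^sub>M W <= N <+>\<^sub>M ?W" by (rule set_add_mono[OF subset_refl set_add_upper1[OF Ws submodule_cyc[OF w]]])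
  then have "E <= colon R M (N <+>\<^sub>M ?W) g" using W(3) by (auto simp: colon_def)
  moreover have "w : ?W" by (rule rev_subsetD[OF cyc_self[OF w] set_add_upper2[OF Ws submodule_cyc[OF w]]])
  then have "e : colon R M (N <+>\<^sub>M ?W) g" using nw e unfolding colon_def mem_set_add[of _ N] by blast
  moreover have "submodule (colon R M (N <+>\<^sub>M ?W) g) R rm"
   using ideal_colon[OF submodule_set_add[OF N sW] g] by (simp add: ideal_iff_submodule)
  ultimately have "E <+>\<^bsub>rm\<^esub> cyc R rm e <= colon R M (N <+>\<^sub>M ?W) g"
   by (intro RM.set_add_least RM.cyc_least)
  moreover have "?W <= X" by (intro set_add_least[OF X W(2)] cyc_least[OF X nw(2)])
  ultimately show ?case using fgW by blast
 qed
 from this[OF ideal_fg[OF ideal_colon[OF NX g]] subset_refl] obtain W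
  where W: "fg R M W" "W <= X" "colon R M (N <+>\<^sub>M X) g <= colon R M (N <+>\<^sub>M W) g" by blast
 have XN: "submodule (X \<inter> N) R M" using submodule_inter[OF X N] .
 have "X = (X \<inter> N) <+>\<^sub>M W"
 proof (rule antisym)
  show "(X \<inter> N) <+>\<^sub>M W <= X" using W(2) by (intro set_add_least[OF X]) auto
  show "X <= (X \<inter> N) <+>\<^sub>M W"
  proof
   fix x assume x: "x : X"
   then have "x : N <+>\<^sub>M cyc R M g" using fg_add.prems(2) by (rule rev_subsetD)
   then obtain n d where nd: "n : N" "d : carrier R" "x = n +\<^sub>M d *\<^sub>M g"
    by (auto simp: mem_set_add cyc_def)
   have nc: "n : carrier M" using nd submodule_carrier[OF N] by blast
   have "d *\<^sub>M g = \<ominus>\<^bsub>M\<^esub> n +\<^sub>M x" unfolding nd(3) using nc nd(2) g by (simp add: M.r_neg1)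
   then have "d : colon R M (N <+>\<^sub>M X) g"
    unfolding colon_def mem_set_add using nd(1,2) x submoduleE(3)[OF N] by blast
   then have "d : colon R M (N <+>\<^sub>M W) g" using W(3) by blast
   then obtain n' w where n': "n' : N" "w : W" "d *\<^sub>M g = n' +\<^sub>M w" by (auto simp: colon_def mem_set_add)
   have c: "n' : carrier M" "w : carrier M" using n' W(2) submodule_carrier[OF N] submodule_carrier[OF X] by auto
   have xe: "x = (n +\<^sub>M n') +\<^sub>M w" using c nc nd(3) n'(3) by (simp add: M.a_assoc)
   then have "n +\<^sub>M n' : X"
    using submodule_add_cancel[OF X, of w "n +\<^sub>M n'"] x n' W(2) c nc by (auto simp: M.a_comm)
   then show "x : (X \<inter> N) <+>\<^sub>M W" unfolding mem_set_add using xe n' nd(1) submoduleE(5)[OF N] by blast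
  qed
 qed
 moreover have "fg R M (X \<inter> N)" using fg_add.IH[OF XN] by blast
 ultimately show ?case using fg_set_add[OF _ W(1)] by metis
qed

end

context noeth
begin

lemma prime_colon_ring:
 assumes "ideal E R" "\<one> ~: E"
 obtains g where "g : carrier R" "g ~: E" "primeideal (colon R rm E g) R"
  "E <= colon R rm E g"
proof -
 obtain g where g: "g : carrier R" "g ~: E" "primeideal (colon R rm E g) R"
  using noeth_module.prime_colon[OF noeth_module_ring_module, of E "\<one>"] assms
  by (auto simp: ideal_iff_submodule)
 moreover have "E <= colon R rm E g"
  using ideal_carrier[OF assms(1)] ideal_rmult[OF assms(1) g(1)] by (auto simp: colon_def)
 ultimately show thesis by (rule that)
qed

text \<open>\<open>Y\<close> is the saturation of \<open>E\<close> by the powers of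
  \<open>a\<close>. A prime colon ideal of \<open>Y\<close> cannot contain \<open>a\<close>, since
  \<open>a g\<close> in \<open>Y\<close> would put \<open>g\<close> into \<open>Y\<close>.\<close>

lemma prime_avoiding_power:
 assumes E: "ideal E R" and a: "a : carrier R" and n: "!!n::nat. a [^] n ~: E"
 shows "EX P. primeideal P R & E <= P & a ~: P"
proof -
 define Y where "Y = {x : carrier R. EX n::nat. a [^] n \<otimes> x : E}"
 have Yi: "ideal Y R"
 proof (rule idealI2)
  show "Y <= carrier R" by (auto simp: Y_def)
  show "\<zero> : Y" using a ideal_zero[OF E] by (auto simp: Y_def)
 next
  fix x y assume "x : Y" "y : Y"
  then obtain n m :: nat where xy: "x : carrier R" "y : carrier R" "a [^] n \<otimes> x : E" "a [^] m \<otimes> y : E"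
   unfolding Y_def by blast
  have "a [^] (n + m) \<otimes> (x \<oplus> y) = a [^] m \<otimes> (a [^] n \<otimes> x) \<oplus> a [^] n \<otimes> (a [^] m \<otimes> y)"
   using xy a by (simp add: r_distr m_ac flip: nat_pow_mult)
  also have "\<dots> : E" using xy a ideal_add[OF E] ideal_lmult[OF E] by simp
  finally show "x \<oplus> y : Y" using xy unfolding Y_def by blast
 next
  fix r x assume r: "r : carrier R" and "x : Y"
  then obtain n :: nat where x: "x : carrier R" "a [^] n \<otimes> x : E" unfolding Y_def by blast
  have "a [^] n \<otimes> (r \<otimes> x) = r \<otimes> (a [^] n \<otimes> x)" using r x a by (simp add: m_ac)
  also have "\<dots> : E" using r x ideal_lmult[OF E] by simp
  finally show "r \<otimes> x : Y" using r x unfolding Y_def by blast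
 qed
 then have Y: "submodule Y R rm" by (simp add: ideal_iff_submodule)
 have "\<one> ~: Y" using n a by (auto simp: Y_def)
 then obtain g where g: "g : carrier R" "g ~: Y" "primeideal (colon R rm Y g) R"
  using noeth_module.prime_colon[OF noeth_module_ring_module Y, of "\<one>"] by auto
 have "E <= colon R rm Y g"
 proof
  fix x assume x: "x : E"
  then have xc: "x : carrier R" by (rule ideal_carrier[OF E])
  have "a [^] (0::nat) \<otimes> (x \<otimes> g) : E" using x xc g E by (simp add: ideal_rmult)
  then have "x \<otimes> g : Y" using xc g(1) unfolding Y_def by blast
  then show "x : colon R rm Y g" using xc by (simp add: colon_def)
 qed
 moreover have "a ~: colon R rm Y g"
 proof
  assume "a : colon R rm Y g"
  then obtain n :: nat where "a [^] n \<otimes> (a \<otimes> g) : E" unfolding colon_def Y_def by auto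
  then have "a [^] (Suc n) \<otimes> g : E" using a g by (simp add: m_assoc)
  then show False using g unfolding Y_def by blast
 qed
 ultimately show ?thesis using g by blast
qed

end

subsection \<open>Krull's principal ideal theorem\<close>

text \<open>Ideals of the localization at \<open>Q\<close> are represented by their contractions to
  \<open>R\<close>: \<open>sat R Q X\<close> is the contraction of the extension of
  \<open>X\<close>, and the contracted ideals are the \<open>saturated\<close> ones.\<close>

definition sat :: "('a, 'k) ring_scheme => 'a set => 'a set => 'a set"
 where "sat R Q X = {x : carrier R. EX u:carrier R - Q. u \<otimes>\<^bsub>R\<^esub> x : X}"

definition saturated :: "('a, 'k) ring_scheme => 'a set => 'a set => bool"
 where "saturated R Q X \<longleftrightarrow>
  (ALL u:carrier R - Q. ALL x:carrier R. u \<otimes>\<^bsub>R\<^esub> x : X --> x : X)"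

context cring
begin

lemma saturatedD: "saturated R Q X ==> u : carrier R ==> u ~: Q ==> x : carrier R ==> u \<otimes> x : X ==> x : X"
 by (simp add: saturated_def)

lemma ideal_sat:
 assumes Q: "primeideal Q R" and X: "ideal X R"
 shows "ideal (sat R Q X) R"
proof (rule idealI2)
 show "sat R Q X <= carrier R" by (auto simp: sat_def)
 have "\<one> : carrier R - Q" using prime_one[OF Q] by simp
 then show "\<zero> : sat R Q X" using ideal_zero[OF X] unfolding sat_def by fastforce
next
 fix a b assume "a : sat R Q X" "b : sat R Q X"
 then obtain u v where uv: "a : carrier R" "b : carrier R" "u : carrier R - Q" "v : carrier R - Q"
  "u \<otimes> a : X" "v \<otimes> b : X" unfolding sat_def by blast
 have "(u \<otimes> v) \<otimes> (a \<oplus> b) = v \<otimes> (u \<otimes> a) \<oplus> u \<otimes> (v \<otimes> b)"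
  using uv by (simp add: r_distr m_ac)
 also have "\<dots> : X" using uv ideal_add[OF X] ideal_lmult[OF X] by simp
 finally show "a \<oplus> b : sat R Q X"
  using uv prime_mult_notin[OF Q uv(3,4)] unfolding sat_def by blast
next
 fix r a assume r: "r : carrier R" and "a : sat R Q X"
 then obtain u where u: "a : carrier R" "u : carrier R - Q" "u \<otimes> a : X" unfolding sat_def by blast
 have "u \<otimes> (r \<otimes> a) = r \<otimes> (u \<otimes> a)" using u r by (simp add: m_ac)
 also have "\<dots> : X" using u r ideal_lmult[OF X] by simp
 finally show "r \<otimes> a : sat R Q X" using u r unfolding sat_def by blast
qed

lemma sat_upper: "primeideal Q R ==> ideal X R ==> x : X ==> x : sat R Q X"
 unfolding sat_def using prime_one[of Q] ideal_carrier[of X x] by (auto intro!: bexI[of _ "\<one>"])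

lemma saturated_sat:
 assumes Q: "primeideal Q R" and X: "ideal X R"
 shows "saturated R Q (sat R Q X)"
 unfolding saturated_def
proof (intro ballI impI)
 fix u x assume u: "u : carrier R - Q" and x: "x : carrier R" and "u \<otimes> x : sat R Q X"
 then obtain v where v: "v : carrier R - Q" "v \<otimes> (u \<otimes> x) : X" unfolding sat_def by blast
 then have "(v \<otimes> u) \<otimes> x : X" using u x by (simp add: m_assoc)
 then show "x : sat R Q X" using prime_mult_notin[OF Q v(1) u] x unfolding sat_def by blast
qed

lemma sat_least:
 assumes "saturated R Q Y" "X <= Y"
 shows "sat R Q X <= Y"
proof
 fix x assume "x : sat R Q X"
 then obtain u where "x : carrier R" "u : carrier R" "u ~: Q" "u \<otimes> x : X" unfolding sat_def by blast
 then show "x : Y" using saturatedD[OF assms(1)] assms(2) by blast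
qed

lemma sat_mono: "X <= Y ==> sat R Q X <= sat R Q Y"
 unfolding sat_def by blast

end

context noeth
begin

text \<open>The localization of \<open>R/E\<close> at \<open>Q\<close> is Artinian when
  \<open>Q\<close> is its only prime. Noetherian induction on \<open>E\<close>: an element
  \<open>g\<close> with \<open>(E : g) = Q\<close> spans a simple module at \<open>Q\<close>, so a
  chain is controlled by its image modulo \<open>g\<close> and by whether its members contain
  \<open>g\<close>.\<close>

lemma dcc_saturated:
 assumes E: "ideal E R" and Q: "primeideal Q R"
 shows "saturated R Q E ==> (!!P. primeideal P R ==> E <= P ==> P <= Q ==> P = Q) ==>
  (!!n::nat. ideal (D n) R & saturated R Q (D n) & E <= D n) ==> (!!n. D (Suc n) <= D n) ==>
  EX N. ALL n>=N. D n = D N"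
 using E
proof (induction arbitrary: D rule: noeth_induct)
 case (step E)
 have Qi: "ideal Q R" using prime_ideal[OF Q] .
 have anti: "D n <= D k" if "k <= n" for k n
  using that step.prems(4) by (rule lift_Suc_antimono_le[rotated]) 
 have Di: "ideal (D n) R" and Ds: "saturated R Q (D n)" and ED: "E <= D n" for n
  using step.prems(3)[of n] by auto
 show ?case
 proof (cases "\<one> : E")
  case True
  then have "D n = carrier R" for n
   using ideal.one_imp_carrier[OF Di] ED by blast
  then show ?thesis by simp
 next
  case False
  obtain g where g: "g : carrier R" "g ~: E" and Pg: "primeideal (colon R rm E g) R"
   and E_sub: "E <= colon R rm E g"
   by (rule prime_colon_ring[OF step.hyps False])
  have sub_Q: "colon R rm E g <= Q"
   using saturatedD[OF step.prems(1) _ _ g(1)] g(2) by (auto simp: colon_def)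
  have Qg: "q \<otimes> g : E" if "q : Q" for q
   using step.prems(2)[OF Pg E_sub sub_Q] that by (auto simp: colon_def)
  define up where "up X = sat R Q (X <+>\<^bsub>R\<^esub> PIdl g)" for X
  have up_ideal: "ideal (up X) R" if "ideal X R" for X
   unfolding up_def by (rule ideal_sat[OF Q ideal_set_add_PIdl[OF that g(1)]])
  have up_sat: "saturated R Q (up X)" if "ideal X R" for X
   unfolding up_def by (rule saturated_sat[OF Q ideal_set_add_PIdl[OF that g(1)]])
  have up_upper: "X <= up X" if "ideal X R" for X
   unfolding up_def
   using sat_upper[OF Q ideal_set_add_PIdl[OF that g(1)]] set_add_upper1[OF that cgenideal_ideal[OF g(1)]]
   by blast
  have up_g: "g : up X" if "ideal X R" for X
   unfolding up_def
   by (rule sat_upper[OF Q ideal_set_add_PIdl[OF that g(1)]])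
     (rule set_add_upper2[OF that cgenideal_ideal[OF g(1)] cgenideal_self[OF g(1)]])
  have up_mono: "up X <= up Y" if "X <= Y" for X Y
   unfolding up_def by (rule sat_mono) (use that in \<open>unfold mem_set_add subset_iff, blast\<close>)
  have up_least: "up X <= Y" if XY: "X <= Y" and gY: "g : Y" and Y: "ideal Y R" "saturated R Q Y" for X Y
   unfolding up_def
  proof (rule sat_least[OF Y(2)], rule subsetI)
   fix x assume "x : X <+>\<^bsub>R\<^esub> PIdl g"
   then obtain i r where "i : X" "r : carrier R" "x = i \<oplus> r \<otimes> g" unfolding mem_set_add_PIdl by blast
   then show "x : Y" using XY gY ideal_add[OF Y(1)] ideal_lmult[OF Y(1)] by blast
  qed
  have IH: "EX N. ALL n>=N. D' n = D' N"
   if D': "!!n::nat. ideal (D' n) R & saturated R Q (D' n) & up E <= D' n" "!!n. D' (Suc n) <= D' n" for D'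
  proof (rule step.IH[of "up E" D'])
   show "ideal (up E) R" "saturated R Q (up E)"
    by (rule up_ideal[OF step.hyps], rule up_sat[OF step.hyps])
   show "ideal (D' n) R & saturated R Q (D' n) & up E <= D' n" "D' (Suc n) <= D' n" for n
    by (rule D')+
   show "E \<subset> up E" using up_upper[OF step.hyps] up_g[OF step.hyps] g(2) by blast
   fix P assume "primeideal P R" "up E <= P" "P <= Q"
   then show "P = Q" using step.prems(2)[of P] up_upper[OF step.hyps] by blast
  qed
  show ?thesis
  proof (cases "ALL n. g : D n")
   case True
   then show ?thesis
    using step.prems(4) up_least[OF ED _ Di Ds] Di Ds by (intro IH) blast+
  next
   case False
   then obtain n0 where n0: "g ~: D n0" by blast
   have "EX N. ALL n>=N. up (D n) = up (D N)"
    using up_ideal[OF Di] up_sat[OF Di] up_mono[OF ED] up_mono[OF step.prems(4)] by (intro IH) blast+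
   then obtain N where N: "!!n. n >= N ==> up (D n) = up (D N)" by blast
   define K where "K = max n0 N"
   have "D n = D K" if n: "n >= K" for n
   proof
    show "D n <= D K" by (rule anti[OF n])
    show "D K <= D n"
    proof
     fix x assume x: "x : D K"
     then have xc: "x : carrier R" by (rule ideal_carrier[OF Di])
     have "up (D K) = up (D n)" using N[of n] N[of K] n by (simp add: K_def)
     then have "x : up (D n)" using x up_upper[OF Di] by blast
     then obtain u d r where u: "u : carrier R" "u ~: Q" "d : D n" "r : carrier R"
      "u \<otimes> x = d \<oplus> r \<otimes> g" unfolding up_def sat_def mem_set_add_PIdl by blast
     have dK: "d : D K" using u(3) anti[OF n] by blast
     have dc: "d : carrier R" by (rule ideal_carrier[OF Di u(3)])
     have "u \<otimes> x \<ominus> d = r \<otimes> g"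
      using u g dc xc by (intro minus_eqI) auto
     moreover have "u \<otimes> x \<ominus> d : D K" using x dK u(1) ideal_minus[OF Di] ideal_lmult[OF Di] by blast
     ultimately have rg: "r \<otimes> g : D K" by simp
     \<comment> \<open>A coefficient outside \<open>Q\<close> would be invertible at
       \<open>Q\<close> and put \<open>g\<close> into \<open>D K\<close>, which is excluded; a
       coefficient inside \<open>Q\<close> sends \<open>g\<close> into \<open>E\<close>.\<close>
     have "r : Q"
     proof (rule ccontr)
      assume "r ~: Q"
      then have "g : D K" using saturatedD[OF Ds u(4) _ g(1) rg] by blast
      then show False using n0 anti[of n0 K] by (auto simp: K_def)
     qed
     then have "r \<otimes> g : D n" using Qg ED by blast
     then have "u \<otimes> x : D n" using u ideal_add[OF Di] by simp
     then show "x : D n" using saturatedD[OF Ds u(1,2) xc] by blast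
    qed
   qed
   then show ?thesis by blast
  qed
 qed
qed

text \<open>Krull's theorem in relative form. If \<open>Q\<close> were minimal over
  \<open>P0 + (a)\<close>, the symbolic powers of \<open>P1\<close> modulo \<open>P0\<close> would
  become stationary: first modulo \<open>a\<close> by the descending chain condition at
  \<open>Q\<close>, then by Nakayama at \<open>Q\<close> because \<open>a\<close> is outside
  \<open>P1\<close>. Nakayama at \<open>P1\<close> would kill a power of \<open>P1\<close> modulo
  \<open>P0\<close>, against \<open>P0 \<subset> P1\<close>.\<close>

lemma principal_ideal_theorem:
 assumes P0: "primeideal P0 R" and P1: "primeideal P1 R" and Q: "primeideal Q R"
  and P0P1: "P0 \<subset> P1" and P1Q: "P1 \<subset> Q" and a: "a : Q"
 shows "EX Q'. primeideal Q' R & P0 <= Q' & a : Q' & Q' \<subset> Q"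
proof (rule ccontr)
 assume "~ ?thesis"
 then have min: "!!Q'. primeideal Q' R ==> P0 <= Q' ==> a : Q' ==> Q' <= Q ==> Q' = Q" by blast
 have ids: "ideal P0 R" "ideal P1 R" "ideal Q R" using P0 P1 Q by (auto intro: prime_ideal)
 have ac: "a : carrier R" using ideal_carrier[OF ids(3) a] .
 have aP1: "a ~: P1" using min[OF P1] P0P1 P1Q by blast
 \<comment> \<open>The n-th symbolic power of \<open>P1\<close>, formed modulo
   \<open>P0\<close>.\<close>
 define S where "S n = sat R P1 (ideal_pow R P1 n <+>\<^bsub>R\<^esub> P0)" for n :: nat
 have sum_ideal: "ideal (ideal_pow R P1 n <+>\<^bsub>R\<^esub> P0) R" for n :: nat
  by (rule add_ideals[OF ideal_pow_ideal[OF ids(2)] ids(1)])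
 have S_ideal: "ideal (S n) R" for n unfolding S_def by (rule ideal_sat[OF P1 sum_ideal])
 have S_sat1: "saturated R P1 (S n)" for n unfolding S_def by (rule saturated_sat[OF P1 sum_ideal])
 have S_sat: "saturated R Q (S n)" for n
  using S_sat1[of n] P1Q unfolding saturated_def by blast
 have S_anti: "S (Suc n) <= S n" for n
  unfolding S_def by (rule sat_mono)
   (use ideal_pow_Suc_subset[OF ids(2), of n] in \<open>unfold mem_set_add subset_iff, blast\<close>)
 have P0S: "P0 <= S n" for n
  unfolding S_def
  using sat_upper[OF P1 sum_ideal] set_add_upper2[OF ideal_pow_ideal[OF ids(2)] ids(1)] by blast
 have PS: "ideal_pow R P1 n <= S n" for n :: nat
  unfolding S_def
  using sat_upper[OF P1 sum_ideal] set_add_upper1[OF ideal_pow_ideal[OF ids(2)] ids(1)] by blast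
 define D where "D n = sat R Q (S n <+>\<^bsub>R\<^esub> PIdl a)" for n
 define E where "E = sat R Q (P0 <+>\<^bsub>R\<^esub> PIdl a)"
 note Sa = ideal_set_add_PIdl[OF S_ideal ac]
 note Pa = ideal_set_add_PIdl[OF ids(1) ac]
 have sub: "X <+>\<^bsub>R\<^esub> PIdl a <= Y <+>\<^bsub>R\<^esub> PIdl a" if "X <= Y" for X Y
  using that unfolding mem_set_add subset_iff by blast
 have "EX N. ALL n>=N. D n = D N"
 proof (rule dcc_saturated[of E Q])
  show "ideal E R" "saturated R Q E"
   unfolding E_def by (rule ideal_sat[OF Q Pa], rule saturated_sat[OF Q Pa])
  show "primeideal Q R" by fact
  fix P assume P: "primeideal P R" "E <= P" "P <= Q"
  have "P0 <= E" "a : E"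
   unfolding E_def
   using sat_upper[OF Q Pa] set_add_upper1[OF ids(1) cgenideal_ideal[OF ac]]
    set_add_upper2[OF ids(1) cgenideal_ideal[OF ac] cgenideal_self[OF ac]] by blast+
  then show "P = Q" using min[OF P(1)] P(2,3) by blast
 next
  fix n :: nat
  show "ideal (D n) R & saturated R Q (D n) & E <= D n"
   unfolding D_def E_def
   using ideal_sat[OF Q Sa] saturated_sat[OF Q Sa] sat_mono[OF sub[OF P0S]] by blast
  show "D (Suc n) <= D n" unfolding D_def by (rule sat_mono[OF sub[OF S_anti]])
 qed
 then obtain N where "D (Suc N) = D N" by (metis le_SucI order_refl)
 \<comment> \<open>\<open>D N = D (Suc N)\<close> gives \<open>u s = p + r a\<close>. Here
   \<open>r a\<close> lies in \<open>S N\<close> and \<open>a\<close> is a unit at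
   \<open>P1\<close>, so \<open>r\<close> itself lies in \<open>S N\<close>, and \<open>r a\<close>
   is in \<open>Q S N\<close>.\<close>
 have step: "EX u:carrier R - Q. u \<odot>\<^bsub>rm\<^esub> s
   : smul rm Q (S N) <+>\<^bsub>rm\<^esub> S (Suc N)" if s: "s : S N" for s
 proof -
  have sc: "s : carrier R" by (rule ideal_carrier[OF S_ideal s])
  have "s : D N" unfolding D_def
   by (rule sat_upper[OF Q Sa set_add_upper1[OF S_ideal cgenideal_ideal[OF ac] s]])
  then have "s : D (Suc N)" using \<open>D (Suc N) = D N\<close> by simp
  then obtain u p r where u: "u : carrier R" "u ~: Q" "p : S (Suc N)" "r : carrier R" "u \<otimes> s = p \<oplus> r \<otimes> a"
   unfolding D_def sat_def mem_set_add_PIdl by blast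
  have pc: "p : carrier R" by (rule ideal_carrier[OF S_ideal u(3)])
  have "u \<otimes> s \<ominus> p = r \<otimes> a" using u pc sc ac by (intro minus_eqI) auto
  moreover have "u \<otimes> s \<ominus> p : S N"
   using u s S_anti ideal_minus[OF S_ideal] ideal_lmult[OF S_ideal] by blast
  ultimately have "a \<otimes> r : S N" using u ac by (simp add: m_comm)
  then have "r : S N" using saturatedD[OF S_sat1 ac aP1 u(4)] by blast
  then have "a \<otimes> r : smul rm Q (S N)" using smul.smul_gen[OF a, of r "S N" rm] by simp
  moreover have "u \<otimes> s = a \<otimes> r \<oplus> p" using u pc ac by (simp add: m_comm a_comm)
  ultimately show ?thesis using u unfolding RM.mem_set_add by fastforce
 qed
 have S_sub: "submodule (S n) R rm" for n using S_ideal by (simp add: ideal_iff_submodule)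
 obtain v where v: "v : carrier R - Q" "ALL x:S N. v \<otimes> x : S (Suc N)"
  using RM.nakayama_relative[OF Q S_sub ideal_fg[OF S_ideal[of N]] step] by auto
 have SN: "S N <= S (Suc N)"
 proof
  fix x assume x: "x : S N"
  show "x : S (Suc N)"
   using saturatedD[OF S_sat, of v x] v x ideal_carrier[OF S_ideal x] by blast
 qed
 have "EX u:carrier R - P1. u \<odot>\<^bsub>rm\<^esub> s
   : smul rm P1 (ideal_pow R P1 N) <+>\<^bsub>rm\<^esub> P0" if s: "s : ideal_pow R P1 N" for s
 proof -
  have "s : S (Suc N)" using s PS SN by blast
  then obtain u where "u : carrier R - P1" "u \<otimes> s : ideal_pow R P1 (Suc N) <+>\<^bsub>R\<^esub> P0"
   unfolding S_def sat_def by blast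
  moreover have "ideal_pow R P1 (Suc N) = smul rm P1 (ideal_pow R P1 N)"
   using smul_eq_ideal_prod[OF ids(2) ideal_pow_ideal[OF ids(2)]] ideal_pow_Suc[of P1 N]
    ideal_prod_commute[OF ids(2) ideal_pow_ideal[OF ids(2)]] by simp
  ultimately show ?thesis by (auto simp: ring_module_set_add)
 qed
 then obtain w where w: "w : carrier R - P1" "ALL x:ideal_pow R P1 N. w \<otimes> x : P0"
  using RM.nakayama_relative[OF P1 _ ideal_fg[OF ideal_pow_ideal[OF ids(2)]], of P0 N] ids(1)
  by (auto simp: ideal_iff_submodule)
 obtain q where q: "q : P1" "q ~: P0" using P0P1 by blast
 have qc: "q : carrier R" using ideal_carrier[OF ids(2) q(1)] .
 have "w \<otimes> q [^] N : P0" using w pow_mem_ideal_pow[OF ids(2) q(1)] by blast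
 moreover have "w ~: P0" using w P0P1 by blast
 ultimately have "q [^] N : P0" using prime_mult[OF P0, of w "q [^] N"] w qc by auto
 then show False using prime_pow[OF P0 qc] q(2) by blast
qed

end

subsection \<open>Local rings\<close>

locale local_ring = noeth R for R (structure) +
 fixes \<mm> :: "'a set"
 assumes maximal_iff: "{J. maximalideal J R} = {\<mm>}"
begin

lemma max_maximal: "maximalideal \<mm> R" using maximal_iff by blast

lemma max_prime: "primeideal \<mm> R" by (rule maximalideal_prime[OF max_maximal])

lemma max_ideal: "ideal \<mm> R" by (rule prime_ideal[OF max_prime])

lemma proper_subset_max:
 assumes I: "ideal I R" and "\<one> ~: I" shows "I <= \<mm>"
proof -
 define S where "S = {J. ideal J R & I <= J & \<one> ~: J}"
 have "S ~= {}" using assms by (auto simp: S_def)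
 moreover have "ideal K R" if "K : S" for K using that by (simp add: S_def)
 ultimately have "EX J:S. ALL K:S. J <= K --> K = J" by (rule maximal_ideal_exists)
 then obtain J where J: "J : S" "!!K. K : S ==> J <= K ==> K = J" by meson
 have "maximalideal J R"
 proof (rule maximalidealI)
  show "ideal J R" "carrier R ~= J" using J(1) by (auto simp: S_def)
  fix K assume K: "ideal K R" "J <= K" "K <= carrier R"
  show "K = J | K = carrier R"
  proof (cases "\<one> : K")
   case True then show ?thesis using ideal.one_imp_carrier[OF K(1)] by blast
  next
   case False then show ?thesis using J K by (auto simp: S_def)
  qed
 qed
 then have "J = \<mm>" using maximal_iff by blast
 then show ?thesis using J(1) by (auto simp: S_def)
qed

lemma prime_subset_max: "primeideal P R ==> P <= \<mm>"
 by (rule proper_subset_max[OF prime_ideal prime_one])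

lemma inverse_exists:
 assumes x: "x : carrier R" "x ~: \<mm>"
 shows "EX y:carrier R. y \<otimes> x = \<one>"
proof -
 have "\<one> : PIdl x"
  using proper_subset_max[OF cgenideal_ideal[OF x(1)]] cgenideal_self[OF x(1)] x(2) by blast
 then show ?thesis by (auto simp: mem_PIdl)
qed

text \<open>Two applications of the principal ideal theorem: first push \<open>f\<close> down the chain, then \<open>t\<close>.\<close>

lemma no_long_prime_chain:
 assumes P: "primeideal P0 R" "primeideal P1 R" "primeideal P2 R" "primeideal P3 R"
  and c: "P0 \<subset> P1" "P1 \<subset> P2" "P2 \<subset> P3"
  and ft: "f : \<mm>" "t : \<mm>"
  and only: "!!P. primeideal P R ==> f : P ==> t : P ==> P = \<mm>"
 shows False
proof -
 have P2m: "P2 \<subset> \<mm>" using c(3) prime_subset_max[OF P(4)] by blast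
 have "EX P2'. primeideal P2' R & P1 \<subset> P2' & f : P2' & P2' \<subset> \<mm>"
 proof (cases "f : P1")
  case True then show ?thesis using c(2) P(3) P2m by blast
 next
  case False
  then show ?thesis using principal_ideal_theorem[OF P(2,3) max_prime c(2) P2m ft(1)] by blast
 qed
 then obtain P2' where P2': "primeideal P2' R" "P1 \<subset> P2'" "f : P2'" "P2' \<subset> \<mm>" by blast
 obtain P1' where P1': "primeideal P1' R" "P0 <= P1'" "f : P1'" "P1' \<subset> P2'"
  using principal_ideal_theorem[OF P(1,2) P2'(1) c(1) P2'(2,3)] by blast
 obtain Q' where "primeideal Q' R" "P1' <= Q'" "t : Q'" "Q' \<subset> \<mm>"
  using principal_ideal_theorem[OF P1'(1) P2'(1) max_prime P1'(4) P2'(4) ft(2)] by blast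
 then show False using only[of Q'] P1'(3) by blast
qed

end

subsection \<open>Completions and embedding dimension\<close>

context local_ring
begin

text \<open>Noetherian induction: if \<open>(E : g)\<close> is the maximal ideal, a power of it
  inside \<open>E + (g)\<close> gets into \<open>E\<close> after one more multiplication.\<close>

lemma max_power_subset:
 assumes "ideal E R" "!!P. primeideal P R ==> E <= P ==> P = \<mm>"
 shows "EX c. ideal_pow R \<mm> c <= E"
 using assms
proof (induction rule: noeth_induct)
 case (step E)
 show ?case
 proof (cases "\<one> : E")
  case True
  then have "E = carrier R" using ideal.one_imp_carrier[OF step.hyps] by simp
  then have "ideal_pow R \<mm> 0 <= E" by (simp only: ideal_pow_0 subset_refl)
  then show ?thesis by blast
 next
  case False
  obtain g where g: "g : carrier R" "g ~: E" and Pg: "primeideal (colon R rm E g) R"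
   and Eg: "E <= colon R rm E g"
   by (rule prime_colon_ring[OF step.hyps False])
  have mg: "colon R rm E g = \<mm>" using step.prems Pg Eg by blast
  note up = set_add_upper1[OF step.hyps cgenideal_ideal[OF g(1)]]
   set_add_upper2[OF step.hyps cgenideal_ideal[OF g(1)] cgenideal_self[OF g(1)]]
  have "EX c. ideal_pow R \<mm> c <= E <+>\<^bsub>R\<^esub> PIdl g"
  proof (rule step.IH)
   show "ideal (E <+>\<^bsub>R\<^esub> PIdl g) R" by (rule ideal_set_add_PIdl[OF step.hyps g(1)])
   show "E \<subset> E <+>\<^bsub>R\<^esub> PIdl g" using up g(2) by blast
   show "P = \<mm>" if "primeideal P R" "E <+>\<^bsub>R\<^esub> PIdl g <= P" for P
    using step.prems[OF that(1)] that(2) up by blast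
  qed
  then obtain c where c: "ideal_pow R \<mm> c <= E <+>\<^bsub>R\<^esub> PIdl g" by blast
  have "ideal_pow R \<mm> (Suc c) <= E"
   unfolding ideal_pow_Suc
  proof (rule ideal_prod_least[OF step.hyps])
   fix a b assume "a : ideal_pow R \<mm> c" and b: "b : \<mm>"
   then obtain i r where ir: "i : E" "r : carrier R" "a = i \<oplus> r \<otimes> g"
    using c unfolding mem_set_add_PIdl[symmetric] by (meson mem_set_add_PIdl rev_subsetD)
   have bc: "b : carrier R" by (rule ideal_carrier[OF max_ideal b])
   have ic: "i : carrier R" by (rule ideal_carrier[OF step.hyps ir(1)])
   have "b \<otimes> g : E" using b mg by (auto simp: colon_def)
   moreover have "a \<otimes> b = i \<otimes> b \<oplus> r \<otimes> (b \<otimes> g)" using ir(2,3) ic bc g m_comm[of g b] by (simp add: l_distr m_assoc)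
   ultimately show "a \<otimes> b : E"
    using ideal_add[OF step.hyps] ideal_lmult[OF step.hyps] ideal_rmult[OF step.hyps] ir bc by simp
  qed
  then show ?thesis by blast
 qed
qed

end

lemma (in ring) coset_eq_iff:
 "ideal I R ==> a : carrier R ==> b : carrier R ==> I +> a = I +> b \<longleftrightarrow> a \<ominus> b : I"
 using quotient_eq_iff_same_a_r_cos[of I a b] by simp

lemma (in ring) coset_self: "ideal I R ==> a : carrier R ==> a : I +> a"
 using ideal_zero[of I] by (auto simp: a_r_coset_def' intro!: bexI[of _ "\<zero>"])

lemma (in ring) coset_mem_iff:
 assumes I: "ideal I R" and a: "a : carrier R"
 shows "b : I +> a \<longleftrightarrow> b : carrier R & b \<ominus> a : I"
proof
 assume "b : I +> a"
 then obtain i where i: "i : I" "b = i \<oplus> a" by (auto simp: a_r_coset_def')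
 then have "b \<ominus> a = i" using a ideal_carrier[OF I] by (intro minus_eqI) (auto simp: a_comm)
 then show "b : carrier R & b \<ominus> a : I" using i a ideal_carrier[OF I] by simp
next
 assume b: "b : carrier R & b \<ominus> a : I"
 then show "b : I +> a" using coset_self[OF I, of b] coset_eq_iff[OF I, of b a] a by simp
qed

text \<open>A surjection \<open>S \<rightarrow> R\<^sup>^\<close> with kernel \<open>F\<close>: the coset of \<open>\<mm>\<^sup>n\<close> that is the \<open>n\<close>-th
 component of the image of \<open>s\<close> is \<open>ap n s\<close>.\<close>

locale completion_quotient = A: local_ring R \<mm> + S: local_ring S \<nn>
 for R :: "('a, 'k) ring_scheme" (structure) and \<mm> and S :: "('s, 'l) ring_scheme" and \<nn> +
 fixes F :: "'s set" and ap :: "nat => 's => 'a set"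
 assumes F_sub: "F <= \<nn>"
  and ap_coset: "s : carrier S ==> EX a:carrier R. ap n s = ideal_pow R \<mm> n +> a"
  and ap_Suc: "s : carrier S ==> ap (Suc n) s <= ap n s"
  and ap_mult: "s : carrier S ==> s' : carrier S ==> a : ap n s ==> b : ap n s' ==> a \<otimes> b : ap n (s \<otimes>\<^bsub>S\<^esub> s')"
  and ap_add: "s : carrier S ==> s' : carrier S ==> a : ap n s ==> b : ap n s' ==> a \<oplus> b : ap n (s \<oplus>\<^bsub>S\<^esub> s')"
  and ap_one: "\<one> : ap n \<one>\<^bsub>S\<^esub>"
  and ap_surj: "(!!n. f n : carrier R) ==> (!!n. f (Suc n) \<ominus> f n : ideal_pow R \<mm> n) ==>
   EX s:carrier S. ALL n. f n : ap n s"
  and ap_kernel: "s : carrier S ==> (!!n. \<zero> : ap n s) ==> s : F"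

text \<open>\<open>ap n s\<close> is the n-th component of the element of the completion that
  corresponds to \<open>s + F\<close>; the laws for \<open>ap\<close> are the ring isomorphism
  expressed on representatives.\<close>

lemma (in local_ring) completion_quotientI:
 assumes S: "local_ring S \<nn>" and F: "ideal F S" "F <= \<nn>" and iso: "adic_completion R \<mm> \<simeq> S Quot F"
 shows "EX ap. completion_quotient R \<mm> S \<nn> F ap"
proof -
 interpret S: local_ring S \<nn> by fact
 interpret F: ideal F S by fact
 define C where "C = adic_completion R \<mm>"
 define I where "I n = ideal_pow R \<mm> n" for n
 have I: "ideal (I n) R" for n unfolding I_def by (rule ideal_pow_ideal[OF max_ideal])
 have I_anti: "I (Suc n) <= I n" for n unfolding I_def by (rule ideal_pow_Suc_subset[OF max_ideal])
 obtain h where h: "h : ring_iso C (S Quot F)" using iso unfolding is_ring_iso_def C_def by blast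
 note h' = ring_iso_memE[OF h]
 have C_carrier: "x : carrier C \<longleftrightarrow> (ALL n. x n : carrier (R Quot (I n)) & x (Suc n) <= x n)" for x
  by (simp add: C_def adic_completion_def I_def)
 have ops: "(x \<otimes>\<^bsub>C\<^esub> y) n = (\<Union>a\<in>x n. \<Union>b\<in>y n. I n +> (a \<otimes> b))" "(x \<oplus>\<^bsub>C\<^esub> y) n = x n <+>\<^bsub>R\<^esub> y n"
  "\<one>\<^bsub>C\<^esub> n = I n +> \<one>" for x y n
  by (simp_all add: C_def adic_completion_def I_def FactRing_def rcoset_mult_def)
 have quot: "carrier (R Quot (I n)) = {I n +> a | a. a : carrier R}" for n
  by (auto simp: FactRing_def A_RCOSETS_def')
 have coset_mono: "I (Suc n) +> a <= I n +> a" for n a using I_anti[of n] by (auto simp: a_r_coset_def')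
 have Q: "ring (R Quot (I n))" for n by (rule ideal.quotient_is_ring[OF I])
 have multC: "x \<otimes>\<^bsub>C\<^esub> y : carrier C" and addC: "x \<oplus>\<^bsub>C\<^esub> y : carrier C"
  if "x : carrier C" "y : carrier C" for x y
 proof -
  note c = that[unfolded C_carrier, rule_format]
  have "(x \<otimes>\<^bsub>C\<^esub> y) n : carrier (R Quot (I n))" "(x \<oplus>\<^bsub>C\<^esub> y) n : carrier (R Quot (I n))" for n
   using ring.ring_simprules(1,5)[OF Q, of "x n" n "y n"] c by (simp_all add: C_def adic_completion_def I_def)
  moreover have "(x \<otimes>\<^bsub>C\<^esub> y) (Suc n) <= (x \<otimes>\<^bsub>C\<^esub> y) n" for n
   unfolding ops using c(1)[of n] c(2)[of n] by (intro UN_mono coset_mono) auto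
  moreover have "(x \<oplus>\<^bsub>C\<^esub> y) (Suc n) <= (x \<oplus>\<^bsub>C\<^esub> y) n" for n
   unfolding ops set_add_def' using c(1)[of n] c(2)[of n] by blast
  ultimately show "x \<otimes>\<^bsub>C\<^esub> y : carrier C" "x \<oplus>\<^bsub>C\<^esub> y : carrier C" unfolding C_carrier by blast+
 qed
 have cosetC: "(%n. I n +> a n) : carrier C" if "!!n. a n : carrier R" "!!n. a (Suc n) \<ominus> a n : I n" for a
  unfolding C_carrier quot using that coset_mono coset_eq_iff[OF I that(1) that(1)] by blast
 define \<psi> where "\<psi> s = inv_into (carrier C) h (F +>\<^bsub>S\<^esub> s)" for s
 have psi: "\<psi> s : carrier C" "h (\<psi> s) = F +>\<^bsub>S\<^esub> s" if "s : carrier S" for s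
 proof -
  have "F +>\<^bsub>S\<^esub> s : h ` carrier C"
   using h'(5) that unfolding bij_betw_def by (auto simp: FactRing_def A_RCOSETS_def')
  then show "\<psi> s : carrier C" "h (\<psi> s) = F +>\<^bsub>S\<^esub> s"
   unfolding \<psi>_def by (simp_all add: inv_into_into f_inv_into_f)
 qed
 have inj: "\<psi> s = x" if "s : carrier S" "x : carrier C" "h x = F +>\<^bsub>S\<^esub> s" for s x
  using psi[OF that(1)] that(2,3) h'(5) unfolding bij_betw_def inj_on_def by metis
 have ap: "EX a:carrier R. \<psi> s n = I n +> a" if "s : carrier S" for s n
  using psi(1)[OF that] unfolding C_carrier quot by blast
 have apc: "a : carrier R" if "s : carrier S" "a : \<psi> s n" for s a n
  using ap[OF that(1), of n] that(2) coset_mem_iff[OF I] by auto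
 have "completion_quotient R \<mm> S \<nn> F (%n s. \<psi> s n)"
 proof (intro completion_quotient.intro completion_quotient_axioms.intro local_ring_axioms S F(2))
  fix n s assume s: "s : carrier S"
  show "EX a:carrier R. \<psi> s n = ideal_pow R \<mm> n +> a" using ap[OF s] by (simp add: I_def)
  show "\<psi> s (Suc n) <= \<psi> s n" using psi(1)[OF s] unfolding C_carrier by blast
  fix s' a b assume s': "s' : carrier S" and ab: "a : \<psi> s n" "b : \<psi> s' n"
  have "\<psi> (s \<otimes>\<^bsub>S\<^esub> s') = \<psi> s \<otimes>\<^bsub>C\<^esub> \<psi> s'"
   using psi s s' F.rcoset_mult_add[OF s s'] by (intro inj multC) (simp_all add: h'(2) FactRing_def)
  then show "a \<otimes> b : \<psi> (s \<otimes>\<^bsub>S\<^esub> s') n"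
   using ab coset_self[OF I, of "a \<otimes> b" n] apc[OF s ab(1)] apc[OF s' ab(2)] by (auto simp: ops)
  have "\<psi> (s \<oplus>\<^bsub>S\<^esub> s') = \<psi> s \<oplus>\<^bsub>C\<^esub> \<psi> s'"
   using psi s s' F.a_rcos_sum[OF s s'] by (intro inj addC) (simp_all add: h'(3) FactRing_def)
  then show "a \<oplus> b : \<psi> (s \<oplus>\<^bsub>S\<^esub> s') n" using ab by (simp only: ops) (auto simp: mem_set_add)
 next
  fix n
  have "\<one>\<^bsub>C\<^esub> = (%n. I n +> \<one>)" by (intro ext ops(3))
  then have one: "\<one>\<^bsub>C\<^esub> : carrier C"
   using cosetC[of "%_. \<one>"] ideal_zero[OF I] by (simp add: a_minus_def r_neg)
  have "\<psi> \<one>\<^bsub>S\<^esub> = \<one>\<^bsub>C\<^esub>" by (rule inj[OF _ one]) (simp_all add: h'(4) FactRing_def)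
  then show "\<one> : \<psi> \<one>\<^bsub>S\<^esub> n" using coset_self[OF I] by (simp add: ops)
 next
  fix a :: "nat => 'a"
  assume a: "!!n. a n : carrier R" "!!n. a (Suc n) \<ominus> a n : ideal_pow R \<mm> n"
  have x: "(%n. I n +> a n) : carrier C" by (rule cosetC) (use a in \<open>simp_all add: I_def\<close>)
  obtain s where s: "s : carrier S" "h (%n. I n +> a n) = F +>\<^bsub>S\<^esub> s"
   using h'(1)[OF x] by (auto simp: FactRing_def A_RCOSETS_def')
  then show "EX s:carrier S. ALL n. a n : \<psi> s n"
   using inj[OF s(1) x s(2)] coset_self[OF I a(1)] by (intro bexI[of _ s]) auto
 next
  fix s assume s: "s : carrier S" and r: "!!n. \<zero> : \<psi> s n"
  have "\<psi> s n = I n +> \<zero>" for n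
  proof -
   obtain a where a: "a : carrier R" "\<psi> s n = I n +> a" using ap[OF s] by blast
   then show ?thesis using r[of n] coset_mem_iff[OF I a(1)] coset_eq_iff[OF I _ a(1), of "\<zero>" n] by simp
  qed
  \<comment> \<open>An element equal to its own double is zero; so additivity of \<open>h\<close>
    alone identifies the kernel.\<close>
  moreover have "(I n +> \<zero>) <+>\<^bsub>R\<^esub> (I n +> \<zero>) = I n +> \<zero>" for n using ideal.a_rcos_sum[OF I, of "\<zero>" "\<zero>"] by simp
  ultimately have "\<psi> s \<oplus>\<^bsub>C\<^esub> \<psi> s = \<psi> s" by (intro ext) (simp add: ops)
  then have "F +>\<^bsub>S\<^esub> (s \<oplus>\<^bsub>S\<^esub> s) = F +>\<^bsub>S\<^esub> s"
   using h'(3)[OF psi(1)[OF s] psi(1)[OF s]] psi(2)[OF s] F.a_rcos_sum[OF s s] by (simp add: FactRing_def)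
  then have "s \<oplus>\<^bsub>S\<^esub> s \<ominus>\<^bsub>S\<^esub> s : F" using S.coset_eq_iff[OF F(1)] s by simp
  moreover have "s \<oplus>\<^bsub>S\<^esub> s \<ominus>\<^bsub>S\<^esub> s = s" using s by (intro S.minus_eqI) auto
  ultimately show "s : F" by simp
 qed
 then show ?thesis by blast
qed

context completion_quotient
begin

abbreviation "pw \<equiv> ideal_pow R \<mm>"

lemma pw_ideal: "ideal (pw n) R" by (rule A.ideal_pow_ideal[OF A.max_ideal])

lemma pw_1: "pw (Suc 0) = \<mm>" by (rule A.ideal_pow_1[OF A.max_ideal])

lemma ap_iff:
 assumes "s : carrier S" "a : ap n s"
 shows "b : ap n s \<longleftrightarrow> b : carrier R & b \<ominus> a : pw n"
proof -
 obtain c where c: "c : carrier R" "ap n s = pw n +> c" using ap_coset[OF assms(1)] by blast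
 then have a: "a : carrier R" "a \<ominus> c : pw n" using assms(2) A.coset_mem_iff[OF pw_ideal] by auto
 then have "ap n s = pw n +> a" using A.coset_eq_iff[OF pw_ideal a(1) c(1)] c(2) a(2) by blast
 then show ?thesis using A.coset_mem_iff[OF pw_ideal a(1)] by simp
qed

lemma ap_carrier: "s : carrier S ==> a : ap n s ==> a : carrier R"
 using ap_iff by blast

lemma ap_ex: "s : carrier S ==> EX a. a : ap n s"
 using ap_coset[of s n] A.coset_self[OF pw_ideal] by force

lemma ap_le: "s : carrier S ==> k <= n ==> ap n s <= ap k s"
 using lift_Suc_antimono_le[of "%n. ap n s" k n] ap_Suc by blast

lemma ap_ideal:
 assumes s: "s : carrier S" "a : ap n s" "b : ap n s" and I: "ideal I R" "pw n <= I" "a : I"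
 shows "b : I"
 using A.ideal_add[OF I(1), of "b \<ominus> a" a] A.minus_plus_cancel[of b a] ap_iff[OF s(1,2), of b]
  ap_carrier[OF s(1,2)] s(3) I by auto

lemma ap_pow: "s : carrier S ==> a : ap n s ==> a [^] (k::nat) : ap n (s [^]\<^bsub>S\<^esub> k)"
 by (induction k) (auto simp: ap_one intro: ap_mult)

lemma ap_const: "x : carrier R ==> EX s:carrier S. ALL n. x : ap n s"
 using ap_surj[of "%_. x"] A.ideal_zero[OF pw_ideal] by (simp add: a_minus_def A.r_neg)

text \<open>The difference is approximated by zero at every level.\<close>

lemma common_F:
 assumes s: "s : carrier S" "s' : carrier S" and c: "!!n. EX a. a : ap n s & a : ap n s'"
 shows "s \<ominus>\<^bsub>S\<^esub> s' : F"
proof (rule ap_kernel)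
 show d: "s \<ominus>\<^bsub>S\<^esub> s' : carrier S" using s by simp
 fix n
 obtain a where a: "a : ap n s" "a : ap n s'" using c by blast
 obtain d where d': "d : ap n (s \<ominus>\<^bsub>S\<^esub> s')" using ap_ex[OF d] by blast
 have c: "a : carrier R" "d : carrier R" using ap_carrier[OF s(1) a(1)] ap_carrier[OF d d'] by auto
 have "d \<oplus> a : ap n s" using ap_add[OF d s(2) d' a(2)] s by (simp add: S.minus_plus_cancel)
 then have "(d \<oplus> a) \<ominus> a : pw n" using ap_iff[OF s(1) a(1)] by blast
 moreover have "(d \<oplus> a) \<ominus> a = d" using c by (intro A.minus_eqI) (auto simp: A.a_comm)
 ultimately have "\<zero> \<ominus> d : pw n" using A.ideal_minus[OF pw_ideal A.ideal_zero[OF pw_ideal]] by simp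
 then show "\<zero> : ap n (s \<ominus>\<^bsub>S\<^esub> s')" using ap_iff[OF d d'] by simp
qed

text \<open>The residue fields agree. The level is \<open>Suc n\<close> because
  \<open>ap 0 q\<close> is all of \<open>R\<close>. If \<open>q\<close> lies in \<open>\<nn>\<close>
  but an approximation is a unit, the inverses of all approximations converge to an inverse of
  \<open>q\<close> modulo \<open>F\<close>, impossible as \<open>F\<close> lies in
  \<open>\<nn>\<close>.\<close>

lemma max_iff: assumes q: "q : carrier S" and a: "a : ap (Suc n) q" shows "a : \<mm> \<longleftrightarrow> q : \<nn>"
proof
 have a1: "a : ap (Suc 0) q" using ap_le[OF q, of "Suc 0" "Suc n"] a by auto
 show "q : \<nn>" if m: "a : \<mm>"
 proof (rule ccontr)
  assume "q ~: \<nn>"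
  then obtain s where s: "s : carrier S" "s \<otimes>\<^bsub>S\<^esub> q = \<one>\<^bsub>S\<^esub>" using S.inverse_exists[OF q] by blast
  obtain b where b: "b : ap (Suc 0) s" using ap_ex[OF s(1)] by blast
  have "b \<otimes> a : \<mm>" using A.ideal_lmult[OF A.max_ideal ap_carrier[OF s(1) b] m] .
  then have "\<one> : \<mm>"
   using ap_ideal[OF S.one_closed _ ap_one A.max_ideal] ap_mult[OF s(1) q b a1] s(2) pw_1 by simp
  then show False using A.prime_one[OF A.max_prime] by simp
 qed
 assume n: "q : \<nn>"
 show "a : \<mm>"
 proof (rule ccontr)
  assume am: "a ~: \<mm>"
  have "ALL n. EX b. b : ap (Suc n) q" using ap_ex[OF q] by blast
  then obtain b where b: "!!n. b n : ap (Suc n) q" by metis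
  have bc: "b n : carrier R" for n using ap_carrier[OF q b] .
  have "b n ~: \<mm>" for n
   using ap_ideal[OF q _ a1 A.max_ideal, of "b n"] ap_le[OF q, of "Suc 0" "Suc n"] b am pw_1 by auto
  then have "EX c. c : carrier R & c \<otimes> b n = \<one>" for n using A.inverse_exists[OF bc] by blast
  then obtain c where c: "!!n. c n : carrier R" "!!n. c n \<otimes> b n = \<one>" by metis
  \<comment> \<open>From \<open>c' - c = c' c (b - b')\<close>: the inverses of a Cauchy sequence of
    units are again Cauchy.\<close>
  have "c (Suc n) \<ominus> c n : pw n" for n
  proof -
   have "b n \<ominus> b (Suc n) : pw (Suc n)" using ap_iff[OF q, of "b (Suc n)" "Suc n" "b n"] ap_Suc[OF q] b by blast
   then have "c (Suc n) \<otimes> c n \<otimes> (b n \<ominus> b (Suc n)) : pw n"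
    using A.ideal_pow_Suc_subset[OF A.max_ideal, of n] A.ideal_lmult[OF pw_ideal] c(1) by blast
   moreover have "c (Suc n) \<otimes> c n \<otimes> (b n \<ominus> b (Suc n)) = c (Suc n) \<otimes> (c n \<otimes> b n) \<ominus> c n \<otimes> (c (Suc n) \<otimes> b (Suc n))"
    using c(1) bc by (simp add: a_minus_def A.r_distr A.r_minus A.m_ac)
   ultimately show ?thesis using c by simp
  qed
  then obtain s where s: "s : carrier S" "!!n. c n : ap n s" using ap_surj[of c] c(1) by blast
  have "\<one> : ap n (s \<otimes>\<^bsub>S\<^esub> q)" for n using ap_mult[OF s(1) q s(2), of "b n" n] ap_Suc[OF q] b c(2) by force
  then have "s \<otimes>\<^bsub>S\<^esub> q \<ominus>\<^bsub>S\<^esub> \<one>\<^bsub>S\<^esub> : \<nn>" using common_F[of "s \<otimes>\<^bsub>S\<^esub> q" "\<one>\<^bsub>S\<^esub>"] ap_one s(1) q F_sub by blast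
  then have "s \<otimes>\<^bsub>S\<^esub> q \<ominus>\<^bsub>S\<^esub> (s \<otimes>\<^bsub>S\<^esub> q \<ominus>\<^bsub>S\<^esub> \<one>\<^bsub>S\<^esub>) : \<nn>"
   using S.ideal_minus[OF S.max_ideal S.ideal_lmult[OF S.max_ideal s(1) n]] by blast
  moreover have "s \<otimes>\<^bsub>S\<^esub> q \<ominus>\<^bsub>S\<^esub> (s \<otimes>\<^bsub>S\<^esub> q \<ominus>\<^bsub>S\<^esub> \<one>\<^bsub>S\<^esub>) = \<one>\<^bsub>S\<^esub>"
   using s q by (intro S.minus_eqI) (auto simp: S.minus_plus_cancel)
  ultimately show False using S.prime_one[OF S.max_prime] by simp
 qed
qed

text \<open>\<open>t\<close> lifts \<open>x\<close>. For \<open>q\<close> in the maximal ideal of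
  \<open>S\<close> the approximations of \<open>q^c\<close> lie in \<open>\<mm>^c\<close>, hence in
  \<open>(x)\<close>; dividing them by the nonzerodivisor \<open>x\<close> gives a Cauchy sequence,
  so \<open>q^c\<close> is a multiple of \<open>t\<close> modulo \<open>f\<close>.\<close>

lemma only_prime_containing:
 assumes f: "f : carrier S" "F = PIdl\<^bsub>S\<^esub> f"
  and x: "x : \<mm>" "!!a. a : carrier R ==> x \<otimes> a = \<zero> ==> a = \<zero>"
  and only: "!!P. primeideal P R ==> x : P ==> P = \<mm>"
 shows "EX t:\<nn>. ALL P. primeideal P S & f : P & t : P --> P = \<nn>"
proof -
 have xc: "x : carrier R" using A.ideal_carrier[OF A.max_ideal x(1)] .
 obtain c' where "pw c' <= PIdl x"
  using A.max_power_subset[OF A.cgenideal_ideal[OF xc]] A.cgenideal_self[OF xc] only by blast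
 then obtain c where c: "pw c <= PIdl x" "c > 0" using A.ideal_pow_Suc_subset[OF A.max_ideal, of c'] by blast
 \<comment> \<open>Division by \<open>x\<close> loses at most \<open>c\<close> levels of precision.
   For this reason the approximations of \<open>s\<close> are taken below at level
   \<open>n + c\<close>.\<close>
 have cn: "EX d:pw n. z = x \<otimes> d" if "z : pw (n + c)" for z n
 proof -
  have "z : pw n \<cdot> pw c" using that A.ideal_pow_add[OF A.max_ideal] by simp
  then show ?thesis
  proof induction
   case (prod i j)
   then obtain r where r: "r : carrier R" "j = r \<otimes> x" using c by (meson A.mem_PIdl subsetD)
   have "i : carrier R" using A.ideal_carrier[OF pw_ideal prod(1)] .
   then show ?case using r xc prod A.ideal_rmult[OF pw_ideal] by (intro bexI[of _ "i \<otimes> r"]) (auto simp: A.m_ac)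
  next
   case (sum a b)
   then obtain d e where "d : pw n" "e : pw n" "a = x \<otimes> d" "b = x \<otimes> e" by blast
   then show ?case using A.ideal_add[OF pw_ideal] A.ideal_carrier[OF pw_ideal] xc
    by (intro bexI[of _ "d \<oplus> e"]) (auto simp: A.r_distr)
  qed
 qed
 obtain t where t: "t : carrier S" "!!n. x : ap n t" using ap_const[OF xc] by blast
 then have tn: "t : \<nn>" using max_iff[OF t(1,2)] x(1) by blast
 have "\<nn> <= P" if P: "primeideal P S" "f : P" "t : P" for P
 proof
  fix q assume q: "q : \<nn>"
  have Pi: "ideal P S" by (rule S.prime_ideal[OF P(1)])
  have qc: "q : carrier S" using S.ideal_carrier[OF S.max_ideal q] .
  define s where "s = q [^]\<^bsub>S\<^esub> c"
  have sc: "s : carrier S" using qc by (simp add: s_def)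
  obtain a where a: "a : ap c q" using ap_ex[OF qc] by blast
  have "a : \<mm>" using max_iff[OF qc, of a "c - 1"] a c(2) q by simp
  then have ac: "a [^] c : pw c" "a [^] c : ap c s"
   using A.pow_mem_ideal_pow[OF A.max_ideal] ap_pow[OF qc a] by (simp_all add: s_def)
  have "ALL n. EX e. e : ap (n + c) s" using ap_ex[OF sc] by blast
  then obtain e where e: "!!n. e n : ap (n + c) s" by metis
  have "e n : pw (0 + c)" for n
   using ap_ideal[OF sc ac(2) _ pw_ideal _ ac(1)] ap_le[OF sc, of c "n + c"] e by auto
  then have "EX d. d : carrier R & e n = x \<otimes> d" for n using cn[of "e n" 0] A.ideal_carrier[OF pw_ideal] by blast
  then obtain d where d: "!!n. d n : carrier R" "!!n. e n = x \<otimes> d n" by metis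
  have "d (Suc n) \<ominus> d n : pw n" for n
  proof -
   have "e (Suc n) \<ominus> e n : pw (n + c)" using ap_iff[OF sc e[of n]] ap_Suc[OF sc, of "n + c"] e[of "Suc n"] by auto
   then obtain g where g: "g : pw n" "e (Suc n) \<ominus> e n = x \<otimes> g" using cn by blast
   have gc: "g : carrier R" using A.ideal_carrier[OF pw_ideal g(1)] .
   have "x \<otimes> (d (Suc n) \<ominus> d n \<ominus> g) = \<zero>"
    using g(2) d[of n] d[of "Suc n"] xc gc
    by (simp add: a_minus_def A.r_distr A.r_minus) (metis A.r_neg A.m_closed)
   then have "d (Suc n) \<ominus> d n \<ominus> g = \<zero>" using x(2) d(1) gc by simp
   then show ?thesis using A.minus_plus_cancel[of "d (Suc n) \<ominus> d n" g] d(1) gc g(1) by simp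
  qed
  then obtain y where y: "y : carrier S" "!!n. d n : ap n y" using ap_surj[of d] d(1) by blast
  have "e n : ap n s & e n : ap n (t \<otimes>\<^bsub>S\<^esub> y)" for n
   using ap_mult[OF t(1) y(1) t(2) y(2)] ap_le[OF sc, of n "n + c"] e[of n] d(2) by auto
  then have "s \<ominus>\<^bsub>S\<^esub> t \<otimes>\<^bsub>S\<^esub> y : F" using t(1) y(1) by (intro common_F sc) auto
  then have "s \<ominus>\<^bsub>S\<^esub> t \<otimes>\<^bsub>S\<^esub> y : P" using f S.cgenideal_minimal[OF Pi P(2)] by blast
  moreover have "t \<otimes>\<^bsub>S\<^esub> y : P" by (rule S.ideal_rmult[OF Pi y(1) P(3)])
  ultimately have "(s \<ominus>\<^bsub>S\<^esub> t \<otimes>\<^bsub>S\<^esub> y) \<oplus>\<^bsub>S\<^esub> t \<otimes>\<^bsub>S\<^esub> y : P" by (rule S.ideal_add[OF Pi])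
  then have "s : P" using S.minus_plus_cancel[of s "t \<otimes>\<^bsub>S\<^esub> y"] sc t y by simp
  then show "q : P" using S.prime_pow[OF P(1) qc] by (simp add: s_def)
 qed
 then have "ALL P. primeideal P S & f : P & t : P --> P = \<nn>" using S.prime_subset_max by blast
 then show ?thesis using tn by blast
qed

text \<open>Approximations at level \<open>Suc 1\<close> are taken modulo the square of the maximal
  ideal, so they generate it up to that square; Nakayama's lemma removes the error.\<close>

lemma max_two_generators:
 assumes xy: "x : \<nn>" "y : \<nn>" "!!q. q : \<nn> ==> EX a:carrier S. EX b:carrier S. q = a \<otimes>\<^bsub>S\<^esub> x \<oplus>\<^bsub>S\<^esub> b \<otimes>\<^bsub>S\<^esub> y"
 shows "EX x:\<mm>. EX y:\<mm>. ALL p:\<mm>. EX a:carrier R. EX b:carrier R. p = a \<otimes> x \<oplus> b \<otimes> y"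
proof -
 have c: "x : carrier S" "y : carrier S" using S.ideal_carrier[OF S.max_ideal] xy by auto
 obtain x' y' where ap: "x' : ap (Suc 1) x" "y' : ap (Suc 1) y" using ap_ex c by meson
 have m: "x' : \<mm>" "y' : \<mm>" using max_iff[OF c(1) ap(1)] max_iff[OF c(2) ap(2)] xy by auto
 have c': "x' : carrier R" "y' : carrier R" using A.ideal_carrier[OF A.max_ideal] m by auto
 define Y where "Y = PIdl x' <+>\<^bsub>R\<^esub> PIdl y'"
 have Yi: "ideal Y R" unfolding Y_def by (intro A.add_ideals A.cgenideal_ideal c')
 have Y: "z : Y \<longleftrightarrow> (EX a:carrier R. EX b:carrier R. z = a \<otimes> x' \<oplus> b \<otimes> y')" for z
  unfolding Y_def A.mem_set_add Bex_def A.mem_PIdl by blast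
 have mm2: "smul (ring_module R) \<mm> \<mm> = pw (Suc 1)"
  using A.smul_eq_ideal_prod[OF A.max_ideal A.max_ideal] A.ideal_pow_Suc[of \<mm> 1] pw_1 by simp
 have "EX u:carrier R - \<mm>. u \<odot>\<^bsub>ring_module R\<^esub> p : smul (ring_module R) \<mm> \<mm> <+>\<^bsub>ring_module R\<^esub> Y" if p: "p : \<mm>" for p
 proof -
  have pc: "p : carrier R" using A.ideal_carrier[OF A.max_ideal p] .
  obtain q where q: "q : carrier S" "!!n. p : ap n q" using ap_const[OF pc] by blast
  then have "q : \<nn>" using max_iff[OF q] p by blast
  then obtain a b where ab: "a : carrier S" "b : carrier S" "q = a \<otimes>\<^bsub>S\<^esub> x \<oplus>\<^bsub>S\<^esub> b \<otimes>\<^bsub>S\<^esub> y" using xy(3) by blast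
  obtain a' b' where r: "a' : ap (Suc 1) a" "b' : ap (Suc 1) b" using ap_ex ab by meson
  define z where "z = a' \<otimes> x' \<oplus> b' \<otimes> y'"
  have z: "z : ap (Suc 1) q" unfolding z_def ab(3) using ab c r ap by (intro ap_add ap_mult) auto
  have d: "p \<ominus> z : pw (Suc 1)" "z : carrier R" using ap_iff[OF q(1) z] q(2) ap_carrier[OF q(1) z] by blast+
  have "p = (p \<ominus> z) \<oplus> z" using pc d by (simp add: A.minus_plus_cancel)
  moreover have "z : Y" unfolding Y z_def using ap_carrier ab r by blast
  ultimately have "p : pw (Suc 1) <+>\<^bsub>R\<^esub> Y" unfolding A.mem_set_add using d by blast
  moreover have "\<one> : carrier R - \<mm>" using A.prime_one[OF A.max_prime] by simp
  ultimately show ?thesis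
   unfolding mm2 using pc by (intro bexI[of _ "\<one>"]) (simp_all add: A.ring_module_set_add)
 qed
 then obtain v where v: "v : carrier R - \<mm>" "ALL p:\<mm>. v \<otimes> p : Y"
  using A.RM.nakayama_relative[OF A.max_prime _ A.ideal_fg[OF A.max_ideal], of Y] Yi
  by (auto simp: A.ideal_iff_submodule)
 obtain w where w: "w : carrier R" "w \<otimes> v = \<one>" using A.inverse_exists[of v] v by blast
 have "p : Y" if p: "p : \<mm>" for p
 proof -
  have "w \<otimes> (v \<otimes> p) : Y" using v p w A.ideal_lmult[OF Yi] by blast
  then show ?thesis using w v A.ideal_carrier[OF A.max_ideal p] by (simp flip: A.m_assoc)
 qed
 then show ?thesis using m Y by blast
qed

end

lemma local_ring_iff: "noetherian_local_ring R m \<longleftrightarrow> local_ring R m"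
 by (auto simp: noetherian_local_ring_def local_ring_def local_ring_axioms_def noeth_def)

context local_ring
begin

text \<open>With \<open>t\<close> lifting \<open>x\<close>, only the maximal ideal of
  \<open>S\<close> contains both \<open>f\<close> and \<open>t\<close>, so \<open>S\<close> has no
  chain of four primes. Regularity turns dimension at most 2 into at most two generators.\<close>

lemma hypersurface_two_generators:
 assumes S: "regular_local_ring S \<nn>" and f: "f : \<nn>"
  and iso: "adic_completion R \<mm> \<simeq> S Quot (PIdl\<^bsub>S\<^esub> f)"
  and x: "x : \<mm>" "!!a. a : carrier R ==> x \<otimes> a = \<zero> ==> a = \<zero>"
  and only: "!!P. primeideal P R ==> x : P ==> P = \<mm>"
 shows "EX x:\<mm>. EX y:\<mm>. ALL p:\<mm>. EX a:carrier R. EX b:carrier R. p = a \<otimes> x \<oplus> b \<otimes> y"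
proof -
 interpret S: local_ring S \<nn> using S by (simp add: regular_local_ring_def local_ring_iff)
 have fc: "f : carrier S" by (rule S.ideal_carrier[OF S.max_ideal f])
 obtain ap where "completion_quotient R \<mm> S \<nn> (PIdl\<^bsub>S\<^esub> f) ap"
  using completion_quotientI[OF S.local_ring_axioms S.cgenideal_ideal[OF fc] S.cgenideal_minimal[OF S.max_ideal f] iso]
  by blast
 then interpret completion_quotient R \<mm> S \<nn> "PIdl\<^bsub>S\<^esub> f" ap .
 obtain t where t: "t : \<nn>" "!!P. primeideal P S ==> f : P ==> t : P ==> P = \<nn>"
  using only_prime_containing[OF fc refl x only] by blast
 obtain X where X: "X <= carrier S" "finite X" "enat (card X) = krull_dim S" "\<nn> = Idl\<^bsub>S\<^esub> X"
  using S unfolding regular_local_ring_def by blast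
 have "n <= 2" if C: "prime_chain S n C" for n C
 proof (rule ccontr)
  assume n: "~ n <= 2"
  have p: "primeideal (C i) S" if "i <= 3" for i using C n that by (simp add: prime_chain_def)
  have s: "C i \<subset> C (Suc i)" if "i < 3" for i using C n that by (simp add: prime_chain_def)
  show False
   by (rule S.no_long_prime_chain[OF p[of 0] p[of 1] p[of 2] p[of 3] _ _ _ f t(1) t(2)])
     (use s[of 0] s[of 1] s[of 2] in \<open>simp_all add: numeral_2_eq_2 numeral_3_eq_3\<close>)
 qed
 then have "krull_dim S <= enat 2" unfolding krull_dim_def by (intro Sup_least) auto
 then have "card X <= 2" using X(3) by (metis enat_ord_simps(1))
 have Xn: "X <= \<nn>" using X(1,4) S.genideal_self by simp
 have "card X = 0 | card X = Suc 0 | card X = 2" using \<open>card X <= 2\<close> by linarith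
 \<comment> \<open>Fewer than two generators are padded by repetition or by zero.\<close>
 then have "EX a b. X <= {a, b} & a : \<nn> & b : \<nn>"
  unfolding card_1_singleton_iff card_2_iff card_0_eq[OF X(2)]
  using Xn S.ideal_zero[OF S.max_ideal] by (elim disjE exE conjE) blast+
 then obtain a b where ab: "X <= {a, b}" "a : \<nn>" "b : \<nn>" by blast
 have abc: "a : carrier S" "b : carrier S" using S.ideal_carrier[OF S.max_ideal] ab by auto
 have "X <= PIdl\<^bsub>S\<^esub> a <+>\<^bsub>S\<^esub> PIdl\<^bsub>S\<^esub> b"
  using ab(1) S.set_add_upper1[OF S.cgenideal_ideal S.cgenideal_ideal S.cgenideal_self]
   S.set_add_upper2[OF S.cgenideal_ideal S.cgenideal_ideal S.cgenideal_self] abc by blast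
 then have sub: "\<nn> <= PIdl\<^bsub>S\<^esub> a <+>\<^bsub>S\<^esub> PIdl\<^bsub>S\<^esub> b"
  unfolding X(4) by (intro S.genideal_minimal S.add_ideals S.cgenideal_ideal abc)
 have "EX r:carrier S. EX r':carrier S. q = r \<otimes>\<^bsub>S\<^esub> a \<oplus>\<^bsub>S\<^esub> r' \<otimes>\<^bsub>S\<^esub> b" if "q : \<nn>" for q
 proof -
  have "q : PIdl\<^bsub>S\<^esub> a <+>\<^bsub>S\<^esub> PIdl\<^bsub>S\<^esub> b" using that sub by blast
  then show ?thesis unfolding S.mem_set_add Bex_def S.mem_PIdl by blast
 qed
 then show ?thesis using max_two_generators[OF ab(2,3)] by blast
qed

end

subsection \<open>Linear combinations\<close>

definition lc :: "('a, 'm, 'l) module_scheme => 'i set => ('i => 'a) => ('i => 'm) => 'm"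
 where "lc M S a u = finsum M (%i. a i \<odot>\<^bsub>M\<^esub> u i) S"

context module
begin

lemma lc_term: "a : S \<rightarrow> carrier R ==> u : S \<rightarrow> carrier M ==> (%i. a i *\<^sub>M u i) : S \<rightarrow> carrier M"
 by (auto simp: Pi_iff)

lemma lc_closed [simp]: "a : S \<rightarrow> carrier R ==> u : S \<rightarrow> carrier M ==> lc M S a u : carrier M"
 unfolding lc_def by (intro M.finsum_closed lc_term)

lemma lc_cong:
 "(!!i. i : S ==> a i *\<^sub>M u i = b i *\<^sub>M v i) ==> b : S \<rightarrow> carrier R ==> v : S \<rightarrow> carrier M ==>
  lc M S a u = lc M S b v"
 unfolding lc_def by (rule M.finsum_cong') (auto simp: Pi_iff)

lemma lc_smult:
 assumes "finite S" "r : carrier R" "a : S \<rightarrow> carrier R" "u : S \<rightarrow> carrier M"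
 shows "r *\<^sub>M lc M S a u = lc M S (%i. r \<otimes> a i) u"
proof -
 have "r *\<^sub>M lc M S a u = finsum M (%i. r *\<^sub>M (a i *\<^sub>M u i)) S"
  unfolding lc_def by (rule finsum_smult_ldistr[OF assms(1,2) lc_term[OF assms(3,4)]])
 also have "\<dots> = lc M S (%i. r \<otimes> a i) u"
  unfolding lc_def by (rule M.finsum_cong') (use assms in \<open>auto simp: Pi_iff smult_assoc1\<close>)
 finally show ?thesis .
qed

lemma lc_add:
 assumes "a : S \<rightarrow> carrier R" "b : S \<rightarrow> carrier R" "u : S \<rightarrow> carrier M"
 shows "lc M S a u +\<^sub>M lc M S b u = lc M S (%i. a i \<oplus> b i) u"
proof -
 have "lc M S a u +\<^sub>M lc M S b u = finsum M (%i. a i *\<^sub>M u i +\<^sub>M b i *\<^sub>M u i) S"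
  unfolding lc_def using lc_term[OF assms(1,3)] lc_term[OF assms(2,3)] by (simp add: M.finsum_addf)
 also have "\<dots> = lc M S (%i. a i \<oplus> b i) u"
  unfolding lc_def by (rule M.finsum_cong') (use assms in \<open>auto simp: Pi_iff smult_l_distr\<close>)
 finally show ?thesis .
qed

lemma lc_insert:
 assumes "finite S" "j ~: S" "a : insert j S \<rightarrow> carrier R" "u : insert j S \<rightarrow> carrier M"
 shows "lc M (insert j S) a u = a j *\<^sub>M u j +\<^sub>M lc M S a u"
 unfolding lc_def using assms by (intro M.finsum_insert) (auto simp: Pi_iff)

lemma lc_empty [simp]: "lc M {} a u = 0\<^sub>M"
 by (simp add: lc_def)

lemma lc_zero: "u : S \<rightarrow> carrier M ==> (!!i. i : S ==> a i = \<zero>) ==> lc M S a u = 0\<^sub>M"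
 unfolding lc_def using M.finsum_cong'[of S S "%_. 0\<^sub>M" "%i. a i *\<^sub>M u i"] by (auto simp: Pi_iff)

lemma lc_single:
 assumes "finite S" "j : S" "r : carrier R" "u : S \<rightarrow> carrier M"
 shows "lc M S (%i. if i = j then r else \<zero>) u = r *\<^sub>M u j"
proof -
 let ?a = "%i. if i = j then r else \<zero>"
 have S: "S = insert j (S - {j})" using assms(2) by blast
 have "lc M (insert j (S - {j})) ?a u = ?a j *\<^sub>M u j +\<^sub>M lc M (S - {j}) ?a u"
  using assms by (intro lc_insert) (auto simp: Pi_iff)
 also have "lc M (S - {j}) ?a u = 0\<^sub>M" using assms by (intro lc_zero) (auto simp: Pi_iff)
 finally show ?thesis using S assms by (auto simp: Pi_iff)
qed

lemma submoduleI2: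
 assumes "X <= carrier M" "0\<^sub>M : X" "!!x y. x : X ==> y : X ==> x +\<^sub>M y : X"
  and sm: "!!a x. a : carrier R ==> x : X ==> a *\<^sub>M x : X"
 shows "submodule X R M"
proof (rule submoduleI)
 show "\<ominus>\<^bsub>M\<^esub> x : X" if "x : X" for x
  using sm[of "\<ominus> \<one>" x] assms(1) that by (simp add: smult_l_minus subset_iff)
qed (use assms in auto)

definition comb :: "'a set => 'i set => ('i => 'c) => 'c set"
 where "comb J S g = {lc M S b g | b. b : S \<rightarrow> J}"

lemma submodule_comb:
 assumes S: "finite S" and g: "g : S \<rightarrow> carrier M" and J: "ideal J R"
 shows "submodule (comb J S g) R M"
proof (rule submoduleI2)
 have Jc: "b : S \<rightarrow> carrier R" if "b : S \<rightarrow> J" for b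
  using that ideal_subset_carrier[OF J] by auto
 show "comb J S g <= carrier M" using Jc g by (auto simp: comb_def)
 show "0\<^sub>M : comb J S g"
  unfolding comb_def using lc_zero[OF g, of "%_. \<zero>"] R.ideal_zero[OF J] by (auto intro!: exI[of _ "%_. \<zero>"])
 show "s *\<^sub>M v : comb J S g" if s: "s : carrier R" and v: "v : comb J S g" for s v
 proof -
  obtain b where b: "b : S \<rightarrow> J" "v = lc M S b g" using v by (auto simp: comb_def)
  have "(%i. s \<otimes> b i) : S \<rightarrow> J" using b(1) R.ideal_lmult[OF J s] by auto
  then show ?thesis using lc_smult[OF S s Jc[OF b(1)] g] b(2) unfolding comb_def by blast
 qed
 fix v w assume "v : comb J S g" "w : comb J S g"
 then obtain b c where bc: "b : S \<rightarrow> J" "v = lc M S b g" "c : S \<rightarrow> J" "w = lc M S c g"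
  by (auto simp: comb_def)
 have "(%i. b i \<oplus> c i) : S \<rightarrow> J" using bc R.ideal_add[OF J] by auto
 then show "v +\<^sub>M w : comb J S g"
  using lc_add[OF Jc[OF bc(1)] Jc[OF bc(3)] g] bc unfolding comb_def by blast
qed

lemma fg_chain_bound:
 "fg R M X ==> (!!k::nat. submodule (Z k) R M & Z k <= Z (Suc k)) ==> X <= (\<Union>k. Z k) ==> EX k. X <= Z k"
proof (induction rule: fg.induct)
 case fg_zero
 then show ?case using submodule_zero by auto
next
 case (fg_add X g)
 have mono: "Z k <= Z l" if "k <= l" for k l
  using lift_Suc_mono_le[of Z, OF _ that] fg_add.prems(1) by blast
 note X = fg_submodule[OF fg_add.hyps(1)] and C = submodule_cyc[OF fg_add.hyps(2)]
 have "X <= (\<Union>k. Z k)" using set_add_upper1[OF X C] fg_add.prems(2) by blast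
 then obtain k where k: "X <= Z k" using fg_add.IH fg_add.prems(1) by blast
 have "g : (\<Union>k. Z k)"
  using set_add_upper2[OF X C] cyc_self[OF fg_add.hyps(2)] fg_add.prems(2) by blast
 then obtain l where l: "g : Z l" by blast
 have "X <= Z (max k l)" "cyc R M g <= Z (max k l)"
  using k mono[of k "max k l"] cyc_least[of "Z (max k l)" g] l mono[of l "max k l"] fg_add.prems(1) by auto
 then show ?case using set_add_least[of "Z (max k l)"] fg_add.prems(1) by blast
qed

end

subsection \<open>Associated primes\<close>

text \<open>The product of finitely many witnesses is again outside the prime \<open>P\<close>, and
  by \<open>mult\<close> it serves all indices.\<close>

lemma (in cring) common_denominator:
 assumes P: "primeideal P R" and T: "finite T" and ex: "!!i. i : T ==> EX s:carrier R - P. Q i s"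
  and mult: "!!i s s'. i : T ==> s : carrier R - P ==> s' : carrier R - P ==> Q i s ==> Q i (s' \<otimes> s)"
 shows "EX s:carrier R - P. ALL i:T. Q i s"
 using T ex mult
proof (induction T rule: finite_induct)
 case empty
 show ?case using prime_one[OF P] by (intro bexI[of _ \<one>]) auto
next
 case (insert j T)
 obtain s where s: "s : carrier R - P" "!!i. i : T ==> Q i s" using insert.IH insert.prems by auto
 obtain s' where s': "s' : carrier R - P" "Q j s'" using insert.prems(1)[of j] by auto
 have "s' \<otimes> s = s \<otimes> s'" using s(1) s'(1) m_comm by simp
 then have "Q j (s' \<otimes> s)" using insert.prems(2)[of j s' s] s s' by simp
 moreover have "Q i (s' \<otimes> s)" if "i : T" for i using insert.prems(2)[of i s s'] s s'(1) that by simp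
 moreover have "s' \<otimes> s : carrier R - P" using s(1) s'(1) prime_mult_notin[OF P] by auto
 ultimately show ?case by (intro bexI[of _ "s' \<otimes> s"]) auto
qed

context noeth
begin

text \<open>\<open>E\<close> is the kernel of localization at \<open>P\<close>. A prime colon ideal
  of \<open>E\<close> lies in \<open>P\<close>, hence equals \<open>P\<close>; clearing the
  denominators of finitely many generators of \<open>P\<close> turns \<open>(E : g)\<close> into the
  annihilator of \<open>v \<otimes> g\<close>.\<close>

lemma minimal_associated:
 assumes P: "primeideal P R" and min: "!!Q. primeideal Q R ==> Q <= P ==> Q = P"
 shows "associated_prime R P"
proof -
 define E where "E = sat R P {\<zero>}"
 have E: "ideal E R" "saturated R P E"
  unfolding E_def by (rule ideal_sat[OF P zeroideal], rule saturated_sat[OF P zeroideal])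
 have "\<one> ~: E"
  using ideal_zero[OF prime_ideal[OF P]] by (auto simp: E_def sat_def)
 then obtain g where g: "g : carrier R" "g ~: E" and Pg: "primeideal (colon R rm E g) R"
  by (rule prime_colon_ring[OF E(1)])
 have "colon R rm E g <= P"
  using saturatedD[OF E(2) _ _ g(1)] g(2) by (auto simp: colon_def)
 then have eq: "colon R rm E g = P" using min[OF Pg] by blast
 obtain A where A: "A <= carrier R" "finite A" "P = Idl A" using finetely_gen[OF prime_ideal[OF P]] by blast
 have "EX v:carrier R - P. ALL a:A. v \<otimes> (a \<otimes> g) = \<zero>"
 proof (rule common_denominator[OF P A(2)])
  show "EX v:carrier R - P. v \<otimes> (a \<otimes> g) = \<zero>" if "a : A" for a
  proof -
   have "a : P" using that genideal_self[OF A(1)] A(3) by blast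
   then have "a \<otimes> g : E" using eq by (auto simp: colon_def)
   then show ?thesis by (auto simp: E_def sat_def)
  qed
  show "v' \<otimes> v \<otimes> (a \<otimes> g) = \<zero>"
   if "a : A" "v : carrier R - P" "v' : carrier R - P" "v \<otimes> (a \<otimes> g) = \<zero>" for a v v'
   using that A(1) g by (simp add: m_assoc subset_iff)
 qed
 then obtain v where v: "v : carrier R - P" "!!a. a : A ==> v \<otimes> (a \<otimes> g) = \<zero>" by blast
 have vg: "v \<otimes> g : carrier R" using v g by simp
 have "P = colon R rm {\<zero>} (v \<otimes> g)"
 proof
  have "ideal (colon R rm {\<zero>} (v \<otimes> g)) R"
   using zeroideal vg by (intro RM.ideal_colon) (simp_all add: ideal_iff_submodule)
  moreover have "A <= colon R rm {\<zero>} (v \<otimes> g)"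
   using A(1) v g m_lcomm by (auto simp: colon_def subset_iff)
  ultimately show "P <= colon R rm {\<zero>} (v \<otimes> g)" unfolding A(3) by (rule genideal_minimal)
  show "colon R rm {\<zero>} (v \<otimes> g) <= P"
  proof (rule subsetI, rule ccontr)
   fix c assume "c : colon R rm {\<zero>} (v \<otimes> g)" and n: "c ~: P"
   then have c: "c : carrier R" "(c \<otimes> v) \<otimes> g = \<zero>" using v g by (auto simp: colon_def m_assoc)
   then have "c \<otimes> v : carrier R - P" using prime_mult_notin[OF P, of c v] n v by blast
   then show False using c(2) g unfolding E_def sat_def by blast
  qed
 qed
 then show ?thesis using P vg unfolding associated_prime_def colon_def by auto
qed

text \<open>Otherwise localizing at \<open>Q\<close> and then at \<open>P\<close> leaves a nonzero
  ring, with kernel \<open>Y\<close>. A prime colon ideal of \<open>Y\<close> lies in both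
  \<open>P\<close> and \<open>Q\<close>, so by minimality both would equal it.\<close>

lemma distinct_minimal_primes_split:
 assumes P: "primeideal P R" and Q: "primeideal Q R" and "P ~= Q"
  and minP: "!!Q'. primeideal Q' R ==> Q' <= P ==> Q' = P"
  and minQ: "!!Q'. primeideal Q' R ==> Q' <= Q ==> Q' = Q"
 shows "EX s:carrier R - Q. EX w:carrier R - P. s \<otimes> w = \<zero>"
proof (rule ccontr)
 assume neg: "~ ?thesis"
 define E where "E = sat R Q {\<zero>}"
 have E: "ideal E R" "saturated R Q E"
  unfolding E_def by (rule ideal_sat[OF Q zeroideal], rule saturated_sat[OF Q zeroideal])
 define Y where "Y = sat R P E"
 have Y: "ideal Y R" "saturated R P Y"
  unfolding Y_def by (rule ideal_sat[OF P E(1)], rule saturated_sat[OF P E(1)])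
 have YQ: "saturated R Q Y"
  unfolding saturated_def
 proof (intro ballI impI)
  fix u x assume u: "u : carrier R - Q" and x: "x : carrier R" and "u \<otimes> x : Y"
  then obtain w where w: "w : carrier R - P" "w \<otimes> (u \<otimes> x) : E" unfolding Y_def sat_def by blast
  then have "u \<otimes> (w \<otimes> x) : E" using u x m_lcomm by simp
  then have "w \<otimes> x : E" using saturatedD[OF E(2), of u "w \<otimes> x"] u w x by blast
  then show "x : Y" using w x unfolding Y_def sat_def by blast
 qed
 have "\<one> ~: Y"
 proof
  assume "\<one> : Y"
  then obtain w where w: "w : carrier R - P" "w : E" unfolding Y_def sat_def by auto
  then obtain s where "s : carrier R - Q" "s \<otimes> w = \<zero>" unfolding E_def sat_def by blast
  then show False using neg w by blast
 qed
 then obtain g where g: "g : carrier R" "g ~: Y" and Pg: "primeideal (colon R rm Y g) R"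
  by (rule prime_colon_ring[OF Y(1)])
 have "colon R rm Y g <= X" if "saturated R X Y" for X
  using saturatedD[OF that _ _ g(1)] g(2) by (auto simp: colon_def)
 from minP[OF Pg this[OF Y(2)]] minQ[OF Pg this[OF YQ]] show False using assms(3) by simp
qed

end

context noeth_module
begin

lemma annihilator_prime:
 assumes v: "v : carrier M" "v ~= 0\<^sub>M"
 shows "EX w:carrier M. w ~= 0\<^sub>M & primeideal (colon R M {0\<^sub>M} w) R &
  colon R M {0\<^sub>M} v <= colon R M {0\<^sub>M} w"
 using prime_colon[OF submodule_singleton_zero v(1)] v(2) by auto

end

subsection \<open>Modules of constant rank over one-dimensional rings\<close>

text \<open>The images of the \<open>u i\<close> form a basis of the localization at
  \<open>P\<close>. This is expressed in \<open>M\<close> itself by clearing denominators, so that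
  bases at different primes can be compared.\<close>

definition local_basis ::
  "('a, 'k) ring_scheme => ('a, 'm, 'l) module_scheme => nat => 'a set => (nat => 'm) => bool"
 where "local_basis R M r P u \<longleftrightarrow> u : {..<r} \<rightarrow> carrier M &
  (ALL x:carrier M. EX s:carrier R - P. EX a:{..<r} \<rightarrow> carrier R. s \<odot>\<^bsub>M\<^esub> x = lc M {..<r} a u) &
  (ALL a:{..<r} \<rightarrow> carrier R. lc M {..<r} a u = \<zero>\<^bsub>M\<^esub> -->
   (EX s:carrier R - P. ALL i<r. s \<otimes>\<^bsub>R\<^esub> a i = \<zero>\<^bsub>R\<^esub>))"

text \<open>\<open>x1\<close> witnesses the positive depth of \<open>M\<close>; that of
  \<open>R\<close> is derived from it in \<open>x1_not_associated\<close>. The condition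
  \<open>dim\<close> makes every nonmaximal prime minimal.\<close>

locale rank_curve = R?: local_ring R \<mm> + noeth_module R M
 for R :: "('a, 'k) ring_scheme" (structure) and \<mm> and M :: "('a, 'm, 'l) module_scheme" (structure) +
 fixes x1 :: 'a and r :: nat and u :: "'a set => nat => 'm"
 assumes M_fg: "fg R M (carrier M)"
  and dim: "primeideal P R ==> P ~= \<mm> ==> primeideal Q R ==> Q <= P ==> Q = P"
  and x1_max: "x1 : \<mm>"
  and x1_regular: "v : carrier M ==> x1 \<odot>\<^bsub>M\<^esub> v = \<zero>\<^bsub>M\<^esub> ==> v = \<zero>\<^bsub>M\<^esub>"
  and nonzero: "EX v:carrier M. v ~= \<zero>\<^bsub>M\<^esub>"
  and rank: "associated_prime R P ==> local_basis R M r P (u P)"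
begin

lemma x1_carrier: "x1 : carrier R"
 by (rule ideal_carrier[OF max_ideal x1_max])

lemma prime_associated: "primeideal P R ==> P ~= \<mm> ==> associated_prime R P"
 using minimal_associated dim by blast

text \<open>An associated prime of \<open>M\<close> avoids \<open>x1\<close>, so it is not maximal
  and \<open>rank\<close> applies to it; rank 0 would make \<open>M\<close> vanish at its own
  associated prime.\<close>

lemma rank_pos: "r > 0"
proof (rule ccontr)
 assume r: "~ r > 0"
 obtain v where v: "v : carrier M" "v ~= 0\<^sub>M" using nonzero by blast
 obtain w where w: "w : carrier M" "w ~= 0\<^sub>M" "primeideal (colon R M {0\<^sub>M} w) R"
  using annihilator_prime[OF v] by blast
 let ?P = "colon R M {0\<^sub>M} w"
 have "x1 ~: ?P" using w x1_regular by (auto simp: colon_def)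
 then have "?P ~= \<mm>" using x1_max by blast
 then have "local_basis R M r ?P (u ?P)" using rank prime_associated w(3) by blast
 then obtain s where "s : carrier R - ?P" "s *\<^sub>M w = 0\<^sub>M"
  using w(1) r by (auto simp: local_basis_def)
 then show False by (auto simp: colon_def)
qed

lemma x1_not_associated: "associated_prime R P ==> x1 ~: P"
proof
 assume P: "associated_prime R P" and x: "x1 : P"
 obtain b where b: "b : carrier R" "P = {z : carrier R. z \<otimes> b = \<zero>}"
  using P unfolding associated_prime_def by blast
 have lb: "local_basis R M r P (u P)" by (rule rank[OF P])
 then have uc: "u P : {..<r} \<rightarrow> carrier M" by (simp add: local_basis_def)
 then have u0: "u P 0 : carrier M" using rank_pos by auto
 have "x1 *\<^sub>M (b *\<^sub>M u P 0) = 0\<^sub>M"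
  using b x x1_carrier u0 by (simp flip: smult_assoc1)
 then have "b *\<^sub>M u P 0 = 0\<^sub>M" using x1_regular b u0 by simp
 then have "lc M {..<r} (%i. if i = 0 then b else \<zero>) (u P) = 0\<^sub>M"
  using lc_single[of "{..<r}" 0 b "u P"] rank_pos b uc by simp
 then have "EX s:carrier R - P. ALL i<r. s \<otimes> (if i = 0 then b else \<zero>) = \<zero>"
  using lb b by (auto simp: local_basis_def)
 then obtain s where s: "s : carrier R - P" "s \<otimes> b = \<zero>" using rank_pos by auto
 then show False using b(2) by simp
qed

lemma max_not_associated: "~ associated_prime R \<mm>"
 using x1_not_associated x1_max by blast

lemma only_max_x1: "primeideal P R ==> x1 : P ==> P = \<mm>"
 using prime_associated x1_not_associated by blast

lemma ring_annihilator_prime: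
 assumes a: "a : carrier R" "a ~= \<zero>"
 shows "EX P. associated_prime R P & P ~= \<mm> & (ALL c:carrier R. c \<otimes> a = \<zero> --> c : P)"
proof -
 obtain b where b: "b : carrier R" "primeideal (colon R rm {\<zero>} b) R"
   "colon R rm {\<zero>} a <= colon R rm {\<zero>} b"
  using noeth_module.annihilator_prime[OF noeth_module_ring_module, of a] a by auto
 have "associated_prime R (colon R rm {\<zero>} b)"
  unfolding associated_prime_def using b by (auto simp: colon_def)
 then show ?thesis using b(3) max_not_associated by (intro exI[of _ "colon R rm {\<zero>} b"]) (auto simp: colon_def)
qed

lemma regular_ring:
 assumes t: "t : carrier R" "!!P. primeideal P R ==> t : P ==> P = \<mm>"
  and a: "a : carrier R" "t \<otimes> a = \<zero>"
 shows "a = \<zero>"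
proof (rule ccontr)
 assume "a ~= \<zero>"
 then obtain P where "associated_prime R P" "t : P" "P ~= \<mm>"
  using ring_annihilator_prime[OF a(1)] a(2) t(1) by blast
 then show False using t(2) by (auto simp: associated_prime_def)
qed

lemma regular_module:
 assumes t: "t : carrier R" "!!P. primeideal P R ==> t : P ==> P = \<mm>"
  and v: "v : carrier M" "t *\<^sub>M v = 0\<^sub>M"
 shows "v = 0\<^sub>M"
proof (rule ccontr)
 assume "v ~= 0\<^sub>M"
 then obtain w where w: "w : carrier M" "w ~= 0\<^sub>M" "primeideal (colon R M {0\<^sub>M} w) R"
   "colon R M {0\<^sub>M} v <= colon R M {0\<^sub>M} w"
  using annihilator_prime[OF v(1)] by blast
 have "t : colon R M {0\<^sub>M} w" using w(4) v t(1) by (auto simp: colon_def)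
 then have "x1 : colon R M {0\<^sub>M} w" using t(2)[OF w(3)] x1_max by simp
 then show False using w(1,2) x1_regular by (auto simp: colon_def)
qed

lemma finite_nonmaximal: "finite {P. primeideal P R & P ~= \<mm>}"
proof -
 from finite_minimal_primes[OF zeroideal] obtain S where
  S: "finite S" "ALL P:S. primeideal P R & {\<zero>} <= P"
   "ALL P. primeideal P R & {\<zero>} <= P --> (EX P':S. P' <= P)" by (elim exE conjE)
 have "P : S" if P: "primeideal P R" "P ~= \<mm>" for P
 proof -
  have "{\<zero>} <= P" using ideal_zero[OF prime_ideal[OF P(1)]] by simp
  then obtain P' where P': "P' : S" "P' <= P" using S(3) P(1) by meson
  have "primeideal P' R" using S(2) P'(1) by simp
  from dim[OF P this P'(2)] show ?thesis using P'(1) by simp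
 qed
 then have "{P. primeideal P R & P ~= \<mm>} <= S" by (intro subsetI) simp
 then show ?thesis by (rule finite_subset[OF _ S(1)])
qed

text \<open>Each prime \<open>P \<noteq> \<mm>\<close> contains at most one of the elements \<open>x + y\<^sup>k\<close>, \<open>k \<ge> 1\<close>.\<close>

lemma exists_parameter:
 assumes xy: "x : \<mm>" "y : \<mm>" "!!p. p : \<mm> ==> EX a:carrier R. EX b:carrier R. p = a \<otimes> x \<oplus> b \<otimes> y"
 shows "EX t:\<mm>. (ALL P. primeideal P R & t : P --> P = \<mm>) &
  (ALL p:\<mm>. EX a:carrier R. EX b:carrier R. p = a \<otimes> t \<oplus> b \<otimes> y)"
proof -
 have c: "x : carrier R" "y : carrier R" using ideal_carrier[OF max_ideal] xy by auto
 define t where "t k = x \<oplus> y [^] Suc k" for k :: nat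
 have ym: "y [^] Suc k : \<mm>" for k :: nat
  unfolding nat_pow_Suc using c xy(2) ideal_lmult[OF max_ideal] by simp
 have tm: "t k : \<mm>" for k unfolding t_def by (rule ideal_add[OF max_ideal xy(1) ym])
 have tc: "t k : carrier R" for k by (rule ideal_carrier[OF max_ideal tm])
 have one: "k = l" if P: "primeideal P R" "P ~= \<mm>" and kl: "t k : P" "t l : P" "k <= l" for P and k l :: nat
 proof (rule ccontr)
  assume "k ~= l"
  then obtain d where d: "l = k + Suc d" using kl(3) by (metis less_natE nat_less_le add_Suc_right)
  have Pi: "ideal P R" by (rule prime_ideal[OF P(1)])
  have "t k \<ominus> t l : P" using ideal_minus[OF Pi kl(1,2)] .
  have yl: "y [^] Suc l = y [^] Suc k \<otimes> y [^] Suc d"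
   using c nat_pow_mult[of y "Suc k" "Suc d"] d by simp
  \<comment> \<open>\<open>t k - t l = y^(k+1) z\<close> with \<open>z\<close> a unit, as
    \<open>y\<close> lies in the maximal ideal. A nonmaximal prime containing both would contain
    \<open>y\<close>, then \<open>x\<close>, then the whole maximal ideal.\<close>
  define z where "z = \<one> \<ominus> y [^] Suc d"
  have zc: "z : carrier R" using c by (simp add: z_def)
  have "z ~: \<mm>"
  proof
   assume "z : \<mm>"
   then have "z \<oplus> y [^] Suc d : \<mm>" using ideal_add[OF max_ideal _ ym] by blast
   then have "\<one> : \<mm>" using c by (simp add: z_def R.minus_plus_cancel del: nat_pow_Suc)
   then show False using prime_one[OF max_prime] by simp
  qed
  have one_eq: "\<one> = z \<oplus> y [^] Suc d" using c by (simp add: z_def R.minus_plus_cancel del: nat_pow_Suc)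
  have "y [^] Suc k = y [^] Suc k \<otimes> (z \<oplus> y [^] Suc d)" using c by (simp only: one_eq[symmetric] r_one nat_pow_closed)
  then have e: "y [^] Suc k = y [^] Suc k \<otimes> z \<oplus> y [^] Suc l"
   unfolding yl using c zc by (simp add: r_distr del: nat_pow_Suc)
  have "t k = t l \<oplus> y [^] Suc k \<otimes> z"
   unfolding t_def using c zc e
   by (metis R.a_assoc R.a_comm m_closed nat_pow_closed)
  then have "t k \<ominus> t l = y [^] Suc k \<otimes> z" using tc c zc by (intro R.minus_eqI) auto
  then have "y [^] Suc k \<otimes> z : P" using \<open>t k \<ominus> t l : P\<close> by simp
  moreover have "z ~: P" using \<open>z ~: \<mm>\<close> prime_subset_max[OF P(1)] by blast
  ultimately have "y [^] Suc k : P" using prime_mult[OF P(1), of "y [^] Suc k" z] c zc by blast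
  then have yP: "y [^] Suc k : P" "y : P" using prime_pow[OF P(1) c(2)] by blast+
  have "t k \<ominus> y [^] Suc k : P" using ideal_minus[OF Pi kl(1) yP(1)] .
  moreover have "t k \<ominus> y [^] Suc k = x"
   unfolding t_def using c by (intro R.minus_eqI) (auto simp: R.a_comm)
  ultimately have xP: "x : P" by simp
  have "\<mm> <= P"
  proof
   fix p assume "p : \<mm>"
   then obtain a b where "a : carrier R" "b : carrier R" "p = a \<otimes> x \<oplus> b \<otimes> y" using xy(3) by blast
   then show "p : P" using xP yP(2) ideal_add[OF Pi] ideal_lmult[OF Pi] by simp
  qed
  then show False using prime_subset_max[OF P(1)] P(2) by blast
 qed
 have "finite {k. t k : P}" if P: "primeideal P R" "P ~= \<mm>" for P
 proof (rule finite_subset)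
  have "(LEAST k. t k : P) = k" if "t k : P" for k
   using one[OF P LeastI[of "%k. t k : P", OF that] that Least_le[of "%k. t k : P", OF that]] .
  then show "{k. t k : P} <= {LEAST k. t k : P}" by blast
 qed simp
 then have "finite (\<Union>P\<in>{P. primeideal P R & P ~= \<mm>}. {k. t k : P})"
  by (intro finite_UN_I[OF finite_nonmaximal]) simp
 then obtain k where k: "k ~: (\<Union>P\<in>{P. primeideal P R & P ~= \<mm>}. {k. t k : P})"
  using ex_new_if_finite[OF infinite_UNIV_nat] by blast
 have "EX a:carrier R. EX b:carrier R. p = a \<otimes> t k \<oplus> b \<otimes> y" if p: "p : \<mm>" for p
 proof -
  obtain a b where ab: "a : carrier R" "b : carrier R" "p = a \<otimes> x \<oplus> b \<otimes> y" using xy(3)[OF p] by blast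
  have yk: "y [^] k : carrier R" using c by simp
  have "(b \<ominus> a \<otimes> y [^] k) \<oplus> a \<otimes> y [^] k = b" using ab yk by (simp add: R.minus_plus_cancel)
  then have "p = a \<otimes> x \<oplus> ((b \<ominus> a \<otimes> y [^] k) \<oplus> a \<otimes> y [^] k) \<otimes> y" using ab(3) by simp
  also have "\<dots> = a \<otimes> t k \<oplus> (b \<ominus> a \<otimes> y [^] k) \<otimes> y"
  proof -
   define q where "q = b \<ominus> a \<otimes> y [^] k"
   have "q : carrier R" using ab yk by (simp add: q_def)
   then have "a \<otimes> x \<oplus> (q \<oplus> a \<otimes> y [^] k) \<otimes> y = a \<otimes> t k \<oplus> q \<otimes> y"
    using ab yk c by (simp add: t_def l_distr r_distr m_assoc R.a_ac)
   then show ?thesis by (simp add: q_def)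
  qed
  finally show ?thesis using ab yk by blast
 qed
 moreover have "ALL P. primeideal P R & t k : P --> P = \<mm>" using k by blast
 ultimately show ?thesis using tm by blast
qed

lemma local_basis_transfer:
 assumes P: "primeideal P R" and b: "local_basis R M r P n" and n': "n' : {..<r} \<rightarrow> carrier M"
  and s: "s : carrier R - P" and w: "w : carrier R - P"
  and eq: "!!i. i < r ==> s *\<^sub>M n' i = w *\<^sub>M n i"
 shows "local_basis R M r P n'"
proof -
 have n: "n : {..<r} \<rightarrow> carrier M" using b by (simp add: local_basis_def)
 have sc: "s : carrier R" "w : carrier R" using s w by auto
 have lceq: "lc M {..<r} (%i. s \<otimes> a i) n' = lc M {..<r} (%i. w \<otimes> a i) n"
  if a: "a : {..<r} \<rightarrow> carrier R" for a
 proof (rule lc_cong)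
  fix i assume i: "i : {..<r}"
  then have c: "a i : carrier R" "n i : carrier M" "n' i : carrier M" using a n n' by auto
  have "(s \<otimes> a i) *\<^sub>M n' i = a i *\<^sub>M (s *\<^sub>M n' i)"
   using c sc by (simp add: smult_assoc1 smult_left_commute)
  also have "\<dots> = (w \<otimes> a i) *\<^sub>M n i"
   using c sc eq i by (simp add: smult_assoc1 smult_left_commute)
  finally show "(s \<otimes> a i) *\<^sub>M n' i = (w \<otimes> a i) *\<^sub>M n i" .
 qed (use a n sc in auto)
 show ?thesis
  unfolding local_basis_def
 proof (intro conjI ballI impI)
  fix x assume x: "x : carrier M"
  then obtain s1 a where a: "s1 : carrier R - P" "a : {..<r} \<rightarrow> carrier R" "s1 *\<^sub>M x = lc M {..<r} a n"
   using b by (auto simp: local_basis_def)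
  have "(w \<otimes> s1) *\<^sub>M x = w *\<^sub>M lc M {..<r} a n" using a x sc by (simp add: smult_assoc1)
  also have "\<dots> = lc M {..<r} (%i. s \<otimes> a i) n'"
   using lc_smult[of "{..<r}" w a n] a n sc lceq[OF a(2)] by simp
  finally show "EX s:carrier R - P. EX a:{..<r} \<rightarrow> carrier R. s *\<^sub>M x = lc M {..<r} a n'"
   using prime_mult_notin[OF P w a(1)] a(2) sc by (intro bexI[of _ "w \<otimes> s1"] bexI[of _ "%i. s \<otimes> a i"]) auto
 next
  fix a assume a: "a : {..<r} \<rightarrow> carrier R" and "lc M {..<r} a n' = 0\<^sub>M"
  then have "lc M {..<r} (%i. w \<otimes> a i) n = 0\<^sub>M"
   using lc_smult[of "{..<r}" s a n'] lceq[OF a] n' sc by simp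
  moreover have "(%i. w \<otimes> a i) : {..<r} \<rightarrow> carrier R" using a sc by auto
  ultimately have "EX s:carrier R - P. ALL i<r. s \<otimes> (w \<otimes> a i) = \<zero>"
   using b unfolding local_basis_def by blast
  then obtain s1 where s1: "s1 : carrier R - P" "ALL i<r. s1 \<otimes> (w \<otimes> a i) = \<zero>" by blast
  have "ALL i<r. (s1 \<otimes> w) \<otimes> a i = \<zero>" using s1 a sc by (auto simp: m_assoc Pi_iff)
  then show "EX s:carrier R - P. ALL i<r. s \<otimes> a i = \<zero>"
   using prime_mult_notin[OF P s1(1) w] by blast
 qed (rule n')
qed

text \<open>A product of the elements from \<open>distinct_minimal_primes_split\<close> over the
  finitely many other primes: a unit at \<open>P\<close>, zero at each of the others.\<close>

lemma separating_element:
 assumes P: "primeideal P R" "P ~= \<mm>"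
 shows "EX c:carrier R - P. ALL Q:{Q. primeideal Q R & Q ~= \<mm>} - {P}. EX s:carrier R - Q. s \<otimes> c = \<zero>"
proof (rule common_denominator[OF P(1)])
 show "EX c:carrier R - P. EX s:carrier R - Q. s \<otimes> c = \<zero>" if "Q : {Q. primeideal Q R & Q ~= \<mm>} - {P}" for Q
  using distinct_minimal_primes_split[OF P(1), of Q] dim[OF P] dim[of Q] that by blast
 show "EX s:carrier R - Q. s \<otimes> (c' \<otimes> c) = \<zero>"
  if "c : carrier R - P" "c' : carrier R - P" and s: "EX s:carrier R - Q. s \<otimes> c = \<zero>" for Q c c'
 proof -
  obtain s where "s : carrier R - Q" "s \<otimes> c = \<zero>" using s by blast
  then show ?thesis using that m_lcomm[of s c' c] by auto
 qed
qed (use finite_nonmaximal in simp)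

text \<open>The sums \<open>n i\<close> of the \<open>c P\<close> times \<open>u P i\<close> over
  all nonmaximal \<open>P\<close> glue the local bases: at \<open>Q\<close> only the term
  \<open>P = Q\<close> survives, multiplied by the unit \<open>c Q\<close>.\<close>

lemma common_local_basis:
 "EX n:{..<r} \<rightarrow> carrier M. ALL Q. primeideal Q R & Q ~= \<mm> --> local_basis R M r Q n"
proof -
 let ?X = "{Q. primeideal Q R & Q ~= \<mm>}"
 define c where "c P = (SOME c. c : carrier R - P & (ALL Q:?X - {P}. EX s:carrier R - Q. s \<otimes> c = \<zero>))" for P
 have c': "c P : carrier R - P & (ALL Q:?X - {P}. EX s:carrier R - Q. s \<otimes> c P = \<zero>)" if "P : ?X" for P
  unfolding c_def by (rule someI_ex) (rule separating_element[of P, unfolded Bex_def[of "carrier R - P"]]; use that in simp)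
 note c = conjunct1[OF c'] bspec[OF conjunct2[OF c']]
 have lb: "local_basis R M r Q (u Q)" if "Q : ?X" for Q using rank prime_associated that by blast
 then have u: "u Q : {..<r} \<rightarrow> carrier M" if "Q : ?X" for Q using that by (simp add: local_basis_def)
 have cR: "c : ?X \<rightarrow> carrier R" using c(1) by blast
 have uM: "(%P. u P i) : ?X \<rightarrow> carrier M" if "i < r" for i using u that by (auto simp: Pi_iff)
 define n where "n i = lc M ?X c (%P. u P i)" for i
 have n: "n : {..<r} \<rightarrow> carrier M" using cR uM by (simp add: n_def)
 have "local_basis R M r Q n" if Q: "Q : ?X" for Q
 proof -
  have Qp: "primeideal Q R" using Q by simp
  have "EX s:carrier R - Q. ALL P:?X - {Q}. s \<otimes> c P = \<zero>"
   by (rule common_denominator[OF Qp]) (use finite_nonmaximal c Q cR in \<open>auto simp: m_assoc Pi_iff\<close>)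
  then obtain s where s: "s : carrier R - Q" "!!P. P : ?X - {Q} ==> s \<otimes> c P = \<zero>" by blast
  have "s *\<^sub>M n i = (s \<otimes> c Q) *\<^sub>M u Q i" if i: "i < r" for i
  proof -
   have X: "insert Q (?X - {Q}) = ?X" using Q by blast
   have "s *\<^sub>M n i = lc M (insert Q (?X - {Q})) (%P. s \<otimes> c P) (%P. u P i)"
    unfolding X n_def using s(1) by (intro lc_smult finite_nonmaximal cR uM[OF i]) simp
   also have "\<dots> = (s \<otimes> c Q) *\<^sub>M u Q i +\<^sub>M lc M (?X - {Q}) (%P. s \<otimes> c P) (%P. u P i)"
    by (rule lc_insert) (use finite_nonmaximal s(1) cR uM[OF i] Q in \<open>auto simp: Pi_iff\<close>)
   also have "lc M (?X - {Q}) (%P. s \<otimes> c P) (%P. u P i) = 0\<^sub>M"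
    by (rule lc_zero[OF _ s(2)]) (use uM[OF i] in \<open>auto simp: Pi_iff\<close>)
   finally show ?thesis using s(1) cR Q u[OF Q] i by (auto simp: Pi_iff)
  qed
  then show ?thesis
   using local_basis_transfer[OF Qp lb[OF Q] n s(1) prime_mult_notin[OF Qp s(1) c(1)[OF Q]]] by blast
 qed
 then show ?thesis using n by blast
qed

text \<open>A nonzero coefficient of a relation would survive at an associated prime, which is not
  maximal. The colon ideal of an element modulo the span lies in no nonmaximal prime, so it contains
  a power of \<open>t\<close>; finite generation makes the exponent uniform.\<close>

lemma global_basis:
 assumes tm: "t : \<mm>"
 shows "EX n:{..<r} \<rightarrow> carrier M.
  (ALL a:{..<r} \<rightarrow> carrier R. lc M {..<r} a n = 0\<^sub>M --> (ALL i<r. a i = \<zero>)) &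
  (EX N::nat. ALL x:carrier M. EX a:{..<r} \<rightarrow> carrier R. t [^] N *\<^sub>M x = lc M {..<r} a n)"
proof -
 have t: "t : carrier R" by (rule ideal_carrier[OF max_ideal tm])
 obtain n where n: "n : {..<r} \<rightarrow> carrier M"
   "!!P. primeideal P R ==> P ~= \<mm> ==> local_basis R M r P n"
  using common_local_basis by blast
 have indep: "a i = \<zero>" if a: "a : {..<r} \<rightarrow> carrier R" "lc M {..<r} a n = 0\<^sub>M" and i: "i < r" for a i
 proof (rule ccontr)
  assume "a i ~= \<zero>"
  then obtain P where P: "associated_prime R P" "P ~= \<mm>" "ALL c:carrier R. c \<otimes> a i = \<zero> --> c : P"
   using ring_annihilator_prime[of "a i"] a i by auto
  then have "local_basis R M r P n" using n(2) by (auto simp: associated_prime_def)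
  then obtain s where "s : carrier R - P" "ALL i<r. s \<otimes> a i = \<zero>" using a unfolding local_basis_def by blast
  then show False using P(3) i by blast
 qed
 define X where "X = comb (carrier R) {..<r} n"
 have X: "submodule X R M" unfolding X_def by (rule submodule_comb[OF finite_lessThan n(1) oneideal])
 have pow: "EX k::nat. t [^] k *\<^sub>M x : X" if x: "x : carrier M" for x
 proof (rule ccontr)
  assume "~ ?thesis"
  then have "t [^] k ~: colon R M X x" for k :: nat by (auto simp: colon_def)
  then obtain P where P: "primeideal P R" "colon R M X x <= P" "t ~: P"
   using prime_avoiding_power[OF ideal_colon[OF X x] t] by blast
  have "P ~= \<mm>" using P(3) tm by blast
  then obtain s a where s: "s : carrier R - P" "a : {..<r} \<rightarrow> carrier R" "s *\<^sub>M x = lc M {..<r} a n"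
   using n(2)[OF P(1)] x unfolding local_basis_def by meson
  then have "s : colon R M X x" by (auto simp: colon_def X_def comb_def)
  then show False using P(2) s(1) by blast
 qed
 define Z where "Z k = {x : carrier M. t [^] k *\<^sub>M x : X}" for k :: nat
 have "submodule (Z k) R M & Z k <= Z (Suc k)" for k
 proof
  show "submodule (Z k) R M"
   using t X by (intro submoduleI2)
    (auto simp: Z_def smult_r_distr smult_left_commute[of "t [^] k"] submodule_zero submoduleE)
  have "t [^] Suc k *\<^sub>M x = t *\<^sub>M (t [^] k *\<^sub>M x)" if "x : carrier M" for x
   using that t smult_left_commute[of t "t [^] k" x] by (simp add: smult_assoc1)
  then show "Z k <= Z (Suc k)" using submoduleE(4)[OF X t] by (auto simp: Z_def)
 qed
 then obtain N where "carrier M <= Z N"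
  using fg_chain_bound[OF M_fg, of Z] pow by (force simp: Z_def)
 then have "ALL x:carrier M. EX a:{..<r} \<rightarrow> carrier R. t [^] N *\<^sub>M x = lc M {..<r} a n"
  unfolding X_def Z_def comb_def by blast
 then show ?thesis using n(1) indep by blast
qed

end

subsection \<open>Lengths modulo a parameter\<close>

context linear
begin

lemma len_image_le:
 assumes X: "submodule X R M" and Y: "submodule Y R M" and YX: "Y <= X"
  and Y': "submodule Y' R N" and hY: "h ` Y <= Y'" and X': "X' <= h ` X <+>\<^bsub>N\<^esub> Y'"
 shows "len R N X' Y' <= len R M X Y"
proof -
 let ?Z = "{x : X. h x : Y'}"
 have Z: "submodule ?Z R M" by (rule submodule_preimage[OF X Y'])
 have "len R N X' Y' <= len R N (h ` X <+>\<^bsub>N\<^esub> Y') Y'" by (rule len_mono[OF X' subset_refl])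
 also have "\<dots> = len R M X ?Z" by (rule len_image[OF X Z _ Y' refl refl, symmetric]) blast
 also have "\<dots> <= len R M X Y" by (rule len_mono) (use YX hY in blast)+
 finally show ?thesis .
qed

end

context module
begin

lemma linear_mult: "a : carrier R ==> linear R M M (%x. a *\<^sub>M x)"
 by (intro linear.intro linear_axioms.intro module_axioms)
   (simp_all add: smult_r_distr smult_left_commute)

lemma linear_orbit: "g : carrier M ==> linear R rm M (%a. a *\<^sub>M g)"
 by (intro linear.intro linear_axioms.intro module_axioms R.module_ring_module)
   (simp_all add: smult_l_distr smult_assoc1)

lemma linear_id: "linear R M M (%x. x)"
 by (intro linear.intro linear_axioms.intro module_axioms) simp_all

definition scale :: "'a => 'c set => 'c set"
 where "scale a X = (%x. a *\<^sub>M x) ` X"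

lemma mem_scale: "x : scale a X \<longleftrightarrow> (EX v:X. x = a *\<^sub>M v)"
 by (auto simp: scale_def)

lemma submodule_scale: "submodule X R M ==> a : carrier R ==> submodule (scale a X) R M"
 unfolding scale_def by (rule linear.submodule_image[OF linear_mult])

lemma scale_subset: "submodule X R M ==> a : carrier R ==> scale a X <= X"
 using submoduleE(4) by (auto simp: scale_def)

lemma scale_mono: "X <= Y ==> scale a X <= scale a Y"
 by (auto simp: scale_def)

lemma scale_mult:
 "submodule X R M ==> a : carrier R ==> b : carrier R ==> scale (a \<otimes> b) X = scale a (scale b X)"
 unfolding scale_def image_image by (intro image_cong refl smult_assoc1 submodule_carrier)

lemma len_scale_le:
 assumes "submodule X R M" "submodule Y R M" "Y <= X" "a : carrier R"
 shows "len R M (scale a X) (scale a Y) <= len R M X Y"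
proof (rule linear.len_image_le[OF linear_mult[OF assms(4)] assms(1-3)])
 show "submodule (scale a Y) R M" by (rule submodule_scale[OF assms(2,4)])
 show "(\<odot>\<^bsub>M\<^esub>) a ` Y <= scale a Y" by (simp add: scale_def)
 show "scale a X <= (\<odot>\<^bsub>M\<^esub>) a ` X <+>\<^sub>M scale a Y"
  using set_add_upper1[OF submodule_scale[OF assms(1,4)] submodule_scale[OF assms(2,4)]]
  by (simp add: scale_def)
qed

lemma len_scale_eq:
 assumes X: "submodule X R M" and Y: "submodule Y R M" and YX: "Y <= X" and a: "a : carrier R"
  and reg: "!!x. x : X ==> a *\<^sub>M x = 0\<^sub>M ==> x = 0\<^sub>M"
 shows "len R M (scale a X) (scale a Y) = len R M X Y"
proof (rule linear.len_image[OF linear_mult[OF a] X Y YX submodule_scale[OF Y a], symmetric])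
 show "scale a X = (\<odot>\<^bsub>M\<^esub>) a ` X <+>\<^sub>M scale a Y"
 proof
  show "scale a X <= (\<odot>\<^bsub>M\<^esub>) a ` X <+>\<^sub>M scale a Y"
   using set_add_upper1[OF submodule_scale[OF X a] submodule_scale[OF Y a]] by (simp add: scale_def)
  show "(\<odot>\<^bsub>M\<^esub>) a ` X <+>\<^sub>M scale a Y <= scale a X"
   by (rule set_add_least[OF submodule_scale[OF X a]]) (use YX in \<open>auto simp: scale_def\<close>)
 qed
 show "Y = {x : X. a *\<^sub>M x : scale a Y}"
 proof
  show "Y <= {x : X. a *\<^sub>M x : scale a Y}" using YX by (auto simp: scale_def)
  show "{x : X. a *\<^sub>M x : scale a Y} <= Y"
  proof clarify
   fix x assume x: "x : X" "a *\<^sub>M x : scale a Y"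
   then obtain v where v: "v : Y" "a *\<^sub>M x = a *\<^sub>M v" by (auto simp: mem_scale)
   have c: "x : carrier M" "v : carrier M" "v : X"
    using submodule_carrier[OF X x(1)] submodule_carrier[OF Y v(1)] v(1) YX by auto
   have "a *\<^sub>M (x \<ominus>\<^bsub>M\<^esub> v) = 0\<^sub>M"
    using v(2) c a by (simp add: a_minus_def smult_r_distr smult_r_minus M.r_neg)
   then have "x \<ominus>\<^bsub>M\<^esub> v = 0\<^sub>M" using reg submodule_minus[OF X x(1) c(3)] by blast
   then have "x = v" using M.minus_plus_cancel[OF c(1,2)] c by simp
   then show "x : Y" using v by simp
  qed
 qed
qed

lemma enat_cancel: "(a::enat) + b = b + c ==> b ~= \<infinity> ==> a = c"
 by (cases a; cases b; cases c) auto

text \<open>The length of \<open>X/aY\<close> is counted through \<open>aX\<close> and through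
  \<open>Y\<close>. Multiplication by \<open>a\<close> identifies \<open>X/Y\<close> with
  \<open>aX/aY\<close>, and this finite length cancels.\<close>

lemma len_scale_commensurable:
 assumes X: "submodule X R M" and Y: "submodule Y R M" and YX: "Y <= X" and a: "a : carrier R"
  and reg: "!!x. x : X ==> a *\<^sub>M x = 0\<^sub>M ==> x = 0\<^sub>M"
  and fin: "len R M X Y ~= \<infinity>"
 shows "len R M X (scale a X) = len R M Y (scale a Y)"
proof -
 note s = submodule_scale[OF X a] submodule_scale[OF Y a]
 have "len R M X (scale a Y) = len R M X (scale a X) + len R M (scale a X) (scale a Y)"
  by (rule len_add[OF X s scale_mono[OF YX] scale_subset[OF X a]])
 moreover have "len R M X (scale a Y) = len R M X Y + len R M Y (scale a Y)"
  by (rule len_add[OF X Y s(2) scale_subset[OF Y a] YX])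
 moreover have "len R M (scale a X) (scale a Y) = len R M X Y"
  by (rule len_scale_eq[OF X Y YX a reg])
 ultimately show ?thesis using enat_cancel fin by metis
qed

lemma scale_set_add:
 assumes "submodule X R M" "submodule Y R M" "a : carrier R"
 shows "scale a (X <+>\<^sub>M Y) = scale a X <+>\<^sub>M scale a Y"
proof (rule Set.set_eqI)
 fix v
 have d: "a *\<^sub>M (x +\<^sub>M y) = a *\<^sub>M x +\<^sub>M a *\<^sub>M y" if "x : X" "y : Y" for x y
  using that assms submodule_carrier[OF assms(1)] submodule_carrier[OF assms(2)]
  by (simp add: smult_r_distr)
 show "v : scale a (X <+>\<^sub>M Y) \<longleftrightarrow> v : scale a X <+>\<^sub>M scale a Y"
 proof
  assume "v : scale a (X <+>\<^sub>M Y)"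
  then obtain w where w: "w : X <+>\<^sub>M Y" "v = a *\<^sub>M w" unfolding mem_scale by blast
  obtain x y where xy: "x : X" "y : Y" "w = x +\<^sub>M y" using w(1) unfolding mem_set_add by blast
  have "v = a *\<^sub>M x +\<^sub>M a *\<^sub>M y" using d xy w(2) by simp
  then show "v : scale a X <+>\<^sub>M scale a Y" unfolding mem_set_add scale_def using xy(1,2) by blast
 next
  assume "v : scale a X <+>\<^sub>M scale a Y"
  then obtain x y where xy: "x : X" "y : Y" "v = a *\<^sub>M x +\<^sub>M a *\<^sub>M y"
   unfolding mem_set_add scale_def by blast
  then have "v = a *\<^sub>M (x +\<^sub>M y)" using d by simp
  moreover have "x +\<^sub>M y : X <+>\<^sub>M Y" unfolding mem_set_add using xy(1,2) by blast
  ultimately show "v : scale a (X <+>\<^sub>M Y)" unfolding mem_scale by blast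
 qed
qed

text \<open>Each new generator contributes a cyclic quotient killed by \<open>a\<close>, of length
  at most that of \<open>R/aR\<close>.\<close>

lemma len_fg_scale_finite:
 assumes a: "a : carrier R" and fin: "len R rm (carrier R) (PIdl a) ~= \<infinity>"
 shows "fg R M X ==> len R M X (scale a X) ~= \<infinity>"
proof (induction rule: fg.induct)
 case fg_zero
 have "scale a {0\<^sub>M} = {0\<^sub>M}" using a by (simp add: scale_def)
 then show ?case using len_self by (simp add: zero_enat_def)
next
 case (fg_add X g)
 have X: "submodule X R M" and C: "submodule (cyc R M g) R M" and g: "g : carrier M"
  using fg_submodule[OF fg_add(1)] submodule_cyc fg_add(2) by auto
 let ?W = "X <+>\<^sub>M cyc R M g" and ?V = "X <+>\<^sub>M scale a (cyc R M g)"
 have aC: "submodule (scale a (cyc R M g)) R M" and aX: "submodule (scale a X) R M"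
  using submodule_scale C X a by auto
 have W: "submodule ?W R M" and V: "submodule ?V R M" using submodule_set_add X C aC by auto
 have aW: "scale a ?W = scale a X <+>\<^sub>M scale a (cyc R M g)" by (rule scale_set_add[OF X C a])
 have saW: "submodule (scale a ?W) R M" by (rule submodule_scale[OF W a])
 have VW: "?V <= ?W" by (rule set_add_mono[OF subset_refl scale_subset[OF C a]])
 have aWV: "scale a ?W <= ?V" unfolding aW by (rule set_add_mono[OF scale_subset[OF X a] subset_refl])
 have Rs: "submodule (carrier R) R rm" "submodule (PIdl a) R rm"
  using R.oneideal R.cgenideal_ideal[OF a] by (simp_all add: R.ideal_iff_submodule)
 have "len R M ?W ?V <= len R rm (carrier R) (PIdl a)"
 proof (rule linear.len_image_le[OF linear_orbit[OF g] Rs _ V])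
  show "PIdl a <= carrier R" using ideal_subset_carrier[OF R.cgenideal_ideal[OF a]] .
  show "(%b. b *\<^sub>M g) ` (PIdl a) <= ?V"
  proof (rule subset_trans[OF _ set_add_upper2[OF X aC]], clarify)
   fix b assume "b : PIdl a"
   then obtain c where c: "c : carrier R" "b = c \<otimes> a" by (auto simp: R.mem_PIdl)
   then have "b *\<^sub>M g = a *\<^sub>M (c *\<^sub>M g)" using a g by (simp add: smult_assoc1 smult_left_commute)
   then show "b *\<^sub>M g : scale a (cyc R M g)" using c unfolding mem_scale cyc_def by blast
  qed
  show "?W <= (%b. b *\<^sub>M g) ` carrier R <+>\<^sub>M ?V"
   unfolding cyc_def[symmetric]
   by (rule set_add_least[OF submodule_set_add[OF C V]])
     (use set_add_upper1[OF C V] set_add_upper2[OF C V] set_add_upper1[OF X aC] in blast)+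
 qed
 moreover have "len R M ?V (scale a ?W) <= len R M X (scale a X)"
 proof (rule linear.len_image_le[OF linear_id X aX scale_subset[OF X a] saW])
  show "(%x. x) ` scale a X <= scale a ?W"
   using scale_mono[OF set_add_upper1[OF X C]] by simp
  show "?V <= (%x. x) ` X <+>\<^sub>M scale a ?W"
   using set_add_mono[OF subset_refl scale_mono[OF set_add_upper2[OF X C]], of X] by simp
 qed
 moreover have "len R M ?W (scale a ?W) = len R M ?W ?V + len R M ?V (scale a ?W)"
  by (rule len_add[OF W V saW aWV VW])
 moreover note fin fg_add.IH
 ultimately show ?case
  by (cases "len R M ?W ?V"; cases "len R M ?V (scale a ?W)") auto
qed

text \<open>The filtration by the \<open>a^k X\<close> has factors that are quotients of
  \<open>X/aX\<close>.\<close>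

lemma len_finite_of_power:
 assumes a: "a : carrier R" and X: "submodule X R M" and Y: "submodule Y R M"
  and fin: "len R M X (scale a X) ~= \<infinity>" and sub: "scale (a [^] (n::nat)) X <= Y"
 shows "len R M X Y ~= \<infinity>"
proof -
 have "len R M X (scale (a [^] k) X) ~= \<infinity>" for k :: nat
 proof (induction k)
  case 0
  have "scale (a [^] (0::nat)) X = X"
   unfolding scale_def using submodule_carrier[OF X] by (simp cong: image_cong)
  then show ?case using len_self by (simp add: zero_enat_def)
 next
  case (Suc k)
  let ?a = "a [^] k"
  have ac: "?a : carrier R" using a by simp
  have e: "scale (a [^] Suc k) X = scale ?a (scale a X)"
   using scale_mult[OF X ac a] by simp
  have "len R M X (scale ?a (scale a X)) = len R M X (scale ?a X) + len R M (scale ?a X) (scale ?a (scale a X))"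
   by (intro len_add X submodule_scale ac a scale_mono scale_subset)
  moreover have "len R M (scale ?a X) (scale ?a (scale a X)) <= len R M X (scale a X)"
   by (intro len_scale_le X submodule_scale a ac scale_subset)
  ultimately show ?case using Suc fin unfolding e
   by (cases "len R M X (scale ?a X)"; cases "len R M (scale ?a X) (scale ?a (scale a X))") auto
 qed
 moreover have "len R M X Y <= len R M X (scale (a [^] n) X)" by (rule len_mono[OF subset_refl sub])
 ultimately show ?thesis by (metis enat_ord_simps(5))
qed

subsection \<open>Spans of independent families\<close>

lemma comb_insert:
 assumes S: "finite S" "j ~: S" and g: "g : insert j S \<rightarrow> carrier M" and J: "ideal J R"
 shows "comb J (insert j S) g = (%a. a *\<^sub>M g j) ` J <+>\<^sub>M comb J S g"
proof (rule Set.set_eqI)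
 fix v
 note Jc = ideal_subset_carrier[OF J]
 show "v : comb J (insert j S) g \<longleftrightarrow> v : (%a. a *\<^sub>M g j) ` J <+>\<^sub>M comb J S g"
 proof
  assume "v : comb J (insert j S) g"
  then obtain b where b: "b : insert j S \<rightarrow> J" "v = lc M (insert j S) b g" by (auto simp: comb_def)
  have "b : insert j S \<rightarrow> carrier R" using b(1) Jc by auto
  then have "v = b j *\<^sub>M g j +\<^sub>M lc M S b g" using lc_insert[OF S _ g] b(2) by blast
  then show "v : (%a. a *\<^sub>M g j) ` J <+>\<^sub>M comb J S g"
   unfolding mem_set_add comb_def using b(1) by blast
 next
  assume "v : (%a. a *\<^sub>M g j) ` J <+>\<^sub>M comb J S g"
  then obtain a b where ab: "a : J" "b : S \<rightarrow> J" "v = a *\<^sub>M g j +\<^sub>M lc M S b g"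
   unfolding mem_set_add comb_def by blast
  let ?b = "%i. if i = j then a else b i"
  have b: "?b : insert j S \<rightarrow> J" using ab by auto
  then have "?b : insert j S \<rightarrow> carrier R" using Jc by auto
  then have "lc M (insert j S) ?b g = ?b j *\<^sub>M g j +\<^sub>M lc M S ?b g" by (rule lc_insert[OF S _ g])
  moreover have "lc M S ?b g = lc M S b g"
   using ab S g Jc by (intro lc_cong) auto
  ultimately have "v = lc M (insert j S) ?b g" using ab(3) by simp
  then show "v : comb J (insert j S) g" unfolding comb_def using b by blast
 qed
qed

text \<open>By the assumption \<open>iff\<close> the quotient by \<open>Y\<close> is the direct sum
  of the \<open>J / K i\<close>, although the family \<open>g\<close> may be dependent. The length
  is accumulated one index at a time.\<close>

lemma len_comb:
 assumes S: "finite S" and g: "g : S \<rightarrow> carrier M" and J: "ideal J R"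
  and K: "!!i. i : S ==> ideal (K i) R" and KJ: "!!i. i : S ==> K i <= J"
  and Y: "submodule Y R M" and YX: "Y <= comb J S g"
  and iff: "!!b. b : S \<rightarrow> J ==> lc M S b g : Y \<longleftrightarrow> (ALL i:S. b i : K i)"
 shows "len R M (comb J S g) Y = (\<Sum>i\<in>S. len R rm J (K i))"
proof -
 note Jc = ideal_subset_carrier[OF J]
 have J0: "\<zero> : J" by (rule R.ideal_zero[OF J])
 have "len R M (comb J T g <+>\<^sub>M Y) Y = (\<Sum>i\<in>T. len R rm J (K i))"
  if "finite T" "T <= S" for T
  using that
 proof (induction T rule: finite_induct)
  case empty
  have "comb J {} g <+>\<^sub>M Y = Y"
   using submodule_carrier[OF Y] by (auto simp: comb_def mem_set_add)
  then show ?case using len_self by simp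
 next
  case (insert j T)
  have jS: "j : S" "T <= S" using insert by auto
  have gT: "g : insert j T \<rightarrow> carrier M" "g : T \<rightarrow> carrier M" "g j : carrier M" using g insert by auto
  note sT = submodule_comb[OF insert.hyps(1) gT(2) J]
  let ?Z = "comb J T g <+>\<^sub>M Y"
  let ?W = "comb J (insert j T) g <+>\<^sub>M Y"
  have Z: "submodule ?Z R M" by (rule submodule_set_add[OF sT Y])
  have sJ: "submodule J R rm" "submodule (K j) R rm"
   using J K[OF jS(1)] by (simp_all add: R.ideal_iff_submodule)
  have hJ: "submodule ((%a. a *\<^sub>M g j) ` J) R M"
   by (rule linear.submodule_image[OF linear_orbit[OF gT(3)] sJ(1)])
  have W_eq: "?W = (%a. a *\<^sub>M g j) ` J <+>\<^sub>M ?Z"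
   unfolding comb_insert[OF insert.hyps(1,2) gT(1) J] by (rule set_add_assoc[OF hJ sT Y, symmetric])
  have W: "submodule ?W R M" unfolding W_eq by (rule submodule_set_add[OF hJ Z])
  have ZW: "?Z <= ?W" unfolding W_eq by (rule set_add_upper2[OF hJ Z])
  have "K j = {a : J. a *\<^sub>M g j : ?Z}"
  proof
   show "K j <= {a : J. a *\<^sub>M g j : ?Z}"
   proof
    fix a assume a: "a : K j"
    have aJ: "a : J" using a KJ jS by blast
    have b: "(%i. if i = j then a else \<zero>) : S \<rightarrow> J" using aJ J0 by auto
    have "lc M S (%i. if i = j then a else \<zero>) g = a *\<^sub>M g j"
     using aJ Jc by (intro lc_single[OF S jS(1) _ g]) auto
    moreover have "lc M S (%i. if i = j then a else \<zero>) g : Y"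
     using iff[OF b] a R.ideal_zero[OF K] by auto
    ultimately have "a *\<^sub>M g j : Y" by simp
    then show "a : {a : J. a *\<^sub>M g j : ?Z}" using aJ set_add_upper2[OF sT Y] by blast
   qed
   show "{a : J. a *\<^sub>M g j : ?Z} <= K j"
   proof clarify
    fix a assume a: "a : J" "a *\<^sub>M g j : ?Z"
    then obtain b v where b: "b : T \<rightarrow> J" "v : Y" "a *\<^sub>M g j = lc M T b g +\<^sub>M v"
     unfolding mem_set_add comb_def by blast
    \<comment> \<open>With these coefficients the combination is \<open>v\<close> itself, an element
      of \<open>Y\<close>, so \<open>iff\<close> can be read off at index \<open>j\<close>.\<close>
    define c where "c i = (if i = j then a else if i : T then \<ominus> b i else \<zero>)" for i
    have "\<ominus> b i : J" if "i : T" for i using R.ideal_neg[OF J] b(1) that by blast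
    then have cJ: "c : S \<rightarrow> J" using a(1) J0 by (auto simp: c_def)
    have bc: "b : T \<rightarrow> carrier R" "c : S \<rightarrow> carrier R" using b(1) cJ Jc by auto
    have ac: "a : carrier R" using a Jc by auto
    have vc: "v : carrier M" by (rule submodule_carrier[OF Y b(2)])
    have "lc M S c g = lc M (insert j T) c g"
     unfolding lc_def
    proof (rule M.add.finprod_mono_neutral_cong_right[OF S])
     show "insert j T <= S" using jS by simp
     show "(%i. c i *\<^sub>M g i) : S \<rightarrow> carrier M" by (rule lc_term[OF bc(2) g])
     show "!!i. i : S - insert j T ==> c i *\<^sub>M g i = 0\<^sub>M" using g by (auto simp: c_def Pi_iff)
    qed auto
    also have "\<dots> = c j *\<^sub>M g j +\<^sub>M lc M T c g"
     using bc(2) jS by (intro lc_insert[OF insert.hyps(1,2) _ gT(1)]) auto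
    also have "lc M T c g = lc M T (%i. \<ominus> \<one> \<otimes> b i) g"
     using insert.hyps(2) bc(1) gT(2) by (intro lc_cong) (auto simp: c_def R.l_minus Pi_iff)
    also have "\<dots> = \<ominus>\<^bsub>M\<^esub> lc M T b g"
     using lc_smult[OF insert.hyps(1) _ bc(1) gT(2), of "\<ominus> \<one>"] lc_closed[OF bc(1) gT(2)]
     by (simp add: smult_l_minus)
    finally have "lc M S c g = a *\<^sub>M g j \<ominus>\<^bsub>M\<^esub> lc M T b g" by (simp add: c_def[of j] a_minus_def)
    also have "\<dots> = v" using b(3) vc lc_closed[OF bc(1) gT(2)] by (intro M.minus_eqI) auto
    finally have "lc M S c g : Y" using b(2) by simp
    then have "c j : K j" using iff[OF cJ] jS by blast
    then show "a : K j" by (simp add: c_def[of j])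
   qed
  qed
  then have "len R M ?W ?Z = len R rm J (K j)"
   by (intro linear.len_image[OF linear_orbit[OF gT(3)] sJ KJ[OF jS(1)] Z W_eq, symmetric])
  moreover have "len R M ?W Y = len R M ?W ?Z + len R M ?Z Y"
   by (rule len_add[OF W Z Y set_add_upper2[OF sT Y] ZW])
  ultimately show ?case using insert jS by simp
 qed
 from this[OF S subset_refl] have "len R M (comb J S g <+>\<^sub>M Y) Y = (\<Sum>i\<in>S. len R rm J (K i))" .
 moreover have "comb J S g <+>\<^sub>M Y = comb J S g"
  using set_add_least[OF submodule_comb[OF S g J] subset_refl YX]
   set_add_upper1[OF submodule_comb[OF S g J] Y] by blast
 ultimately show ?thesis by simp
qed

lemma smul_comb:
 assumes S: "finite S" and g: "g : S \<rightarrow> carrier M" and J: "ideal J R" and M: "carrier M = comb (carrier R) S g"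
 shows "smul M J (carrier M) = comb J S g"
proof
 note Jc = ideal_subset_carrier[OF J]
 show "smul M J (carrier M) <= comb J S g"
 proof (rule smul_least[OF submodule_comb[OF S g J]])
  fix a x assume a: "a : J" and "x : carrier M"
  then obtain b where b: "b : S \<rightarrow> carrier R" "x = lc M S b g" unfolding M comb_def by blast
  have "a *\<^sub>M x = lc M S (%i. a \<otimes> b i) g" using lc_smult[OF S _ b(1) g] a Jc b(2) by blast
  moreover have "(%i. a \<otimes> b i) : S \<rightarrow> J" using a b(1) R.ideal_rmult[OF J] by auto
  ultimately show "a *\<^sub>M x : comb J S g" unfolding comb_def by blast
 qed
 show "comb J S g <= smul M J (carrier M)"
 proof
  fix v assume "v : comb J S g"
  then obtain b where b: "b : S \<rightarrow> J" "v = lc M S b g" by (auto simp: comb_def)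
  have "submodule (smul M J (carrier M)) R M" by (rule submodule_smul[OF subset_refl J])
  then show "v : smul M J (carrier M)"
   unfolding b(2) lc_def
  proof (rule submodule_finsum[OF _ S])
   fix i assume "i : S"
   then show "b i *\<^sub>M g i : smul M J (carrier M)" using b(1) g by (intro smul.smul_gen) auto
  qed
 qed
qed

end

context local_ring
begin

lemma len_max_le: "len R rm (carrier R) \<mm> <= 1"
proof (rule len_least)
 fix n C assume C: "mchain R rm (carrier R) \<mm> n C"
 have "n <= 1"
 proof (rule ccontr)
  assume "~ n <= 1"
  then have n: "1 < n" by simp
  have C1: "ideal (C 1) R" using mchainD(1)[OF C, of 1] n by (simp add: ideal_iff_submodule)
  have s: "\<mm> \<subset> C 1" "C 1 \<subset> carrier R"
   using mchainD(2)[OF C, of 0] mchainD(4)[OF C, of 0] mchainD(4)[OF C, of 1] mchainD(3)[OF C, of "Suc 1"] n by auto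
  have "\<one> ~: C 1" using ideal.one_imp_carrier[OF C1] s(2) by blast
  then show False using proper_subset_max[OF C1] s(1) by blast
 qed
 then show "enat n <= 1" by (simp add: one_enat_def)
qed

text \<open>Noetherian induction: with \<open>(E : g)\<close> maximal, passing from \<open>E\<close>
  to \<open>E + (g)\<close> costs at most the length 1 of the residue field.\<close>

lemma len_finite:
 assumes "ideal E R" "!!P. primeideal P R ==> E <= P ==> P = \<mm>"
 shows "len R rm (carrier R) E ~= \<infinity>"
 using assms
proof (induction rule: noeth_induct)
 case (step E)
 show ?case
 proof (cases "\<one> : E")
  case True
  then have "E = carrier R" using ideal.one_imp_carrier[OF step.hyps] by simp
  then show ?thesis using RM.len_self by (simp add: zero_enat_def)
 next
  case False
  obtain g where g: "g : carrier R" "g ~: E" and Pg: "primeideal (colon R rm E g) R"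
   and Eg: "E <= colon R rm E g"
   by (rule prime_colon_ring[OF step.hyps False])
  have mg: "colon R rm E g = \<mm>" using step.prems Pg Eg by blast
  let ?E = "E <+>\<^bsub>R\<^esub> PIdl g"
  have E': "ideal ?E R" by (rule ideal_set_add_PIdl[OF step.hyps g(1)])
  have up: "E <= ?E" "g : ?E"
   using set_add_upper1[OF step.hyps cgenideal_ideal[OF g(1)]]
    set_add_upper2[OF step.hyps cgenideal_ideal[OF g(1)] cgenideal_self[OF g(1)]] by auto
  have fin: "len R rm (carrier R) ?E ~= \<infinity>"
  proof (rule step.IH[OF E'])
   show "E \<subset> ?E" using up g(2) by blast
   show "P = \<mm>" if "primeideal P R" "?E <= P" for P using step.prems[OF that(1)] that(2) up(1) by blast
  qed
  have "len R rm ?E E <= len R rm (carrier R) \<mm>"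
  proof (rule linear.len_image_le[OF RM.linear_orbit])
   show "g : carrier rm" using g by simp
   show "submodule (carrier R) R rm" "submodule \<mm> R rm" "submodule E R rm"
    using oneideal max_ideal step.hyps by (simp_all add: ideal_iff_submodule)
   show "\<mm> <= carrier R" by (rule ideal_subset_carrier[OF max_ideal])
   show "(%a. a \<odot>\<^bsub>rm\<^esub> g) ` \<mm> <= E" using mg by (auto simp: colon_def)
   show "?E <= (%a. a \<odot>\<^bsub>rm\<^esub> g) ` carrier R <+>\<^bsub>rm\<^esub> E"
   proof
    fix x assume "x : ?E"
    then obtain i c where "i : E" "c : carrier R" "x = i \<oplus> c \<otimes> g" unfolding mem_set_add_PIdl by blast
    then have "x = c \<otimes> g \<oplus> i" using g ideal_carrier[OF step.hyps] a_comm by simp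
    then show "x : (%a. a \<odot>\<^bsub>rm\<^esub> g) ` carrier R <+>\<^bsub>rm\<^esub> E"
     unfolding ring_module_set_add mem_set_add using \<open>i : E\<close> \<open>c : carrier R\<close> by auto
   qed
  qed
  then have "len R rm ?E E <= 1" using len_max_le order_trans by blast
  then have f2: "len R rm ?E E ~= \<infinity>"
   by (metis enat_ord_simps(5) infinity_ne_i1)
  have "len R rm (carrier R) E = len R rm (carrier R) ?E + len R rm ?E E"
   by (rule RM.len_add)
     (use oneideal E' step.hyps up ideal_subset_carrier[OF E'] in \<open>simp_all add: ideal_iff_submodule\<close>)
  then show ?thesis using fin f2
   by (cases "len R rm (carrier R) ?E"; cases "len R rm ?E E") auto
 qed
qed

end

locale local_module = R?: local_ring R \<mm> + noeth_module R M
 for R :: "('a, 'k) ring_scheme" (structure) and \<mm> and M :: "('a, 'm, 'l) module_scheme" (structure)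
begin

lemma nakayama:
 assumes N: "fg R M N" and Y: "submodule Y R M" and sub: "N <= smul M \<mm> N <+>\<^sub>M Y"
 shows "N <= Y"
proof
 have 1: "\<one> : carrier R - \<mm>" using prime_one[OF max_prime] by simp
 have Nc: "N <= carrier M" by (rule submoduleE(1)[OF fg_submodule[OF N]])
 have "EX u:carrier R - \<mm>. u *\<^sub>M x : smul M \<mm> N <+>\<^sub>M Y" if "x : N" for x
  using that sub Nc 1 by (intro bexI[of _ "\<one>"]) (auto simp: subset_iff)
 then obtain v where v: "v : carrier R - \<mm>" "ALL x:N. v *\<^sub>M x : Y"
  using nakayama_relative[OF max_prime Y N] by meson
 obtain w where w: "w : carrier R" "w \<otimes> v = \<one>" using inverse_exists[of v] v(1) by blast
 fix x assume x: "x : N"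
 have xc: "x : carrier M" using x Nc by (rule rev_subsetD)
 have "w *\<^sub>M (v *\<^sub>M x) : Y" using v(2) x w(1) submoduleE(4)[OF Y] by blast
 moreover have "w *\<^sub>M (v *\<^sub>M x) = x" using w v(1) xc by (simp flip: smult_assoc1)
 ultimately show "x : Y" by simp
qed

end

context local_ring
begin

lemma local_module_ring_module: "local_module R \<mm> rm"
 by (intro local_module.intro local_ring_axioms noeth_module_ring_module)

lemma ideal_nakayama:
 assumes N: "ideal N R" and Y: "ideal Y R" and sub: "!!x. x : N ==> EX a:\<mm> \<cdot> N. EX b:Y. x = a \<oplus> b"
 shows "N <= Y"
proof (rule local_module.nakayama[OF local_module_ring_module])
 show "fg R rm N" by (rule ideal_fg[OF N])
 show "submodule Y R rm" using Y by (simp add: ideal_iff_submodule)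
 show "N <= smul rm \<mm> N <+>\<^bsub>rm\<^esub> Y"
  using sub unfolding ring_module_set_add smul_eq_ideal_prod[OF max_ideal N] subset_iff mem_set_add by blast
qed

text \<open>\<open>N = tN\<close> forces \<open>N = 0\<close> by Nakayama. This turns divisibility
  by \<open>t\<close> within one ideal into vanishing, for annihilators and for coefficients of
  relations.\<close>

lemma ideal_eq_zero_of_scale:
 assumes N: "ideal N R" and t: "t : \<mm>" and sub: "!!x. x : N ==> EX x':N. x = t \<otimes> x'"
 shows "N <= {\<zero>}"
proof (rule ideal_nakayama[OF N zeroideal])
 fix x assume "x : N"
 then obtain x' where "x' : N" "x = t \<otimes> x'" using sub by blast
 moreover from this have "x : \<mm> \<cdot> N" using t by (simp add: ideal_prod.prod)
 moreover have "x : carrier R" using \<open>x : N\<close> ideal_carrier[OF N] by blast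
 ultimately show "EX a:\<mm> \<cdot> N. EX b:{\<zero>}. x = a \<oplus> b" by (intro bexI[of _ x] bexI[of _ "\<zero>"]) auto
qed

end

subsection \<open>Dividing by a parameter complementary to \<open>y\<close>\<close>

locale param_ring = local_ring R \<mm> for R :: "('a, 'k) ring_scheme" (structure) and \<mm> +
 fixes t y :: 'a
 assumes t_max: "t : \<mm>" and y_max: "y : \<mm>"
  and max_gen: "p : \<mm> ==> EX a:carrier R. EX b:carrier R. p = a \<otimes> t \<oplus> b \<otimes> y"
  and t_regular: "a : carrier R ==> t \<otimes> a = \<zero> ==> a = \<zero>"
  and t_only: "primeideal P R ==> t : P ==> P = \<mm>"
begin

lemma ty_carrier [simp]: "t : carrier R" "y : carrier R"
 using ideal_carrier[OF max_ideal] t_max y_max by auto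

definition E :: "nat => 'a set"
 where "E i = {b \<otimes> y [^] i \<oplus> c \<otimes> t | b c. b : carrier R & c : carrier R}"

text \<open>The nilpotency index of \<open>y\<close> modulo \<open>t\<close>; by
  \<open>len_ring_E\<close> also the length of \<open>R/tR\<close>.\<close>

definition e :: nat where "e = (LEAST n. y [^] n : PIdl t)"

lemma E_ideal: "ideal (E i) R"
proof -
 have "E i = PIdl (y [^] i) <+>\<^bsub>R\<^esub> PIdl t"
  unfolding E_def set_add_def' cgenideal_def by blast
 then show ?thesis by (simp add: add_ideals cgenideal_ideal)
qed

lemma PIdl_t_ideal: "ideal (PIdl t) R" by (simp add: cgenideal_ideal)

lemma t_in_E: "t : E i"
proof -
 have "t = \<zero> \<otimes> y [^] i \<oplus> \<one> \<otimes> t" by simp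
 then show ?thesis unfolding E_def by blast
qed

lemma y_in_E: "y [^] i : E i"
proof -
 have "y [^] i = \<one> \<otimes> y [^] i \<oplus> \<zero> \<otimes> t" by simp
 then show ?thesis unfolding E_def by blast
qed

lemma PIdl_t_E: "PIdl t <= E i" by (rule cgenideal_minimal[OF E_ideal t_in_E])

lemma E_least: "ideal D R ==> t : D ==> y [^] i : D ==> E i <= D"
 unfolding E_def using ideal_add ideal_lmult by blast

lemma y_pow_e: "y [^] e : PIdl t"
proof -
 have "EX n::nat. y [^] n : PIdl t"
 proof (rule ccontr)
  assume "~ ?thesis"
  then obtain P where P: "primeideal P R" "PIdl t <= P" "y ~: P"
   using prime_avoiding_power[OF PIdl_t_ideal ty_carrier(2)] by blast
  have "t : PIdl t" by (simp add: cgenideal_self)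
  then show False using P t_only y_max by blast
 qed
 then show ?thesis unfolding e_def by (rule LeastI_ex)
qed

lemma y_pow_less_e: "i < e ==> y [^] i ~: PIdl t"
 unfolding e_def by (rule not_less_Least)

lemma E_anti: "i <= j ==> E j <= E i"
proof (rule E_least[OF E_ideal t_in_E])
 assume "i <= j"
 then have "y [^] j = y [^] (j - i) \<otimes> y [^] i" by (simp add: nat_pow_mult)
 then show "y [^] j : E i" using ideal_lmult[OF E_ideal _ y_in_E] by simp
qed

lemma E_0: "E 0 = carrier R"
 using ideal.one_imp_carrier[OF E_ideal] y_in_E[of 0] by simp

lemma E_e: "E e = PIdl t"
 using PIdl_t_E E_least[OF PIdl_t_ideal cgenideal_self y_pow_e] by auto

lemma E_1: "E 1 = \<mm>"
proof
 show "E 1 <= \<mm>" using y_max by (intro E_least[OF max_ideal t_max]) simp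
 show "\<mm> <= E 1"
 proof
  fix p assume "p : \<mm>"
  then obtain a b where "a : carrier R" "b : carrier R" "p = a \<otimes> t \<oplus> b \<otimes> y" using max_gen by blast
  then have "p = b \<otimes> y [^] (1::nat) \<oplus> a \<otimes> t" by (simp add: a_comm)
  then show "p : E 1" unfolding E_def using \<open>a : carrier R\<close> \<open>b : carrier R\<close> by blast
 qed
qed

lemma E_Suc_unit:
 assumes bc: "b : carrier R" "c : carrier R" and n: "b \<otimes> y [^] i \<oplus> c \<otimes> t ~: E (Suc i)"
 shows "b ~: \<mm>"
proof
 assume "b : \<mm>"
 then obtain d f where df: "d : carrier R" "f : carrier R" "b = d \<otimes> t \<oplus> f \<otimes> y" using max_gen by blast
 have "b \<otimes> y [^] i = (d \<otimes> y [^] i) \<otimes> t \<oplus> f \<otimes> y [^] Suc i"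
  unfolding df(3) using df(1,2) by (simp add: l_distr m_assoc m_comm[of t "y [^] i"] m_comm[of y "y [^] i"])
 moreover have "(d \<otimes> y [^] i) \<otimes> t : E (Suc i)" using df(1) ideal_lmult[OF E_ideal _ t_in_E] by simp
 moreover have "f \<otimes> y [^] Suc i : E (Suc i)" by (rule ideal_lmult[OF E_ideal df(2) y_in_E])
 moreover have "c \<otimes> t : E (Suc i)" by (rule ideal_lmult[OF E_ideal bc(2) t_in_E])
 ultimately show False using n ideal_add[OF E_ideal] by metis
qed

lemma order_exists:
 assumes "a : carrier R"
 shows "a ~: E n ==> EX i<n. EX b:carrier R - \<mm>. EX c:carrier R. a = b \<otimes> y [^] i \<oplus> c \<otimes> t"
proof (induction n)
 case 0 then show ?case using assms E_0 by simp
next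
 case (Suc n)
 show ?case
 proof (cases "a : E n")
  case True
  then obtain b c where "b : carrier R" "c : carrier R" "a = b \<otimes> y [^] n \<oplus> c \<otimes> t" unfolding E_def by blast
  moreover from this have "b ~: \<mm>" using E_Suc_unit Suc.prems by blast
  ultimately show ?thesis by blast
 next
  case False then show ?thesis using Suc.IH less_SucI by blast
 qed
qed

lemma unit_cancel:
 assumes D: "ideal D R" and b: "b : carrier R" "b ~: \<mm>" and a: "a : carrier R" "b \<otimes> a : D"
 shows "a : D"
proof -
 obtain w where w: "w : carrier R" "w \<otimes> b = \<one>" using inverse_exists[OF b] by blast
 have "w \<otimes> (b \<otimes> a) : D" by (rule ideal_lmult[OF D w(1) a(2)])
 moreover have "w \<otimes> (b \<otimes> a) = (w \<otimes> b) \<otimes> a" using w(1) a b by (simp add: m_assoc)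
 ultimately show ?thesis using w a by simp
qed

text \<open>By \<open>order_exists\<close> an element outside \<open>(t)\<close> is modulo
  \<open>t\<close> a unit times a power of \<open>y\<close>, so the ideal is determined by the least
  power of \<open>y\<close> that it contains.\<close>

lemma ideal_above_t:
 assumes D: "ideal D R" and tD: "t : D"
 shows "EX k<=e. D = E k"
proof -
 have sub: "PIdl t <= D" by (rule cgenideal_minimal[OF D tD])
 define k :: nat where "k = (LEAST k. y [^] k : D)"
 have "y [^] e : D" using y_pow_e sub by blast
 then have k: "y [^] k : D" "k <= e" unfolding k_def by (rule LeastI, rule Least_le)
 have "D <= E k"
 proof (rule subsetI, rule ccontr)
  fix a assume a: "a : D" and "a ~: E k"
  then obtain i b c where i: "i < k" "b : carrier R" "b ~: \<mm>" "c : carrier R" "a = b \<otimes> y [^] i \<oplus> c \<otimes> t"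
   using order_exists[OF ideal_carrier[OF D a]] by blast
  have "a \<ominus> c \<otimes> t : D" using ideal_minus[OF D a ideal_lmult[OF D i(4) tD]] .
  moreover have "a \<ominus> c \<otimes> t = b \<otimes> y [^] i" using i by (intro minus_eqI) (auto simp: a_comm)
  ultimately have "y [^] i : D" using unit_cancel[OF D i(2,3)] by simp
  then show False using not_less_Least i(1) unfolding k_def by blast
 qed
 then show ?thesis using E_least[OF D tD k(1)] k(2) by blast
qed

lemma E_strict: "i < e ==> E i ~= E (Suc i)"
proof
 assume i: "i < e" "E i = E (Suc i)"
 then obtain b c where bc: "b : carrier R" "c : carrier R" "y [^] i = b \<otimes> y [^] Suc i \<oplus> c \<otimes> t"
  using y_in_E[of i] unfolding E_def by blast
 have z: "\<one> \<ominus> b \<otimes> y ~: \<mm>"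
 proof
  assume "\<one> \<ominus> b \<otimes> y : \<mm>"
  then have "(\<one> \<ominus> b \<otimes> y) \<oplus> b \<otimes> y : \<mm>"
   using ideal_add[OF max_ideal] ideal_lmult[OF max_ideal bc(1) y_max] by blast
  then show False using bc prime_one[OF max_prime] by (simp add: minus_plus_cancel)
 qed
 have "y [^] i \<ominus> b \<otimes> y [^] Suc i = c \<otimes> t" using bc by (intro minus_eqI) auto
 moreover have "(\<one> \<ominus> b \<otimes> y) \<otimes> y [^] i = y [^] i \<ominus> b \<otimes> y [^] Suc i"
  using bc by (simp add: a_minus_def l_distr l_minus m_assoc m_comm[of y "y [^] i"])
 ultimately have "(\<one> \<ominus> b \<otimes> y) \<otimes> y [^] i = c \<otimes> t" by simp
 then have "(\<one> \<ominus> b \<otimes> y) \<otimes> y [^] i : PIdl t" unfolding mem_PIdl using bc(2) by (intro bexI)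
 then have "y [^] i : PIdl t" using unit_cancel[OF PIdl_t_ideal _ z] bc(1) by simp
 then show False using y_pow_less_e[OF i(1)] by blast
qed

definition JE :: "'a set => nat => 'a set" where "JE J i = J \<cdot> E i"

lemma JE_ideal: "ideal J R ==> ideal (JE J i) R"
 unfolding JE_def by (rule ideal_prod_is_ideal[OF _ E_ideal])

lemma JE_sub: "ideal J R ==> submodule (JE J i) R rm"
 by (simp add: JE_ideal ideal_iff_submodule)

lemma JE_0: "ideal J R ==> JE J 0 = J"
 unfolding JE_def E_0 by (rule ideal_prod_one)

lemma JE_anti: assumes J: "ideal J R" and "i <= j" shows "JE J j <= JE J i"
 unfolding JE_def[of J j]
proof (rule ideal_prod_least[OF JE_ideal[OF J]])
 fix a b assume "a : J" "b : E j"
 then show "a \<otimes> b : JE J i" unfolding JE_def using E_anti[OF assms(2)] by (intro ideal_prod.prod) auto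
qed

lemma JE_e: assumes J: "ideal J R" shows "JE J e = RM.scale t J"
proof
 have s: "ideal (RM.scale t J) R"
  using RM.submodule_scale[of J t] J by (simp add: ideal_iff_submodule)
 show "JE J e <= RM.scale t J"
  unfolding JE_def E_e
 proof (rule ideal_prod_least[OF s])
  fix a b assume a: "a : J" and "b : PIdl t"
  then obtain c where c: "c : carrier R" "b = c \<otimes> t" by (auto simp: mem_PIdl)
  have "a \<otimes> b = t \<otimes> (a \<otimes> c)" using c ideal_carrier[OF J a] by (simp add: m_ac)
  then show "a \<otimes> b : RM.scale t J"
   unfolding RM.mem_scale using ideal_rmult[OF J c(1) a] by auto
 qed
 show "RM.scale t J <= JE J e"
 proof
  fix x assume "x : RM.scale t J"
  then obtain a where "a : J" "x = t \<otimes> a" by (auto simp: RM.mem_scale)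
  then show "x : JE J e" unfolding JE_def using t_in_E[of e] ideal_carrier[OF J]
   by (simp add: m_comm[of t] ideal_prod.prod)
 qed
qed

text \<open>The numbers \<delta>_k. For \<open>i < e\<close> the length is finite by
  \<open>dl_eq\<close>, so \<open>the_enat\<close> loses nothing.\<close>

definition dl :: "'a set => nat => nat"
 where "dl J i = the_enat (len R rm (JE J i) (JE J (Suc i)))"

lemma len_t_finite: "len R rm (carrier R) (PIdl t) ~= \<infinity>"
proof (rule len_finite[OF PIdl_t_ideal])
 fix P assume P: "primeideal P R" "PIdl t <= P"
 have "t : P" using P(2) cgenideal_self[of t] by auto
 then show "P = \<mm>" by (rule t_only[OF P(1)])
qed

lemma len_J_finite: "ideal J R ==> len R rm J (JE J e) ~= \<infinity>"
 unfolding JE_e by (rule RM.len_fg_scale_finite[OF _ len_t_finite ideal_fg]) simp_all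

lemma dl_eq:
 assumes J: "ideal J R" and i: "Suc i <= e"
 shows "len R rm (JE J i) (JE J (Suc i)) = enat (dl J i)"
proof -
 have "len R rm (JE J i) (JE J (Suc i)) <= len R rm J (JE J e)"
  using JE_anti[OF J, of 0 i] JE_0[OF J] JE_anti[OF J i] by (intro len_mono) simp_all
 then have "len R rm (JE J i) (JE J (Suc i)) ~= \<infinity>"
  using len_J_finite[OF J] by (metis enat_ord_simps(5))
 then show ?thesis unfolding dl_def by auto
qed

lemma len_JE:
 assumes J: "ideal J R" shows "a <= e ==> len R rm J (JE J a) = enat (\<Sum>i<a. dl J i)"
proof (induction a)
 case 0
 then show ?case using JE_0[OF J] RM.len_self by (simp add: zero_enat_def)
next
 case (Suc a)
 have "len R rm J (JE J (Suc a)) =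
   len R rm J (JE J a) + len R rm (JE J a) (JE J (Suc a))"
  using JE_anti[OF J, of a "Suc a"] JE_anti[OF J, of 0 a] JE_0[OF J] JE_sub[OF J] J
  by (intro RM.len_add) (simp_all add: ideal_iff_submodule)
 then show ?case using Suc dl_eq[OF J, of a] by simp
qed

text \<open>Multiplication by \<open>y\<close> maps \<open>JE J i\<close> into
  \<open>JE J (Suc i)\<close> and covers it modulo \<open>JE J (Suc (Suc i))\<close>, since the
  other generator \<open>t\<close> lies in every \<open>E k\<close>.\<close>

lemma dl_anti:
 assumes J: "ideal J R" and i: "Suc (Suc i) <= e"
 shows "dl J (Suc i) <= dl J i"
proof -
 have "len R rm (JE J (Suc i)) (JE J (Suc (Suc i))) <= len R rm (JE J i) (JE J (Suc i))"
 proof (rule linear.len_image_le[OF RM.linear_mult[of y]])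
  show "y : carrier R" by simp
  show "submodule (JE J i) R rm" "submodule (JE J (Suc i)) R rm"
   "submodule (JE J (Suc (Suc i))) R rm" by (rule JE_sub[OF J])+
  show "JE J (Suc i) <= JE J i" by (rule JE_anti[OF J]) simp
  have yE: "y \<otimes> b : E (Suc k)" if b: "b : E k" for b k
  proof -
   obtain c d where cd: "c : carrier R" "d : carrier R" "b = c \<otimes> y [^] k \<oplus> d \<otimes> t" using b unfolding E_def by blast
   have "y \<otimes> b = c \<otimes> y [^] Suc k \<oplus> (y \<otimes> d) \<otimes> t"
    unfolding cd(3) using cd(1,2) by (simp add: r_distr m_ac)
   moreover have "y \<otimes> d : carrier R" using cd(2) by simp
   ultimately show ?thesis unfolding E_def mem_Collect_eq using cd(1) by (intro exI conjI)
  qed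
  have yJE: "y \<otimes> x : JE J (Suc k)" if "x : JE J k" for x k
   using that unfolding JE_def
  proof induction
   case (prod a b)
   have c: "a : carrier R" "b : carrier R" using prod ideal_carrier[OF J] ideal_carrier[OF E_ideal] by auto
   have "y \<otimes> (a \<otimes> b) = a \<otimes> (y \<otimes> b)" using c m_lcomm by simp
   then show ?case using ideal_prod.prod[OF prod(1) yE[OF prod(2)], of R] by simp
  next
   case (sum a b)
   have "a : carrier R" "b : carrier R"
    using sum ideal_carrier[OF JE_ideal[OF J]] unfolding JE_def by auto
   then show ?case using sum by (simp add: r_distr ideal_prod.sum)
  qed
  then show "(%x. y \<odot>\<^bsub>rm\<^esub> x) ` JE J (Suc i) <= JE J (Suc (Suc i))" by auto
  let ?A = "(%x. y \<odot>\<^bsub>rm\<^esub> x) ` JE J i" and ?B = "JE J (Suc (Suc i))"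
  have A: "submodule ?A R rm"
   by (rule linear.submodule_image[OF RM.linear_mult JE_sub[OF J]]) simp
  have AB: "ideal (?A <+>\<^bsub>rm\<^esub> ?B) R"
   using RM.submodule_set_add[OF A JE_sub[OF J]] by (simp add: ideal_iff_submodule)
  show "JE J (Suc i) <= ?A <+>\<^bsub>rm\<^esub> ?B"
   unfolding JE_def[of J "Suc i"]
  proof (rule ideal_prod_least[OF AB])
   fix a b assume a: "a : J" and "b : E (Suc i)"
   then obtain c d where cd: "c : carrier R" "d : carrier R" "b = c \<otimes> y [^] Suc i \<oplus> d \<otimes> t" unfolding E_def by blast
   have ac: "a : carrier R" by (rule ideal_carrier[OF J a])
   have "a \<otimes> b = y \<otimes> (a \<otimes> (c \<otimes> y [^] i)) \<oplus> a \<otimes> (d \<otimes> t)"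
    unfolding cd(3) using cd(1,2) ac by (simp add: r_distr m_ac)
   moreover have "a \<otimes> (c \<otimes> y [^] i) : JE J i"
    unfolding JE_def using a ideal_lmult[OF E_ideal cd(1) y_in_E] by (intro ideal_prod.prod)
   moreover have "a \<otimes> (d \<otimes> t) : ?B"
    unfolding JE_def using a ideal_lmult[OF E_ideal cd(2) t_in_E] by (intro ideal_prod.prod)
   ultimately show "a \<otimes> b : ?A <+>\<^bsub>rm\<^esub> ?B"
    unfolding RM.mem_set_add by auto
  qed
 qed
 then show ?thesis using dl_eq[OF J, of i] dl_eq[OF J, of "Suc i"] i by simp
qed

text \<open>For \<open>J = R\<close> the first factor is the residue field, of length at most 1; the
  later ones are bounded by it through \<open>dl_anti\<close> and nonzero by
  \<open>E_strict\<close>.\<close>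

lemma dl_ring: assumes "i < e" shows "dl (carrier R) i = 1"
proof -
 have JE_R: "JE (carrier R) k = E k" for k
  unfolding JE_def using ideal_prod_commute[OF oneideal E_ideal] ideal_prod_one[OF E_ideal] by simp
 have J: "ideal (carrier R) R" by (rule oneideal)
 have anti: "dl (carrier R) k <= dl (carrier R) 0" if "k < e" for k
  using that
 proof (induction k)
  case (Suc k)
  then show ?case using dl_anti[OF J, of k] by simp
 qed simp
 have "enat (dl (carrier R) 0) <= 1"
  using dl_eq[OF J, of 0] assms len_max_le by (simp add: JE_R E_0 E_1[unfolded One_nat_def])
 then have "dl (carrier R) i <= 1" using anti[OF assms] by (simp add: one_enat_def)
 moreover have "dl (carrier R) i ~= 0"
 proof
  assume "dl (carrier R) i = 0"
  then have "len R rm (E i) (E (Suc i)) = 0"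
   using dl_eq[OF J, of i] assms by (simp add: JE_R zero_enat_def)
  then have "E i = E (Suc i)"
   by (intro RM.len_eq_0D) (simp_all add: ideal_iff_submodule E_ideal E_anti)
  then show False using E_strict[OF assms] by blast
 qed
 ultimately show ?thesis by simp
qed

lemma len_ring_E: "a <= e ==> len R rm (carrier R) (E a) = enat a"
proof -
 assume a: "a <= e"
 have "JE (carrier R) a = E a"
  unfolding JE_def using ideal_prod_commute[OF oneideal E_ideal] ideal_prod_one[OF E_ideal] by simp
 moreover have "(\<Sum>i<a. dl (carrier R) i) = a" using dl_ring a by simp
 ultimately show ?thesis using len_JE[OF oneideal a] by simp
qed

text \<open>If the annihilator \<open>B\<close> of \<open>J\<close> were inside \<open>(t)\<close>,
  regularity of \<open>t\<close> would give \<open>B = tB\<close>, hence \<open>B = 0\<close>. So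
  some \<open>b\<close> in \<open>B\<close> has the form \<open>u y^i + c t\<close> with
  \<open>u\<close> a unit and \<open>i < e\<close>; then \<open>y^i J\<close> lies in
  \<open>tJ\<close>, and so does \<open>y^(e-1) J\<close>.\<close>

lemma dl_last_zero:
 assumes J: "ideal J R" and z: "z : carrier R" "z ~= \<zero>" "!!a. a : J ==> z \<otimes> a = \<zero>" and e: "0 < e"
 shows "dl J (e - 1) = 0"
proof -
 define B where "B = {b : carrier R. ALL a:J. b \<otimes> a = \<zero>}"
 have Jc: "a : carrier R" if "a : J" for a using that ideal_carrier[OF J] by blast
 have B: "ideal B R"
  by (rule idealI2) (auto simp: B_def Jc l_distr m_assoc)
 have "~ B <= PIdl t"
 proof
  assume sub: "B <= PIdl t"
  have "B <= {\<zero>}"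
  proof (rule ideal_eq_zero_of_scale[OF B t_max])
   fix x assume x: "x : B"
   then obtain c where c: "c : carrier R" "x = c \<otimes> t" using sub by (meson mem_PIdl subsetD)
   have "c \<otimes> a = \<zero>" if a: "a : J" for a
   proof (rule t_regular)
    have "t \<otimes> (c \<otimes> a) = x \<otimes> a" using c Jc[OF a] by (simp add: m_ac)
    then show "t \<otimes> (c \<otimes> a) = \<zero>" using x a by (simp add: B_def)
   qed (use c Jc[OF a] in simp)
   then have "c : B" using c by (simp add: B_def)
   then show "EX x':B. x = t \<otimes> x'" using c by (intro bexI[of _ c]) (simp_all add: m_comm)
  qed
  then show False using z by (auto simp: B_def)
 qed
 then obtain b where b: "b : B" "b ~: PIdl t" by blast
 have bc: "b : carrier R" using b by (simp add: B_def)
 obtain i u c where i: "i < e" "u : carrier R" "u ~: \<mm>" "c : carrier R" "b = u \<otimes> y [^] i \<oplus> c \<otimes> t"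
  using order_exists[OF bc b(2)[folded E_e]] by blast
 have "JE J (e - 1) <= JE J e"
  unfolding JE_def[of J "e - 1"]
 proof (rule ideal_prod_least[OF JE_ideal[OF J]])
  fix a x assume a: "a : J" and "x : E (e - 1)"
  then obtain f d where fd: "f : carrier R" "d : carrier R" "x = f \<otimes> y [^] (e - 1) \<oplus> d \<otimes> t" unfolding E_def by blast
  note ac = Jc[OF a]
  have tJ: "a \<otimes> (k \<otimes> t) : JE J e" if "k : carrier R" for k
   unfolding JE_def using a ideal_lmult[OF E_ideal that t_in_E] by (intro ideal_prod.prod)
  have "u \<otimes> (y [^] i \<otimes> a) \<oplus> a \<otimes> (c \<otimes> t) = b \<otimes> a"
   unfolding i(5) using i(2,4) ac m_comm[of a "c \<otimes> t"] by (simp add: l_distr m_assoc)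
  also have "\<dots> = \<zero>" using b a by (simp add: B_def)
  finally have "u \<otimes> (y [^] i \<otimes> a) = \<ominus> (a \<otimes> (c \<otimes> t))"
   using i ac by (simp add: minus_equality)
  then have "u \<otimes> (y [^] i \<otimes> a) : JE J e" using ideal_neg[OF JE_ideal[OF J] tJ[OF i(4)]] by simp
  then have yi: "y [^] i \<otimes> a : JE J e" using unit_cancel[OF JE_ideal[OF J] i(2,3)] ac by simp
  have "y [^] (e - 1) = y [^] (e - 1 - i) \<otimes> y [^] i" using i(1) by (simp add: nat_pow_mult)
  then have "a \<otimes> x = (f \<otimes> y [^] (e - 1 - i)) \<otimes> (y [^] i \<otimes> a) \<oplus> a \<otimes> (d \<otimes> t)"
   unfolding fd(3) using fd(1,2) ac by (simp add: r_distr m_ac)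
  then show "a \<otimes> x : JE J e"
   using ideal_add[OF JE_ideal[OF J]] ideal_lmult[OF JE_ideal[OF J] _ yi] tJ[OF fd(2)] fd(1) by simp
 qed
 then have "JE J (e - 1) = JE J e" using JE_anti[OF J, of "e - 1" e] by auto
 then have "len R rm (JE J (e - 1)) (JE J (Suc (e - 1))) = 0"
  using e RM.len_self by simp
 then show ?thesis unfolding dl_def zero_enat_def by simp
qed

text \<open>\<open>E 1\<close> is the maximal ideal, so the assumption says
  \<open>J = \<mm>J\<close>.\<close>

lemma dl_first_zero:
 assumes J: "ideal J R" and e: "0 < e" and z: "dl J 0 = 0"
 shows "J <= {\<zero>}"
proof (rule ideal_nakayama[OF J zeroideal])
 have "len R rm (JE J 0) (JE J 1) = 0" using dl_eq[OF J, of 0] e z by (simp add: zero_enat_def)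
 then have "JE J 0 = JE J 1"
  using JE_anti[OF J, of 0 1] by (intro RM.len_eq_0D JE_sub[OF J]) simp_all
 then have "J = J \<cdot> \<mm>" using JE_0[OF J] E_1 by (simp add: JE_def)
 then have eq: "J = \<mm> \<cdot> J" using ideal_prod_commute[OF J max_ideal] by simp
 fix x assume x: "x : J"
 then have "x : \<mm> \<cdot> J" using eq by simp
 then show "EX a:\<mm> \<cdot> J. EX b:{\<zero>}. x = a \<oplus> b" using ideal_carrier[OF J x] by (intro bexI[of _ x] bexI[of _ "\<zero>"]) auto
qed

end

text \<open>Chebyshev's inequality as an identity: the right side minus the left side is the sum
  \<open>?D\<close> of all \<delta>_i - \<delta>_k with i < a \<le> k < e, where natural subtraction
  is exact by monotonicity. Equality kills every term, in particular the one for i = 0 and k = e -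
  1.\<close>

lemma antitone_partial_sum:
 fixes \<delta> :: "nat => nat"
 assumes anti: "!!i. Suc i < e ==> \<delta> (Suc i) <= \<delta> i" and a: "a <= e"
 shows "a * (\<Sum>i<e. \<delta> i) <= e * (\<Sum>i<a. \<delta> i)"
  and "0 < a ==> a < e ==> a * (\<Sum>i<e. \<delta> i) = e * (\<Sum>i<a. \<delta> i) ==> \<delta> (e - 1) = \<delta> 0"
proof -
 have mono: "\<delta> j <= \<delta> i" if "i <= j" "j < e" for i j
  using that
 proof (induction j)
  case (Suc j)
  then show ?case using anti[of j] by (cases "i = Suc j") auto
 qed simp
 let ?D = "\<Sum>i<a. \<Sum>k=a..<e. \<delta> i - \<delta> k"
 have split: "(\<Sum>i<e. \<delta> i) = (\<Sum>i<a. \<delta> i) + (\<Sum>i=a..<e. \<delta> i)"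
  using a by (metis atLeast0LessThan sum.atLeastLessThan_concat zero_le)
 have "(\<Sum>i<a. \<Sum>k=a..<e. \<delta> i) = (\<Sum>i<a. \<Sum>k=a..<e. \<delta> k + (\<delta> i - \<delta> k))"
  by (intro sum.cong refl) (use mono in auto)
 then have "(e - a) * (\<Sum>i<a. \<delta> i) = a * (\<Sum>k=a..<e. \<delta> k) + ?D"
  by (simp add: sum.distrib sum_distrib_left)
 moreover have "e * (\<Sum>i<a. \<delta> i) = a * (\<Sum>i<a. \<delta> i) + (e - a) * (\<Sum>i<a. \<delta> i)"
  using a by (simp flip: add_mult_distrib)
 ultimately have D: "e * (\<Sum>i<a. \<delta> i) = a * (\<Sum>i<e. \<delta> i) + ?D"
  unfolding split add_mult_distrib2 by simp
 then show "a * (\<Sum>i<e. \<delta> i) <= e * (\<Sum>i<a. \<delta> i)" by simp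
 assume a0: "0 < a" "a < e" and "a * (\<Sum>i<e. \<delta> i) = e * (\<Sum>i<a. \<delta> i)"
 then have "?D = 0" using D by simp
 then have "\<delta> 0 - \<delta> (e - 1) = 0" using a0 by simp
 then show "\<delta> (e - 1) = \<delta> 0" using mono[of 0 "e - 1"] a0 by simp
qed

section \<open>Diagonalization modulo t and the counting argument\<close>

locale param_module = R?: param_ring R \<mm> t y + local_module R \<mm> M
 for R :: "('a, 'k) ring_scheme" (structure) and \<mm> t y and M :: "('a, 'm, 'l) module_scheme" (structure) +
 assumes t_regular_M: "v : carrier M ==> t \<odot>\<^bsub>M\<^esub> v = \<zero>\<^bsub>M\<^esub> ==> v = \<zero>\<^bsub>M\<^esub>"
begin

lemma comb_mem: "g : S \<rightarrow> carrier M ==> finite S ==> i : S ==> g i : comb (carrier R) S g"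
 unfolding comb_def using lc_single[of S i "\<one>" g]
 by (auto simp: Pi_iff intro!: exI[of _ "%j. if j = i then \<one> else \<zero>"])

lemma comb_least:
 assumes "submodule X R M" "finite S" "!!i. i : S ==> g i : X"
 shows "comb (carrier R) S g <= X"
proof
 fix v assume "v : comb (carrier R) S g"
 then obtain b where b: "b : S \<rightarrow> carrier R" "v = lc M S b g" unfolding comb_def by blast
 show "v : X" unfolding b(2) lc_def
  by (rule submodule_finsum[OF assms(1,2)]) (use b(1) assms(3) submoduleE(4)[OF assms(1)] in blast)
qed

text \<open>Diagonalises the relations of \<open>M/Y\<close> over the uniserial ring \<open>R/tR\<close>, pivoting on a
 coefficient of least order in \<open>y\<close>.\<close>

lemma smith:
 assumes Y: "submodule Y R M"
 shows "finite S ==> g : S \<rightarrow> carrier M ==> (!!v. v : comb (carrier R) S g ==> t *\<^sub>M v : Y) ==>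
  EX g':S \<rightarrow> carrier M. comb (carrier R) S g' = comb (carrier R) S g &
   (ALL d:S \<rightarrow> carrier R. lc M S d g' : Y --> (ALL i:S. d i *\<^sub>M g' i : Y))"
proof (induction "card S" arbitrary: S g)
 case 0
 then show ?case by auto
next
 case (Suc n)
 note S = \<open>finite S\<close> and g = \<open>g : S \<rightarrow> carrier M\<close> and tY = Suc.prems(3)
 define rel where "rel d \<longleftrightarrow> d : S \<rightarrow> carrier R & lc M S d g : Y" for d
 have gi: "g i : comb (carrier R) S g" if "i : S" for i by (rule comb_mem[OF g S that])
 note cS = submodule_comb[OF S g R.oneideal]
 show ?case
 proof (cases "ALL d i. rel d & i : S --> d i : PIdl t")
  case True
  have "d i *\<^sub>M g i : Y" if "rel d" "i : S" for d i
  proof -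
   obtain c where c: "c : carrier R" "d i = c \<otimes> t" using True \<open>rel d\<close> \<open>i : S\<close> by (meson mem_PIdl)
   have "g i : carrier M" using g that(2) by blast
   then have "d i *\<^sub>M g i = c *\<^sub>M (t *\<^sub>M g i)" using c by (simp add: smult_assoc1)
   also have "\<dots> : Y" by (rule submoduleE(4)[OF Y c(1) tY[OF gi[OF that(2)]]])
   finally show ?thesis .
  qed
  then show ?thesis using g by (intro bexI[of _ g]) (auto simp: rel_def)
 next
  case False
  \<comment> \<open>\<open>k\<close> becomes the least order in \<open>y\<close> of a coefficient of
    any relation: all coefficients lie in \<open>E k\<close>, and the pivot \<open>d p\<close> is
    outside \<open>E (Suc k)\<close>. It exists because some coefficient is outside
    \<open>(t) = E e\<close>, that is, \<open>bad (e - 1)\<close>.\<close>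
  define bad where "bad k \<longleftrightarrow> (EX d p. rel d & p : S & d p ~: E (Suc k))" for k
  define k where "k = (LEAST k. bad k)"
  have "bad (e - 1)" using False E_0 E_e by (cases e) (auto simp: bad_def rel_def)
  then have "bad k" unfolding k_def by (rule LeastI)
  then obtain d p where d: "rel d" and p: "p : S" and dp: "d p ~: E (Suc k)" unfolding bad_def by blast
  have all: "d i : E k" if d: "rel d" and i: "i : S" for d i
  proof (cases k)
   case 0 then show ?thesis using E_0 d i by (auto simp: rel_def)
  next
   case (Suc j)
   then have "~ bad j" using not_less_Least[of j bad] by (simp add: k_def)
   then show ?thesis using d i unfolding bad_def Suc by blast
  qed
  have "ALL i:S. EX b c. b : carrier R & c : carrier R & d i = b \<otimes> y [^] k \<oplus> c \<otimes> t"
   using all[OF d] unfolding E_def by blast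
  then obtain b c where "!!i. i : S ==> b i : carrier R & c i : carrier R & d i = b i \<otimes> y [^] k \<oplus> c i \<otimes> t"
   by metis
  then have bc: "b : S \<rightarrow> carrier R" "c : S \<rightarrow> carrier R" "!!i. i : S ==> d i = b i \<otimes> y [^] k \<oplus> c i \<otimes> t"
   by auto
  have u: "b p : carrier R" "b p ~: \<mm>" using bc p dp E_Suc_unit[of "b p" "c p" k] by (auto simp: Pi_iff)
  \<comment> \<open>Dividing the pivot relation by \<open>y^k\<close> modulo \<open>t\<close>
    produces \<open>w\<close> with \<open>y^k w\<close> in \<open>Y\<close>. It can replace
    \<open>g p\<close>, whose coefficient in \<open>w\<close> is the unit
    \<open>b p\<close>.\<close>
  define w where "w = lc M S b g"
  have wS: "w : comb (carrier R) S g" unfolding w_def comb_def using bc(1) by blast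
  have wc: "w : carrier M" by (rule submodule_carrier[OF cS wS])
  have lcc: "lc M S c g : comb (carrier R) S g" unfolding comb_def using bc(2) by blast
  have ykw: "y [^] k *\<^sub>M w : Y"
  proof -
   have "y [^] k *\<^sub>M w +\<^sub>M t *\<^sub>M lc M S c g = lc M S (%i. y [^] k \<otimes> b i) g +\<^sub>M lc M S (%i. t \<otimes> c i) g"
    unfolding w_def using lc_smult[OF S _ bc(1) g, of "y [^] k"] lc_smult[OF S _ bc(2) g, of t] by simp
   also have "\<dots> = lc M S (%i. y [^] k \<otimes> b i \<oplus> t \<otimes> c i) g"
    using bc(1,2) by (intro lc_add[OF _ _ g]) auto
   also have "\<dots> = lc M S d g"
   proof (rule lc_cong[OF _ _ g])
    show "d : S \<rightarrow> carrier R" using d by (simp add: rel_def)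
    fix i assume i: "i : S"
    then have "b i : carrier R" "c i : carrier R" using bc(1,2) by auto
    then have "y [^] k \<otimes> b i \<oplus> t \<otimes> c i = d i" using bc(3)[OF i] R.m_comm[of t] R.m_comm[of "y [^] k"] by simp
    then show "(y [^] k \<otimes> b i \<oplus> t \<otimes> c i) *\<^sub>M g i = d i *\<^sub>M g i" by simp
   qed
   finally have e: "t *\<^sub>M lc M S c g +\<^sub>M y [^] k *\<^sub>M w = lc M S d g"
    using wc submodule_carrier[OF cS lcc] by (simp add: M.a_comm)
   show ?thesis
   proof (rule submodule_add_cancel[OF Y])
    show "t *\<^sub>M lc M S c g +\<^sub>M y [^] k *\<^sub>M w : Y" unfolding e using d by (simp add: rel_def)
    show "t *\<^sub>M lc M S c g : Y" by (rule tY[OF lcc])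
    show "y [^] k *\<^sub>M w : carrier M" using wc by simp
   qed
  qed
  let ?S = "S - {p}"
  have S_eq: "S = insert p ?S" "p ~: ?S" "finite ?S" using p S by auto
  have g': "g : ?S \<rightarrow> carrier M" "g p : carrier M" using g p by auto
  note cS' = submodule_comb[OF S_eq(3) g'(1) R.oneideal]
  have sub: "comb (carrier R) ?S g <= comb (carrier R) S g"
   by (rule comb_least[OF cS S_eq(3)]) (use gi in blast)
  have "n = card ?S" using Suc.hyps(2) S p by simp
  from Suc.hyps(1)[OF this S_eq(3) g'(1)] obtain g2 where
   g2: "g2 : ?S \<rightarrow> carrier M" "comb (carrier R) ?S g2 = comb (carrier R) ?S g"
    "!!d. d : ?S \<rightarrow> carrier R ==> lc M ?S d g2 : Y ==> ALL i:?S. d i *\<^sub>M g2 i : Y"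
   using tY sub by blast
  define h where "h = g2(p := w)"
  have h: "h : S \<rightarrow> carrier M" using g2(1) wc by (auto simp: h_def)
  have comb_h: "comb (carrier R) S h = cyc R M w <+>\<^sub>M comb (carrier R) ?S g"
  proof -
   have "comb (carrier R) (insert p ?S) h = cyc R M (h p) <+>\<^sub>M comb (carrier R) ?S h"
    unfolding cyc_def using h S_eq(1) by (intro comb_insert[OF S_eq(3,2) _ R.oneideal]) simp
   moreover have "comb (carrier R) ?S h = comb (carrier R) ?S g2"
    unfolding comb_def using g2(1) lc_cong[of ?S _ h _ g2] by (auto simp: h_def) (metis (no_types, lifting) lc_cong)+
   ultimately show ?thesis using S_eq(1) g2(2) by (simp add: h_def)
  qed
  have "comb (carrier R) S h = comb (carrier R) S g"
  proof
   show "comb (carrier R) S h <= comb (carrier R) S g"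
    unfolding comb_h by (rule set_add_least[OF cS cyc_least[OF cS wS] sub])
   show "comb (carrier R) S g <= comb (carrier R) S h"
   proof (rule comb_least[OF submodule_comb[OF S h R.oneideal] S])
    fix i assume i: "i : S"
    have up: "comb (carrier R) ?S g <= comb (carrier R) S h"
     unfolding comb_h by (rule set_add_upper2[OF submodule_cyc[OF wc] cS'])
    have wh: "w : comb (carrier R) S h"
     unfolding comb_h using set_add_upper1[OF submodule_cyc[OF wc] cS'] cyc_self[OF wc] by blast
    note sh = submodule_comb[OF S h R.oneideal]
    show "g i : comb (carrier R) S h"
    proof (cases "i = p")
     case False then show ?thesis using up comb_mem[OF g'(1) S_eq(3), of i] i by blast
    next
     case True
     have "lc M (insert p ?S) b g = b p *\<^sub>M g p +\<^sub>M lc M ?S b g"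
      using bc(1) g S_eq by (intro lc_insert) auto
     then have we: "w = lc M ?S b g +\<^sub>M b p *\<^sub>M g p"
      using S_eq(1) u(1) g' bc(1) lc_closed[of b ?S g] by (simp add: w_def M.a_comm Pi_iff)
     have "lc M ?S b g : comb (carrier R) ?S g" unfolding comb_def using bc(1) by blast
     then have "b p *\<^sub>M g p : comb (carrier R) S h"
      using submodule_add_cancel[OF sh, of "lc M ?S b g" "b p *\<^sub>M g p"] wh we up u(1) g'(2) by auto
     moreover obtain v where v: "v : carrier R" "v \<otimes> b p = \<one>" using inverse_exists[OF u(1,2)] by blast
     ultimately have "v *\<^sub>M (b p *\<^sub>M g p) : comb (carrier R) S h" using submoduleE(4)[OF sh] by blast
     moreover have "v *\<^sub>M (b p *\<^sub>M g p) = g p" using v u(1) g'(2) by (simp flip: smult_assoc1)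
     ultimately show ?thesis using True by simp
    qed
   qed
  qed
  moreover have "ALL i:S. f i *\<^sub>M h i : Y" if f: "f : S \<rightarrow> carrier R" "lc M S f h : Y" for f
  proof -
   have fc: "f p : carrier R" "f : ?S \<rightarrow> carrier R" using f p by auto
   have "lc M (insert p ?S) f h = f p *\<^sub>M h p +\<^sub>M lc M ?S f h"
    using f(1) h S_eq by (intro lc_insert) auto
   moreover have "lc M ?S f h = lc M ?S f g2"
    using fc(2) g2(1) by (intro lc_cong) (auto simp: h_def)
   ultimately have lf: "lc M S f h = f p *\<^sub>M w +\<^sub>M lc M ?S f g2"
    using S_eq(1) by (simp add: h_def)
   have "lc M ?S f g2 : comb (carrier R) ?S g2" unfolding comb_def using fc(2) by blast
   then have "lc M ?S f g2 : comb (carrier R) ?S g" unfolding g2(2) .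
   then obtain q where q: "q : ?S \<rightarrow> carrier R" "lc M ?S f g2 = lc M ?S q g" unfolding comb_def by blast
   define q' where "q' i = (if i = p then \<zero> else q i)" for i
   have q': "q' : S \<rightarrow> carrier R" using q(1) by (auto simp: q'_def)
   have "lc M (insert p ?S) q' g = q' p *\<^sub>M g p +\<^sub>M lc M ?S q' g"
    using q' g S_eq by (intro lc_insert) auto
   moreover have "lc M ?S q' g = lc M ?S q g" using q(1) g' by (intro lc_cong) (auto simp: q'_def)
   ultimately have q'g: "lc M S q' g = lc M ?S f g2"
    using S_eq(1) g' q lc_closed[OF q(1) g'(1)] by (simp add: q'_def[of p])
   have fb: "(%i. f p \<otimes> b i) : S \<rightarrow> carrier R" using fc bc(1) by auto
   \<comment> \<open>A relation among the new generators is rewritten in the old ones. Its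
     coefficient at \<open>p\<close> is \<open>f p\<close> times \<open>b p\<close>, so minimality
     of \<open>k\<close> puts \<open>f p\<close> into \<open>E k\<close>, hence \<open>f p w\<close>
     into \<open>Y\<close>, and the other terms form a relation of their own.\<close>
   have "lc M S (%i. f p \<otimes> b i \<oplus> q' i) g = lc M S f h"
    unfolding lf w_def lc_smult[OF S fc(1) bc(1) g] q'g[symmetric]
    by (rule lc_add[OF fb q' g, symmetric])
   then have "rel (%i. f p \<otimes> b i \<oplus> q' i)"
    unfolding rel_def using f(2) fb q' by auto
   from all[OF this p] have "b p \<otimes> f p : E k" using fc(1) u(1) by (simp add: q'_def R.m_comm)
   then have "f p : E k" by (rule unit_cancel[OF E_ideal u(1,2) fc(1)])
   then obtain x z where xz: "x : carrier R" "z : carrier R" "f p = x \<otimes> y [^] k \<oplus> z \<otimes> t" unfolding E_def by blast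
   have "f p *\<^sub>M w = x *\<^sub>M (y [^] k *\<^sub>M w) +\<^sub>M z *\<^sub>M (t *\<^sub>M w)"
    using xz wc by (simp add: smult_l_distr smult_assoc1)
   then have fpw: "f p *\<^sub>M w : Y"
    using submoduleE(4,5)[OF Y] ykw tY[OF wS] xz(1,2) by simp
   have "lc M ?S f g2 : Y"
    using submodule_add_cancel[OF Y, of "f p *\<^sub>M w" "lc M ?S f g2"] f(2) lf fpw lc_closed[OF fc(2) g2(1)] by simp
   from g2(3)[OF fc(2) this] show ?thesis using fpw by (auto simp: h_def)
  qed
  ultimately show ?thesis using h by blast
 qed
qed

end

context module
begin

lemma fg_comb: "finite S ==> g : S \<rightarrow> carrier M ==> fg R M (comb (carrier R) S g)"
proof (induction S rule: finite_induct)
 case empty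
 have "comb (carrier R) {} g = {0\<^sub>M}" by (auto simp: comb_def)
 then show ?case by (simp add: fg.fg_zero)
next
 case (insert j S)
 have g: "g : S \<rightarrow> carrier M" "g j : carrier M" using insert by auto
 have "comb (carrier R) (insert j S) g = cyc R M (g j) <+>\<^sub>M comb (carrier R) S g"
  unfolding cyc_def by (rule comb_insert[OF insert.hyps insert.prems R.oneideal])
 moreover have "fg R M (cyc R M (g j))"
 proof -
  have "fg R M ({0\<^sub>M} <+>\<^sub>M cyc R M (g j))" by (rule fg.fg_add[OF fg.fg_zero g(2)])
  moreover have "{0\<^sub>M} <+>\<^sub>M cyc R M (g j) = cyc R M (g j)"
   using submodule_carrier[OF submodule_cyc[OF g(2)]] by (auto simp: mem_set_add)
  ultimately show ?thesis by simp
 qed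
 ultimately show ?case using fg_set_add insert.IH[OF g(1)] by simp
qed

lemma scale_comb:
 assumes S: "finite S" and g: "g : S \<rightarrow> carrier M" and J: "ideal J R" and v: "v : scale a (comb J S g)"
  and a: "a : carrier R"
 shows "EX c:S \<rightarrow> J. v = lc M S (%i. a \<otimes> c i) g"
proof -
 obtain c where c: "c : S \<rightarrow> J" "v = a *\<^sub>M lc M S c g" using v unfolding mem_scale comb_def by blast
 have "c : S \<rightarrow> carrier R" using c(1) ideal_subset_carrier[OF J] by auto
 then show ?thesis using lc_smult[OF S a _ g, of c] c by auto
qed

lemma lc_minus:
 assumes "finite S" "a : S \<rightarrow> carrier R" "b : S \<rightarrow> carrier R" "g : S \<rightarrow> carrier M"
  "lc M S a g = lc M S b g"
 shows "lc M S (%i. a i \<ominus> b i) g = 0\<^sub>M"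
proof -
 have "(%i. \<ominus> \<one> \<otimes> b i) : S \<rightarrow> carrier R" using assms(3) by auto
 from lc_add[OF assms(2) this assms(4)]
 have "lc M S (%i. a i \<oplus> \<ominus> \<one> \<otimes> b i) g = lc M S a g +\<^sub>M (\<ominus> \<one>) *\<^sub>M lc M S b g"
  using lc_smult[OF assms(1) _ assms(3,4), of "\<ominus> \<one>"] by simp
 also have "\<dots> = 0\<^sub>M"
  using assms(5) lc_closed[OF assms(3,4)] by (simp add: smult_l_minus M.r_neg)
 finally have "lc M S (%i. a i \<oplus> \<ominus> \<one> \<otimes> b i) g = 0\<^sub>M" .
 moreover have "lc M S (%i. a i \<ominus> b i) g = lc M S (%i. a i \<oplus> \<ominus> \<one> \<otimes> b i) g"
  using assms by (intro lc_cong) (auto simp: a_minus_def R.l_minus Pi_iff)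
 ultimately show ?thesis by simp
qed

end

context param_module
begin

text \<open>\<open>H\<close> is the vanishing of Tor in coordinates, required for every generating
  family because the diagonalizing one is found only inside the proof; it is applied with
  \<open>D i = E (a i)\<close>. The family \<open>n\<close> and the exponent \<open>N\<close> carry
  the rank, and \<open>z\<close> annihilates \<open>J\<close>.\<close>

theorem free_of_tor_condition:
 fixes r :: nat
 assumes S: "finite S" and g0: "g0 : S \<rightarrow> carrier M" "comb (carrier R) S g0 = carrier M"
  and n: "n : {..<r} \<rightarrow> carrier M"
  and indep: "!!a i. a : {..<r} \<rightarrow> carrier R ==> lc M {..<r} a n = 0\<^sub>M ==> i < r ==> a i = \<zero>"
  and tN: "!!x. x : carrier M ==> EX a:{..<r} \<rightarrow> carrier R. t [^] (N::nat) *\<^sub>M x = lc M {..<r} a n"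
  and J: "ideal J R" and J_nz: "EX a:J. a ~= \<zero>"
  and z: "z : carrier R" "z ~= \<zero>" "!!a. a : J ==> z \<otimes> a = \<zero>"
  and H: "!!g b D i. g : S \<rightarrow> carrier M ==> comb (carrier R) S g = carrier M ==> b : S \<rightarrow> J ==> lc M S b g = 0\<^sub>M ==>
   (!!i. i : S ==> ideal (D i) R) ==>
   (!!d i. d : S \<rightarrow> carrier R ==> lc M S d g = 0\<^sub>M ==> i : S ==> d i : D i) ==>
   i : S ==> b i : J \<cdot> D i"
 shows "EX T g. T <= S & g : T \<rightarrow> carrier M & comb (carrier R) T g = carrier M &
  (ALL d:T \<rightarrow> carrier R. lc M T d g = 0\<^sub>M --> (ALL i:T. d i = \<zero>))"
proof -
 have tc: "t : carrier R" by simp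
 have Ms: "submodule (carrier M) R M" by (rule carrier_is_submodule)
 define Y where "Y = scale t (carrier M)"
 have Y: "submodule Y R M" unfolding Y_def by (rule submodule_scale[OF Ms tc])
 have tY: "t *\<^sub>M v : Y" if "v : carrier M" for v using that by (auto simp: Y_def mem_scale)
 obtain g where g: "g : S \<rightarrow> carrier M" "comb (carrier R) S g = carrier M"
  "!!d i. d : S \<rightarrow> carrier R ==> lc M S d g : Y ==> i : S ==> d i *\<^sub>M g i : Y"
  using smith[OF Y S g0(1)] tY unfolding g0(2) by metis
 have gi: "g i : carrier M" if "i : S" for i using g(1) that by blast
 have "EX k<=e. colon R M Y (g i) = E k" if "i : S" for i
  using ideal_above_t[OF ideal_colon[OF Y gi[OF that]]] tY gi[OF that] by (auto simp: colon_def)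
 then obtain a where a: "!!i. i : S ==> a i <= e" "!!i. i : S ==> colon R M Y (g i) = E (a i)" by metis
 \<comment> \<open>Membership in \<open>tM\<close> is now coordinatewise: \<open>M/tM\<close> is the
   direct sum of the \<open>R / E (a i)\<close>.\<close>
 have Rel: "lc M S b g : Y \<longleftrightarrow> (ALL i:S. b i : E (a i))" if b: "b : S \<rightarrow> carrier R" for b
 proof
  assume "lc M S b g : Y"
  then show "ALL i:S. b i : E (a i)" using g(3)[OF b] a(2) b by (auto simp: colon_def)
 next
  assume h: "ALL i:S. b i : E (a i)"
  show "lc M S b g : Y" unfolding lc_def
   by (rule submodule_finsum[OF Y S]) (use h a(2) in \<open>auto simp: colon_def\<close>)
 qed
 have len_fin: "len R M X (scale t X) ~= \<infinity>" if "submodule X R M" for X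
 proof -
  have "fg R M (carrier M)" using fg_comb[OF S g(1)] g(2) by simp
  then have "fg R M X" using submodule_fg that submoduleE(1) by blast
  then show ?thesis by (rule len_fg_scale_finite[OF tc len_t_finite])
 qed
 \<comment> \<open>\<open>KM\<close> contains the copy of \<open>K^r\<close> spanned by
   \<open>n\<close> with finite colength, because \<open>t^N\<close> maps \<open>KM\<close> into it;
   commensurability then transfers the length modulo \<open>t\<close>.\<close>
 have rank_len: "len R M (smul M K (carrier M)) (scale t (smul M K (carrier M))) = of_nat r * len R rm K (JE K e)"
  if K: "ideal K R" for K
 proof -
  have Kc: "K <= carrier R" by (rule ideal_subset_carrier[OF K])
  let ?X = "smul M K (carrier M)" and ?Z = "comb K {..<r} n"
  have X: "submodule ?X R M" by (rule submodule_smul[OF subset_refl K])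
  have Z: "submodule ?Z R M" by (rule submodule_comb[OF finite_lessThan n K])
  have ZX: "?Z <= ?X"
  proof
   fix v assume "v : ?Z"
   then obtain b where b: "b : {..<r} \<rightarrow> K" "v = lc M {..<r} b n" unfolding comb_def by blast
   show "v : ?X" unfolding b(2) lc_def
    by (rule submodule_finsum[OF X finite_lessThan]) (use b(1) n in \<open>blast intro: smul.smul_gen\<close>)
  qed
  have "scale (t [^] N) ?X <= ?Z"
  proof
   fix v assume "v : scale (t [^] N) ?X"
   then obtain x where x: "x : ?X" "v = t [^] N *\<^sub>M x" unfolding mem_scale by blast
   have "t [^] N *\<^sub>M x : ?Z" using x(1)
   proof induction
    case smul_zero show ?case using submodule_zero[OF Z] by simp
   next
    case (smul_gen b x)
    obtain c where c: "c : {..<r} \<rightarrow> carrier R" "t [^] N *\<^sub>M x = lc M {..<r} c n" using tN[OF smul_gen(2)] by blast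
    have bc: "b : carrier R" using smul_gen(1) Kc by blast
    have "t [^] N *\<^sub>M (b *\<^sub>M x) = b *\<^sub>M lc M {..<r} c n"
     using c(2) bc smul_gen(2) smult_left_commute[of "t [^] N" b x] by simp
    also have "\<dots> = lc M {..<r} (%i. b \<otimes> c i) n" by (rule lc_smult[OF finite_lessThan bc c(1) n])
    also have "\<dots> : ?Z" unfolding comb_def using c(1) ideal_rmult[OF K _ smul_gen(1)] by blast
    finally show ?case .
   next
    case (smul_add x x')
    have "x : carrier M" "x' : carrier M" using smul_add submodule_carrier[OF X] by auto
    then show ?case using smul_add submoduleE(5)[OF Z] by (simp add: smult_r_distr)
   qed
   then show "v : ?Z" using x(2) by simp
  qed
  from len_finite_of_power[OF tc X Z len_fin[OF X] this] have "len R M ?X ?Z ~= \<infinity>" .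
  then have "len R M ?X (scale t ?X) = len R M ?Z (scale t ?Z)"
   using t_regular_M submodule_carrier[OF X] by (intro len_scale_commensurable[OF X Z ZX tc]) blast+
  also have "\<dots> = (\<Sum>i\<in>{..<r}. len R rm K (JE K e))"
  proof (rule len_comb[OF finite_lessThan n K])
   show "ideal (JE K e) R" by (rule JE_ideal[OF K])
   show "JE K e <= K" using JE_anti[OF K, of 0 e] JE_0[OF K] by simp
   show "submodule (scale t ?Z) R M" by (rule submodule_scale[OF Z tc])
   show "scale t ?Z <= ?Z" by (rule scale_subset[OF Z tc])
   fix b assume b: "b : {..<r} \<rightarrow> K"
   then have bc: "b : {..<r} \<rightarrow> carrier R" using Kc by auto
   show "lc M {..<r} b n : scale t ?Z \<longleftrightarrow> (ALL i:{..<r}. b i : JE K e)"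
   proof
    assume "lc M {..<r} b n : scale t ?Z"
    from scale_comb[OF finite_lessThan n K this tc] obtain c where
     c: "c : {..<r} \<rightarrow> K" "lc M {..<r} b n = lc M {..<r} (%i. t \<otimes> c i) n" by blast
    have cc: "(%i. t \<otimes> c i) : {..<r} \<rightarrow> carrier R" using c(1) Kc by auto
    have "b i : JE K e" if i: "i < r" for i
    proof -
     have "b i \<ominus> t \<otimes> c i = \<zero>"
      using indep[OF _ lc_minus[OF finite_lessThan bc cc n c(2)] i] bc cc by auto
     then have "b i = t \<otimes> c i" using bc cc i by (metis (no_types, lifting) PiE R.r_right_minus_eq lessThan_iff)
     then show ?thesis unfolding JE_e[OF K] RM.mem_scale using c(1) i by auto
    qed
    then show "ALL i:{..<r}. b i : JE K e" by simp
   next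
    assume "ALL i:{..<r}. b i : JE K e"
    then have "ALL i:{..<r}. EX c:K. b i = t \<otimes> c" unfolding JE_e[OF K] RM.mem_scale by simp
    then obtain c where c: "ALL i:{..<r}. c i : K & b i = t \<otimes> c i" by metis
    have cK: "c : {..<r} \<rightarrow> K" "c : {..<r} \<rightarrow> carrier R" using c Kc by auto
    have "t *\<^sub>M lc M {..<r} c n = lc M {..<r} (%i. t \<otimes> c i) n"
     by (rule lc_smult[OF finite_lessThan tc cK(2) n])
    also have "\<dots> = lc M {..<r} b n" by (rule lc_cong[OF _ bc n]) (use c in auto)
    finally have "lc M {..<r} b n = t *\<^sub>M lc M {..<r} c n" by simp
    then show "lc M {..<r} b n : scale t ?Z" unfolding mem_scale comb_def using cK(1) by blast
   qed
  qed
  finally show ?thesis by simp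
 qed
 have M_R: "smul M (carrier R) (carrier M) = carrier M"
  using smul_comb[OF S g(1) R.oneideal g(2)[symmetric]] g(2) by simp
 have JE_R: "JE (carrier R) k = E k" for k
  unfolding JE_def using R.ideal_prod_commute[OF R.oneideal E_ideal] R.ideal_prod_one[OF E_ideal] by simp
 have cnt1: "len R M (carrier M) Y = (\<Sum>i\<in>S. len R rm (carrier R) (E (a i)))"
  unfolding g(2)[symmetric]
 proof (rule len_comb[OF S g(1) R.oneideal])
  show "Y <= comb (carrier R) S g" unfolding g(2) by (rule submoduleE(1)[OF Y])
 qed (use Y E_ideal ideal_subset_carrier[OF E_ideal] Rel in auto)
 have sum_a: "(\<Sum>i\<in>S. a i) = r * e"
 proof -
  have "len R M (carrier M) Y = of_nat r * enat e"
   using rank_len[OF R.oneideal] len_ring_E[of e] unfolding M_R Y_def JE_R by simp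
  moreover have "(\<Sum>i\<in>S. len R rm (carrier R) (E (a i))) = (\<Sum>i\<in>S. enat (a i))"
   using a(1) by (intro sum.cong refl len_ring_E) auto
  moreover have "(\<Sum>i\<in>S. enat (a i)) = enat (\<Sum>i\<in>S. a i)" using S by (induction S) (auto simp: zero_enat_def)
  ultimately have "enat (\<Sum>i\<in>S. a i) = enat (r * e)" using cnt1 by (simp add: of_nat_eq_enat)
  then show ?thesis by simp
 qed
 define JM where "JM = smul M J (carrier M)"
 have JM_eq: "JM = comb J S g" unfolding JM_def by (rule smul_comb[OF S g(1) J g(2)[symmetric]])
 have Jc: "J <= carrier R" by (rule ideal_subset_carrier[OF J])
 have JMs: "submodule JM R M" unfolding JM_eq by (rule submodule_comb[OF S g(1) J])
 \<comment> \<open>Here the vanishing of Tor enters. If the combination with coefficients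
   \<open>b\<close> equals \<open>t\<close> times the one with coefficients \<open>c\<close>, both
   in \<open>J\<close>, the differences \<open>b i - t c i\<close> form a relation with coefficients
   in \<open>J\<close>. \<open>H\<close> puts them into \<open>J E (a i)\<close>, which also
   contains \<open>t c i\<close>.\<close>
 have cnt2: "len R M JM (scale t JM) = (\<Sum>i\<in>S. len R rm J (JE J (a i)))"
  unfolding JM_eq
 proof (rule len_comb[OF S g(1) J])
  show "ideal (JE J (a i)) R" for i by (rule JE_ideal[OF J])
  show "JE J (a i) <= J" for i using JE_anti[OF J, of 0 "a i"] JE_0[OF J] by simp
  show "submodule (scale t (comb J S g)) R M" "scale t (comb J S g) <= comb J S g"
   using submodule_scale[OF JMs tc] scale_subset[OF JMs tc] unfolding JM_eq by auto
  fix b assume b: "b : S \<rightarrow> J"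
  then have bc: "b : S \<rightarrow> carrier R" using Jc by auto
  show "lc M S b g : scale t (comb J S g) \<longleftrightarrow> (ALL i:S. b i : JE J (a i))"
  proof
   assume "lc M S b g : scale t (comb J S g)"
   from scale_comb[OF S g(1) J this tc] obtain c where
    c: "c : S \<rightarrow> J" "lc M S b g = lc M S (%i. t \<otimes> c i) g" by blast
   have cJ: "(%i. t \<otimes> c i) : S \<rightarrow> J" using c(1) ideal_lmult[OF J tc] by auto
   then have cc: "(%i. t \<otimes> c i) : S \<rightarrow> carrier R" using Jc by auto
   have dJ: "(%i. b i \<ominus> t \<otimes> c i) : S \<rightarrow> J" using b cJ R.ideal_minus[OF J] by (simp add: Pi_iff)
   show "ALL i:S. b i : JE J (a i)"
   proof
    fix i assume i: "i : S"
    have "b i \<ominus> t \<otimes> c i : J \<cdot> E (a i)"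
    proof (rule H[OF g(1,2) dJ lc_minus[OF S bc cc g(1) c(2)] E_ideal _ i])
     fix d j assume d: "d : S \<rightarrow> carrier R" "lc M S d g = 0\<^sub>M" "j : S"
     then show "d j : E (a j)" using Rel[OF d(1)] submodule_zero[OF Y] by simp
    qed
    moreover have "t \<otimes> c i : J \<cdot> E (a i)"
    proof -
     have ci: "c i : J" using c(1) i by blast
     then have "c i \<otimes> t : J \<cdot> E (a i)" using t_in_E by (rule ideal_prod.prod)
     then show ?thesis using ci Jc R.m_comm[of t "c i"] by auto
    qed
    ultimately have "(b i \<ominus> t \<otimes> c i) \<oplus> t \<otimes> c i : J \<cdot> E (a i)" by (rule ideal_prod.sum)
    then show "b i : JE J (a i)"
     unfolding JE_def using bc cc i R.minus_plus_cancel[of "b i" "t \<otimes> c i"] by (auto simp: Pi_iff)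
   qed
  next
   assume h: "ALL i:S. b i : JE J (a i)"
   have tJM: "submodule (scale t JM) R M" by (rule submodule_scale[OF JMs tc])
   have "x *\<^sub>M g i : scale t JM" if i: "i : S" and x: "x : J \<cdot> E (a i)" for x i
    using x
   proof induction
    case (prod j q)
    have "q *\<^sub>M g i : Y" "q : carrier R" using prod(2) a(2)[OF i] by (auto simp: colon_def)
    then obtain v where v: "v : carrier M" "q *\<^sub>M g i = t *\<^sub>M v" unfolding Y_def mem_scale by blast
    have jc: "j : carrier R" using prod(1) Jc by blast
    have "(j \<otimes> q) *\<^sub>M g i = t *\<^sub>M (j *\<^sub>M v)"
     using v jc \<open>q : carrier R\<close> gi[OF i] smult_left_commute[of j t v] by (simp add: smult_assoc1)
    moreover have "j *\<^sub>M v : JM" unfolding JM_def using prod(1) v(1) by (rule smul.smul_gen)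
    ultimately show ?case unfolding mem_scale by blast
   next
    case (sum p q)
    have "p : carrier R" "q : carrier R"
     using sum(1,2) ideal_carrier[OF JE_ideal[OF J]] unfolding JE_def by auto
    then show ?case using sum(3,4) gi[OF i] submoduleE(5)[OF tJM] by (simp add: smult_l_distr)
   qed
   then have "lc M S b g : scale t JM"
    unfolding lc_def using h by (intro submodule_finsum[OF tJM S]) (simp add: JE_def)
   then show "lc M S b g : scale t (comb J S g)" unfolding JM_eq .
  qed
 qed
 define \<delta> where "\<delta> = dl J"
 have sum_d: "(\<Sum>i\<in>S. \<Sum>k<a i. \<delta> k) = r * (\<Sum>k<e. \<delta> k)"
 proof -
  have "len R M JM (scale t JM) = of_nat r * enat (\<Sum>k<e. \<delta> k)"
   unfolding JM_def rank_len[OF J] len_JE[OF J order_refl] \<delta>_def ..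
  moreover have "(\<Sum>i\<in>S. len R rm J (JE J (a i))) = (\<Sum>i\<in>S. enat (\<Sum>k<a i. \<delta> k))"
   unfolding \<delta>_def using a(1) by (intro sum.cong refl len_JE[OF J]) auto
  moreover have "(\<Sum>i\<in>S. enat (\<Sum>k<a i. \<delta> k)) = enat (\<Sum>i\<in>S. \<Sum>k<a i. \<delta> k)"
   using S by (induction S) (auto simp: zero_enat_def)
  ultimately have "enat (\<Sum>i\<in>S. \<Sum>k<a i. \<delta> k) = enat (r * (\<Sum>k<e. \<delta> k))" using cnt2 by (simp add: of_nat_eq_enat)
  then show ?thesis by simp
 qed
 have anti: "\<delta> (Suc i) <= \<delta> i" if "Suc i < e" for i unfolding \<delta>_def using dl_anti[OF J] that by simp
 have le: "a i * (\<Sum>k<e. \<delta> k) <= e * (\<Sum>k<a i. \<delta> k)" if "i : S" for i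
  by (rule antitone_partial_sum(1)[of e \<delta>, OF anti a(1)[OF that]])
 have "(\<Sum>i\<in>S. a i * (\<Sum>k<e. \<delta> k)) = (\<Sum>i\<in>S. e * (\<Sum>k<a i. \<delta> k))"
  using sum_d sum_a by (simp flip: sum_distrib_left sum_distrib_right)
 \<comment> \<open>The termwise inequalities \<open>le\<close> add up to an equality, so each of
   them is an equality.\<close>
 then have eq: "a i * (\<Sum>k<e. \<delta> k) = e * (\<Sum>k<a i. \<delta> k)" if "i : S" for i
  using le sum_strict_mono_ex1[OF S, of "%i. a i * (\<Sum>k<e. \<delta> k)" "%i. e * (\<Sum>k<a i. \<delta> k)"] that
  by (metis (no_types, lifting) less_irrefl order_le_imp_less_or_eq)
 \<comment> \<open>A value strictly between 0 and \<open>e\<close> forces \<delta>_(e-1) =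
   \<delta>_0; the left side is 0 because \<open>J\<close> has a nonzero annihilator, the right side
   is positive because \<open>J\<close> is nonzero.\<close>
 have a_cases: "a i = 0 | a i = e" if i: "i : S" for i
 proof (rule ccontr)
  assume n: "~ ?thesis"
  then have ai: "0 < a i" "a i < e" using a(1)[OF i] by auto
  have "\<delta> (e - 1) = \<delta> 0" by (rule antitone_partial_sum(2)[of e \<delta>, OF anti a(1)[OF i] ai eq[OF i]])
  moreover have "\<delta> (e - 1) = 0" unfolding \<delta>_def using ai by (intro dl_last_zero[OF J z]) auto
  ultimately have "J <= {\<zero>}" using dl_first_zero[OF J] ai unfolding \<delta>_def by simp
  then show False using J_nz by blast
 qed
 \<comment> \<open>Generators with \<open>a i = 0\<close> lie in \<open>tM\<close> and are redundant
   by Nakayama; those with \<open>a i = e\<close> are independent modulo \<open>t\<close>.\<close>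
 define T where "T = {i : S. a i = e}"
 have T: "finite T" "T <= S" using S by (auto simp: T_def)
 have gT: "g : T \<rightarrow> carrier M" using g(1) T(2) by auto
 note cT = submodule_comb[OF T(1) gT R.oneideal]
 have gen: "carrier M <= comb (carrier R) T g"
 proof (rule nakayama[OF _ cT])
  show "fg R M (carrier M)" using fg_comb[OF S g(1)] g(2) by simp
  have mM: "submodule (smul M \<mm> (carrier M)) R M" by (rule submodule_smul[OF subset_refl max_ideal])
  note sW = submodule_set_add[OF mM cT]
  show "carrier M <= smul M \<mm> (carrier M) <+>\<^sub>M comb (carrier R) T g"
   unfolding g(2)[symmetric]
  proof (rule comb_least[OF _ S])
   show "submodule (smul M \<mm> (comb (carrier R) S g) <+>\<^sub>M comb (carrier R) T g) R M"
    unfolding g(2) by (rule sW)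
   fix i assume i: "i : S"
   show "g i : smul M \<mm> (comb (carrier R) S g) <+>\<^sub>M comb (carrier R) T g"
    unfolding g(2)
   proof (cases "i : T")
    case True
    then show "g i : smul M \<mm> (carrier M) <+>\<^sub>M comb (carrier R) T g"
     using set_add_upper2[OF mM cT] comb_mem[OF gT T(1)] by blast
   next
    case False
    then have "a i = 0" using a_cases[OF i] i by (auto simp: T_def)
    then have "\<one> : colon R M Y (g i)" using a(2)[OF i] E_0 by simp
    then have "g i : Y" using gi[OF i] by (simp add: colon_def)
    then obtain v where "v : carrier M" "g i = t *\<^sub>M v" unfolding Y_def mem_scale by blast
    then have "g i : smul M \<mm> (carrier M)" using t_max by (simp add: smul.smul_gen)
    then show "g i : smul M \<mm> (carrier M) <+>\<^sub>M comb (carrier R) T g"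
     using set_add_upper1[OF mM cT] by blast
   qed
  qed
 qed
 have indepT: "d i = \<zero>" if d: "d : T \<rightarrow> carrier R" "lc M T d g = 0\<^sub>M" and i: "i : T" for d i
 proof -
  \<comment> \<open>The i-th coefficients of all relations. Every relation is divisible by
    \<open>t\<close>, and since \<open>t\<close> is regular on \<open>M\<close> the quotient is
    again a relation; hence the ideal generated by \<open>D\<close> is contained in its own multiple
    by \<open>t\<close>.\<close>
  define D where "D = {d i | d. d : T \<rightarrow> carrier R & lc M T d g = 0\<^sub>M}"
  have divt: "EX d':T \<rightarrow> carrier R. lc M T d' g = 0\<^sub>M & (ALL i:T. d i = t \<otimes> d' i)"
   if d: "d : T \<rightarrow> carrier R" "lc M T d g = 0\<^sub>M" for d
  proof -
   define f where "f i = (if i : T then d i else \<zero>)" for i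
   have f: "f : S \<rightarrow> carrier R" using d(1) by (auto simp: f_def)
   have "lc M S f g = lc M T d g"
    unfolding lc_def
   proof (rule M.add.finprod_mono_neutral_cong_right[OF S T(2)])
    show "(%i. f i *\<^sub>M g i) : S \<rightarrow> carrier M" by (rule lc_term[OF f g(1)])
   qed (use gi in \<open>auto simp: f_def\<close>)
   then have "lc M S f g : Y" using d(2) submodule_zero[OF Y] by simp
   then have "ALL i:S. f i : E (a i)" using Rel[OF f] by blast
   then have "d i : PIdl t" if "i : T" for i
    using that E_e unfolding f_def T_def by fastforce
   then have "EX c. c : carrier R & d i = t \<otimes> c" if "i : T" for i
    using that mem_PIdl R.m_comm[OF tc] by metis
   then obtain d' where d': "!!i. i : T ==> d' i : carrier R & d i = t \<otimes> d' i" by metis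
   have d'c: "d' : T \<rightarrow> carrier R" using d' by auto
   have "t *\<^sub>M lc M T d' g = lc M T (%i. t \<otimes> d' i) g" by (rule lc_smult[OF T(1) tc d'c gT])
   also have "\<dots> = lc M T d g" by (rule lc_cong[OF _ d(1) gT]) (use d' in auto)
   finally have "lc M T d' g = 0\<^sub>M" using t_regular_M d(2) lc_closed[OF d'c gT] by simp
   then show ?thesis using d' d'c by blast
  qed
  have Dc: "D <= carrier R" using i by (auto simp: D_def)
  note N = R.genideal_ideal[OF Dc]
  have "ideal (RM.scale t (Idl D)) R"
   using RM.submodule_scale[of "Idl D" t] N by (simp add: ideal_iff_submodule)
  moreover have "D <= RM.scale t (Idl D)"
  proof
   fix x assume "x : D"
   then obtain b where b: "b : T \<rightarrow> carrier R" "lc M T b g = 0\<^sub>M" "x = b i" by (auto simp: D_def)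
   from divt[OF b(1,2)] obtain d' where d': "d' : T \<rightarrow> carrier R" "lc M T d' g = 0\<^sub>M" "ALL i:T. b i = t \<otimes> d' i" by blast
   then have "d' i : Idl D" using R.genideal_self[OF Dc] unfolding D_def by blast
   then show "x : RM.scale t (Idl D)" unfolding RM.mem_scale using i b(3) d'(3) by auto
  qed
  ultimately have "Idl D <= RM.scale t (Idl D)" by (rule R.genideal_minimal)
  then have "Idl D <= {\<zero>}" by (intro ideal_eq_zero_of_scale[OF N t_max]) (auto simp: RM.mem_scale)
  then have "D <= {\<zero>}" using R.genideal_self[OF Dc] by blast
  then show ?thesis using d unfolding D_def by blast
 qed
 have "comb (carrier R) T g = carrier M" using gen submoduleE(1)[OF cT] by blast
 then show ?thesis using T(2) gT indepT by (intro exI[of _ T] exI[of _ g] conjI ballI impI) simp_all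
qed

end

subsection \<open>Free modules\<close>

definition unit_vec :: "('a, 'k) ring_scheme => 'x => 'x => 'a"
 where "unit_vec R x = (%z. if z = x then \<one>\<^bsub>R\<^esub> else \<zero>\<^bsub>R\<^esub>)"

text \<open>Linear extension of a map given on the basis, for arbitrary index types;
  \<open>lin_comb\<close> is the case of the identity.\<close>

definition fext :: "('a, 'k) ring_scheme => ('a, 'm, 'l) module_scheme => ('x => 'm) => ('x => 'a) => 'm"
 where "fext R M \<phi> f = (\<Oplus>\<^bsub>M\<^esub>x\<in>{x. f x ~= \<zero>\<^bsub>R\<^esub>}. f x \<odot>\<^bsub>M\<^esub> \<phi> x)"

lemma lin_comb_eq_fext: "lin_comb R M = fext R M (%x. x)"
 by (auto simp: lin_comb_def fext_def)

lemma tensor_gen_eq_unit_vec: "tensor_gen R x y = unit_vec R (x, y)"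
 by (simp add: tensor_gen_def unit_vec_def)

context cring
begin

lemma free_carrier: "f : carrier (free_module R X) \<longleftrightarrow>
  (ALL x. f x : carrier R) & (ALL x. x ~: X --> f x = \<zero>) & finite {x. f x ~= \<zero>}"
 by (simp add: free_module_def)

lemma free_simps [simp]:
 "\<zero>\<^bsub>free_module R X\<^esub> = (%x. \<zero>)" "f \<oplus>\<^bsub>free_module R X\<^esub> g = (%x. f x \<oplus> g x)"
 "a \<odot>\<^bsub>free_module R X\<^esub> f = (%x. a \<otimes> f x)"
 by (simp_all add: free_module_def)

lemma free_add_closed:
 assumes "f : carrier (free_module R X)" "g : carrier (free_module R X)"
 shows "(%x. f x \<oplus> g x) : carrier (free_module R X)"
proof -
 have "{x. f x \<oplus> g x ~= \<zero>} <= {x. f x ~= \<zero>} \<union> {x. g x ~= \<zero>}" by auto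
 moreover have "finite ({x. f x ~= \<zero>} \<union> {x. g x ~= \<zero>})" using assms by (simp add: free_carrier)
 ultimately have "finite {x. f x \<oplus> g x ~= \<zero>}" by (rule finite_subset)
 then show ?thesis using assms by (auto simp: free_carrier)
qed

lemma free_smult_closed:
 assumes "f : carrier (free_module R X)" "a : carrier R"
 shows "(%x. a \<otimes> f x) : carrier (free_module R X)"
proof -
 have "{x. a \<otimes> f x ~= \<zero>} <= {x. f x ~= \<zero>}" using assms by auto
 moreover have "finite {x. f x ~= \<zero>}" using assms by (simp add: free_carrier)
 ultimately have "finite {x. a \<otimes> f x ~= \<zero>}" by (rule finite_subset)
 then show ?thesis using assms by (auto simp: free_carrier)
qed

lemma module_free: "module R (free_module R X)"
proof (rule moduleI)
 show "cring R" by (rule is_cring)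
 show "abelian_group (free_module R X)"
 proof (rule abelian_groupI)
  fix f assume f: "f : carrier (free_module R X)"
  have "(%x. \<ominus> \<one> \<otimes> f x) : carrier (free_module R X)" by (rule free_smult_closed[OF f]) simp
  moreover have "(%x. \<ominus> \<one> \<otimes> f x) \<oplus>\<^bsub>free_module R X\<^esub> f = \<zero>\<^bsub>free_module R X\<^esub>"
   using f by (auto simp: free_carrier l_minus l_neg)
  ultimately show "EX g:carrier (free_module R X). g \<oplus>\<^bsub>free_module R X\<^esub> f = \<zero>\<^bsub>free_module R X\<^esub>" by blast
 next
  fix f g h assume "f : carrier (free_module R X)" "g : carrier (free_module R X)" "h : carrier (free_module R X)"
  then show "f \<oplus>\<^bsub>free_module R X\<^esub> g \<oplus>\<^bsub>free_module R X\<^esub> h = f \<oplus>\<^bsub>free_module R X\<^esub> (g \<oplus>\<^bsub>free_module R X\<^esub> h)"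
   by (auto simp: free_carrier a_assoc)
 next
  fix f g assume "f : carrier (free_module R X)" "g : carrier (free_module R X)"
  then show "f \<oplus>\<^bsub>free_module R X\<^esub> g = g \<oplus>\<^bsub>free_module R X\<^esub> f" by (auto simp: free_carrier a_comm)
 qed (simp_all add: free_add_closed, auto simp: free_carrier)
qed (simp add: free_smult_closed, auto simp: free_carrier l_distr r_distr m_assoc)

lemma unit_vec_closed: "x : X ==> unit_vec R x : carrier (free_module R X)"
 by (auto simp: free_carrier unit_vec_def)

lemma free_span:
 assumes W: "submodule W R (free_module R X)" and e: "!!x. x : X ==> unit_vec R x : W"
 shows "carrier (free_module R X) <= W"
proof -
 interpret F: module R "free_module R X" by (rule module_free)
 have "f : W" if "finite S" "f : carrier (free_module R X)" "{x. f x ~= \<zero>} <= S" for S f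
  using that
 proof (induction S arbitrary: f rule: finite_induct)
  case empty
  then have "f = (%x. \<zero>)" by auto
  then show ?case using F.submodule_zero[OF W] by simp
 next
  case (insert s S)
  have fc: "f x : carrier R" for x using insert.prems by (simp add: free_carrier)
  define g where "g = f(s := \<zero>)"
  have "{x. g x ~= \<zero>} <= {x. f x ~= \<zero>}" by (auto simp: g_def)
  moreover have "finite {x. f x ~= \<zero>}" using insert.prems(1) by (simp add: free_carrier)
  ultimately have "finite {x. g x ~= \<zero>}" by (rule finite_subset)
  then have "g : carrier (free_module R X)"
   using insert.prems(1) fc by (simp add: free_carrier g_def)
  moreover have "{x. g x ~= \<zero>} <= S" using insert.prems(2) by (auto simp: g_def)
  ultimately have gW: "g : W" by (rule insert.IH)
  show ?case
  proof (cases "s : X")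
   case True
   have "f s \<odot>\<^bsub>free_module R X\<^esub> unit_vec R s : W" by (rule F.submoduleE(4)[OF W fc e[OF True]])
   then have "f s \<odot>\<^bsub>free_module R X\<^esub> unit_vec R s \<oplus>\<^bsub>free_module R X\<^esub> g : W"
    using gW F.submoduleE(5)[OF W] by blast
   moreover have "f s \<odot>\<^bsub>free_module R X\<^esub> unit_vec R s \<oplus>\<^bsub>free_module R X\<^esub> g = f"
    using fc by (auto simp: unit_vec_def g_def)
   ultimately show ?thesis by simp
  next
   case False
   then have "f s = \<zero>" using insert.prems(1) by (simp add: free_carrier)
   then have "g = f" by (auto simp: g_def)
   then show ?thesis using gW by simp
  qed
 qed
 note main = this
 show ?thesis
 proof
  fix f assume f: "f : carrier (free_module R X)"
  then have "finite {x. f x ~= \<zero>}" by (simp add: free_carrier)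
  then show "f : W" using f by (rule main) simp
 qed
qed

end

context module
begin

lemma fext_superset:
 assumes "finite S" "{x. f x ~= \<zero>} <= S" "!!x. f x : carrier R" "!!x. x : S ==> \<phi> x : carrier M"
 shows "fext R M \<phi> f = lc M S f \<phi>"
 unfolding fext_def lc_def
 by (rule M.add.finprod_mono_neutral_cong_left) (use assms in auto)

lemma linear_fext:
 assumes \<phi>: "!!x. x : X ==> \<phi> x : carrier M"
 shows "linear R (free_module R X) M (fext R M \<phi>)"
proof (intro linear.intro linear_axioms.intro R.module_free module_axioms)
 have supp: "{x. f x ~= \<zero>} <= X" "finite {x. f x ~= \<zero>}" "!!x. f x : carrier R"
  if "f : carrier (free_module R X)" for f
  using that by (auto simp: R.free_carrier)
 fix f assume f: "f : carrier (free_module R X)"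
 show "fext R M \<phi> f : carrier M"
  unfolding fext_def using supp[OF f] \<phi> by (intro M.finsum_closed) auto
 {
  fix g assume g: "g : carrier (free_module R X)"
  define S where "S = {x. f x ~= \<zero>} \<union> {x. g x ~= \<zero>}"
  have S: "finite S" "S <= X" using supp[OF f] supp[OF g] by (auto simp: S_def)
  have \<phi>S: "\<phi> : S \<rightarrow> carrier M" using S \<phi> by auto
  have "fext R M \<phi> f = lc M S f \<phi>" "fext R M \<phi> g = lc M S g \<phi>"
   "fext R M \<phi> (%x. f x \<oplus> g x) = lc M S (%x. f x \<oplus> g x) \<phi>"
   using supp[OF f] supp[OF g] S \<phi> by (auto intro!: fext_superset simp: S_def)
  then show "fext R M \<phi> (f \<oplus>\<^bsub>free_module R X\<^esub> g) = fext R M \<phi> f +\<^sub>M fext R M \<phi> g"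
   using lc_add[of f S g \<phi>] supp(3)[OF f] supp(3)[OF g] \<phi>S by simp
 }
 fix a assume a: "a : carrier R"
 define S where "S = {x. f x ~= \<zero>}"
 have S: "finite S" "S <= X" using supp[OF f] by (auto simp: S_def)
 have \<phi>S: "\<phi> : S \<rightarrow> carrier M" using S \<phi> by auto
 have "fext R M \<phi> f = lc M S f \<phi>" "fext R M \<phi> (%x. a \<otimes> f x) = lc M S (%x. a \<otimes> f x) \<phi>"
  using supp[OF f] S \<phi> a by (auto intro!: fext_superset simp: S_def)
 then show "fext R M \<phi> (a \<odot>\<^bsub>free_module R X\<^esub> f) = a *\<^sub>M fext R M \<phi> f"
  using lc_smult[OF S(1) a _ \<phi>S, of f] supp(3)[OF f] by simp
qed

lemma fext_unit_vec: "\<phi> x : carrier M ==> fext R M \<phi> (unit_vec R x) = \<phi> x"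
proof -
 assume x: "\<phi> x : carrier M"
 have "fext R M \<phi> (unit_vec R x) = lc M {x} (unit_vec R x) \<phi>"
  using x by (intro fext_superset) (auto simp: unit_vec_def split: if_splits)
 also have "\<dots> = \<phi> x" using x lc_insert[of "{}" x "unit_vec R x" \<phi>] by (simp add: unit_vec_def)
 finally show ?thesis .
qed

end

locale plain_module = module R M for R (structure) and M :: "('a, 'm) module" (structure)
begin

lemma linear_lin_comb: "linear R (free_module R (carrier M)) M (lin_comb R M)"
 unfolding lin_comb_eq_fext by (rule linear_fext)

lemma lin_comb_unit_vec: "x : carrier M ==> lin_comb R M (unit_vec R x) = x"
 unfolding lin_comb_eq_fext by (rule fext_unit_vec)

lemma lin_comb_surj: "lin_comb R M ` carrier (free_module R (carrier M)) = carrier M"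
proof
 interpret linear R "free_module R (carrier M)" M "lin_comb R M" by (rule linear_lin_comb)
 show "lin_comb R M ` carrier (free_module R (carrier M)) <= carrier M" by auto
 show "carrier M <= lin_comb R M ` carrier (free_module R (carrier M))"
 proof
  fix x assume x: "x : carrier M"
  show "x : lin_comb R M ` carrier (free_module R (carrier M))"
   by (rule image_eqI[OF _ R.unit_vec_closed[OF x]]) (simp add: lin_comb_unit_vec x)
 qed
qed

end

lemma linear_eq_on_free:
 fixes R (structure)
 assumes f: "linear R (free_module R X) M f" and g: "linear R (free_module R X) M g"
  and eq: "!!x. x : X ==> f (unit_vec R x) = g (unit_vec R x)" and v: "v : carrier (free_module R X)"
 shows "f v = g v"
proof -
 interpret f: linear R "free_module R X" M f by fact
 interpret g: linear R "free_module R X" M g by fact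
 let ?W = "{v : carrier (free_module R X). f v = g v}"
 have "submodule ?W R (free_module R X)"
 proof (rule f.M.submoduleI)
  show "\<ominus>\<^bsub>free_module R X\<^esub> a : ?W" if "a : ?W" for a
   using that f.h_neg[of a] g.h_neg[of a] by simp
  show "a \<oplus>\<^bsub>free_module R X\<^esub> b : ?W" if "a : ?W" "b : ?W" for a b
   using that f.h_add[of a b] g.h_add[of a b] f.M.M.a_closed[of a b] by auto
  show "r \<odot>\<^bsub>free_module R X\<^esub> a : ?W" if "r : carrier R" "a : ?W" for r a
   using that f.h_smult[of r a] g.h_smult[of r a] f.M.smult_closed[of r a] by auto
  show "\<zero>\<^bsub>free_module R X\<^esub> : ?W" using f.h_zero g.h_zero f.M.M.zero_closed by simp
 qed auto
 then have "carrier (free_module R X) <= ?W"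
 proof (rule f.M.R.free_span)
  show "unit_vec R x : ?W" if "x : X" for x
   using eq[OF that] f.M.R.unit_vec_closed[OF that] by simp
 qed
 then show ?thesis using v by blast
qed

subsection \<open>Quotient modules\<close>

context plain_module
begin

lemma abelian_subgroup_submodule: "submodule N R M ==> abelian_subgroup N M"
 by (rule abelian_subgroupI3) (simp_all add: additive_subgroup.intro submodule.axioms(1) M.abelian_group_axioms)

lemma coset_self: "submodule N R M ==> x : carrier M ==> x : N +>\<^bsub>M\<^esub> x"
 using submodule_zero[of N] by (auto simp: a_r_coset_def' intro!: bexI[of _ "0\<^sub>M"])

lemma coset_eq_iff:
 assumes N: "submodule N R M" and x: "x : carrier M" "y : carrier M"
 shows "N +>\<^bsub>M\<^esub> x = N +>\<^bsub>M\<^esub> y \<longleftrightarrow> x \<ominus>\<^bsub>M\<^esub> y : N"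
proof
 assume "N +>\<^bsub>M\<^esub> x = N +>\<^bsub>M\<^esub> y"
 then have "x : N +>\<^bsub>M\<^esub> y" using coset_self[OF N x(1)] by simp
 then obtain n where n: "n : N" "x = n +\<^sub>M y" by (auto simp: a_r_coset_def')
 have "n : carrier M" by (rule submodule_carrier[OF N n(1)])
 then have "x \<ominus>\<^bsub>M\<^esub> y = n" using n(2) x(2) by (simp add: a_minus_def M.a_assoc M.r_neg)
 then show "x \<ominus>\<^bsub>M\<^esub> y : N" using n(1) by simp
next
 assume n: "x \<ominus>\<^bsub>M\<^esub> y : N"
 interpret N: abelian_subgroup N M by (rule abelian_subgroup_submodule[OF N])
 have "x = (x \<ominus>\<^bsub>M\<^esub> y) +\<^sub>M y" using x by (simp add: a_minus_def M.a_assoc M.l_neg)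
 then have "N +>\<^bsub>M\<^esub> x = (N +>\<^bsub>M\<^esub> (x \<ominus>\<^bsub>M\<^esub> y)) +>\<^bsub>M\<^esub> y"
  using M.a_coset_add_assoc[OF submoduleE(1)[OF N] M.minus_closed[OF x] x(2)] by simp
 then show "N +>\<^bsub>M\<^esub> x = N +>\<^bsub>M\<^esub> y" using N.a_rcos_const[OF n] by simp
qed

lemma coset_zero_iff:
 assumes N: "submodule N R M" and x: "x : carrier M"
 shows "N +>\<^bsub>M\<^esub> x = N \<longleftrightarrow> x : N"
proof -
 have "x \<ominus>\<^bsub>M\<^esub> 0\<^sub>M = x" by (rule M.minus_eqI) (use x in auto)
 then show ?thesis
  using coset_eq_iff[OF N x M.zero_closed] M.a_coset_add_zero[OF submoduleE(1)[OF N]] by simp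
qed

lemma quot_carrier: "carrier (quot_module M N) = {N +>\<^bsub>M\<^esub> x | x. x : carrier M}"
 by (auto simp: quot_module_def A_RCOSETS_def')

lemma quot_zero: "\<zero>\<^bsub>quot_module M N\<^esub> = N"
 by (simp add: quot_module_def)

lemma quot_add:
 "submodule N R M ==> x : carrier M ==> y : carrier M ==>
  (N +>\<^bsub>M\<^esub> x) \<oplus>\<^bsub>quot_module M N\<^esub> (N +>\<^bsub>M\<^esub> y) = N +>\<^bsub>M\<^esub> (x +\<^sub>M y)"
 using abelian_subgroup.a_rcos_sum[OF abelian_subgroup_submodule] by (simp add: quot_module_def)

lemma coset_memD:
 assumes N: "submodule N R M" and x: "x : carrier M" and y: "y : N +>\<^bsub>M\<^esub> x"
 shows "y : carrier M & N +>\<^bsub>M\<^esub> y = N +>\<^bsub>M\<^esub> x"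
proof -
 obtain n where n: "n : N" "y = n +\<^sub>M x" using y by (auto simp: a_r_coset_def')
 have "n : carrier M" by (rule submodule_carrier[OF N n(1)])
 moreover from this have "y \<ominus>\<^bsub>M\<^esub> x = n"
  using n x by (simp add: a_minus_def M.a_assoc M.r_neg)
 ultimately show ?thesis using coset_eq_iff[OF N _ x] n x by simp
qed

lemma quot_smult:
 assumes N: "submodule N R M" and a: "a : carrier R" and x: "x : carrier M"
 shows "a \<odot>\<^bsub>quot_module M N\<^esub> (N +>\<^bsub>M\<^esub> x) = N +>\<^bsub>M\<^esub> (a *\<^sub>M x)"
proof -
 have "N +>\<^bsub>M\<^esub> (a *\<^sub>M y) = N +>\<^bsub>M\<^esub> (a *\<^sub>M x)" if y: "y : N +>\<^bsub>M\<^esub> x" for y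
 proof -
  have yc: "y : carrier M" "y \<ominus>\<^bsub>M\<^esub> x : N"
   using coset_memD[OF N x y] coset_eq_iff[OF N _ x] by auto
  have "a *\<^sub>M y \<ominus>\<^bsub>M\<^esub> a *\<^sub>M x = a *\<^sub>M (y \<ominus>\<^bsub>M\<^esub> x)"
   using a x yc by (simp add: a_minus_def smult_r_distr smult_r_minus)
  then show ?thesis using coset_eq_iff[OF N, of "a *\<^sub>M y" "a *\<^sub>M x"] submoduleE(4)[OF N a yc(2)] a x yc by simp
 qed
 then have "(\<Union>y\<in>N +>\<^bsub>M\<^esub> x. N +>\<^bsub>M\<^esub> (a *\<^sub>M y)) = N +>\<^bsub>M\<^esub> (a *\<^sub>M x)"
  using coset_self[OF N x] by blast
 then show ?thesis by (simp add: quot_module_def)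
qed

lemma module_quot:
 assumes N: "submodule N R M" shows "module R (quot_module M N)"
proof -
 note qa = quot_add[OF N] and qs = quot_smult[OF N]
 have N0: "N = N +>\<^bsub>M\<^esub> 0\<^sub>M" using M.a_coset_add_zero[OF submoduleE(1)[OF N]] by simp
 have ex: "EX x. x : carrier M & X = N +>\<^bsub>M\<^esub> x" if "X : carrier (quot_module M N)" for X
  using that by (auto simp: quot_carrier)
 have cl: "N +>\<^bsub>M\<^esub> x : carrier (quot_module M N)" if "x : carrier M" for x
  using that by (auto simp: quot_carrier)
 have z: "\<zero>\<^bsub>quot_module M N\<^esub> = N +>\<^bsub>M\<^esub> 0\<^sub>M" using quot_zero N0 by simp
 show ?thesis
 proof (rule moduleI)
  show "cring R" by (rule R.is_cring)
  show "abelian_group (quot_module M N)"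
  proof (rule abelian_groupI)
   fix X Y assume "X : carrier (quot_module M N)" "Y : carrier (quot_module M N)"
   then obtain x y where xy: "x : carrier M" "X = N +>\<^bsub>M\<^esub> x" "y : carrier M" "Y = N +>\<^bsub>M\<^esub> y" using ex by metis
   show "X \<oplus>\<^bsub>quot_module M N\<^esub> Y : carrier (quot_module M N)" using xy cl qa by simp
   show "X \<oplus>\<^bsub>quot_module M N\<^esub> Y = Y \<oplus>\<^bsub>quot_module M N\<^esub> X" using xy qa by (simp add: M.a_comm)
   fix Z assume "Z : carrier (quot_module M N)"
   then obtain w where w: "w : carrier M" "Z = N +>\<^bsub>M\<^esub> w" using ex by metis
   show "X \<oplus>\<^bsub>quot_module M N\<^esub> Y \<oplus>\<^bsub>quot_module M N\<^esub> Z = X \<oplus>\<^bsub>quot_module M N\<^esub> (Y \<oplus>\<^bsub>quot_module M N\<^esub> Z)"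
    using xy w qa by (simp add: M.a_assoc)
  next
   fix X assume "X : carrier (quot_module M N)"
   then obtain x where x: "x : carrier M" "X = N +>\<^bsub>M\<^esub> x" using ex by metis
   show "\<zero>\<^bsub>quot_module M N\<^esub> \<oplus>\<^bsub>quot_module M N\<^esub> X = X" using x qa z by simp
   have "(N +>\<^bsub>M\<^esub> \<ominus>\<^bsub>M\<^esub> x) \<oplus>\<^bsub>quot_module M N\<^esub> X = \<zero>\<^bsub>quot_module M N\<^esub>" using x qa z by (simp add: M.l_neg)
   then show "EX Y:carrier (quot_module M N). Y \<oplus>\<^bsub>quot_module M N\<^esub> X = \<zero>\<^bsub>quot_module M N\<^esub>"
    using cl x by blast
  qed (simp add: z cl)
 next
  fix a X assume a: "a : carrier R" and "X : carrier (quot_module M N)"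
  then obtain x where x: "x : carrier M" "X = N +>\<^bsub>M\<^esub> x" using ex by metis
  show "a \<odot>\<^bsub>quot_module M N\<^esub> X : carrier (quot_module M N)" using a x qs cl by simp
  {
   fix b assume b: "b : carrier R"
   show "(a \<oplus> b) \<odot>\<^bsub>quot_module M N\<^esub> X = a \<odot>\<^bsub>quot_module M N\<^esub> X \<oplus>\<^bsub>quot_module M N\<^esub> b \<odot>\<^bsub>quot_module M N\<^esub> X"
    using a b x qs qa by (simp add: smult_l_distr)
   show "(a \<otimes> b) \<odot>\<^bsub>quot_module M N\<^esub> X = a \<odot>\<^bsub>quot_module M N\<^esub> (b \<odot>\<^bsub>quot_module M N\<^esub> X)"
    using a b x qs by (simp add: smult_assoc1)
  }
  fix Y assume "Y : carrier (quot_module M N)"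
  then obtain y where y: "y : carrier M" "Y = N +>\<^bsub>M\<^esub> y" using ex by metis
  show "a \<odot>\<^bsub>quot_module M N\<^esub> (X \<oplus>\<^bsub>quot_module M N\<^esub> Y) = a \<odot>\<^bsub>quot_module M N\<^esub> X \<oplus>\<^bsub>quot_module M N\<^esub> a \<odot>\<^bsub>quot_module M N\<^esub> Y"
   using a x y qs qa by (simp add: smult_r_distr)
 next
  fix X assume "X : carrier (quot_module M N)"
  then obtain x where x: "x : carrier M" "X = N +>\<^bsub>M\<^esub> x" using ex by metis
  show "\<one> \<odot>\<^bsub>quot_module M N\<^esub> X = X" using x qs by simp
 qed
qed

lemma linear_quot: "submodule N R M ==> linear R M (quot_module M N) (%x. N +>\<^bsub>M\<^esub> x)"
proof (intro linear.intro linear_axioms.intro module_axioms module_quot)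
 fix x assume "x : carrier M"
 then show "N +>\<^bsub>M\<^esub> x : carrier (quot_module M N)" by (auto simp: quot_carrier)
qed (simp_all add: quot_add quot_smult)

end

subsection \<open>Restriction of the carrier\<close>

context module
begin

text \<open>The cycles in \<open>Tor1\<close> are a record update of a carrier; this carries their
  submodules, and hence lengths, over to the ambient module.\<close>

lemma submodule_restrict_iff:
 assumes X: "submodule X R M"
 shows "submodule C R (M\<lparr>carrier := X\<rparr>) \<longleftrightarrow> submodule C R M & C <= X"
proof -
 interpret X: module R "M\<lparr>carrier := X\<rparr>"
  by (rule submodule.submodule_is_module[OF X module_axioms])
 show ?thesis
 proof
  assume C: "submodule C R (M\<lparr>carrier := X\<rparr>)"
  have CX: "C <= X" using X.submoduleE(1)[OF C] by simp
  have cl: "r *\<^sub>M a : C" if "r : carrier R" "a : C" for r a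
   using X.submoduleE(4)[OF C that] by simp
  have "submodule C R M"
  proof (rule submoduleI)
   show "C <= carrier M" using CX submoduleE(1)[OF X] by blast
   show "0\<^sub>M : C" using X.submodule_zero[OF C] by simp
   show "\<ominus>\<^bsub>M\<^esub> a : C" if a: "a : C" for a
   proof -
    have "a : carrier M" using a CX submodule_carrier[OF X] by blast
    then show ?thesis using cl[of "\<ominus> \<one>" a] a by (simp add: smult_l_minus)
   qed
   show "a +\<^sub>M b : C" if "a : C" "b : C" for a b using X.submoduleE(5)[OF C that] by simp
   show "r *\<^sub>M a : C" if "r : carrier R" "a : C" for r a using cl that .
  qed
  then show "submodule C R M & C <= X" using CX by blast
 next
  assume C: "submodule C R M & C <= X"
  then have Cs: "submodule C R M" by blast
  have cl: "r *\<^sub>M a : C" if "r : carrier R" "a : C" for r a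
   using submoduleE(4)[OF Cs that] .
  show "submodule C R (M\<lparr>carrier := X\<rparr>)"
  proof (rule X.submoduleI)
   show "\<ominus>\<^bsub>M\<lparr>carrier := X\<rparr>\<^esub> a : C" if a: "a : C" for a
   proof -
    have "a : carrier (M\<lparr>carrier := X\<rparr>)" using a C by auto
    then have "\<ominus>\<^bsub>M\<lparr>carrier := X\<rparr>\<^esub> a = (\<ominus> \<one>) \<odot>\<^bsub>M\<lparr>carrier := X\<rparr>\<^esub> a"
     using X.smult_l_minus[of "\<one>" a] X.smult_one[of a] by simp
    then show ?thesis using cl[of "\<ominus> \<one>" a] a by simp
   qed
  qed (use C submodule_zero[OF Cs] submoduleE(5)[OF Cs] cl in auto)
 qed
qed

lemma len_restrict:
 assumes X: "submodule X R M" and "Y <= X"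
 shows "len R (M\<lparr>carrier := X\<rparr>) Y Z = len R M Y Z"
proof -
 have "mchain R (M\<lparr>carrier := X\<rparr>) Y Z n C \<longleftrightarrow> mchain R M Y Z n C" for n C
  unfolding mchain_def submodule_restrict_iff[OF X] using assms(2) by blast
 then show ?thesis unfolding len_def by simp
qed

end

context cring
begin

declare free_simps [simp del]

lemma plain_free: "plain_module R (free_module R X)"
 by (intro plain_module.intro module_free)

lemma linear_eval: "linear R (free_module R X) rm (%f. f x)"
 by (intro linear.intro linear_axioms.intro module_free module_ring_module)
   (auto simp: free_carrier free_simps)

lemma finsum_ring_module:
 "finite S ==> f : S \<rightarrow> carrier R ==> finsum rm f S = finsum R f S"
 by (induction S rule: finite_induct) (auto simp: Pi_iff)

end

context linear
begin

lemma smul_image: "X <= carrier M ==> J <= carrier R ==> smul N J (h ` X) = h ` smul M J X"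
proof
 assume X: "X <= carrier M" and J: "J <= carrier R"
 have sc: "x : carrier M" if "x : smul M J X" for x
  using that by induction (use X J in \<open>auto simp: subset_iff\<close>)
 show "smul N J (h ` X) <= h ` smul M J X"
 proof
  fix y assume "y : smul N J (h ` X)"
  then show "y : h ` smul M J X"
  proof induction
   case smul_zero
   show ?case by (rule image_eqI[of _ _ "0\<^sub>M"]) (auto intro: smul.intros)
  next
   case (smul_gen a z)
   then obtain x where x: "x : X" "z = h x" by blast
   have "h (a *\<^sub>M x) = a \<odot>\<^bsub>N\<^esub> z" using smul_gen(1) x X J by (auto simp: h_smult subset_iff)
   then show ?case using smul.smul_gen[OF smul_gen(1) x(1), of M] by (metis imageI)
  next
   case (smul_add y z)
   then obtain u v where u: "u : smul M J X" "y = h u" and v: "v : smul M J X" "z = h v" by blast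
   have "h (u +\<^sub>M v) = y \<oplus>\<^bsub>N\<^esub> z" using u v sc by (simp add: h_add)
   then show ?case using smul.smul_add[OF u(1) v(1)] by (metis imageI)
  qed
 qed
 show "h ` smul M J X <= smul N J (h ` X)"
 proof
  fix y assume "y : h ` smul M J X"
  then obtain x where x: "x : smul M J X" "y = h x" by blast
  from x(1) have "h x : smul N J (h ` X)"
  proof induction
   case (smul_gen a z)
   then have "h (a *\<^sub>M z) = a \<odot>\<^bsub>N\<^esub> h z" using X J by (auto simp: h_smult subset_iff)
   then show ?case using smul.smul_gen[of a J "h z" "h ` X" N] smul_gen by auto
  next
   case (smul_add u v)
   then show ?case using sc by (simp add: h_add smul.smul_add)
  qed (simp add: smul.smul_zero)
  then show "y : smul N J (h ` X)" using x by simp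
 qed
qed

end

subsection \<open>Tensor products with cyclic modules\<close>

context module
begin

lemma submodule_gen: "X <= carrier M ==> submodule (\<Inter>{N. submodule N R M & X <= N}) R M"
proof (rule submoduleI)
 assume X: "X <= carrier M"
 show "\<Inter>{N. submodule N R M & X <= N} <= carrier M"
  using carrier_is_submodule X by (intro Inter_lower) simp
qed (auto intro: submodule_zero submoduleE(3) submoduleE(4) submoduleE(5))

end

context plain_module
begin

lemma submodule_gen_submodule: "X <= carrier M ==> submodule (gen_submodule R M X) R M"
 unfolding gen_submodule_def by (rule submodule_gen)

lemma gen_submodule_upper: "X <= gen_submodule R M X"
 unfolding gen_submodule_def by blast

lemma gen_submodule_least: "submodule N R M ==> X <= N ==> gen_submodule R M X <= N"
 unfolding gen_submodule_def by blast

end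

definition bilinear_rel ::
  "('a, 'k) ring_scheme => ('a, 'm) module => ('a, 'n) module => ('a, 'p) module => ('m => 'n => 'p) => 'p set"
 where "bilinear_rel R M N F e =
  {e (x \<oplus>\<^bsub>M\<^esub> x') y \<ominus>\<^bsub>F\<^esub> (e x y \<oplus>\<^bsub>F\<^esub> e x' y) | x x' y.
      x : carrier M & x' : carrier M & y : carrier N} \<union>
    {e x (y \<oplus>\<^bsub>N\<^esub> y') \<ominus>\<^bsub>F\<^esub> (e x y \<oplus>\<^bsub>F\<^esub> e x y') | x y y'.
      x : carrier M & y : carrier N & y' : carrier N} \<union>
    {e (a \<odot>\<^bsub>M\<^esub> x) y \<ominus>\<^bsub>F\<^esub> (a \<odot>\<^bsub>F\<^esub> e x y) | a x y.
      a : carrier R & x : carrier M & y : carrier N} \<union>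
    {e x (a \<odot>\<^bsub>N\<^esub> y) \<ominus>\<^bsub>F\<^esub> (a \<odot>\<^bsub>F\<^esub> e x y) | a x y.
      a : carrier R & x : carrier M & y : carrier N}"

lemma tensor_rel_eq:
 "tensor_rel R M N = gen_submodule R (free_module R (carrier M \<times> carrier N))
   (bilinear_rel R M N (free_module R (carrier M \<times> carrier N)) (tensor_gen R))"
 by (simp add: tensor_rel_def bilinear_rel_def Let_def)

lemma bilinear_relI:
 "x : carrier M ==> x' : carrier M ==> y : carrier N ==>
   e (x \<oplus>\<^bsub>M\<^esub> x') y \<ominus>\<^bsub>F\<^esub> (e x y \<oplus>\<^bsub>F\<^esub> e x' y) : bilinear_rel R M N F e"
 "x : carrier M ==> y : carrier N ==> y' : carrier N ==>
   e x (y \<oplus>\<^bsub>N\<^esub> y') \<ominus>\<^bsub>F\<^esub> (e x y \<oplus>\<^bsub>F\<^esub> e x y') : bilinear_rel R M N F e"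
 "a : carrier R ==> x : carrier M ==> y : carrier N ==>
   e (a \<odot>\<^bsub>M\<^esub> x) y \<ominus>\<^bsub>F\<^esub> (a \<odot>\<^bsub>F\<^esub> e x y) : bilinear_rel R M N F e"
 "a : carrier R ==> x : carrier M ==> y : carrier N ==>
   e x (a \<odot>\<^bsub>N\<^esub> y) \<ominus>\<^bsub>F\<^esub> (a \<odot>\<^bsub>F\<^esub> e x y) : bilinear_rel R M N F e"
 unfolding bilinear_rel_def by blast+

lemma bilinear_rel_least:
 assumes "!!x x' y. x : carrier M ==> x' : carrier M ==> y : carrier N ==>
   e (x \<oplus>\<^bsub>M\<^esub> x') y \<ominus>\<^bsub>F\<^esub> (e x y \<oplus>\<^bsub>F\<^esub> e x' y) : W"
 and "!!x y y'. x : carrier M ==> y : carrier N ==> y' : carrier N ==>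
   e x (y \<oplus>\<^bsub>N\<^esub> y') \<ominus>\<^bsub>F\<^esub> (e x y \<oplus>\<^bsub>F\<^esub> e x y') : W"
 and "!!a x y. a : carrier R ==> x : carrier M ==> y : carrier N ==>
   e (a \<odot>\<^bsub>M\<^esub> x) y \<ominus>\<^bsub>F\<^esub> (a \<odot>\<^bsub>F\<^esub> e x y) : W"
 and "!!a x y. a : carrier R ==> x : carrier M ==> y : carrier N ==>
   e x (a \<odot>\<^bsub>N\<^esub> y) \<ominus>\<^bsub>F\<^esub> (a \<odot>\<^bsub>F\<^esub> e x y) : W"
 shows "bilinear_rel R M N F e <= W"
 unfolding bilinear_rel_def using assms by blast

locale cyclic_tensor = plain_module R P for R (structure) and P :: "('a, 'p) module" +
 fixes J :: "'a set"
 assumes ideal_J: "ideal J R"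
begin

abbreviation N where "N \<equiv> quot_module (ring_module R) J"
abbreviation Fr where "Fr \<equiv> free_module R (carrier P \<times> carrier N)"
abbreviation rel where "rel \<equiv> tensor_rel R P N"
abbreviation \<nu> where "\<nu> \<equiv> J +>\<^bsub>ring_module R\<^esub> \<one>"

text \<open>The tensor of \<open>u\<close> with 1. It induces the isomorphism of \<open>P/JP\<close>
  with the tensor product of \<open>P\<close> and \<open>R/J\<close>; surjectivity and kernel are
  \<open>\<tau>_surj\<close> and \<open>\<tau>_zero_iff\<close>.\<close>

definition \<tau> :: "'p => ('p \<times> 'a set => 'a) set"
 where "\<tau> u = rel +>\<^bsub>Fr\<^esub> tensor_gen R u \<nu>"

sublocale RMp: plain_module R "ring_module R" by (intro plain_module.intro R.module_ring_module)
sublocale Fr: plain_module R Fr by (rule R.plain_free)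

lemma J_submodule: "submodule J R (ring_module R)" using R.ideal_iff_submodule ideal_J by simp

lemma J_carrier: "J <= carrier R" by (rule ideal_subset_carrier[OF ideal_J])

sublocale N: plain_module R N by (intro plain_module.intro RMp.module_quot J_submodule)

lemma coset_closed: "r : carrier R ==> J +>\<^bsub>ring_module R\<^esub> r : carrier N"
 by (auto simp: RMp.quot_carrier)

lemma coset_ex: "y : carrier N ==> EX r:carrier R. y = J +>\<^bsub>ring_module R\<^esub> r"
 by (auto simp: RMp.quot_carrier)

lemma coset_smult:
 "r : carrier R ==> s : carrier R ==>
  r \<odot>\<^bsub>N\<^esub> (J +>\<^bsub>ring_module R\<^esub> s) = J +>\<^bsub>ring_module R\<^esub> (r \<otimes> s)"
 using RMp.quot_smult[OF J_submodule, of r s] by simp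

lemma coset_add:
 "r : carrier R ==> s : carrier R ==>
  (J +>\<^bsub>ring_module R\<^esub> r) \<oplus>\<^bsub>N\<^esub> (J +>\<^bsub>ring_module R\<^esub> s) = J +>\<^bsub>ring_module R\<^esub> (r \<oplus> s)"
 using RMp.quot_add[OF J_submodule, of r s] by simp

lemma gen_closed: "x : carrier P ==> y : carrier N ==> tensor_gen R x y : carrier Fr"
 unfolding tensor_gen_eq_unit_vec by (rule R.unit_vec_closed) simp

lemma rel_submodule: "submodule rel R Fr"
 unfolding tensor_rel_eq
proof (rule Fr.submodule_gen_submodule, rule bilinear_rel_least)
qed (intro Fr.M.minus_closed Fr.M.a_closed Fr.smult_closed gen_closed; simp)+

lemma rel_gen: "bilinear_rel R P N Fr (tensor_gen R) <= rel"
 unfolding tensor_rel_eq by (rule Fr.gen_submodule_upper)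

lemma rel_least: "submodule W R Fr ==> bilinear_rel R P N Fr (tensor_gen R) <= W ==> rel <= W"
 unfolding tensor_rel_eq by (rule Fr.gen_submodule_least)

sublocale T: plain_module R "tensor R P N"
 unfolding tensor_def by (intro plain_module.intro Fr.module_quot rel_submodule)

lemma linear_class: "linear R Fr (tensor R P N) (%f. rel +>\<^bsub>Fr\<^esub> f)"
 unfolding tensor_def by (rule Fr.linear_quot[OF rel_submodule])

sublocale q: linear R Fr "tensor R P N" "%f. rel +>\<^bsub>Fr\<^esub> f" by (rule linear_class)

lemma class_eqI: "f : carrier Fr ==> g : carrier Fr ==> f \<ominus>\<^bsub>Fr\<^esub> g : rel ==> rel +>\<^bsub>Fr\<^esub> f = rel +>\<^bsub>Fr\<^esub> g"
 using Fr.coset_eq_iff[OF rel_submodule] by simp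

lemma \<tau>_smult_right:
 assumes "x : carrier P" "a : carrier R"
 shows "rel +>\<^bsub>Fr\<^esub> tensor_gen R x (J +>\<^bsub>ring_module R\<^esub> a) = a \<odot>\<^bsub>tensor R P N\<^esub> \<tau> x"
proof -
 note g = gen_closed[OF _ coset_closed]
 have "rel +>\<^bsub>Fr\<^esub> tensor_gen R x (a \<odot>\<^bsub>N\<^esub> \<nu>) = rel +>\<^bsub>Fr\<^esub> (a \<odot>\<^bsub>Fr\<^esub> tensor_gen R x \<nu>)"
  using assms g coset_smult[OF assms(2), of \<one>]
  by (intro class_eqI subsetD[OF rel_gen] bilinear_relI) (auto intro: coset_closed)
 then show ?thesis using assms g coset_smult[OF assms(2), of \<one>] by (simp add: q.h_smult \<tau>_def)
qed

lemma linear_\<tau>: "linear R P (tensor R P N) \<tau>"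
proof (intro linear.intro linear_axioms.intro module_axioms T.module_axioms)
 note g = gen_closed[OF _ coset_closed[OF R.one_closed]]
 have \<nu>: "\<nu> : carrier N" by (rule coset_closed) simp
 show "\<tau> x : carrier (tensor R P N)" if "x : carrier P" for x
  using that g by (simp add: \<tau>_def)
 show "\<tau> (x \<oplus>\<^bsub>P\<^esub> y) = \<tau> x \<oplus>\<^bsub>tensor R P N\<^esub> \<tau> y" if x: "x : carrier P" "y : carrier P" for x y
 proof -
  have "\<tau> (x \<oplus>\<^bsub>P\<^esub> y) = rel +>\<^bsub>Fr\<^esub> (tensor_gen R x \<nu> \<oplus>\<^bsub>Fr\<^esub> tensor_gen R y \<nu>)"
   unfolding \<tau>_def using x g \<nu>
   by (intro class_eqI subsetD[OF rel_gen] bilinear_relI) auto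
  then show ?thesis using x g by (simp add: q.h_add \<tau>_def)
 qed
 show "\<tau> (a \<odot>\<^bsub>P\<^esub> x) = a \<odot>\<^bsub>tensor R P N\<^esub> \<tau> x" if x: "a : carrier R" "x : carrier P" for a x
 proof -
  have "\<tau> (a \<odot>\<^bsub>P\<^esub> x) = rel +>\<^bsub>Fr\<^esub> (a \<odot>\<^bsub>Fr\<^esub> tensor_gen R x \<nu>)"
   unfolding \<tau>_def using x g \<nu>
   by (intro class_eqI subsetD[OF rel_gen] bilinear_relI) auto
  then show ?thesis using x g by (simp add: q.h_smult \<tau>_def)
 qed
qed

sublocale t: linear R P "tensor R P N" \<tau> by (rule linear_\<tau>)

text \<open>The tensor of \<open>x\<close> with the class of \<open>a\<close> is that of
  \<open>a x\<close> with 1.\<close>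

lemma \<tau>_surj: "carrier (tensor R P N) = \<tau> ` carrier P"
proof
 have "carrier Fr <= {f : carrier Fr. rel +>\<^bsub>Fr\<^esub> f : \<tau> ` carrier P}" (is "_ <= ?W")
 proof (rule R.free_span)
  show "submodule ?W R Fr"
   by (intro q.submodule_preimage Fr.carrier_is_submodule t.submodule_image carrier_is_submodule)
  fix q assume q: "q : carrier P \<times> carrier N"
  then obtain x a where x: "x : carrier P" "a : carrier R" "q = (x, J +>\<^bsub>ring_module R\<^esub> a)"
   using coset_ex by (metis mem_Sigma_iff prod.collapse)
  have "rel +>\<^bsub>Fr\<^esub> unit_vec R q = \<tau> (a \<odot>\<^bsub>P\<^esub> x)"
   using \<tau>_smult_right[OF x(1,2)] x by (simp add: tensor_gen_eq_unit_vec t.h_smult)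
  then have "rel +>\<^bsub>Fr\<^esub> unit_vec R q : \<tau> ` carrier P" using x by simp
  then show "unit_vec R q : ?W" using R.unit_vec_closed[OF q] by simp
 qed
 moreover have "carrier (tensor R P N) = (%f. rel +>\<^bsub>Fr\<^esub> f) ` carrier Fr"
  unfolding tensor_def Fr.quot_carrier by auto
 ultimately show "carrier (tensor R P N) <= \<tau> ` carrier P" by auto
 show "\<tau> ` carrier P <= carrier (tensor R P N)" by auto
qed

abbreviation JP where "JP \<equiv> smul P J (carrier P)"

lemma JP_submodule: "submodule JP R P" by (rule submodule_smul[OF subset_refl ideal_J])

text \<open>That \<open>JP\<close> dies is a computation. For the converse, sending \<open>x\<close>
  and the class of \<open>r\<close> to the class of \<open>r x\<close> in \<open>P/JP\<close>
  extends to the free module, kills the tensor relations, and maps the generator for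
  \<open>u\<close> and 1 to the class of \<open>u\<close>.\<close>

lemma \<tau>_zero_iff:
 assumes u: "u : carrier P"
 shows "\<tau> u = \<zero>\<^bsub>tensor R P N\<^esub> \<longleftrightarrow> u : JP"
proof
 have "JP <= {x : carrier P. \<tau> x : {\<zero>\<^bsub>tensor R P N\<^esub>}}"
 proof (rule smul_least)
  show "submodule {x : carrier P. \<tau> x : {\<zero>\<^bsub>tensor R P N\<^esub>}} R P"
   by (intro t.submodule_preimage carrier_is_submodule T.submodule_singleton_zero)
  fix a x assume a: "a : J" and x: "x : carrier P"
  have ac: "a : carrier R" using a J_carrier by blast
  have "J +>\<^bsub>ring_module R\<^esub> a = J +>\<^bsub>ring_module R\<^esub> \<zero>"
   using RMp.coset_eq_iff[OF J_submodule, of a "\<zero>"] a ac by (simp add: R.ring_module_minus R.minus_eqI)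
  then have "a \<odot>\<^bsub>tensor R P N\<^esub> \<tau> x = \<zero> \<odot>\<^bsub>tensor R P N\<^esub> \<tau> x"
   using \<tau>_smult_right[OF x ac] \<tau>_smult_right[OF x R.zero_closed] by simp
  then have "\<tau> (a \<odot>\<^bsub>P\<^esub> x) = \<zero>\<^bsub>tensor R P N\<^esub>" using ac x by (simp add: t.h_smult)
  then show "a \<odot>\<^bsub>P\<^esub> x : {x : carrier P. \<tau> x : {\<zero>\<^bsub>tensor R P N\<^esub>}}" using ac x by simp
 qed
 then show "u : JP ==> \<tau> u = \<zero>\<^bsub>tensor R P N\<^esub>" by blast
next
 assume 0: "\<tau> u = \<zero>\<^bsub>tensor R P N\<^esub>"
 let ?Q = "quot_module P JP"
 interpret Q: plain_module R ?Q by (intro plain_module.intro module_quot JP_submodule)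
 note qs = quot_smult[OF JP_submodule] and qa = quot_add[OF JP_submodule]
 \<comment> \<open>A chosen representative of the coset; \<open>\<psi>\<close> does not depend on
   it, because the difference of two representatives lies in \<open>J\<close>.\<close>
 define rep where "rep y = (SOME r. r : carrier R & y = J +>\<^bsub>ring_module R\<^esub> r)" for y
 define \<psi> where "\<psi> q = JP +>\<^bsub>P\<^esub> (rep (snd q) \<odot>\<^bsub>P\<^esub> fst q)" for q
 have rep: "rep y : carrier R & y = J +>\<^bsub>ring_module R\<^esub> rep y" if "y : carrier N" for y
  unfolding rep_def by (rule someI_ex) (use coset_ex[OF that] in blast)
 have cl: "JP +>\<^bsub>P\<^esub> x : carrier ?Q" if "x : carrier P" for x
  using that by (auto simp: quot_carrier)
 have \<psi>c: "\<psi> q : carrier ?Q" if "q : carrier P \<times> carrier N" for q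
  unfolding \<psi>_def using that rep[of "snd q"] by (intro cl) auto
 have \<psi>: "\<psi> (x, J +>\<^bsub>ring_module R\<^esub> r) = JP +>\<^bsub>P\<^esub> (r \<odot>\<^bsub>P\<^esub> x)"
  if x: "x : carrier P" and r: "r : carrier R" for x r
 proof -
  let ?s = "rep (J +>\<^bsub>ring_module R\<^esub> r)"
  have s: "?s : carrier R" "J +>\<^bsub>ring_module R\<^esub> r = J +>\<^bsub>ring_module R\<^esub> ?s"
   using rep[OF coset_closed[OF r]] by auto
  then have "J +>\<^bsub>ring_module R\<^esub> ?s = J +>\<^bsub>ring_module R\<^esub> r" by metis
  then have "?s \<ominus> r : J"
   using RMp.coset_eq_iff[OF J_submodule, of ?s r] s(1) r by (simp add: R.ring_module_minus)
  then have "(?s \<ominus> r) \<odot>\<^bsub>P\<^esub> x : JP" using x by (rule smul.smul_gen)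
  moreover have "(?s \<ominus> r) \<odot>\<^bsub>P\<^esub> x = ?s \<odot>\<^bsub>P\<^esub> x \<ominus>\<^bsub>P\<^esub> r \<odot>\<^bsub>P\<^esub> x"
   using s(1) r x by (simp add: a_minus_def smult_l_distr smult_l_minus)
  ultimately show ?thesis
   unfolding \<psi>_def using coset_eq_iff[OF JP_submodule, of "?s \<odot>\<^bsub>P\<^esub> x" "r \<odot>\<^bsub>P\<^esub> x"] s(1) r x by simp
 qed
 interpret k: linear R Fr ?Q "fext R ?Q \<psi>" by (rule Q.linear_fext[OF \<psi>c])
 have kg: "fext R ?Q \<psi> (tensor_gen R x y) = \<psi> (x, y)" if "x : carrier P" "y : carrier N" for x y
  unfolding tensor_gen_eq_unit_vec by (rule Q.fext_unit_vec, rule \<psi>c) (use that in simp)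
 note kk = k.h_minus k.h_add k.h_smult kg gen_closed \<psi>
 have self0: "v \<ominus>\<^bsub>?Q\<^esub> v = \<zero>\<^bsub>?Q\<^esub>" if "v : carrier ?Q" for v
  using that by (simp add: a_minus_def Q.M.r_neg)
 have "rel <= {f : carrier Fr. fext R ?Q \<psi> f : {\<zero>\<^bsub>?Q\<^esub>}}" (is "_ <= ?W")
 proof (intro rel_least k.submodule_preimage Fr.carrier_is_submodule Q.submodule_singleton_zero bilinear_rel_least)
  fix x x' y assume x: "x : carrier P" "x' : carrier P" and "y : carrier N"
  then obtain r where r: "r : carrier R" "y = J +>\<^bsub>ring_module R\<^esub> r" using coset_ex by blast
  show "tensor_gen R (x \<oplus>\<^bsub>P\<^esub> x') y \<ominus>\<^bsub>Fr\<^esub> (tensor_gen R x y \<oplus>\<^bsub>Fr\<^esub> tensor_gen R x' y) : ?W"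
   using x r coset_closed[OF r(1)] by (simp add: kk qa smult_r_distr self0 cl)
 next
  fix x y y' assume x: "x : carrier P" and "y : carrier N" "y' : carrier N"
  then obtain r s where r: "r : carrier R" "y = J +>\<^bsub>ring_module R\<^esub> r" "s : carrier R" "y' = J +>\<^bsub>ring_module R\<^esub> s"
   using coset_ex by metis
  show "tensor_gen R x (y \<oplus>\<^bsub>N\<^esub> y') \<ominus>\<^bsub>Fr\<^esub> (tensor_gen R x y \<oplus>\<^bsub>Fr\<^esub> tensor_gen R x y') : ?W"
   using x r coset_closed by (simp add: kk coset_add qa smult_l_distr self0 cl)
 next
  fix a x y assume x: "a : carrier R" "x : carrier P" and "y : carrier N"
  then obtain r where r: "r : carrier R" "y = J +>\<^bsub>ring_module R\<^esub> r" using coset_ex by blast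
  show "tensor_gen R (a \<odot>\<^bsub>P\<^esub> x) y \<ominus>\<^bsub>Fr\<^esub> a \<odot>\<^bsub>Fr\<^esub> tensor_gen R x y : ?W"
   using x r coset_closed[OF r(1)] by (simp add: kk qs self0 cl smult_left_commute)
  show "tensor_gen R x (a \<odot>\<^bsub>N\<^esub> y) \<ominus>\<^bsub>Fr\<^esub> a \<odot>\<^bsub>Fr\<^esub> tensor_gen R x y : ?W"
   using x r coset_closed by (simp add: kk coset_smult qs self0 cl smult_assoc1)
 qed
 moreover have "tensor_gen R u \<nu> : rel"
  using 0 Fr.coset_zero_iff[OF rel_submodule gen_closed[OF u coset_closed[OF R.one_closed]]]
  by (simp add: \<tau>_def tensor_def Fr.quot_zero)
 ultimately have "\<psi> (u, \<nu>) = \<zero>\<^bsub>?Q\<^esub>" using kg[OF u coset_closed[OF R.one_closed]] by auto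
 then show "u : JP" using \<psi>[OF u R.one_closed] u by (simp add: quot_zero coset_zero_iff[OF JP_submodule])
qed

end


subsection \<open>Comparison of presentations\<close>

text \<open>On a product \<open>a x\<close> the difference is \<open>a (x - \<gamma> x)\<close>,
  with second factor in \<open>K\<close>.\<close>

lemma smul_homotopy:
 fixes R (structure)
 assumes "linear R F F \<gamma>" and h: "!!x. x : carrier F ==> x \<ominus>\<^bsub>F\<^esub> \<gamma> x : K"
  and J: "ideal J R" and K: "K <= carrier F" and x: "x : smul F J (carrier F)"
 shows "x \<ominus>\<^bsub>F\<^esub> \<gamma> x : smul F J K"
proof -
 interpret linear R F F \<gamma> by fact
 note JK = M.submodule_smul[OF K J]
 have "x : carrier F & x \<ominus>\<^bsub>F\<^esub> \<gamma> x : smul F J K" using x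
 proof induction
  case smul_zero
  show ?case using M.submodule_zero[OF JK] M.M.minus_eqI[of "\<zero>\<^bsub>F\<^esub>" "\<zero>\<^bsub>F\<^esub>" "\<zero>\<^bsub>F\<^esub>"] by simp
 next
  case (smul_gen a x)
  have ac: "a : carrier R" using smul_gen(1) ideal_subset_carrier[OF J] by blast
  have "a \<odot>\<^bsub>F\<^esub> x \<ominus>\<^bsub>F\<^esub> \<gamma> (a \<odot>\<^bsub>F\<^esub> x) = a \<odot>\<^bsub>F\<^esub> (x \<ominus>\<^bsub>F\<^esub> \<gamma> x)"
   using ac smul_gen(2) by (simp add: h_smult a_minus_def M.smult_r_distr M.smult_r_minus)
  then show ?case using smul.smul_gen[OF smul_gen(1) h[OF smul_gen(2)]] ac smul_gen(2) by simp
 next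
  case (smul_add x y)
  then have c: "x : carrier F" "y : carrier F" by auto
  have "x \<oplus>\<^bsub>F\<^esub> y \<ominus>\<^bsub>F\<^esub> \<gamma> (x \<oplus>\<^bsub>F\<^esub> y) = (x \<ominus>\<^bsub>F\<^esub> \<gamma> x) \<oplus>\<^bsub>F\<^esub> (y \<ominus>\<^bsub>F\<^esub> \<gamma> y)"
   using c by (simp add: h_add a_minus_def M.M.minus_add M.M.a_ac)
  then show ?case using smul_add smul.smul_add[of _ F J K] c by simp
 qed
 then show ?thesis by blast
qed

text \<open>\<open>x - \<alpha> (\<beta> x)\<close> lies in \<open>K\<close> for all
  \<open>x\<close>, hence in \<open>JK\<close> for \<open>x\<close> in \<open>JF\<close> by
  \<open>smul_homotopy\<close>. So \<open>\<alpha>\<close> induces a surjection onto the quotient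
  for \<open>F\<close>.\<close>

lemma len_presentation_le:
 fixes R (structure)
 assumes \<alpha>: "linear R F' F \<alpha>" and \<beta>: "linear R F F' \<beta>"
  and \<epsilon>: "linear R F M \<epsilon>" and \<epsilon>': "linear R F' M \<epsilon>'"
  and \<epsilon>\<alpha>: "!!x. x : carrier F' ==> \<epsilon> (\<alpha> x) = \<epsilon>' x"
  and \<epsilon>\<beta>: "!!x. x : carrier F ==> \<epsilon>' (\<beta> x) = \<epsilon> x"
  and J: "ideal J R"
  and K_eq: "K = {x : carrier F. \<epsilon> x = \<zero>\<^bsub>M\<^esub>}" and K'_eq: "K' = {x : carrier F'. \<epsilon>' x = \<zero>\<^bsub>M\<^esub>}"
 shows "len R F (K \<inter> smul F J (carrier F)) (smul F J K) <=
  len R F' (K' \<inter> smul F' J (carrier F')) (smul F' J K')"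
proof -
 interpret a: linear R F' F \<alpha> by fact
 interpret b: linear R F F' \<beta> by fact
 interpret e: linear R F M \<epsilon> by fact
 interpret e': linear R F' M \<epsilon>' by fact
 note Jc = ideal_subset_carrier[OF J]
 have K: "submodule K R F"
  using e.submodule_preimage[OF a.N.carrier_is_submodule e.N.submodule_singleton_zero] by (simp add: K_eq)
 have K': "submodule K' R F'"
  using e'.submodule_preimage[OF a.M.carrier_is_submodule e.N.submodule_singleton_zero] by (simp add: K'_eq)
 note Kc = a.N.submoduleE(1)[OF K] a.M.submoduleE(1)[OF K']
 have JK: "submodule (smul F J K) R F" and JK': "submodule (smul F' J K') R F'"
  by (intro a.N.submodule_smul a.M.submodule_smul Kc J)+
 have JF: "submodule (smul F J (carrier F)) R F" and JF': "submodule (smul F' J (carrier F')) R F'"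
  by (intro a.N.submodule_smul a.M.submodule_smul subset_refl J)+
 have \<alpha>K: "\<alpha> ` K' <= K" and \<beta>K: "\<beta> ` K <= K'" using \<epsilon>\<alpha> \<epsilon>\<beta> by (auto simp: K_eq K'_eq)
 have \<beta>J: "\<beta> x : smul F' J (carrier F')" if "x : smul F J (carrier F)" for x
  using that b.smul_image[OF subset_refl Jc] a.M.smul_mono[of J J "\<beta> ` carrier F" "carrier F'"] by fastforce
 have \<alpha>JK: "\<alpha> x : smul F J K" if "x : smul F' J K'" for x
  using that a.smul_image[OF Kc(2) Jc] a.N.smul_mono[OF subset_refl \<alpha>K, of J] by fastforce
 have h: "x \<ominus>\<^bsub>F\<^esub> \<alpha> (\<beta> x) : smul F J K" if "x : smul F J (carrier F)" for x
 proof (rule smul_homotopy[OF _ _ J Kc(1) that])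
  show "linear R F F (%x. \<alpha> (\<beta> x))"
   by (intro linear.intro linear_axioms.intro a.N.module_axioms)
     (simp_all add: a.h_add b.h_add a.h_smult b.h_smult)
  show "y \<ominus>\<^bsub>F\<^esub> \<alpha> (\<beta> y) : K" if "y : carrier F" for y
   using that \<epsilon>\<alpha> \<epsilon>\<beta> by (simp add: K_eq e.h_minus e.N.M.minus_eqI)
 qed
 show ?thesis
 proof (rule a.len_image_le)
  show "submodule (K' \<inter> smul F' J (carrier F')) R F'" by (rule a.M.submodule_inter[OF K' JF'])
  show "smul F' J K' <= K' \<inter> smul F' J (carrier F')"
   using a.M.smul_subset[OF K' Jc] a.M.smul_mono[OF subset_refl Kc(2), of J] by blast
  show "\<alpha> ` smul F' J K' <= smul F J K" using \<alpha>JK by blast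
  show "K \<inter> smul F J (carrier F) <= \<alpha> ` (K' \<inter> smul F' J (carrier F')) <+>\<^bsub>F\<^esub> smul F J K"
  proof
   fix x assume x: "x : K \<inter> smul F J (carrier F)"
   then have xc: "x : carrier F" using Kc by blast
   have "\<alpha> (\<beta> x) : \<alpha> ` (K' \<inter> smul F' J (carrier F'))" using x \<beta>K \<beta>J by blast
   moreover have "x = \<alpha> (\<beta> x) \<oplus>\<^bsub>F\<^esub> (x \<ominus>\<^bsub>F\<^esub> \<alpha> (\<beta> x))"
    using xc by (simp add: a.N.M.plus_minus_cancel)
   ultimately show "x : \<alpha> ` (K' \<inter> smul F' J (carrier F')) <+>\<^bsub>F\<^esub> smul F J K"
    unfolding a.N.mem_set_add using h[of x] x by blast
  qed
 qed (intro JK JK')+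
qed

lemma len_presentation:
 fixes R (structure)
 assumes \<alpha>: "linear R F' F \<alpha>" and \<beta>: "linear R F F' \<beta>"
  and \<epsilon>: "linear R F M \<epsilon>" and \<epsilon>': "linear R F' M \<epsilon>'"
  and \<epsilon>\<alpha>: "!!x. x : carrier F' ==> \<epsilon> (\<alpha> x) = \<epsilon>' x"
  and \<epsilon>\<beta>: "!!x. x : carrier F ==> \<epsilon>' (\<beta> x) = \<epsilon> x"
  and J: "ideal J R"
  and K_eq: "K = {x : carrier F. \<epsilon> x = \<zero>\<^bsub>M\<^esub>}" and K'_eq: "K' = {x : carrier F'. \<epsilon>' x = \<zero>\<^bsub>M\<^esub>}"
 shows "len R F' (K' \<inter> smul F' J (carrier F')) (smul F' J K') =
  len R F (K \<inter> smul F J (carrier F)) (smul F J K)"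
 using len_presentation_le[OF \<alpha> \<beta> \<epsilon> \<epsilon>' \<epsilon>\<alpha> \<epsilon>\<beta> J K_eq K'_eq]
  len_presentation_le[OF \<beta> \<alpha> \<epsilon>' \<epsilon> \<epsilon>\<beta> \<epsilon>\<alpha> J K'_eq K_eq] by (intro antisym)

subsection \<open>The length of Tor\<close>

locale cyclic_tensor_linear = D: cyclic_tensor R P J + C: cyclic_tensor R P' J + linear R P P' h
 for R (structure) and P :: "('a, 'p) module" and P' :: "('a, 'q) module" and J h
begin

definition push :: "('p \<times> 'a set => 'a) => 'q \<times> 'a set => 'a"
 where "push f = (%(x', y). \<Oplus>x\<in>{x. f (x, y) ~= \<zero> & h x = x'}. f (x, y))"

text \<open>The sum over a fibre of \<open>h\<close> that occurs in \<open>tensor_map\<close> is a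
  coordinate of the linear map taking the basis vector at \<open>(x, y)\<close> to the one at
  \<open>(h x, y)\<close>.\<close>

lemma push_eq:
 assumes f: "f : carrier D.Fr"
 shows "push f = fext R C.Fr (%q. unit_vec R (h (fst q), snd q)) f"
proof
 fix p :: "'q \<times> 'a set"
 obtain x' y where p: "p = (x', y)" by force
 let ?S = "{q. f q ~= \<zero>}" and ?\<phi> = "%q. unit_vec R (h (fst q), snd q)"
 interpret ev: linear R C.Fr "ring_module R" "%f. f p" by (rule D.R.linear_eval)
 have S: "finite ?S" and fc: "f q : carrier R" for q using f unfolding D.R.free_carrier by blast+
 have SP: "?S <= carrier P \<times> carrier D.N" using f unfolding D.R.free_carrier by blast
 have \<phi>: "?\<phi> q : carrier C.Fr" if "q : ?S" for q
  using that SP by (intro D.R.unit_vec_closed) auto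
 have "fext R C.Fr ?\<phi> f p = finsum (ring_module R) (%q. (f q \<odot>\<^bsub>C.Fr\<^esub> ?\<phi> q) p) ?S"
  unfolding fext_def using S \<phi> fc by (intro ev.h_finsum) auto
 also have "\<dots> = finsum R (%q. (f q \<odot>\<^bsub>C.Fr\<^esub> ?\<phi> q) p) ?S"
  using S fc by (intro D.R.finsum_ring_module) (auto simp: D.R.free_simps unit_vec_def)
 also have "\<dots> = finsum R f {q : ?S. (h (fst q), snd q) = p}"
  by (rule D.R.add.finprod_mono_neutral_cong_right[OF S])
    (use fc in \<open>auto simp: D.R.free_simps unit_vec_def split: if_splits\<close>)
 also have "{q : ?S. (h (fst q), snd q) = p} = (%x. (x, y)) ` {x. f (x, y) ~= \<zero> & h x = x'}"
  using p by force
 also have "finsum R f \<dots> = (\<Oplus>x\<in>{x. f (x, y) ~= \<zero> & h x = x'}. f (x, y))"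
  by (rule D.R.add.finprod_reindex) (use fc in \<open>auto simp: inj_on_def\<close>)
 finally show "push f p = fext R C.Fr ?\<phi> f p" by (simp add: push_def p)
qed

lemma linear_push: "linear R D.Fr C.Fr (fext R C.Fr (%q. unit_vec R (h (fst q), snd q)))"
 by (rule C.Fr.linear_fext) (auto intro!: D.R.unit_vec_closed)

text \<open>All cosets in the union defining \<open>tensor_map\<close> coincide, since the linear
  map on the free modules respects the bilinearity relations.\<close>

lemma tensor_map_\<tau>:
 assumes u: "u : carrier P"
 shows "tensor_map R P' D.N h (D.\<tau> u) = C.\<tau> (h u)"
proof -
 let ?p = "fext R C.Fr (%q. unit_vec R (h (fst q), snd q))"
 interpret p: linear R D.Fr C.Fr ?p by (rule linear_push)
 have \<nu>: "D.\<nu> : carrier D.N" by (rule D.coset_closed) simp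
 have pg: "?p (tensor_gen R x y) = tensor_gen R (h x) y" if "x : carrier P" "y : carrier D.N" for x y
  unfolding tensor_gen_eq_unit_vec using that
  by (subst C.Fr.fext_unit_vec) (auto intro!: D.R.unit_vec_closed)
 note ps = p.h_minus p.h_add p.h_smult pg D.gen_closed
 have "D.rel <= {f : carrier D.Fr. ?p f : C.rel}"
  by (intro D.rel_least p.submodule_preimage D.Fr.carrier_is_submodule C.rel_submodule bilinear_rel_least)
    (simp_all add: ps h_add h_smult subsetD[OF C.rel_gen] bilinear_relI)
 then have pr: "?p f : C.rel" if "f : D.rel" for f using that by blast
 have "C.rel +>\<^bsub>C.Fr\<^esub> push f = C.\<tau> (h u)" if f: "f : D.\<tau> u" for f
 proof -
  have fc: "f : carrier D.Fr" "f \<ominus>\<^bsub>D.Fr\<^esub> tensor_gen R u D.\<nu> : D.rel"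
   using D.Fr.coset_memD[OF D.rel_submodule D.gen_closed[OF u \<nu>]] f
    D.Fr.coset_eq_iff[OF D.rel_submodule _ D.gen_closed[OF u \<nu>], of f] unfolding D.\<tau>_def by auto
  then have "?p f \<ominus>\<^bsub>C.Fr\<^esub> tensor_gen R (h u) D.\<nu> : C.rel"
   using pr[OF fc(2)] u \<nu> by (simp add: ps)
  then have "C.rel +>\<^bsub>C.Fr\<^esub> ?p f = C.\<tau> (h u)"
   unfolding C.\<tau>_def using C.class_eqI[OF _ C.gen_closed[OF h_closed[OF u] \<nu>]] fc(1) by simp
  then show ?thesis by (simp add: push_eq[OF fc(1)])
 qed
 moreover have "tensor_gen R u D.\<nu> : D.\<tau> u"
  unfolding D.\<tau>_def by (rule D.Fr.coset_self[OF D.rel_submodule D.gen_closed[OF u \<nu>]])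
 moreover have "tensor_map R P' D.N h (D.\<tau> u) = (\<Union>f\<in>D.\<tau> u. C.rel +>\<^bsub>C.Fr\<^esub> push f)"
  by (simp add: tensor_map_def push_def)
 ultimately show ?thesis by blast
qed

end

context plain_module
begin

abbreviation F0 where "F0 \<equiv> free_module R (carrier M)"
abbreviation M1 where "M1 \<equiv> syzygy R M"

lemma syzygy_carrier: "carrier M1 = {x : carrier F0. lin_comb R M x = 0\<^sub>M}"
 by (auto simp: syzygy_def a_kernel_def')

lemma syzygy_submodule: "submodule (carrier M1) R F0"
proof -
 interpret e: linear R F0 M "lin_comb R M" by (rule linear_lin_comb)
 show ?thesis
  using e.submodule_preimage[OF e.M.carrier_is_submodule submodule_singleton_zero]
  by (simp add: syzygy_carrier)
qed

lemma syzygy_plain: "plain_module R M1"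
 using submodule.submodule_is_module[OF syzygy_submodule R.module_free]
 by (simp add: plain_module_def syzygy_def)

lemma syzygy_simps: "zero M1 = zero F0" "add M1 = add F0" "smult M1 = smult F0"
 by (simp_all add: syzygy_def)

text \<open>Tensoring with \<open>R/J\<close> replaces each \<open>F\<close> by \<open>F/JF\<close>.
  Pulled back to \<open>F1\<close>, the cycles are the \<open>u\<close> with \<open>d1 u\<close> in
  \<open>J F0\<close>, and the boundaries are \<open>M2 + J F1\<close>, the preimage of
  \<open>J M1\<close>, because \<open>d1\<close> maps \<open>F1\<close> onto \<open>M1\<close> with
  kernel \<open>M2\<close>. So \<open>d1\<close> identifies the homology with the quotient on the
  right.\<close>

lemma module_length_Tor1:
 assumes J: "ideal J R"
 shows "module_length R (Tor1 R M (quot_module (ring_module R) J)) =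
  len R F0 (carrier M1 \<inter> smul F0 J (carrier F0)) (smul F0 J (carrier M1))"
proof -
 let ?M2 = "syzygy R M1"
 let ?F1 = "free_module R (carrier M1)" and ?F2 = "free_module R (carrier ?M2)"
 let ?d1 = "lin_comb R M1" and ?d2 = "lin_comb R ?M2"
 let ?N = "quot_module (ring_module R) J"
 let ?T0 = "tensor R F0 ?N" and ?T1 = "tensor R ?F1 ?N"
 interpret F0: plain_module R F0 by (rule R.plain_free)
 interpret M1: plain_module R M1 by (rule syzygy_plain)
 interpret M2: plain_module R ?M2 by (rule M1.syzygy_plain)
 interpret d1': linear R ?F1 M1 ?d1 by (rule M1.linear_lin_comb)
 have d1c: "?d1 u : carrier F0" if "u : carrier ?F1" for u
  using d1'.h_closed[OF that] unfolding syzygy_carrier by blast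
 have "linear R ?F1 F0 ?d1"
  using d1c d1'.h_add d1'.h_smult
  by (intro linear.intro linear_axioms.intro R.module_free) (simp_all add: syzygy_simps)
 then interpret d1: linear R ?F1 F0 ?d1 .
 interpret d2': linear R ?F2 ?M2 ?d2 by (rule M2.linear_lin_comb)
 have d2c: "?d2 u : carrier ?F1" if "u : carrier ?F2" for u
  using d2'.h_closed[OF that] unfolding M1.syzygy_carrier by blast
 have "linear R ?F2 ?F1 ?d2"
  using d2c d2'.h_add d2'.h_smult
  by (intro linear.intro linear_axioms.intro R.module_free) (simp_all add: M1.syzygy_simps)
 then interpret d2: linear R ?F2 ?F1 ?d2 .
 interpret c1: cyclic_tensor_linear R ?F1 F0 J ?d1
  by (intro cyclic_tensor_linear.intro cyclic_tensor.intro cyclic_tensor_axioms.intro R.plain_free J d1.linear_axioms)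
 interpret c2: cyclic_tensor_linear R ?F2 ?F1 J ?d2
  by (intro cyclic_tensor_linear.intro cyclic_tensor.intro cyclic_tensor_axioms.intro R.plain_free J d2.linear_axioms)
 note Jc = ideal_subset_carrier[OF J]
 note JF0 = c1.C.JP_submodule
 have M1c: "carrier M1 <= carrier F0" and JM1: "submodule (smul F0 J (carrier M1)) R F0"
  using F0.submoduleE(1)[OF syzygy_submodule] F0.submodule_smul[OF _ J] by auto
 have d1_img: "?d1 ` carrier ?F1 = carrier M1" by (rule M1.lin_comb_surj)
 have d2_img: "?d2 ` carrier ?F2 = carrier ?M2" by (rule M2.lin_comb_surj)
 have M2_eq: "carrier ?M2 = {u : carrier ?F1. ?d1 u = \<zero>\<^bsub>F0\<^esub>}"
  by (simp add: M1.syzygy_carrier syzygy_simps)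
 have d1J: "?d1 ` smul ?F1 J (carrier ?F1) = smul F0 J (carrier M1)"
  using d1.smul_image[OF subset_refl Jc] d1_img by simp
 \<comment> \<open>\<open>X\<close> and \<open>Y\<close> are the cycles and boundaries pulled back
   to \<open>F1\<close>.\<close>
 define X where "X = {u : carrier ?F1. ?d1 u : smul F0 J (carrier F0)}"
 define Y where "Y = {u : X. ?d1 u : smul F0 J (carrier M1)}"
 have X: "submodule X R ?F1"
  unfolding X_def by (rule d1.submodule_preimage[OF d1'.M.carrier_is_submodule JF0])
 have Y: "submodule Y R ?F1"
  unfolding Y_def by (rule d1.submodule_preimage[OF X JM1])
 have JM1s: "smul F0 J (carrier M1) <= carrier M1 \<inter> smul F0 J (carrier F0)"
  using F0.smul_subset[OF syzygy_submodule Jc] F0.smul_mono[OF subset_refl M1c, of J] by blast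
 have M1J: "submodule (carrier M1 \<inter> smul F0 J (carrier F0)) R F0"
  by (rule F0.submodule_inter[OF syzygy_submodule JF0])
 have imeq: "f ` {u : A. f u : W} = f ` A \<inter> W" for f :: "(('m => 'a) => 'a) => 'm => 'a" and A W by blast
 have "?d1 ` X = carrier M1 \<inter> smul F0 J (carrier F0)"
  using imeq[of ?d1 "carrier ?F1" "smul F0 J (carrier F0)"] d1_img by (simp only: X_def)
 then have X': "carrier M1 \<inter> smul F0 J (carrier F0) = ?d1 ` X <+>\<^bsub>F0\<^esub> smul F0 J (carrier M1)"
  using F0.set_add_upper1[OF M1J JM1] F0.set_add_least[OF M1J subset_refl JM1s] by simp
 have len1: "len R ?F1 X Y = len R F0 (carrier M1 \<inter> smul F0 J (carrier F0)) (smul F0 J (carrier M1))"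
  by (rule d1.len_image[OF X Y _ JM1 X' Y_def]) (simp add: Y_def)

 have ker: "a_kernel ?T1 ?T0 (tensor_map R F0 ?N ?d1) = c1.D.\<tau> ` X"
 proof -
  have "tensor_map R F0 ?N ?d1 (c1.D.\<tau> u) = \<zero>\<^bsub>?T0\<^esub> \<longleftrightarrow> ?d1 u : smul F0 J (carrier F0)"
   if "u : carrier ?F1" for u
   using c1.tensor_map_\<tau>[OF that] c1.C.\<tau>_zero_iff[OF d1c[OF that]] by simp
  then show ?thesis unfolding a_kernel_def' c1.D.\<tau>_surj X_def by auto
 qed
 define B where "B = c1.D.\<tau> ` carrier ?M2"
 have img: "tensor_map R ?F1 ?N ?d2 ` carrier (tensor R ?F2 ?N) = B"
 proof -
  have "tensor_map R ?F1 ?N ?d2 ` carrier (tensor R ?F2 ?N) = (%w. c1.D.\<tau> (?d2 w)) ` carrier ?F2"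
   unfolding c2.D.\<tau>_surj image_image by (rule image_cong) (auto simp: c2.tensor_map_\<tau>)
  then show ?thesis using arg_cong[OF d2_img, of "(`) c1.D.\<tau>"] by (simp only: B_def image_image)
 qed
 have tX: "submodule (c1.D.\<tau> ` X) R ?T1" by (rule c1.D.t.submodule_image[OF X])
 have M2s: "submodule (carrier ?M2) R ?F1" by (rule M1.syzygy_submodule)
 have B: "submodule B R ?T1" unfolding B_def by (rule c1.D.t.submodule_image[OF M2s])
 have M2X: "carrier ?M2 <= X" unfolding M2_eq X_def using F0.submodule_zero[OF JF0] by auto
 have BX: "B <= c1.D.\<tau> ` X" unfolding B_def using M2X by blast
 let ?K = "?T1\<lparr>carrier := c1.D.\<tau> ` X\<rparr>"
 interpret K: plain_module R ?K
  by (intro plain_module.intro submodule.submodule_is_module[OF tX c1.D.T.module_axioms])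
 have BK: "submodule B R ?K" using c1.D.T.submodule_restrict_iff[OF tX] B BX by simp
 have Tor: "Tor1 R M ?N = quot_module ?K B"
  by (simp add: Tor1_def Let_def ker img)
 interpret Q: linear R ?K "quot_module ?K B" "%x. B +>\<^bsub>?K\<^esub> x" by (rule K.linear_quot[OF BK])
 have "module_length R (Tor1 R M ?N) = len R (quot_module ?K B) (carrier (quot_module ?K B)) {\<zero>\<^bsub>quot_module ?K B\<^esub>}"
  unfolding Tor by (rule module_length_eq_len[OF Q.N.module_axioms])
 also have "\<dots> = len R ?K (carrier ?K) B"
 proof (rule Q.len_image[symmetric, OF K.carrier_is_submodule BK K.submoduleE(1)[OF BK] Q.N.submodule_singleton_zero])
  have "(%x. B +>\<^bsub>?K\<^esub> x) ` carrier ?K = carrier (quot_module ?K B)"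
   unfolding K.quot_carrier by blast
  then show "carrier (quot_module ?K B) = (%x. B +>\<^bsub>?K\<^esub> x) ` carrier ?K <+>\<^bsub>quot_module ?K B\<^esub> {\<zero>\<^bsub>quot_module ?K B\<^esub>}"
   using Q.N.set_add_zero[OF Q.N.carrier_is_submodule] by simp
  show "B = {x : carrier ?K. B +>\<^bsub>?K\<^esub> x : {\<zero>\<^bsub>quot_module ?K B\<^esub>}}"
   using K.coset_zero_iff[OF BK] K.submodule_carrier[OF BK] unfolding K.quot_zero by blast
 qed
 also have "\<dots> = len R ?T1 (c1.D.\<tau> ` X) B"
  using c1.D.T.len_restrict[OF tX subset_refl, of B] by (simp add: c1.D.T.len_restrict[OF tX])
 also have "\<dots> = len R ?F1 X Y"
 proof (rule c1.D.t.len_image[symmetric, OF X Y _ B])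
  show "Y <= X" by (simp add: Y_def)
  show "c1.D.\<tau> ` X = c1.D.\<tau> ` X <+>\<^bsub>?T1\<^esub> B"
   using c1.D.T.set_add_upper1[OF tX B] c1.D.T.set_add_least[OF tX subset_refl BX] by blast
  show "Y = {u : X. c1.D.\<tau> u : B}"
  proof (intro Set.set_eqI iffI)
   fix u assume "u : Y"
   then have u: "u : X" "u : carrier ?F1" "?d1 u : smul F0 J (carrier M1)" by (auto simp: Y_def X_def)
   then obtain v where v: "v : smul ?F1 J (carrier ?F1)" "?d1 u = ?d1 v" using d1J by blast
   have vc: "v : carrier ?F1" using v(1) d1'.M.smul_subset[OF d1'.M.carrier_is_submodule Jc] by blast
   \<comment> \<open>Two elements of \<open>F1\<close> with the same image under \<open>d1\<close>
     differ by an element of the second syzygy.\<close>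
   have w: "u \<ominus>\<^bsub>?F1\<^esub> v : carrier ?M2"
    using u vc v(2) by (simp add: M2_eq d1.h_minus F0.M.minus_eqI)
   have "c1.D.\<tau> u = c1.D.\<tau> ((u \<ominus>\<^bsub>?F1\<^esub> v) \<oplus>\<^bsub>?F1\<^esub> v)" using u vc by (simp add: d1'.M.M.minus_plus_cancel)
   also have "\<dots> = c1.D.\<tau> (u \<ominus>\<^bsub>?F1\<^esub> v) \<oplus>\<^bsub>?T1\<^esub> c1.D.\<tau> v" using u vc by (simp add: c1.D.t.h_add)
   also have "c1.D.\<tau> v = \<zero>\<^bsub>?T1\<^esub>" using c1.D.\<tau>_zero_iff[OF vc] v by simp
   finally have "c1.D.\<tau> u = c1.D.\<tau> (u \<ominus>\<^bsub>?F1\<^esub> v)" using u vc by simp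
   then show "u : {u : X. c1.D.\<tau> u : B}" using u w by (auto simp: B_def)
  next
   fix u assume "u : {u : X. c1.D.\<tau> u : B}"
   then obtain w where u: "u : X" "u : carrier ?F1" and w: "w : carrier ?M2" "c1.D.\<tau> u = c1.D.\<tau> w"
    by (auto simp: X_def B_def)
   have wc: "w : carrier ?F1" "?d1 w = \<zero>\<^bsub>F0\<^esub>" using w by (auto simp: M2_eq)
   have "c1.D.\<tau> (u \<ominus>\<^bsub>?F1\<^esub> w) = \<zero>\<^bsub>?T1\<^esub>"
    using u wc w by (simp add: c1.D.t.h_minus c1.D.T.M.minus_eqI)
   then have "u \<ominus>\<^bsub>?F1\<^esub> w : smul ?F1 J (carrier ?F1)" using c1.D.\<tau>_zero_iff u wc by simp
   then have "?d1 (u \<ominus>\<^bsub>?F1\<^esub> w) : smul F0 J (carrier M1)" using d1J by blast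
   moreover have "?d1 (u \<ominus>\<^bsub>?F1\<^esub> w) = ?d1 u" using u wc by (simp add: d1.h_minus F0.M.minus_eqI)
   ultimately show "u : Y" using u by (simp add: Y_def)
  qed
 qed
 finally show ?thesis using len1 by simp
qed

text \<open>Any generating family computes the length of Tor, since \<open>id\<close> and the composite of the
 comparison maps differ by a map into the syzygies.\<close>

lemma module_length_Tor1_generators:
 assumes J: "ideal J R" and g: "!!i. i : X ==> g i : carrier M"
  and surj: "fext R M g ` carrier (free_module R X) = carrier M"
  and K_eq: "K = {f : carrier (free_module R X). fext R M g f = 0\<^sub>M}"
 shows "module_length R (Tor1 R M (quot_module (ring_module R) J)) =
  len R (free_module R X) (K \<inter> smul (free_module R X) J (carrier (free_module R X)))
   (smul (free_module R X) J K)"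
proof -
 let ?F = "free_module R X"
 interpret F0: plain_module R F0 by (rule R.plain_free)
 interpret F: plain_module R ?F by (rule R.plain_free)
 define c where "c x = (SOME f. f : carrier ?F & fext R M g f = x)" for x
 have c: "c x : carrier ?F" "fext R M g (c x) = x" if "x : carrier M" for x
 proof -
  have "x : fext R M g ` carrier ?F" using that surj by simp
  then have "EX f. f : carrier ?F & fext R M g f = x" by (rule imageE) (intro exI conjI, assumption, rule sym)
  from someI_ex[OF this] show "c x : carrier ?F" "fext R M g (c x) = x" unfolding c_def by simp_all
 qed
 let ?\<alpha> = "fext R F0 (%i. unit_vec R (g i))" and ?\<beta> = "fext R ?F c"
 have \<alpha>: "linear R ?F F0 ?\<alpha>" by (rule F0.linear_fext) (rule R.unit_vec_closed[OF g])
 have \<beta>: "linear R F0 ?F ?\<beta>" by (rule F.linear_fext) (rule c)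
 have \<epsilon>: "linear R F0 M (lin_comb R M)" by (rule linear_lin_comb)
 have \<epsilon>': "linear R ?F M (fext R M g)" by (rule linear_fext[OF g])
 interpret a: linear R ?F F0 ?\<alpha> by (rule \<alpha>)
 interpret b: linear R F0 ?F ?\<beta> by (rule \<beta>)
 interpret e: linear R F0 M "lin_comb R M" by (rule \<epsilon>)
 interpret e': linear R ?F M "fext R M g" by (rule \<epsilon>')
 have ea: "linear R ?F M (%x. lin_comb R M (?\<alpha> x))"
  by (intro linear.intro linear_axioms.intro F.module_axioms module_axioms)
    (simp_all add: a.h_add e.h_add a.h_smult e.h_smult)
 have eb: "linear R F0 M (%x. fext R M g (?\<beta> x))"
  by (intro linear.intro linear_axioms.intro F0.module_axioms module_axioms)
    (simp_all add: b.h_add e'.h_add b.h_smult e'.h_smult)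
 have "lin_comb R M (?\<alpha> x) = fext R M g x" if "x : carrier ?F" for x
 proof (rule linear_eq_on_free[OF ea \<epsilon>' _ that])
  fix i assume i: "i : X"
  show "lin_comb R M (?\<alpha> (unit_vec R i)) = fext R M g (unit_vec R i)"
   using F0.fext_unit_vec[of "%i. unit_vec R (g i)" i] R.unit_vec_closed[OF g[OF i]]
    lin_comb_unit_vec[OF g[OF i]] fext_unit_vec[of g, OF g[OF i]] by simp
 qed
 moreover have "fext R M g (?\<beta> x) = lin_comb R M x" if "x : carrier F0" for x
 proof (rule linear_eq_on_free[OF eb \<epsilon> _ that])
  fix i assume i: "i : carrier M"
  show "fext R M g (?\<beta> (unit_vec R i)) = lin_comb R M (unit_vec R i)"
   using F.fext_unit_vec[of c i] c[OF i] lin_comb_unit_vec[OF i] by simp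
 qed
 ultimately show ?thesis
  unfolding module_length_Tor1[OF J]
  by (intro len_presentation[OF \<alpha> \<beta> \<epsilon> \<epsilon>' _ _ J syzygy_carrier K_eq, symmetric])
qed

text \<open>A basis is a generating family whose kernel of relations is zero.\<close>

lemma free_imp_Tor1_zero:
 assumes J: "ideal J R" and free: "is_free_module R M"
 shows "module_length R (Tor1 R M (quot_module (ring_module R) J)) = 0"
proof -
 obtain B where B: "B <= carrier M" "bij_betw (lin_comb R M) (carrier (free_module R B)) (carrier M)"
  using free unfolding is_free_module_def by blast
 let ?F = "free_module R B"
 let ?K = "{f : carrier ?F. fext R M (%x. x) f = 0\<^sub>M}"
 interpret e: linear R ?F M "fext R M (%x. x)" by (rule linear_fext) (use B in blast)
 have K: "?K = {\<zero>\<^bsub>?F\<^esub>}"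
 proof (intro Set.set_eqI iffI)
  fix f assume "f : ?K"
  then have f: "f : carrier ?F" "fext R M (%x. x) f = fext R M (%x. x) \<zero>\<^bsub>?F\<^esub>" by simp_all
  have "inj_on (fext R M (%x. x)) (carrier ?F)"
   using B(2) by (simp add: bij_betw_def lin_comb_eq_fext)
  then show "f : {\<zero>\<^bsub>?F\<^esub>}" using inj_onD[OF _ f(2) f(1) e.M.M.zero_closed] by simp
 qed simp
 have "module_length R (Tor1 R M (quot_module (ring_module R) J)) =
   len R ?F (?K \<inter> smul ?F J (carrier ?F)) (smul ?F J ?K)"
  by (rule module_length_Tor1_generators[OF J _ _ refl])
    (use B in \<open>auto simp: bij_betw_def lin_comb_eq_fext\<close>)
 also have "\<dots> <= len R ?F {\<zero>\<^bsub>?F\<^esub>} {\<zero>\<^bsub>?F\<^esub>}"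
  by (rule len_mono) (auto simp: K intro: smul.smul_zero)
 finally show ?thesis by (simp add: e.M.len_self)
qed

end

subsection \<open>Finite presentations\<close>

definition zext :: "('a, 'k) ring_scheme => 'i set => ('i => 'a) => 'i => 'a"
 where "zext R S b = (%i. if i : S then b i else \<zero>\<^bsub>R\<^esub>)"

context module
begin

lemma zext_closed: "finite S ==> b : S \<rightarrow> carrier R ==> zext R S b : carrier (free_module R S)"
 unfolding R.free_carrier zext_def by (auto intro: rev_finite_subset)

lemma fext_zext:
 assumes S: "finite S" and b: "b : S \<rightarrow> carrier R" and g: "g : S \<rightarrow> carrier M"
 shows "fext R M g (zext R S b) = lc M S b g"
proof -
 have "fext R M g (zext R S b) = lc M S (zext R S b) g"
  by (rule fext_superset[OF S]) (use b g in \<open>auto simp: zext_def\<close>)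
 also have "\<dots> = lc M S b g" by (rule lc_cong[OF _ b g]) (simp add: zext_def)
 finally show ?thesis .
qed

lemma fext_eq_lc:
 assumes S: "finite S" and f: "f : carrier (free_module R S)" and g: "g : S \<rightarrow> carrier M"
 shows "fext R M g f = lc M S f g" "f : S \<rightarrow> carrier R"
proof -
 have f': "!!i. f i : carrier R" "!!i. i ~: S ==> f i = \<zero>" using f unfolding R.free_carrier by blast+
 show "fext R M g f = lc M S f g" by (rule fext_superset[OF S]) (use f' g in auto)
 show "f : S \<rightarrow> carrier R" using f'(1) by simp
qed

lemma fext_image:
 assumes S: "finite S" and g: "g : S \<rightarrow> carrier M"
 shows "fext R M g ` carrier (free_module R S) = comb (carrier R) S g"
proof
 show "fext R M g ` carrier (free_module R S) <= comb (carrier R) S g"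
  using fext_eq_lc[OF S _ g] unfolding comb_def by auto
 show "comb (carrier R) S g <= fext R M g ` carrier (free_module R S)"
 proof
  fix v assume "v : comb (carrier R) S g"
  then obtain b where b: "b : S \<rightarrow> carrier R" "v = lc M S b g" by (auto simp: comb_def)
  then show "v : fext R M g ` carrier (free_module R S)"
   using fext_zext[OF S b(1) g] zext_closed[OF S b(1)] by (metis imageI)
 qed
qed

end

context plain_module
begin

text \<open>The vector \<open>b\<close> lies in \<open>K \<inter> JF\<close>, which equals
  \<open>JK\<close> because Tor vanishes; the i-th coordinate of an element of \<open>JK\<close>
  lies in \<open>J \<cdot> D\<close>.\<close>

lemma Tor1_zero_coefficients:
 assumes S: "finite S" and g: "g : S \<rightarrow> carrier M" and gen: "comb (carrier R) S g = carrier M"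
  and J: "ideal J R" and Tor: "module_length R (Tor1 R M (quot_module (ring_module R) J)) = 0"
  and b: "b : S \<rightarrow> J" "lc M S b g = 0\<^sub>M" and D: "ideal D R" and i: "i : S"
  and rel: "!!d. d : S \<rightarrow> carrier R ==> lc M S d g = 0\<^sub>M ==> d i : D"
 shows "b i : J \<cdot> D"
proof -
 let ?F = "free_module R S"
 let ?K = "{f : carrier ?F. fext R M g f = 0\<^sub>M}"
 interpret F: plain_module R ?F by (rule R.plain_free)
 note Jc = ideal_subset_carrier[OF J]
 have gc: "!!j. j : S ==> g j : carrier M" using g by auto
 interpret e: linear R ?F M "fext R M g" by (rule linear_fext[OF gc])
 have bc: "b : S \<rightarrow> carrier R" using b(1) Jc by auto
 have K: "submodule ?K R ?F"
  using e.submodule_preimage[OF F.carrier_is_submodule submodule_singleton_zero] by simp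
 have JF: "submodule (smul ?F J (carrier ?F)) R ?F" and JK: "submodule (smul ?F J ?K) R ?F"
  by (intro F.submodule_smul J F.submoduleE(1)[OF K] subset_refl)+
 have "len R ?F (?K \<inter> smul ?F J (carrier ?F)) (smul ?F J ?K) = 0"
  using module_length_Tor1_generators[OF J gc _ refl] fext_image[OF S g] gen Tor by simp
 moreover have "smul ?F J ?K <= ?K \<inter> smul ?F J (carrier ?F)"
  using F.smul_subset[OF K Jc] F.smul_mono[OF subset_refl F.submoduleE(1)[OF K], of J] by blast
 ultimately have eq: "?K \<inter> smul ?F J (carrier ?F) = smul ?F J ?K"
  using F.len_eq_0D[OF F.submodule_inter[OF K JF] JK] by blast
 have zc: "zext R S b : carrier ?F" by (rule zext_closed[OF S bc])
 have "zext R S b = lc ?F S b (unit_vec R)"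
 proof -
  have u: "unit_vec R : S \<rightarrow> carrier ?F" using R.unit_vec_closed by auto
  interpret id: linear R ?F ?F "%f. f" by (rule F.linear_id)
  have "zext R S b = fext R ?F (unit_vec R) (zext R S b)"
  proof (rule linear_eq_on_free[OF F.linear_id F.linear_fext _ zc])
   show "unit_vec R j = fext R ?F (unit_vec R) (unit_vec R j)" if "j : S" for j
    by (rule F.fext_unit_vec[symmetric]) (rule R.unit_vec_closed[OF that])
  qed (rule R.unit_vec_closed)
  also have "\<dots> = lc ?F S b (unit_vec R)" by (rule F.fext_zext[OF S bc u])
  finally show ?thesis .
 qed
 also have "\<dots> : smul ?F J (carrier ?F)"
  unfolding lc_def using S b(1) R.unit_vec_closed
  by (intro F.submodule_finsum[OF JF] smul.smul_gen) auto
 finally have zs: "zext R S b : smul ?F J (carrier ?F)" .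
 have "zext R S b : ?K" using zc fext_zext[OF S bc g] b(2) by simp
 then have "zext R S b : smul ?F J ?K" using IntI[OF _ zs, of ?K] unfolding eq by simp
 moreover have "smul ?F J ?K <= {f : carrier ?F. f i : J \<cdot> D}"
 proof (rule F.smul_least)
  interpret ev: linear R ?F "ring_module R" "%f. f i" by (rule R.linear_eval)
  show "submodule {f : carrier ?F. f i : J \<cdot> D} R ?F"
   using R.ideal_iff_submodule R.ideal_prod_is_ideal[OF J D]
   by (intro ev.submodule_preimage F.carrier_is_submodule) simp
  fix a f assume a: "a : J" and "f : ?K"
  then have f: "f : carrier ?F" "fext R M g f = 0\<^sub>M" by simp_all
  have ac: "a : carrier R" using a Jc by blast
  have "f i : D" using rel[of f] fext_eq_lc[OF S f(1) g] f(2) by simp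
  then have "(a \<odot>\<^bsub>?F\<^esub> f) i : J \<cdot> D" using a by (simp add: R.free_simps ideal_prod.prod)
  then show "a \<odot>\<^bsub>?F\<^esub> f : {f : carrier ?F. f i : J \<cdot> D}" using F.smult_closed[OF ac f(1)] by simp
 qed
 ultimately have "zext R S b i : J \<cdot> D" by blast
 then show ?thesis using i by (simp add: zext_def)
qed

text \<open>\<open>is_free_module\<close> asks for a basis that is a subset of \<open>M\<close>, so
  the family must be injective: two equal members would give a relation with coefficients 1 and -1,
  which \<open>nz\<close> excludes.\<close>

lemma free_of_independent:
 assumes nz: "\<one> ~= \<zero>" and T: "finite T" and g: "g : T \<rightarrow> carrier M"
  and gen: "comb (carrier R) T g = carrier M"
  and indep: "!!d i. d : T \<rightarrow> carrier R ==> lc M T d g = 0\<^sub>M ==> i : T ==> d i = \<zero>"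
 shows "is_free_module R M"
proof -
 let ?B = "g ` T"
 have gc: "!!j. j : T ==> g j : carrier M" using g by auto
 have inj: "inj_on g T"
 proof (rule inj_onI, rule ccontr)
  fix i j assume ij: "i : T" "j : T" "g i = g j" "i ~= j"
  let ?d = "%k. if k = i then \<one> else \<zero>" and ?d' = "%k. if k = j then \<ominus> \<one> else \<zero>"
  have "lc M T (%k. ?d k \<oplus> ?d' k) g = lc M T ?d g +\<^sub>M lc M T ?d' g"
   by (rule lc_add[symmetric]) (use g in auto)
  also have "\<dots> = \<one> *\<^sub>M g i +\<^sub>M (\<ominus> \<one>) *\<^sub>M g j"
   using lc_single[OF T ij(1) R.one_closed g] lc_single[OF T ij(2) _ g, of "\<ominus> \<one>"] by simp
  also have "\<dots> = 0\<^sub>M" using ij gc by (simp add: smult_l_minus M.r_neg)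
  finally have "?d i \<oplus> ?d' i = \<zero>" by (intro indep[OF _ _ ij(1)]) auto
  then show False using ij(4) nz by simp
 qed
 have B: "finite ?B" "(%x. x) : ?B \<rightarrow> carrier M" "?B <= carrier M" using T gc by auto
 have reidx: "lc M ?B f (%x. x) = lc M T (%i. f (g i)) g" if f: "f : ?B \<rightarrow> carrier R" for f
  unfolding lc_def by (rule M.add.finprod_reindex[OF _ inj]) (use f gc in auto)
 interpret e: linear R "free_module R ?B" M "lin_comb R M"
  unfolding lin_comb_eq_fext by (rule linear_fext) (use B in blast)
 have "bij_betw (lin_comb R M) (carrier (free_module R ?B)) (carrier M)"
  unfolding bij_betw_def
 proof
  show "inj_on (lin_comb R M) (carrier (free_module R ?B))"
  proof (rule inj_onI)
   fix f f' assume f: "f : carrier (free_module R ?B)" "f' : carrier (free_module R ?B)"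
    "lin_comb R M f = lin_comb R M f'"
   define u where "u = f \<ominus>\<^bsub>free_module R ?B\<^esub> f'"
   have u: "u : carrier (free_module R ?B)" "lin_comb R M u = 0\<^sub>M"
    using f unfolding u_def by (simp_all add: e.h_minus M.minus_eqI)
   have "lc M T (%i. u (g i)) g = 0\<^sub>M"
    using fext_eq_lc[OF B(1) u(1) B(2)] reidx u(2) by (simp add: lin_comb_eq_fext)
   moreover have uc: "!!i. u i : carrier R" "!!i. i ~: ?B ==> u i = \<zero>"
    using u(1) unfolding R.free_carrier by blast+
   ultimately have "u (g i) = \<zero>" if "i : T" for i using indep[OF _ _ that, of "%i. u (g i)"] by simp
   then have "u x = \<zero>" for x using uc(2)[of x] by blast
   then have "u = \<zero>\<^bsub>free_module R ?B\<^esub>" by (auto simp: R.free_simps)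
   then have "f = \<zero>\<^bsub>free_module R ?B\<^esub> \<oplus>\<^bsub>free_module R ?B\<^esub> f'"
    using e.M.M.minus_plus_cancel[OF f(1,2)] by (simp add: u_def)
   then show "f = f'" using f(2) by simp
  qed
  show "lin_comb R M ` carrier (free_module R ?B) = carrier M"
  proof
   show "lin_comb R M ` carrier (free_module R ?B) <= carrier M" by auto
   show "carrier M <= lin_comb R M ` carrier (free_module R ?B)"
   proof
    fix v assume "v : carrier M"
    then obtain b where b: "b : T \<rightarrow> carrier R" "v = lc M T b g"
     using gen by (auto simp: comb_def)
    define c where "c = (%x. b (the_inv_into T g x))"
    have c: "c : ?B \<rightarrow> carrier R" using b(1) by (auto simp: c_def the_inv_into_f_f[OF inj])
    have "lc M ?B c (%x. x) = lc M T (%i. c (g i)) g" by (rule reidx[OF c])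
    also have "\<dots> = lc M T b g"
     by (rule lc_cong[OF _ b(1) g]) (simp add: c_def the_inv_into_f_f[OF inj])
    finally show "v : lin_comb R M ` carrier (free_module R ?B)"
     using fext_image[OF B(1,2)] c b(2) unfolding lin_comb_eq_fext comb_def by auto
   qed
  qed
 qed
 then show ?thesis using B(3) module_axioms unfolding is_free_module_def by blast
qed

end

subsection \<open>Hilbert functions\<close>

text \<open>A graded module over \<open>R[y\<^sub>1, \<dots>, y\<^sub>j]\<close> is encoded by its pieces \<open>X n / Y n\<close>, subquotients of
 one fixed module \<open>M\<close>, with each \<open>y\<^sub>i \<in> R\<close> acting with degree 1.\<close>

definition graded_pair :: "('a, 'k) ring_scheme => ('a, 'm, 'l) module_scheme => 'a set =>
  (nat => 'm set) => (nat => 'm set) => bool"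
 where "graded_pair R M ys X Y \<longleftrightarrow> (ALL n. submodule (X n) R M & submodule (Y n) R M & Y n <= X n &
  (ALL y:ys. ALL x:X n. y \<odot>\<^bsub>M\<^esub> x : X (Suc n)) & (ALL y:ys. ALL x:Y n. y \<odot>\<^bsub>M\<^esub> x : Y (Suc n)))"

definition graded_chain :: "('a, 'k) ring_scheme => ('a, 'm, 'l) module_scheme => 'a set =>
  (nat => 'm set) => (nat => 'm set) => (nat => nat => 'm set) => bool"
 where "graded_chain R M ys X Y Z \<longleftrightarrow> (ALL k n. submodule (Z k n) R M & Y n <= Z k n & Z k n <= X n &
  Z k n <= Z (Suc k) n & (ALL y:ys. ALL x:Z k n. y \<odot>\<^bsub>M\<^esub> x : Z k (Suc n)))"

text \<open>The chain condition on graded submodules between \<open>Y\<close> and \<open>X\<close>,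
  with one index \<open>k0\<close> for all degrees.\<close>

definition graded_noeth :: "('a, 'k) ring_scheme => ('a, 'm, 'l) module_scheme => 'a set =>
  (nat => 'm set) => (nat => 'm set) => bool"
 where "graded_noeth R M ys X Y \<longleftrightarrow>
  (ALL Z. graded_chain R M ys X Y Z --> (EX k0. ALL k>=k0. ALL n. Z k n = Z k0 n))"

lemma graded_pairD:
 assumes "graded_pair R M ys X Y"
 shows "submodule (X n) R M" "submodule (Y n) R M" "Y n <= X n"
  "y : ys ==> x : X n ==> y \<odot>\<^bsub>M\<^esub> x : X (Suc n)" "y : ys ==> x : Y n ==> y \<odot>\<^bsub>M\<^esub> x : Y (Suc n)"
 using assms unfolding graded_pair_def by blast+

lemma graded_chainD:
 assumes "graded_chain R M ys X Y Z"
 shows "submodule (Z k n) R M" "Y n <= Z k n" "Z k n <= X n" "Z k n <= Z (Suc k) n"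
  "y : ys ==> x : Z k n ==> y \<odot>\<^bsub>M\<^esub> x : Z k (Suc n)"
 using assms unfolding graded_chain_def by blast+

lemma graded_chain_mono: "graded_chain R M ys X Y Z ==> k <= k' ==> Z k n <= Z k' n"
 using lift_Suc_mono_le[of "%k. Z k n" k k'] graded_chainD(4) by metis

lemma graded_noethD:
 assumes "graded_noeth R M ys X Y" "graded_chain R M ys X Y Z"
 shows "EX k0. ALL k>=k0. ALL n. Z k n = Z k0 n"
 using assms unfolding graded_noeth_def by blast

text \<open>Besides passing to a subquotient, this drops operators that act on it as zero; the
  induction in \<open>hilbert_serre\<close> depends on that.\<close>

lemma graded_noeth_mono:
 assumes N: "graded_noeth R M ys X Y" and X: "!!n. X' n <= X n" and Y: "!!n. Y n <= Y' n"
  and ys: "!!y x n. y : ys ==> y ~: ys' ==> x : X' n ==> y \<odot>\<^bsub>M\<^esub> x : Y' (Suc n)"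
 shows "graded_noeth R M ys' X' Y'"
 unfolding graded_noeth_def
proof (intro allI impI)
 fix Z assume Z: "graded_chain R M ys' X' Y' Z"
 note d = graded_chainD[OF Z]
 have "graded_chain R M ys X Y Z"
  unfolding graded_chain_def
 proof (intro allI conjI ballI)
  fix k n
  show "submodule (Z k n) R M" "Z k n <= Z (Suc k) n" by (fact d)+
  show "Y n <= Z k n" "Z k n <= X n" using d(2)[of n k] d(3)[of k n] X[of n] Y[of n] by auto
  show "y \<odot>\<^bsub>M\<^esub> x : Z k (Suc n)" if y: "y : ys" and x: "x : Z k n" for y x
  proof (cases "y : ys'")
   case True then show ?thesis using d(5) x by blast
  next
   case False
   have "y \<odot>\<^bsub>M\<^esub> x : Y' (Suc n)" by (rule ys[OF y False]) (use d(3) x in blast)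
   then show ?thesis using d(2) by blast
  qed
 qed
 then show "EX k0. ALL k>=k0. ALL n. Z k n = Z k0 n" by (rule graded_noethD[OF N])
qed

context module
begin

text \<open>The elements of polynomial degree less than \<open>d\<close> in a new variable acting as \<open>y\<close>, with
 coefficients in the \<open>X n\<close>; the coefficient of the leading power sits in degree \<open>e\<close>.\<close>

primrec low :: "'a => (nat => 'c set) => nat => nat => 'c set"
 where "low y X 0 e = {0\<^sub>M}"
 | "low y X (Suc d) e = scale (y [^] d) (X e) <+>\<^sub>M low y X d (Suc e)"

context
 fixes y ys X
 assumes y: "y : carrier R" and X: "graded_pair R M ys X (%_. {\<zero>\<^bsub>M\<^esub>})" and ys: "ys <= carrier R"
begin

lemma submodule_low: "submodule (low y X d e) R M"
 by (induction d arbitrary: e)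
   (use y graded_pairD[OF X] in \<open>auto intro!: submodule_set_add submodule_scale submodule_singleton_zero\<close>)

lemma low_act: "a : ys ==> x : low y X d e ==> a *\<^sub>M x : low y X d (Suc e)"
proof (induction d arbitrary: x e)
 case 0
 then show ?case using ys by (auto simp: subset_iff)
next
 case (Suc d)
 have ac: "a : carrier R" using Suc.prems(1) ys by blast
 obtain u v where u: "u : X e" "v : low y X d (Suc e)" "x = y [^] d *\<^sub>M u +\<^sub>M v"
  using Suc.prems(2) by (auto simp: mem_set_add mem_scale)
 have uc: "u : carrier M" and vc: "v : carrier M"
  using submodule_carrier[OF graded_pairD(1)[OF X] u(1)] submodule_carrier[OF submodule_low u(2)] by auto
 have "a *\<^sub>M x = y [^] d *\<^sub>M (a *\<^sub>M u) +\<^sub>M a *\<^sub>M v"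
  using ac y uc vc u(3) by (simp add: smult_r_distr smult_left_commute)
 moreover have "a *\<^sub>M u : X (Suc e)" by (rule graded_pairD(4)[OF X Suc.prems(1) u(1)])
 then have "y [^] d *\<^sub>M (a *\<^sub>M u) : scale (y [^] d) (X (Suc e))" by (auto simp: mem_scale)
 ultimately show ?case using Suc.IH[OF Suc.prems(1) u(2)] unfolding low.simps(2) mem_set_add by blast
qed

lemma low_shift: "low y X d (Suc e) <= low y X (Suc d) e"
 using set_add_upper2[OF submodule_scale[OF graded_pairD(1)[OF X], of "y [^] d" e] submodule_low] y by simp

lemma low_mult: "x : low y X d e ==> y *\<^sub>M x : low y X (Suc d) e"
proof (induction d arbitrary: x e)
 case 0
 then have "y *\<^sub>M x = 0\<^sub>M" using y by simp
 then show ?case using submodule_zero[OF submodule_low] by metis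
next
 case (Suc d)
 obtain u v where u: "u : X e" "v : low y X d (Suc e)" "x = y [^] d *\<^sub>M u +\<^sub>M v"
  using Suc.prems by (auto simp: mem_set_add mem_scale)
 have uc: "u : carrier M" and vc: "v : carrier M"
  using submodule_carrier[OF graded_pairD(1)[OF X] u(1)] submodule_carrier[OF submodule_low u(2)] by auto
 have "y *\<^sub>M x = y [^] (Suc d) *\<^sub>M u +\<^sub>M y *\<^sub>M v"
  using y uc vc u(3) by (simp add: smult_r_distr smult_assoc1[symmetric] R.m_comm)
 moreover have "y [^] (Suc d) *\<^sub>M u : scale (y [^] (Suc d)) (X e)" using u(1) by (auto simp: mem_scale)
 ultimately have "y *\<^sub>M x : scale (y [^] (Suc d)) (X e) <+>\<^sub>M low y X (Suc d) (Suc e)"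
  using Suc.IH[OF u(2)] unfolding mem_set_add by blast
 then show ?case by (subst low.simps(2))
qed

text \<open>The possible coefficients of \<open>y^d\<close> in elements of \<open>Z (d + e)\<close>
  of degree at most \<open>d\<close> in \<open>y\<close>. An element of \<open>M\<close> does not
  determine a polynomial, so the coefficient is taken modulo terms of lower degree.\<close>

definition lead :: "(nat => 'c set) => nat => nat => 'c set"
 where "lead Z d e = {u : X e. y [^] d *\<^sub>M u : Z (d + e) <+>\<^sub>M low y X d (Suc e)}"

lemma lead_iff:
 assumes Z: "submodule (Z (d + e)) R M"
 shows "u : lead Z d e \<longleftrightarrow> u : X e & (EX v:low y X d (Suc e). y [^] d *\<^sub>M u +\<^sub>M v : Z (d + e))"
proof (cases "u : X e")
 case True
 define x where "x = y [^] d *\<^sub>M u"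
 have xc: "x : carrier M"
  unfolding x_def using submodule_carrier[OF graded_pairD(1)[OF X] True] y by simp
 note L = submodule_low[of d "Suc e"]
 have "x : Z (d + e) <+>\<^sub>M low y X d (Suc e) \<longleftrightarrow> (EX v:low y X d (Suc e). x +\<^sub>M v : Z (d + e))"
 proof
  assume "x : Z (d + e) <+>\<^sub>M low y X d (Suc e)"
  then obtain z v where v: "z : Z (d + e)" "v : low y X d (Suc e)" "x = z +\<^sub>M v" by (auto simp: mem_set_add)
  have "x +\<^sub>M \<ominus>\<^bsub>M\<^esub> v = z"
   using v(3) submodule_carrier[OF Z v(1)] submodule_carrier[OF L v(2)] by (simp add: M.a_assoc M.r_neg)
  then show "EX v:low y X d (Suc e). x +\<^sub>M v : Z (d + e)"
   using v(1) submoduleE(3)[OF L v(2)] by metis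
 next
  assume "EX v:low y X d (Suc e). x +\<^sub>M v : Z (d + e)"
  then obtain v where v: "v : low y X d (Suc e)" "x +\<^sub>M v : Z (d + e)" by blast
  have "x = (x +\<^sub>M v) +\<^sub>M \<ominus>\<^bsub>M\<^esub> v"
   using xc submodule_carrier[OF L v(1)] by (simp add: M.a_assoc M.r_neg)
  then show "x : Z (d + e) <+>\<^sub>M low y X d (Suc e)"
   unfolding mem_set_add using v(2) submoduleE(3)[OF L v(1)] by blast
 qed
 then show ?thesis using True by (simp add: lead_def x_def)
qed (simp add: lead_def)

text \<open>Descent on the degree \<open>d\<close> in \<open>y\<close>: the leading coefficient of
  an element of \<open>Z' n\<close> is realised in \<open>Z n\<close>, and the difference has
  smaller degree.\<close>

lemma lead_determines:
 assumes Z: "!!n. submodule (Z n) R M" and Z': "!!n. submodule (Z' n) R M" and ZZ': "!!n. Z n <= Z' n"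
  and lead: "!!d e. lead Z' d e <= lead Z d e"
 shows "d + e = Suc n ==> x : Z' n ==> x : low y X d e ==> x : Z n"
proof (induction d arbitrary: e x)
 case 0
 then show ?case using submodule_zero[OF Z] by simp
next
 case (Suc d)
 have n: "n = d + e" using Suc.prems(1) by simp
 obtain u v where u: "u : X e" "v : low y X d (Suc e)" "x = y [^] d *\<^sub>M u +\<^sub>M v"
  using Suc.prems(3) by (auto simp: mem_set_add mem_scale)
 have uc: "u : carrier M" and vc: "v : carrier M"
  using submodule_carrier[OF graded_pairD(1)[OF X] u(1)] submodule_carrier[OF submodule_low u(2)] by auto
 have "u : lead Z' d e" using lead_iff[of Z' d e u, OF Z'] u Suc.prems(2) n by blast
 then have "u : lead Z d e" using lead by blast
 then obtain v' where v': "v' : low y X d (Suc e)" "y [^] d *\<^sub>M u +\<^sub>M v' : Z n"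
  using lead_iff[of Z d e u, OF Z] n by blast
 let ?z = "y [^] d *\<^sub>M u +\<^sub>M v'"
 have v'c: "v' : carrier M" by (rule submodule_carrier[OF submodule_low v'(1)])
 have pc: "y [^] d *\<^sub>M u : carrier M" using y uc by simp
 have "v \<ominus>\<^bsub>M\<^esub> v' = x \<ominus>\<^bsub>M\<^esub> ?z"
  using pc vc v'c u(3) by (simp add: a_minus_def M.minus_add M.a_ac M.r_neg M.r_neg2 M.r_neg1)
 moreover have "x \<ominus>\<^bsub>M\<^esub> ?z : Z' n" using Suc.prems(2) v'(2) ZZ' by (intro submodule_minus[OF Z']) auto
 moreover have "v \<ominus>\<^bsub>M\<^esub> v' : low y X d (Suc e)" by (rule submodule_minus[OF submodule_low u(2) v'(1)])
 ultimately have "x \<ominus>\<^bsub>M\<^esub> ?z : Z n" using Suc.IH[of "Suc e"] Suc.prems(1) by simp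
 then have "x \<ominus>\<^bsub>M\<^esub> ?z +\<^sub>M ?z : Z n" using v'(2) by (rule submoduleE(5)[OF Z])
 then show ?case using pc vc v'c u(3) by (simp add: M.minus_plus_cancel)
qed

text \<open>Hilbert's basis theorem: chains are controlled by their leading coefficients.\<close>

lemma graded_noeth_adjoin:
 assumes N: "graded_noeth R M ys X (%_. {0\<^sub>M})"
 shows "graded_noeth R M (insert y ys) (%n. low y X (Suc n) 0) (%_. {0\<^sub>M})"
 unfolding graded_noeth_def
proof (intro allI impI)
 fix Z assume Z: "graded_chain R M (insert y ys) (%n. low y X (Suc n) 0) (%_. {0\<^sub>M}) Z"
 note d = graded_chainD[OF Z]
 define L where "L k = lead (Z k)" for k
 have L_iff: "u : L k i e \<longleftrightarrow> u : X e & (EX v:low y X i (Suc e). y [^] i *\<^sub>M u +\<^sub>M v : Z k (i + e))" for k i e u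
  unfolding L_def by (rule lead_iff[OF d(1)])
 have Ls: "submodule (L k i e) R M" for k i e
  unfolding L_def lead_def
  by (intro linear.submodule_preimage[OF linear_mult] graded_pairD(1)[OF X] submodule_set_add d(1) submodule_low)
    (simp add: y)
 have Lk: "L k i e <= L k' i e" if "k <= k'" for k k' i e
  using graded_chain_mono[OF Z that, of "i + e"] unfolding subset_iff L_iff by blast
 have xc: "u : X e ==> u : carrier M" for u e by (rule submodule_carrier[OF graded_pairD(1)[OF X]])
 have lc: "v : low y X i e ==> v : carrier M" for v i e by (rule submodule_carrier[OF submodule_low])
 have Li': "L k i e <= L k (Suc i) e" for k i e
 proof
  fix u assume "u : L k i e"
  then obtain v where v: "u : X e" "v : low y X i (Suc e)" "y [^] i *\<^sub>M u +\<^sub>M v : Z k (i + e)"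
   unfolding L_iff by blast
  have "y *\<^sub>M (y [^] i *\<^sub>M u +\<^sub>M v) : Z k (Suc (i + e))" by (rule d(5)[OF insertI1 v(3)])
  moreover have "y *\<^sub>M (y [^] i *\<^sub>M u +\<^sub>M v) = y [^] (Suc i) *\<^sub>M u +\<^sub>M y *\<^sub>M v"
   using y xc[OF v(1)] lc[OF v(2)] by (simp add: smult_r_distr smult_assoc1[symmetric] R.m_comm)
  ultimately have "y [^] (Suc i) *\<^sub>M u +\<^sub>M y *\<^sub>M v : Z k (Suc i + e)" by simp
  then show "u : L k (Suc i) e" unfolding L_iff using v(1) low_mult[OF v(2)] by blast
 qed
 have Li: "L k i e <= L k i' e" if "i <= i'" for k i i' e
  using lift_Suc_mono_le[of "%i. L k i e", OF Li' that] .
 have La: "a *\<^sub>M u : L k i (Suc e)" if a: "a : ys" and u: "u : L k i e" for a u k i e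
 proof -
  have ac: "a : carrier R" using a ys by blast
  obtain v where v: "u : X e" "v : low y X i (Suc e)" "y [^] i *\<^sub>M u +\<^sub>M v : Z k (i + e)"
   using u unfolding L_iff by blast
  have "a *\<^sub>M (y [^] i *\<^sub>M u +\<^sub>M v) : Z k (Suc (i + e))" by (rule d(5)[OF insertI2[OF a] v(3)])
  moreover have "a *\<^sub>M (y [^] i *\<^sub>M u +\<^sub>M v) = y [^] i *\<^sub>M (a *\<^sub>M u) +\<^sub>M a *\<^sub>M v"
   using y ac xc[OF v(1)] lc[OF v(2)] by (simp add: smult_r_distr smult_left_commute)
  ultimately have "y [^] i *\<^sub>M (a *\<^sub>M u) +\<^sub>M a *\<^sub>M v : Z k (i + Suc e)" by simp
  then show ?thesis unfolding L_iff using graded_pairD(4)[OF X a v(1)] low_act[OF a v(2)] by blast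
 qed
 have stab: "EX k0. ALL k>=k0. ALL e. L (\<kappa> k) (\<iota> k) e = L (\<kappa> k0) (\<iota> k0) e"
  if m: "!!k. \<kappa> k <= \<kappa> (Suc k)" "!!k. \<iota> k <= \<iota> (Suc k)" for \<kappa> \<iota> :: "nat => nat"
 proof (rule graded_noethD[OF N])
  show "graded_chain R M ys X (%_. {0\<^sub>M}) (%k. L (\<kappa> k) (\<iota> k))"
   unfolding graded_chain_def
  proof (intro allI conjI ballI)
   fix k n
   show "submodule (L (\<kappa> k) (\<iota> k) n) R M" by (rule Ls)
   show "{0\<^sub>M} <= L (\<kappa> k) (\<iota> k) n" using submodule_zero[OF Ls] by simp
   show "L (\<kappa> k) (\<iota> k) n <= X n" unfolding L_def lead_def by blast
   show "L (\<kappa> k) (\<iota> k) n <= L (\<kappa> (Suc k)) (\<iota> (Suc k)) n" using Lk[OF m(1)] Li[OF m(2)] by blast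
  qed (rule La)
 qed
 \<comment> \<open>\<open>L k i\<close> increases in both indices. Its diagonal is stationary from
   \<open>k0\<close> on, which settles all \<open>i \<ge> k0\<close>; the finitely many
   \<open>i < k0\<close> become stationary separately, and \<open>K\<close> bounds all these
   indices.\<close>
 obtain k0 where k0: "!!k e. k0 <= k ==> L k k e = L k0 k0 e" using stab[of "%k. k" "%k. k"] by auto
 have "EX k1. ALL k>=k1. ALL e. L k i e = L k1 i e" for i using stab[of "%k. k" "%_. i"] by simp
 then obtain \<kappa> where \<kappa>: "!!i k e. \<kappa> i <= k ==> L k i e = L (\<kappa> i) i e" by metis
 define K where "K = Max (insert k0 (\<kappa> ` {..<k0}))"
 have K0: "k0 <= K" unfolding K_def by (rule Max_ge) auto
 have K1: "\<kappa> i <= K" if "i < k0" for i unfolding K_def by (rule Max_ge) (use that in auto)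
 have LK: "L k i e = L K i e" if k: "K <= k" for k i e
 proof (cases "i < k0")
  case True
  then show ?thesis using \<kappa>[of i k e] \<kappa>[of i K e] K1[OF True] k by simp
 next
  case False
  have top: "L k' i e = L k0 k0 e" if "k0 <= k'" for k'
  proof
   show "L k0 k0 e <= L k' i e" using Lk[OF that, of k0 e] Li[of k0 i k' e] False by auto
   show "L k' i e <= L k0 k0 e"
    using Lk[of k' "max k' i" i e] Li[of i "max k' i" "max k' i" e] k0[of "max k' i" e] that by auto
  qed
  show ?thesis using top[of k] top[of K] K0 k by simp
 qed
 have "Z k n <= Z K n" if k: "K <= k" for k n
 proof
  fix x assume x: "x : Z k n"
  show "x : Z K n"
  proof (rule lead_determines[of "Z K" "Z k", OF d(1) d(1) _ _ _ x])
   show "Z K m <= Z k m" for m by (rule graded_chain_mono[OF Z k])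
   show "lead (Z k) i e <= lead (Z K) i e" for i e using LK[OF k] by (simp add: L_def)
   show "x : low y X (Suc n) 0" using d(3) x by blast
  qed simp
 qed
 then show "EX k0. ALL k>=k0. ALL n. Z k n = Z k0 n" using graded_chain_mono[OF Z] by blast
qed

lemma graded_pair_adjoin:
 "graded_pair R M (insert y ys) (%n. low y X (Suc n) 0) (%_. {0\<^sub>M})"
 unfolding graded_pair_def
proof (intro allI conjI ballI)
 fix n
 show "submodule (low y X (Suc n) 0) R M" by (rule submodule_low)
 show "{0\<^sub>M} <= low y X (Suc n) 0" using submodule_zero[OF submodule_low] by blast
 show "a *\<^sub>M x : low y X (Suc (Suc n)) 0" if a: "a : insert y ys" and x: "x : low y X (Suc n) 0" for a x
 proof (cases "a = y")
  case True then show ?thesis using low_mult[OF x] by simp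
 next
  case False
  then have "a *\<^sub>M x : low y X (Suc n) (Suc 0)" using low_act[OF _ x] a by blast
  then show ?thesis using low_shift[of "Suc n" 0] by blast
 qed
 show "a *\<^sub>M x : {0\<^sub>M}" if "a : insert y ys" "x : {0\<^sub>M}" for a x using that y ys by auto
qed (rule submodule_singleton_zero)

end

end

context module
begin

lemma graded_noeth_degree_zero:
 assumes acc: "!!Z. (!!k::nat. submodule (Z k) R M & Z k <= Z (Suc k)) ==> EX k0. ALL k>=k0. Z k = Z k0"
 shows "graded_noeth R M {} (%n. if n = 0 then carrier M else {0\<^sub>M}) (%_. {0\<^sub>M})"
 unfolding graded_noeth_def
proof (intro allI impI)
 fix Z assume Z: "graded_chain R M {} (%n. if n = 0 then carrier M else {0\<^sub>M}) (%_. {0\<^sub>M}) Z"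
 note d = graded_chainD[OF Z]
 obtain k0 where k0: "!!k. k0 <= k ==> Z k 0 = Z k0 0" using acc[of "%k. Z k 0"] d(1,4) by blast
 have "Z k n = Z k0 n" if "k0 <= k" for k n
  using k0[OF that] d(2,3)[of k n] d(2,3)[of k0 n] by (cases "n = 0") auto
 then show "EX k0. ALL k>=k0. ALL n. Z k n = Z k0 n" by blast
qed

lemma graded_pair_degree_zero:
 "graded_pair R M {} (%n. if n = 0 then carrier M else {0\<^sub>M}) (%_. {0\<^sub>M})"
 unfolding graded_pair_def using carrier_is_submodule submodule_singleton_zero by auto

end

lemma (in noeth_module) acc:
 assumes M: "fg R M (carrier M)" and Z: "!!k::nat. submodule (Z k) R M & Z k <= Z (Suc k)"
 shows "EX k0. ALL k>=k0. Z k = Z k0"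
proof -
 have mono: "Z k <= Z l" if "k <= l" for k l
  using lift_Suc_mono_le[of Z, OF _ that] Z by blast
 have "submodule (\<Union>k. Z k) R M"
 proof (rule submoduleI)
  show "(\<Union>k. Z k) <= carrier M" using Z submoduleE(1) by blast
  show "0\<^sub>M : (\<Union>k. Z k)" using Z submodule_zero by blast
  show "\<ominus>\<^bsub>M\<^esub> a : (\<Union>k. Z k)" if "a : (\<Union>k. Z k)" for a using that Z submoduleE(3) by blast
  show "a *\<^sub>M x : (\<Union>k. Z k)" if "a : carrier R" "x : (\<Union>k. Z k)" for a x
   using that Z submoduleE(4) by blast
  fix a b assume "a : (\<Union>k. Z k)" "b : (\<Union>k. Z k)"
  then obtain k l where kl: "a : Z k" "b : Z l" by blast
  then have "a : Z (max k l)" "b : Z (max k l)" using mono[of k "max k l"] mono[of l "max k l"] by auto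
  then show "a +\<^sub>M b : (\<Union>k. Z k)" using Z submoduleE(5) by blast
 qed
 then have "fg R M (\<Union>k. Z k)" by (rule submodule_fg[OF M]) (use Z submoduleE(1) in blast)
 then obtain k0 where k0: "(\<Union>k. Z k) <= Z k0" using fg_chain_bound[where Z = Z, OF _ Z subset_refl] by blast
 have "Z k = Z k0" if "k0 <= k" for k using mono[OF that] k0 by blast
 then show ?thesis by blast
qed

context noeth_module
begin

text \<open>\<open>M\<close> concentrated in degree 0 satisfies the chain condition, and each
  operator is adjoined by the basis theorem.\<close>

lemma graded_noeth_generators:
 assumes M: "fg R M (carrier M)" and ys: "finite ys" "ys <= carrier R"
 shows "EX X. graded_pair R M ys X (%_. {0\<^sub>M}) & graded_noeth R M ys X (%_. {0\<^sub>M}) & X 0 = carrier M"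
 using ys
proof (induction rule: finite_induct)
 case empty
 show ?case
  by (rule exI, intro conjI, rule graded_pair_degree_zero, rule graded_noeth_degree_zero[OF acc[OF M]])
    auto
next
 case (insert y ys)
 obtain X where X: "graded_pair R M ys X (%_. {0\<^sub>M})" "graded_noeth R M ys X (%_. {0\<^sub>M})"
  "X 0 = carrier M" using insert by auto
 have y: "y : carrier R" "ys <= carrier R" using insert.prems by auto
 have "low y X (Suc 0) 0 = carrier M"
  using scale_subset[OF carrier_is_submodule R.one_closed] set_add_zero[OF carrier_is_submodule]
  by (simp add: X(3) scale_def)
 then show ?case using graded_pair_adjoin[OF y(1) X(1) y(2)] graded_noeth_adjoin[OF y(1) X(1) y(2) X(2)] by blast
qed

text \<open>Since \<open>ys\<close> generates \<open>I\<close> and \<open>X 0 = M\<close>, the piece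
  \<open>I^n M\<close> lies inside \<open>X n\<close>; a graded submodule inherits the chain
  condition.\<close>

lemma rees_noeth:
 assumes M: "fg R M (carrier M)" and I: "ideal I R" and ys: "finite ys" "I = Idl ys" "ys <= carrier R"
 shows "graded_noeth R M ys (%n. smul M (ideal_pow R I n) (carrier M)) (%_. {0\<^sub>M})"
proof -
 obtain X where X: "graded_pair R M ys X (%_. {0\<^sub>M})" "graded_noeth R M ys X (%_. {0\<^sub>M})" "X 0 = carrier M"
  using graded_noeth_generators[OF M ys(1,3)] by blast
 note Xs = graded_pairD(1)[OF X(1)]
 have act: "a *\<^sub>M x : X (Suc n)" if a: "a : I" and x: "x : X n" for a x n
 proof -
  have xc: "x : carrier M" by (rule submodule_carrier[OF Xs x])
  have "Idl ys <= colon R M (X (Suc n)) x"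
  proof (rule genideal_minimal[OF ideal_colon[OF Xs xc]])
   show "ys <= colon R M (X (Suc n)) x"
    using graded_pairD(4)[OF X(1) _ x] ys(3) by (auto simp: colon_def)
  qed
  then show ?thesis using a ys(2) by (auto simp: colon_def)
 qed
 have pow: "a *\<^sub>M x : X n" if "a : ideal_pow R I n" "x : carrier M" for a x n
  using that
 proof (induction n arbitrary: a x)
  case 0
  then show ?case using X(3) by (simp add: ideal_pow_0[simplified])
 next
  case (Suc n)
  have "a : ideal_pow R I n \<cdot> I" using Suc.prems(1) by (simp only: ideal_pow_Suc)
  then show ?case
  proof induction
   case (prod i j)
   have c: "i : carrier R" "j : carrier R"
    using prod ideal_subset_carrier[OF ideal_pow_ideal[OF I]] ideal_subset_carrier[OF I] by auto
   have "(i \<otimes> j) *\<^sub>M x = j *\<^sub>M (i *\<^sub>M x)" using c Suc.prems(2) by (simp add: smult_assoc1 smult_left_commute)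
   then show ?case using act[OF prod(2) Suc.IH[OF prod(1) Suc.prems(2)]] by simp
  next
   case (sum a b)
   have "a : carrier R" "b : carrier R"
    using sum(1,2) ideal_subset_carrier[OF ideal_prod_is_ideal[OF ideal_pow_ideal[OF I] I]] by blast+
   then have "(a \<oplus> b) *\<^sub>M x = a *\<^sub>M x +\<^sub>M b *\<^sub>M x" using Suc.prems(2) by (simp add: smult_l_distr)
   then show ?case using submoduleE(5)[OF Xs sum(3,4)] by simp
  qed
 qed
 show ?thesis
 proof (rule graded_noeth_mono[OF X(2)])
  show "smul M (ideal_pow R I n) (carrier M) <= X n" for n by (rule smul_least[OF Xs pow])
 qed auto
qed

end

subsection \<open>The Hilbert--Serre theorem\<close>

text \<open>The functions that are differences of polynomials are closed under linear combinations;
  \<open>n^d\<close> is obtained from the difference of \<open>n^(d+1)\<close> by removing lower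
  powers with the binomial formula.\<close>

lemma poly_antidifference:
 "EX r::rat poly. ALL n::nat. poly r (of_nat n + 1) - poly r (of_nat n) = poly q (of_nat n)"
proof -
 let ?A = "%(f::nat => rat). EX r::rat poly. ALL n::nat. poly r (of_nat n + 1) - poly r (of_nat n) = f n"
 have add: "?A (%n. f n + g n)" if "?A f" "?A g" for f g
 proof -
  from that obtain r s where r: "!!n::nat. poly r (of_nat n + 1) - poly r (of_nat n) = f n"
   and s: "!!n::nat. poly s (of_nat n + 1) - poly s (of_nat n) = g n" by blast
  show ?thesis by (rule exI[of _ "r + s"]) (simp add: r[symmetric] s[symmetric] algebra_simps)
 qed
 have mult: "?A (%n. c * f n)" if "?A f" for c f
 proof -
  from that obtain r where r: "!!n::nat. poly r (of_nat n + 1) - poly r (of_nat n) = f n" by blast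
  show ?thesis by (rule exI[of _ "[:c:] * r"]) (simp add: r[symmetric] algebra_simps)
 qed
 have sum: "?A (%n. \<Sum>i<d. f i n)" if "!!i. i < d ==> ?A (f i)" for f :: "nat => nat => rat" and d :: nat
  using that
 proof (induction d)
  case 0
  show ?case by (rule exI[of _ 0]) simp
 next
  case (Suc d)
  then show ?case using add[of "%n. \<Sum>i<d. f i n" "f d"] by simp
 qed
 have power: "?A (%n. of_nat n ^ d)" for d :: nat
 proof (induction d rule: less_induct)
  case (less d)
  have "?A (%n. \<Sum>i<d. of_nat (Suc d choose i) * of_nat n ^ i)" by (intro sum mult less)
  then have "?A (%n. - 1 * (\<Sum>i<d. of_nat (Suc d choose i) * of_nat n ^ i))" by (rule mult)
  moreover have "?A (%n. (of_nat n + 1) ^ Suc d - of_nat n ^ Suc d)"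
   by (rule exI[of _ "[:0, 1:] ^ Suc d"]) (simp del: power_Suc add: poly_power)
  ultimately have "?A (%n. ((of_nat n + 1) ^ Suc d - of_nat n ^ Suc d) +
    - 1 * (\<Sum>i<d. of_nat (Suc d choose i) * of_nat n ^ i))" by (rule add[rotated])
  then have "?A (%n. (1 / of_nat (Suc d)) * (((of_nat n + 1) ^ Suc d - of_nat n ^ Suc d) +
    - 1 * (\<Sum>i<d. of_nat (Suc d choose i) * of_nat n ^ i)))" by (rule mult)
  moreover have "(x + 1) ^ Suc d - x ^ Suc d = of_nat (Suc d) * x ^ d + (\<Sum>i<d. of_nat (Suc d choose i) * x ^ i)" for x :: rat
  proof -
   have "(x + 1) ^ Suc d = (\<Sum>i\<le>Suc d. of_nat (Suc d choose i) * x ^ i)"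
    using binomial_ring[of x 1 "Suc d"] by simp
   also have "\<dots> = (\<Sum>i<d. of_nat (Suc d choose i) * x ^ i) + of_nat (Suc d choose d) * x ^ d + x ^ Suc d"
    by (simp add: lessThan_Suc_atMost[symmetric] del: power_Suc binomial_Suc_Suc binomial_Suc_n)
   also have "Suc d choose d = Suc d" by simp
   finally show ?thesis by simp
  qed
  ultimately show ?case by (simp del: power_Suc of_nat_Suc)
 qed
 have "?A (%n. \<Sum>i<Suc (Polynomial.degree q). coeff q i * of_nat n ^ i)" by (intro sum mult power)
 then show ?thesis by (simp add: poly_altdef lessThan_Suc_atMost del: sum.lessThan_Suc)
qed

definition numerical :: "(nat => enat) => rat poly => bool"
 where "numerical l p \<longleftrightarrow> (\<forall>\<^sub>F n in sequentially. EX k::nat. l n = enat k & poly p (of_nat n) = of_nat k)"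

text \<open>The two identities give \<open>l (n+1) - l n = c (n+1) - k n\<close>, eventually a
  polynomial; \<open>pcompose p [:1, 1:]\<close> is \<open>p\<close> shifted by one. So
  \<open>l\<close> is a polynomial antidifference up to a constant, fixed at
  \<open>n0\<close>.\<close>

lemma numerical_step:
 fixes l a k c :: "nat => enat"
 assumes l: "!!n. l n = a n + k n" and ls: "!!n. l (Suc n) = c (Suc n) + a n" and fin: "!!n. l n ~= \<infinity>"
  and c: "numerical c p" and k: "numerical k q"
 shows "EX p. numerical l p"
proof -
 obtain r where r: "!!n::nat. poly r (of_nat n + 1) - poly r (of_nat n) = poly (pcompose p [:1, 1:] - q) (of_nat n)"
  using poly_antidifference by blast
 define L where "L n = the_enat (l n)" for n
 have L: "l n = enat (L n)" for n using fin[of n] by (cases "l n") (simp_all add: L_def)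
 obtain n0 where n0: "!!n. n0 <= n ==> (EX k::nat. c n = enat k & poly p (of_nat n) = of_nat k) &
   (EX j::nat. k n = enat j & poly q (of_nat n) = of_nat j)"
  using eventually_conj[OF c[unfolded numerical_def] k[unfolded numerical_def]]
  unfolding eventually_sequentially by blast
 have diff: "(of_nat (L (Suc n)) :: rat) - of_nat (L n) = poly r (of_nat (Suc n)) - poly r (of_nat n)"
  if n: "n0 <= n" for n
 proof -
  obtain C :: nat where C: "c (Suc n) = enat C" "poly p (of_nat (Suc n)) = of_nat C" using n0[of "Suc n"] n by auto
  obtain K :: nat where K: "k n = enat K" "poly q (of_nat n) = of_nat K" using n0[OF n] by auto
  obtain a' where a': "a n = enat a'" using l[of n] L[of n] by (cases "a n") auto
  have "L (Suc n) = C + a'" "L n = a' + K" using l[of n] ls[of n] L C(1) K(1) a' by auto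
  then have "(of_nat (L (Suc n)) :: rat) - of_nat (L n) = of_nat C - of_nat K" by simp
  also have "\<dots> = poly (pcompose p [:1, 1:] - q) (of_nat n)" using C(2) K(2) by (simp add: poly_pcompose)
  finally show ?thesis using r[of n] by (simp add: add.commute)
 qed
 have const: "(of_nat (L n) :: rat) = poly r (of_nat n) + (of_nat (L n0) - poly r (of_nat n0))" if "n0 <= n" for n
  using that
 proof (induction n rule: dec_induct)
  case (step n)
  then show ?case using diff[OF step.hyps(1)] by (simp add: algebra_simps)
 qed simp
 have "numerical l (r + [:of_nat (L n0) - poly r (of_nat n0):])"
  unfolding numerical_def eventually_sequentially
 proof (intro exI allI impI conjI)
  fix n assume "n0 <= n"
  then show "poly (r + [:of_nat (L n0) - poly r (of_nat n0):]) (of_nat n) = of_nat (L n)"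
   using const[of n] by simp
 qed (rule L)
 then show ?thesis by blast
qed

context module
begin

text \<open>Multiplication by \<open>y\<close> has kernel \<open>K/Y\<close> and cokernel
  \<open>X/C\<close>. On both \<open>y\<close> acts as zero, so the induction hypothesis applies
  with the remaining operators, and the length identities feed
  \<open>numerical_step\<close>.\<close>

theorem hilbert_serre:
 assumes "finite ys" "ys <= carrier R" "graded_pair R M ys X Y" "graded_noeth R M ys X Y"
  and "!!n. len R M (X n) (Y n) ~= \<infinity>"
 shows "EX p. numerical (%n. len R M (X n) (Y n)) p"
 using assms
proof (induction ys arbitrary: X Y rule: finite_induct)
 case empty
 note d = graded_pairD[OF empty(2)]
 \<comment> \<open>Without operators the truncations at degree \<open>k\<close> form a chain; that
   it is stationary means \<open>X n = Y n\<close> for large \<open>n\<close>.\<close>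
 have "graded_chain R M {} X Y (%k n. if n <= k then X n else Y n)"
  unfolding graded_chain_def using d(1-3) by auto
 then obtain k0 where k0: "!!k n. k0 <= k ==> (if n <= k then X n else Y n) = (if n <= k0 then X n else Y n)"
  using graded_noethD[OF empty(3)] by blast
 have "len R M (X n) (Y n) = 0" if "k0 < n" for n using k0[of n n] that len_self by simp
 then have "numerical (%n. len R M (X n) (Y n)) 0"
  unfolding numerical_def eventually_sequentially
  by (intro exI[of _ "Suc k0"] allI impI exI[of _ 0]) (simp add: zero_enat_def)
 then show ?case by blast
next
 case (insert y ys)
 have y: "y : carrier R" and ys: "ys <= carrier R" using insert.prems(1) by auto
 note d = graded_pairD[OF insert.prems(2)]
 note Xc = submodule_carrier[OF d(1)]
 define K where "K n = {x : X n. y *\<^sub>M x : Y (Suc n)}" for n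
 \<comment> \<open>The image of \<open>y\<close> from degree \<open>n - 1\<close>, plus
   \<open>Y n\<close>; nothing is mapped into degree 0, hence \<open>C 0 = Y 0\<close>.\<close>
 define C where "C n = (case n of 0 => Y 0 | Suc m => scale y (X m) <+>\<^sub>M Y (Suc m))" for n
 have K: "submodule (K n) R M" for n
  unfolding K_def by (rule linear.submodule_preimage[OF linear_mult[OF y] d(1,2)])
 have KX: "K n <= X n" and YK: "Y n <= K n" for n
  using d(3)[of n] d(5)[OF insertI1] by (auto simp: K_def)
 have C: "submodule (C n) R M" for n
  unfolding C_def by (cases n) (simp_all add: d(2) submodule_set_add submodule_scale[OF d(1) y])
 have yX: "scale y (X n) <= X (Suc n)" for n using d(4)[OF insertI1] by (auto simp: mem_scale)
 have CX: "C n <= X n" for n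
  unfolding C_def using d(3) set_add_least[OF d(1) yX d(3)] by (cases n) simp_all
 have YC: "Y n <= C n" for n
  unfolding C_def using set_add_upper2[OF submodule_scale[OF d(1) y] d(2)] by (cases n) simp_all
 have yC: "y *\<^sub>M x : C (Suc n)" if "x : X n" for x n
 proof -
  have "y *\<^sub>M x : scale y (X n)" using that by (auto simp: mem_scale)
  then show ?thesis
   using set_add_upper1[OF submodule_scale[OF d(1) y, of n] d(2)[of "Suc n"]] by (auto simp: C_def)
 qed
 have aC: "a *\<^sub>M x : C (Suc n)" if a: "a : ys" and x: "x : C n" for a x n
 proof (cases n)
  case 0
  then have "x : Y n" using x by (simp add: C_def)
  then show ?thesis by (rule subsetD[OF YC d(5)[OF insertI2[OF a]]])
 next
  case (Suc m)
  have ac: "a : carrier R" using a ys by blast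
  obtain u v where u: "u : X m" "v : Y n" "x = y *\<^sub>M u +\<^sub>M v"
   using x Suc by (auto simp: C_def mem_set_add mem_scale)
  have "a *\<^sub>M x = y *\<^sub>M (a *\<^sub>M u) +\<^sub>M a *\<^sub>M v"
   using ac y Xc[OF u(1)] submodule_carrier[OF d(2) u(2)] u(3)
   by (simp add: smult_r_distr smult_left_commute)
  moreover have "y *\<^sub>M (a *\<^sub>M u) : C (Suc n)" using yC d(4)[OF insertI2[OF a] u(1)] Suc by simp
  moreover have "a *\<^sub>M v : C (Suc n)" using YC d(5)[OF insertI2[OF a] u(2)] by blast
  ultimately show ?thesis using submoduleE(5)[OF C] by simp
 qed
 have aK: "a *\<^sub>M x : K (Suc n)" if a: "a : ys" and x: "x : K n" for a x n
 proof -
  have ac: "a : carrier R" using a ys by blast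
  have "y *\<^sub>M (a *\<^sub>M x) = a *\<^sub>M (y *\<^sub>M x)"
   using ac y Xc[of x n] x by (simp add: K_def smult_left_commute)
  then show ?thesis using d(4)[OF insertI2[OF a], of x n] d(5)[OF insertI2[OF a], of "y *\<^sub>M x"] x
   by (simp add: K_def)
 qed
 have pK: "graded_pair R M ys K Y" and pC: "graded_pair R M ys X C"
  unfolding graded_pair_def using K d YK C CX aK aC by auto
 have nK: "graded_noeth R M ys K Y"
  by (rule graded_noeth_mono[OF insert.prems(3)]) (use KX in \<open>auto simp: K_def\<close>)
 have nC: "graded_noeth R M ys X C"
  by (rule graded_noeth_mono[OF insert.prems(3)]) (use YC yC in auto)
 have l1: "len R M (X n) (Y n) = len R M (X n) (K n) + len R M (K n) (Y n)" for n
  by (rule len_add[OF d(1) K d(2) YK KX])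
 have "len R M (X n) (K n) = len R M (C (Suc n)) (Y (Suc n))" for n
  by (rule linear.len_image[OF linear_mult[OF y] d(1) K KX d(2)]) (simp_all add: C_def K_def scale_def)
 then have l2: "len R M (X (Suc n)) (Y (Suc n)) = len R M (X (Suc n)) (C (Suc n)) + len R M (X n) (K n)" for n
  using len_add[OF d(1) C d(2) YC CX, of "Suc n"] by simp
 have fC: "len R M (X n) (C n) ~= \<infinity>" for n
  using len_mono[OF subset_refl YC, of R M "X n" n] insert.prems(4)[of n] by (metis enat_ord_simps(5))
 have fK: "len R M (K n) (Y n) ~= \<infinity>" for n
  using len_mono[OF KX subset_refl, of R M n "Y n"] insert.prems(4)[of n] by (metis enat_ord_simps(5))
 obtain p q where p: "numerical (%n. len R M (X n) (C n)) p" and q: "numerical (%n. len R M (K n) (Y n)) q"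
  using insert.IH[OF ys pC nC fC] insert.IH[OF ys pK nK fK] by blast
 show ?case by (rule numerical_step[OF l1 l2 insert.prems(4) p q])
qed

end

lemma (in module) smul_pow_act:
 assumes I: "ideal I R" and y: "y : I" and Z: "Z <= carrier M" and x: "x : smul M (ideal_pow R I n) Z"
 shows "y *\<^sub>M x : smul M (ideal_pow R I (Suc n)) Z"
proof -
 have yc: "y : carrier R" using y ideal_subset_carrier[OF I] by blast
 note s = submodule_smul[OF Z R.ideal_pow_ideal[OF I]]
 have "smul M (ideal_pow R I n) Z <= {x : carrier M. y *\<^sub>M x : smul M (ideal_pow R I (Suc n)) Z}"
 proof (rule smul_least)
  show "submodule {x : carrier M. y *\<^sub>M x : smul M (ideal_pow R I (Suc n)) Z} R M"
   by (rule linear.submodule_preimage[OF linear_mult[OF yc] carrier_is_submodule s])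
  fix a w assume a: "a : ideal_pow R I n" and w: "w : Z"
  have ac: "a : carrier R" using a ideal_subset_carrier[OF R.ideal_pow_ideal[OF I]] by blast
  have wc: "w : carrier M" using w Z by blast
  have "a \<otimes> y : ideal_pow R I (Suc n)" unfolding R.ideal_pow_Suc by (rule ideal_prod.prod[OF a y])
  then have "(a \<otimes> y) *\<^sub>M w : smul M (ideal_pow R I (Suc n)) Z" using w by (rule smul.smul_gen)
  moreover have "y *\<^sub>M (a *\<^sub>M w) = (a \<otimes> y) *\<^sub>M w"
   using ac yc wc by (simp add: smult_assoc1 smult_left_commute)
  ultimately show "a *\<^sub>M w : {x : carrier M. y *\<^sub>M x : smul M (ideal_pow R I (Suc n)) Z}"
   using ac wc by simp
 qed
 then show ?thesis using x by blast
qed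

locale noeth_plain = R?: noeth R + plain_module R M
 for R :: "('a, 'k) ring_scheme" (structure) and M :: "('a, 'm) module" (structure)
begin

text \<open>The quotients of \<open>K \<inter> I^n F\<close> by \<open>I^n K\<close> are a graded
  subquotient of the Rees module of \<open>F\<close>. Their length is finite because
  \<open>t^N\<close> acts on \<open>IF\<close> like \<open>z\<close>: multiplication by
  \<open>t^(N n)\<close> agrees on \<open>K \<inter> I^n F\<close> with multiplication by
  \<open>z^n\<close> and so lands in \<open>I^n K\<close>.\<close>

lemma Tor1_numerical:
 assumes I: "ideal I R" and S: "finite S" and g: "g : S \<rightarrow> carrier M"
  and gen: "comb (carrier R) S g = carrier M"
  and t: "t : carrier R" "len R (ring_module R) (carrier R) (PIdl t) ~= \<infinity>"
  and z: "z : I" "!!a. a : I ==> z \<otimes> a = t [^] (N::nat) \<otimes> a"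
 shows "EX p. numerical (%n. module_length R (Tor1 R M (quot_module (ring_module R) (ideal_pow R I n)))) p"
proof -
 let ?F = "free_module R S"
 let ?K = "{f : carrier ?F. fext R M g f = 0\<^sub>M}"
 interpret F: noeth_module R ?F by (intro noeth_module.intro R.noeth_axioms module_free)
 note Ic = ideal_subset_carrier[OF I] and Ip = ideal_pow_ideal[OF I]
 have zc: "z : carrier R" using z(1) Ic by blast
 have tN: "t [^] k : carrier R" for k :: nat using t(1) by simp
 have gc: "!!j. j : S ==> g j : carrier M" using g by auto
 interpret e: linear R ?F M "fext R M g" by (rule linear_fext[OF gc])
 have K: "submodule ?K R ?F"
  using e.submodule_preimage[OF F.carrier_is_submodule submodule_singleton_zero] by simp
 note Kc = F.submoduleE(1)[OF K]
 define X where "X n = ?K \<inter> smul ?F (ideal_pow R I n) (carrier ?F)" for n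
 define Y where "Y n = smul ?F (ideal_pow R I n) ?K" for n
 have Xs: "submodule (X n) R ?F" and Ys: "submodule (Y n) R ?F" for n
  unfolding X_def Y_def by (intro F.submodule_inter K F.submodule_smul Ip Kc subset_refl)+
 have YX: "Y n <= X n" for n
  unfolding X_def Y_def using F.smul_subset[OF K ideal_subset_carrier[OF Ip]] F.smul_mono[OF subset_refl Kc] by blast
 have u: "unit_vec R : S \<rightarrow> carrier ?F" using unit_vec_closed by auto
 have "carrier ?F <= F.comb (carrier R) S (unit_vec R)"
 proof (rule free_span[OF F.submodule_comb[OF S u oneideal]])
  fix i assume i: "i : S"
  have "lc ?F S (%j. if j = i then \<one> else \<zero>) (unit_vec R) = unit_vec R i"
   using F.lc_single[OF S i one_closed u] unit_vec_closed[OF i] by simp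
  then show "unit_vec R i : F.comb (carrier R) S (unit_vec R)"
   unfolding F.comb_def by (intro CollectI exI[of _ "%j. if j = i then \<one> else \<zero>"]) auto
 qed
 then have "carrier ?F = F.comb (carrier R) S (unit_vec R)"
  using F.submoduleE(1)[OF F.submodule_comb[OF S u oneideal]] by blast
 then have Ffg: "fg R ?F (carrier ?F)" using F.fg_comb[OF S u] by simp
 obtain ys where ys: "ys <= carrier R" "finite ys" "I = Idl ys" using finetely_gen[OF I] by blast
 have ysI: "ys <= I" unfolding ys(3) by (rule genideal_self[OF ys(1)])
 have pair: "graded_pair R ?F ys X Y"
  unfolding graded_pair_def
 proof (intro allI conjI ballI Xs Ys YX)
  fix n y x assume y: "y : ys"
  then have yI: "y : I" and yc: "y : carrier R" using ysI ys(1) by auto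
  show "y \<odot>\<^bsub>?F\<^esub> x : X (Suc n)" if "x : X n"
   using that F.submoduleE(4)[OF K yc] F.smul_pow_act[OF I yI subset_refl] unfolding X_def by blast
  show "y \<odot>\<^bsub>?F\<^esub> x : Y (Suc n)" if "x : Y n"
   using that F.smul_pow_act[OF I yI Kc] unfolding Y_def by blast
 qed
 have noeth: "graded_noeth R ?F ys X Y"
 proof (rule graded_noeth_mono[OF F.rees_noeth[OF Ffg I ys(2,3,1)]])
  show "X n <= smul ?F (ideal_pow R I n) (carrier ?F)" for n by (simp add: X_def)
  show "{\<zero>\<^bsub>?F\<^esub>} <= Y n" for n using F.submodule_zero[OF Ys] by simp
 qed blast
 have zt: "z \<odot>\<^bsub>?F\<^esub> x = t [^] N \<odot>\<^bsub>?F\<^esub> x" if "x : smul ?F I (carrier ?F)" for x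
 proof -
  have "x : carrier ?F & z \<odot>\<^bsub>?F\<^esub> x = t [^] N \<odot>\<^bsub>?F\<^esub> x" using that
  proof induction
   case smul_zero
   show ?case using zc tN by simp
  next
   case (smul_gen a x)
   have "a : carrier R" using smul_gen(1) Ic by blast
   then show ?case using smul_gen zc tN z(2) by (simp add: F.smult_assoc1[symmetric])
  next
   case (smul_add x y)
   then show ?case using zc tN by (simp add: F.smult_r_distr)
  qed
  then show ?thesis by blast
 qed
 have zpow: "t [^] (N * n) \<odot>\<^bsub>?F\<^esub> x = z [^] n \<odot>\<^bsub>?F\<^esub> x" if x: "x : smul ?F I (carrier ?F)" for x and n :: nat
 proof (induction n)
  case (Suc n)
  have xc: "x : carrier ?F"
   using x F.submodule_carrier[OF F.submodule_smul[OF subset_refl I]] by blast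
  have "t [^] (N * Suc n) \<odot>\<^bsub>?F\<^esub> x = t [^] N \<odot>\<^bsub>?F\<^esub> (t [^] (N * n) \<odot>\<^bsub>?F\<^esub> x)"
   using tN xc t(1) by (simp add: F.smult_assoc1[symmetric] nat_pow_mult)
  also have "\<dots> = z [^] n \<odot>\<^bsub>?F\<^esub> (t [^] N \<odot>\<^bsub>?F\<^esub> x)"
   using Suc tN xc zc by (simp add: F.smult_left_commute)
  also have "\<dots> = z [^] Suc n \<odot>\<^bsub>?F\<^esub> x"
   using zt[OF x] xc zc by (simp add: F.smult_assoc1)
  finally show ?case .
 qed simp
 have sub: "F.scale (t [^] (N * n)) (X n) <= Y n" for n
 proof
  fix v assume "v : F.scale (t [^] (N * n)) (X n)"
  then obtain x where x: "x : ?K" "x : smul ?F (ideal_pow R I n) (carrier ?F)" "v = t [^] (N * n) \<odot>\<^bsub>?F\<^esub> x"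
   unfolding F.mem_scale X_def by blast
  have xc: "x : carrier ?F" using x(1) by simp
  have "v = z [^] n \<odot>\<^bsub>?F\<^esub> x"
  proof (cases "n = 0")
   case False
   then have "ideal_pow R I n <= I" by (intro ideal_pow_subset I) simp
   then have "x : smul ?F I (carrier ?F)" using x(2) F.smul_mono[OF _ subset_refl] by blast
   then show ?thesis using zpow x(3) by simp
  qed (use x xc in simp)
  moreover have "z [^] n : ideal_pow R I n" by (rule pow_mem_ideal_pow[OF I z(1)])
  ultimately show "v : Y n" unfolding Y_def using x(1) by (auto intro: smul.smul_gen)
 qed
 have fin: "len R ?F (X n) (Y n) ~= \<infinity>" for n
 proof (rule F.len_finite_of_power[OF t(1) Xs Ys _ sub])
  show "len R ?F (X n) (F.scale t (X n)) ~= \<infinity>"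
   by (rule F.len_fg_scale_finite[OF t F.submodule_fg[OF Ffg Xs F.submoduleE(1)[OF Xs]]])
 qed
 have "module_length R (Tor1 R M (quot_module (ring_module R) (ideal_pow R I n))) = len R ?F (X n) (Y n)" for n
  unfolding X_def Y_def
  by (rule module_length_Tor1_generators[OF Ip gc _ refl]) (use fext_image[OF S g] gen in auto)
 then show ?thesis using F.hilbert_serre[OF ys(2,1) pair noeth fin] by simp
qed

end

text \<open>The shift by one accounts for the exponent \<open>n + 1\<close> in
  \<open>is_tor_polynomial\<close>.\<close>

lemma numerical_imp_tor_polynomial:
 assumes "numerical (%n. module_length R (Tor1 R M (quot_module (ring_module R) (ideal_pow R I n)))) p"
 shows "is_tor_polynomial R I M (pcompose p [:1, 1:])"
proof -
 obtain n0 where n0: "!!n. n0 <= n ==> EX k. module_length R (Tor1 R M (quot_module (ring_module R) (ideal_pow R I n))) = enat k &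
   poly p (of_nat n) = of_nat k"
  using assms unfolding numerical_def eventually_sequentially by blast
 show ?thesis
  unfolding is_tor_polynomial_def eventually_sequentially
 proof (rule exI[of _ n0], intro allI impI)
  fix n assume n: "n0 <= n"
  have e: "poly (pcompose p [:1, 1:]) (of_nat n) = poly p (of_nat (n + 1))"
   by (simp add: poly_pcompose add.commute)
  show "EX k. module_length R (Tor1 R M (quot_module (ring_module R) (ideal_pow R I (n + 1)))) = enat k &
    poly (pcompose p [:1, 1:]) (of_nat n) = of_nat k"
   unfolding e by (rule n0) (use n in simp)
 qed
qed

lemma is_tor_polynomial_unique:
 assumes "is_tor_polynomial R I M p" "is_tor_polynomial R I M q"
 shows "p = q"
proof -
 obtain n0 where n0: "!!n. n0 <= n ==> poly p (of_nat n) = poly q (of_nat n)"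
 proof -
  have "\<forall>\<^sub>F n in sequentially. poly p (of_nat n) = poly q (of_nat n)"
   using eventually_conj[OF assms[unfolded is_tor_polynomial_def]] by (rule eventually_mono) auto
  then show ?thesis using that unfolding eventually_sequentially by blast
 qed
 have "(of_nat ` {n0..} :: rat set) <= {x. poly (p - q) x = 0}" using n0 by auto
 moreover have "infinite (of_nat ` {n0..} :: rat set)"
  using finite_imageD[of "of_nat :: nat => rat" "{n0..}"] infinite_Ici by (auto simp: inj_on_def)
 ultimately have "infinite {x. poly (p - q) x = 0}" using finite_subset by blast
 then show ?thesis using poly_roots_finite[of "p - q"] by auto
qed

lemma tor_polynomial_eq: "is_tor_polynomial R I M p ==> tor_polynomial R I M = p"
 unfolding tor_polynomial_def by (rule the_equality) (auto intro: is_tor_polynomial_unique)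

lemma poly_deg_less_0_iff: "poly_deg p < 0 \<longleftrightarrow> p = 0"
 by (simp add: poly_deg_def)

subsection \<open>Localization\<close>

locale localized = plain_module R M for R (structure) and M :: "('a, 'm) module" +
 fixes P :: "'a set"
 assumes P: "primeideal P R"
begin

abbreviation S where "S \<equiv> carrier R - P"
abbreviation fr where "fr \<equiv> frac R P M"

lemma S_one: "\<one> : S" using R.prime_one[OF P] by simp

lemma S_mult: "s : S ==> t : S ==> s \<otimes> t : S" using R.prime_mult_notin[OF P] by auto

lemma mem_frac:
 "(y, t) : fr x s \<longleftrightarrow> y : carrier M & t : S & (EX u:S. u *\<^sub>M (t *\<^sub>M x) = u *\<^sub>M (s *\<^sub>M y))"
 by (simp add: frac_def)

lemma frac_self: "x : carrier M ==> s : S ==> (x, s) : fr x s"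
 unfolding mem_frac using S_one by blast

lemma frac_trans:
 assumes c: "x : carrier M" "s : S" "y : carrier M" "t : S"
  and u: "u : S" "u *\<^sub>M (t *\<^sub>M x) = u *\<^sub>M (s *\<^sub>M y)"
  and z: "(z, v) : fr x s"
 shows "(z, v) : fr y t"
proof -
 obtain w where w: "z : carrier M" "v : S" "w : S" "w *\<^sub>M (v *\<^sub>M x) = w *\<^sub>M (s *\<^sub>M z)"
  using z unfolding mem_frac by blast
 have R: "u : carrier R" "w : carrier R" "s : carrier R" "t : carrier R" "v : carrier R" using c u w by auto
 let ?k = "u \<otimes> w \<otimes> s"
 have "?k *\<^sub>M (v *\<^sub>M y) = (w \<otimes> v) *\<^sub>M (u *\<^sub>M (s *\<^sub>M y))"
  using R c by (simp add: smult_assoc1 smult_left_commute)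
 also have "\<dots> = (u \<otimes> t) *\<^sub>M (w *\<^sub>M (v *\<^sub>M x))"
  using R c u(2)[symmetric] by (simp add: smult_assoc1 smult_left_commute)
 also have "\<dots> = ?k *\<^sub>M (t *\<^sub>M z)"
  using R c w by (simp add: smult_assoc1 smult_left_commute)
 finally show ?thesis unfolding mem_frac using w S_mult[OF S_mult[OF u(1) w(3)] c(2)] by blast
qed

lemma frac_eqI:
 assumes c: "x : carrier M" "s : S" "y : carrier M" "t : S"
  and u: "u : S" "u *\<^sub>M (t *\<^sub>M x) = u *\<^sub>M (s *\<^sub>M y)"
 shows "fr x s = fr y t"
 using frac_trans[OF c u] frac_trans[OF c(3,4,1,2) u(1) u(2)[symmetric]] by fast

lemma frac_eq_iff:
 assumes c: "x : carrier M" "s : S" "y : carrier M" "t : S"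
 shows "fr x s = fr y t \<longleftrightarrow> (EX u:S. u *\<^sub>M (t *\<^sub>M x) = u *\<^sub>M (s *\<^sub>M y))"
proof
 assume "fr x s = fr y t"
 then have "(y, t) : fr x s" using frac_self[OF c(3,4)] by simp
 then show "EX u:S. u *\<^sub>M (t *\<^sub>M x) = u *\<^sub>M (s *\<^sub>M y)" unfolding mem_frac by blast
qed (use frac_eqI[OF c] in blast)

lemma frac_cancel:
 assumes "x : carrier M" "s : S" "t : S"
 shows "fr (t *\<^sub>M x) (t \<otimes> s) = fr x s"
proof -
 have "s : carrier R" "t : carrier R" using assms by auto
 then show ?thesis
  using assms S_mult[OF assms(3,2)] S_one
  by (intro frac_eqI[of _ _ _ _ \<one>]) (auto simp: smult_assoc1 smult_left_commute)
qed

lemma frac_mem_cases: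
 assumes "(x', s') : fr x s" "x : carrier M" "s : S"
 shows "x' : carrier M" "s' : S" "fr x' s' = fr x s"
proof -
 obtain u where u: "x' : carrier M" "s' : S" "u : S" "u *\<^sub>M (s' *\<^sub>M x) = u *\<^sub>M (s *\<^sub>M x')"
  using assms(1) unfolding mem_frac by blast
 then show "x' : carrier M" "s' : S" by blast+
 show "fr x' s' = fr x s" by (rule frac_eqI[OF assms(2,3) u, symmetric])
qed

lemma frac_add_cong:
 assumes x: "x : carrier M" "x' : carrier M" "s : S" "s' : S" "fr x' s' = fr x s"
  and y: "y : carrier M" "y' : carrier M" "t : S" "t' : S" "fr y' t' = fr y t"
 shows "fr (t' *\<^sub>M x' +\<^sub>M s' *\<^sub>M y') (s' \<otimes> t') = fr (t *\<^sub>M x +\<^sub>M s *\<^sub>M y) (s \<otimes> t)"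
proof -
 obtain u where u: "u : S" "u *\<^sub>M (s *\<^sub>M x') = u *\<^sub>M (s' *\<^sub>M x)" using frac_eq_iff[of x' s' x s] x by blast
 obtain v where v: "v : S" "v *\<^sub>M (t *\<^sub>M y') = v *\<^sub>M (t' *\<^sub>M y)" using frac_eq_iff[of y' t' y t] y by blast
 have R: "u : carrier R" "v : carrier R" "s : carrier R" "t : carrier R" "s' : carrier R" "t' : carrier R"
  using x y u v by auto
 have "(u \<otimes> v) *\<^sub>M ((s \<otimes> t) *\<^sub>M (t' *\<^sub>M x' +\<^sub>M s' *\<^sub>M y')) =
   (v \<otimes> t \<otimes> t') *\<^sub>M (u *\<^sub>M (s *\<^sub>M x')) +\<^sub>M (u \<otimes> s \<otimes> s') *\<^sub>M (v *\<^sub>M (t *\<^sub>M y'))"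
  using R x y by (simp add: smult_r_distr smult_assoc1[symmetric] R.m_ac)
 also have "\<dots> = (u \<otimes> v) *\<^sub>M ((s' \<otimes> t') *\<^sub>M (t *\<^sub>M x +\<^sub>M s *\<^sub>M y))"
  unfolding u(2) v(2) using R x y by (simp add: smult_r_distr smult_assoc1[symmetric] R.m_ac)
 finally show ?thesis
  using x y R by (intro frac_eqI[OF _ S_mult _ S_mult S_mult[OF u(1) v(1)]]) auto
qed

lemma loc_carrier: "carrier (loc_module R P M) = {fr x s | x s. x : carrier M & s : S}"
 by (simp add: loc_module_def)

lemma loc_add:
 assumes x: "x : carrier M" "s : S" and y: "y : carrier M" "t : S"
 shows "fr x s \<oplus>\<^bsub>loc_module R P M\<^esub> fr y t = fr (t *\<^sub>M x +\<^sub>M s *\<^sub>M y) (s \<otimes> t)"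
proof -
 have "fr (t' *\<^sub>M x' +\<^sub>M s' *\<^sub>M y') (s' \<otimes> t') = fr (t *\<^sub>M x +\<^sub>M s *\<^sub>M y) (s \<otimes> t)"
  if "(x', s') : fr x s" "(y', t') : fr y t" for x' s' y' t'
  using frac_mem_cases[OF that(1) x] frac_mem_cases[OF that(2) y] x y by (intro frac_add_cong) auto
 then have "(\<Union>(x', s')\<in>fr x s. \<Union>(y', t')\<in>fr y t. fr (t' *\<^sub>M x' +\<^sub>M s' *\<^sub>M y') (s' \<otimes> t')) =
   (\<Union>p\<in>fr x s. \<Union>q\<in>fr y t. fr (t *\<^sub>M x +\<^sub>M s *\<^sub>M y) (s \<otimes> t))"
  by (intro SUP_cong) auto
 also have "\<dots> = fr (t *\<^sub>M x +\<^sub>M s *\<^sub>M y) (s \<otimes> t)"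
  using frac_self[OF x] frac_self[OF y] by auto
 finally show ?thesis by (simp add: loc_module_def)
qed

end

locale localized_module = A: localized R "ring_module R" P + M: localized R M P
 for R :: "('a, 'k) ring_scheme" (structure) and M :: "('a, 'm) module" and P
begin

abbreviation S where "S \<equiv> carrier R - P"

lemma frac_smult_cong:
 assumes x: "a : carrier R" "a' : carrier R" "s : S" "s' : S" "A.fr a' s' = A.fr a s"
  and y: "y : carrier M" "y' : carrier M" "t : S" "t' : S" "M.fr y' t' = M.fr y t"
 shows "M.fr (a' *\<^sub>M y') (s' \<otimes> t') = M.fr (a *\<^sub>M y) (s \<otimes> t)"
proof -
 obtain u where u: "u : S" "u \<otimes> (s \<otimes> a') = u \<otimes> (s' \<otimes> a)" using A.frac_eq_iff[of a' s' a s] x by auto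
 obtain v where v: "v : S" "v *\<^sub>M (t *\<^sub>M y') = v *\<^sub>M (t' *\<^sub>M y)" using M.frac_eq_iff[of y' t' y t] y by blast
 have R: "u : carrier R" "v : carrier R" "s : carrier R" "t : carrier R" "s' : carrier R" "t' : carrier R"
  using x y u v by auto
 have "(u \<otimes> v) *\<^sub>M ((s \<otimes> t) *\<^sub>M (a' *\<^sub>M y')) = (u \<otimes> (s \<otimes> a')) *\<^sub>M (v *\<^sub>M (t *\<^sub>M y'))"
  using R x y by (simp add: M.smult_assoc1[symmetric] A.R.m_ac)
 also have "\<dots> = (u \<otimes> v) *\<^sub>M ((s' \<otimes> t') *\<^sub>M (a *\<^sub>M y))"
  unfolding u(2) v(2) using R x y by (simp add: M.smult_assoc1[symmetric] A.R.m_ac)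
 finally show ?thesis
  using x y R by (intro M.frac_eqI[OF _ M.S_mult _ M.S_mult M.S_mult[OF u(1) v(1)]]) auto
qed

lemma loc_smult:
 assumes x: "a : carrier R" "s : S" and y: "y : carrier M" "t : S"
 shows "A.fr a s \<odot>\<^bsub>loc_module R P M\<^esub> M.fr y t = M.fr (a *\<^sub>M y) (s \<otimes> t)"
proof -
 have x': "a : carrier (ring_module R)" using x by simp
 have "M.fr (a' *\<^sub>M y') (s' \<otimes> t') = M.fr (a *\<^sub>M y) (s \<otimes> t)"
  if "(a', s') : A.fr a s" "(y', t') : M.fr y t" for a' s' y' t'
  using A.frac_mem_cases[OF that(1) x' x(2)] M.frac_mem_cases[OF that(2) y] x y
  by (intro frac_smult_cong) auto
 then have "(\<Union>(a', s')\<in>A.fr a s. \<Union>(y', t')\<in>M.fr y t. M.fr (a' *\<^sub>M y') (s' \<otimes> t')) =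
   (\<Union>p\<in>A.fr a s. \<Union>q\<in>M.fr y t. M.fr (a *\<^sub>M y) (s \<otimes> t))"
  by (intro SUP_cong) auto
 also have "\<dots> = M.fr (a *\<^sub>M y) (s \<otimes> t)"
  using A.frac_self[OF x' x(2)] M.frac_self[OF y] by auto
 finally show ?thesis by (simp add: loc_module_def)
qed

end

context cring
begin

lemma localized_ring_module: "primeideal P R ==> localized R rm P"
 by (intro localized.intro plain_module.intro module_ring_module localized_axioms.intro)

lemma loc_ring_simps:
 "carrier (loc_ring R P) = carrier (loc_module R P rm)"
 "\<zero>\<^bsub>loc_ring R P\<^esub> = frac R P rm \<zero> \<one>" "\<one>\<^bsub>loc_ring R P\<^esub> = frac R P rm \<one> \<one>"
 "add (loc_ring R P) = add (loc_module R P rm)"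
 "monoid.mult (loc_ring R P) = smult (loc_module R P rm)"
 by (simp_all add: loc_ring_def Let_def loc_module_def)

context
 fixes P assumes P: "primeideal P R"
begin

interpretation A: localized_module R rm P
 by (intro localized_module.intro localized_ring_module P)

lemma loc_ring_elem: "X : carrier (loc_ring R P) ==>
  EX a s. a : carrier R & s : carrier R - P & X = frac R P rm a s"
 by (auto simp: loc_ring_simps A.A.loc_carrier)

lemma loc_ring_closed: "a : carrier R ==> s : carrier R - P ==>
  frac R P rm a s : carrier (loc_ring R P)"
 by (auto simp: loc_ring_simps A.A.loc_carrier)

lemma loc_ring_add: "a : carrier R ==> s : carrier R - P ==> b : carrier R ==> t : carrier R - P ==>
  frac R P rm a s \<oplus>\<^bsub>loc_ring R P\<^esub> frac R P rm b t =
  frac R P rm (t \<otimes> a \<oplus> s \<otimes> b) (s \<otimes> t)"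
 using A.A.loc_add[of a s b t] by (simp add: loc_ring_simps)

lemma loc_ring_mult: "a : carrier R ==> s : carrier R - P ==> b : carrier R ==> t : carrier R - P ==>
  frac R P rm a s \<otimes>\<^bsub>loc_ring R P\<^esub> frac R P rm b t =
  frac R P rm (a \<otimes> b) (s \<otimes> t)"
 using A.loc_smult[of a s b t] by (simp add: loc_ring_simps)

lemma loc_ring_frac_zero_iff: "a : carrier R ==> s : carrier R - P ==>
  frac R P rm a s = \<zero>\<^bsub>loc_ring R P\<^esub> \<longleftrightarrow> (EX u:carrier R - P. u \<otimes> a = \<zero>)"
 using A.A.frac_eq_iff[of a s \<zero> \<one>] A.A.S_one by (auto simp: loc_ring_simps)

end

end

text \<open>The unit vectors are pulled back through the isomorphism to fractions with one common
  denominator \<open>\<sigma>\<close>; the numerators \<open>u i\<close> form the local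
  basis.\<close>

lemma (in localized_module) free_localization_imp_local_basis:
 assumes iso: "module_iso (loc_ring R P) (loc_module R P M) (free_module (loc_ring R P) {..<r::nat})"
 shows "EX u. local_basis R M r P u"
proof -
 let ?B = "loc_ring R P" and ?L = "loc_module R P M"
 let ?F = "free_module ?B {..<r}"
 let ?f = "A.fr"
 obtain h where bij: "bij_betw h (carrier ?L) (carrier ?F)"
  and hadd: "!!X Y. X : carrier ?L ==> Y : carrier ?L ==> h (X \<oplus>\<^bsub>?L\<^esub> Y) = (%i. h X i \<oplus>\<^bsub>?B\<^esub> h Y i)"
  and hsm: "!!a X. a : carrier ?B ==> X : carrier ?L ==> h (a \<odot>\<^bsub>?L\<^esub> X) = (%i. a \<otimes>\<^bsub>?B\<^esub> h X i)"
  using iso unfolding module_iso_def by (auto simp: free_module_def)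
 have Pr: "primeideal P R" by (rule A.P)
 note one = A.S_one and mult = A.S_mult
 note Badd = A.R.loc_ring_add[OF Pr] and Bmult = A.R.loc_ring_mult[OF Pr]
  and Bzero = A.R.loc_ring_frac_zero_iff[OF Pr] and Bcl = A.R.loc_ring_closed[OF Pr] and Bel = A.R.loc_ring_elem[OF Pr]
 have frL: "M.fr x s : carrier ?L" if "x : carrier M" "s : S" for x s
  using that by (auto simp: M.loc_carrier)
 define H where "H x = h (M.fr x \<one>)" for x
 have Hc: "H x : carrier ?F" if "x : carrier M" for x
  using bij frL[OF that one] unfolding H_def bij_betw_def by blast
 have HB: "H x i : carrier ?B" and Hout: "i >= r ==> H x i = \<zero>\<^bsub>?B\<^esub>" if "x : carrier M" for x i
  using Hc[OF that] by (auto simp: free_module_def)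
 have Hadd: "H (x +\<^sub>M y) i = H x i \<oplus>\<^bsub>?B\<^esub> H y i" if "x : carrier M" "y : carrier M" for x y i
  using hadd[OF frL[OF that(1) one] frL[OF that(2) one]] M.loc_add[OF that(1) one that(2) one] that
  by (simp add: H_def)
 have Hsm: "H (a *\<^sub>M x) i = ?f a \<one> \<otimes>\<^bsub>?B\<^esub> H x i" if "a : carrier R" "x : carrier M" for a x i
  using hsm[OF Bcl[OF that(1) one] frL[OF that(2) one]] loc_smult[OF that(1) one that(2) one] that
  by (simp add: H_def)
 have Bz: "\<zero>\<^bsub>?B\<^esub> = ?f \<zero> \<one>" and Bo: "\<one>\<^bsub>?B\<^esub> = ?f \<one> \<one>" by (simp_all add: A.R.loc_ring_simps)
 have Hinj: "EX v:S. v *\<^sub>M x = v *\<^sub>M y" if x: "x : carrier M" and y: "y : carrier M" and eq: "!!i. i < r ==> H x i = H y i" for x y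
 proof -
  have "H x i = H y i" for i using eq[of i] Hout[OF x, of i] Hout[OF y, of i] by (cases "i < r") auto
  then have "h (M.fr x \<one>) = h (M.fr y \<one>)" by (auto simp: H_def)
  then have "M.fr x \<one> = M.fr y \<one>"
   using bij frL[OF x one] frL[OF y one] unfolding bij_betw_def by (meson inj_onD)
  then show ?thesis using M.frac_eq_iff[OF x one y one] x y by auto
 qed
 define \<delta> where "\<delta> i = (%j. if j = i then \<one>\<^bsub>?B\<^esub> else \<zero>\<^bsub>?B\<^esub>)" for i :: nat
 have ex: "EX s:S. EX w:carrier M. h (M.fr w s) = \<delta> i" if i: "i < r" for i
 proof -
  have "\<delta> i : carrier ?F"
   using i Bcl[OF _ one, of \<zero>] Bcl[OF _ one, of \<one>] by (auto simp: free_module_def \<delta>_def Bz Bo)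
  then have "\<delta> i : h ` carrier ?L" using bij by (simp add: bij_betw_def)
  then obtain X where X: "\<delta> i = h X" "X : carrier ?L" by (rule imageE)
  from X(2) obtain w s where "w : carrier M" "s : S" "X = M.fr w s" unfolding M.loc_carrier by blast
  then show ?thesis using X(1) by metis
 qed
 have "EX s:S. ALL i:{..<r}. EX w:carrier M. h (M.fr w s) = \<delta> i"
 proof (intro A.R.common_denominator[OF Pr])
  fix i s s' assume s: "s : S" "s' : S" and "EX w:carrier M. h (M.fr w s) = \<delta> i"
  then obtain w where w: "w : carrier M" "h (M.fr w s) = \<delta> i" by blast
  then show "EX w:carrier M. h (M.fr w (s' \<otimes> s)) = \<delta> i"
   using M.frac_cancel[OF w(1) s] s by (intro bexI[of _ "s' *\<^sub>M w"]) auto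
 qed (use ex in \<open>simp_all\<close>)
 then obtain \<sigma> where \<sigma>: "\<sigma> : S" and "ALL i:{..<r}. EX w:carrier M. h (M.fr w \<sigma>) = \<delta> i" by blast
 then obtain u where u: "!!i. i < r ==> u i : carrier M" "!!i. i < r ==> h (M.fr (u i) \<sigma>) = \<delta> i"
  by (metis lessThan_iff)
 have \<sigma>c: "\<sigma> : carrier R" using \<sigma> by blast
 have Hu: "H (u i) j = (if j = i then ?f \<sigma> \<one> else ?f \<zero> \<one>)" if i: "i < r" for i j
 proof -
  have "M.fr (u i) \<one> = ?f \<sigma> \<one> \<odot>\<^bsub>?L\<^esub> M.fr (u i) \<sigma>"
   using loc_smult[OF \<sigma>c one u(1)[OF i] \<sigma>] M.frac_cancel[OF u(1)[OF i] one \<sigma>] \<sigma>c by simp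
  then have "H (u i) j = ?f \<sigma> \<one> \<otimes>\<^bsub>?B\<^esub> \<delta> i j"
   using hsm[OF Bcl[OF \<sigma>c one] frL[OF u(1)[OF i] \<sigma>]] u(2)[OF i] by (simp add: H_def)
  then show ?thesis using Bmult[OF \<sigma>c one _ one, of \<one>] Bmult[OF \<sigma>c one _ one, of \<zero>] \<sigma>c
   by (simp add: \<delta>_def Bz Bo)
 qed
 have uc: "u : {..<r} \<rightarrow> carrier M" using u(1) by auto
 \<comment> \<open>The j-th coordinate of the combination is \<open>a j\<close> times
   \<open>\<sigma>\<close>, or zero outside the index set; spanning and independence are both read
   off from this.\<close>
 have Hlc: "H (lc M T a u) j = ?f (if j : T then a j \<otimes> \<sigma> else \<zero>) \<one>"
  if "finite T" "T <= {..<r}" "a : T \<rightarrow> carrier R" for T a j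
  using that
 proof (induction T rule: finite_induct)
  case empty
  have "H 0\<^sub>M j = ?f \<zero> \<one> \<otimes>\<^bsub>?B\<^esub> H 0\<^sub>M j" using Hsm[of \<zero> "0\<^sub>M" j] by simp
  moreover obtain b s where b: "b : carrier R" "s : S" "H 0\<^sub>M j = ?f b s" using Bel[OF HB] by blast
  ultimately have "H 0\<^sub>M j = ?f \<zero> s" using Bmult[of \<zero> \<one> b s] one by auto
  then show ?case using Bzero[of \<zero> s] b(2) one by (auto simp: Bz)
 next
  case (insert i T)
  have i: "i < r" "a i : carrier R" and T: "T <= {..<r}" "a : T \<rightarrow> carrier R" using insert.prems by auto
  have uT: "u : insert i T \<rightarrow> carrier M" "u : T \<rightarrow> carrier M" using uc insert.prems(1) by auto
  have "lc M (insert i T) a u = a i *\<^sub>M u i +\<^sub>M lc M T a u"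
   by (rule M.lc_insert[OF insert.hyps insert.prems(2) uT(1)])
  then have "H (lc M (insert i T) a u) j = (?f (a i) \<one> \<otimes>\<^bsub>?B\<^esub> H (u i) j) \<oplus>\<^bsub>?B\<^esub> H (lc M T a u) j"
   using i u(1) T uT by (simp add: Hadd Hsm)
  also have "\<dots> = ?f (if j = i then a i \<otimes> \<sigma> else \<zero>) \<one> \<oplus>\<^bsub>?B\<^esub> ?f (if j : T then a j \<otimes> \<sigma> else \<zero>) \<one>"
   using Hu[OF i(1)] i(2) \<sigma>c one insert.IH[OF T] by (simp add: Bmult)
  also have "\<dots> = ?f (if j : insert i T then a j \<otimes> \<sigma> else \<zero>) \<one>"
  proof -
   have "(if j = i then a i \<otimes> \<sigma> else \<zero>) : carrier R" "(if j : T then a j \<otimes> \<sigma> else \<zero>) : carrier R"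
    using i(2) T(2) \<sigma>c by auto
   moreover from this have "(if j = i then a i \<otimes> \<sigma> else \<zero>) \<oplus> (if j : T then a j \<otimes> \<sigma> else \<zero>) =
     (if j : insert i T then a j \<otimes> \<sigma> else \<zero>)"
    using insert.hyps(2) by (cases "j = i"; cases "j : T") simp_all
   ultimately show ?thesis using one by (simp add: Badd del: insert_iff)
  qed
  finally show ?case .
 qed
 show ?thesis
  unfolding local_basis_def
 proof (intro exI[of _ u] conjI ballI impI uc)
  fix x assume x: "x : carrier M"
  have "EX d:S. ALL i:{..<r}. EX b:carrier R. H (d *\<^sub>M x) i = ?f b \<one>"
  proof (intro A.R.common_denominator[OF Pr])
   fix i
   obtain b c where b: "b : carrier R" "c : S" "H x i = ?f b c" using Bel[OF HB[OF x]] by blast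
   have cc: "c : carrier R" using b by blast
   have "H (c *\<^sub>M x) i = ?f (c \<otimes> b) c" using b x one cc by (simp add: Hsm Bmult)
   also have "\<dots> = ?f b \<one>" using A.frac_cancel[of b \<one> c] b one cc by simp
   finally show "EX s:S. EX b:carrier R. H (s *\<^sub>M x) i = ?f b \<one>" using b by blast
  next
   fix i s s' assume s: "s : S" "s' : S" and "EX b:carrier R. H (s *\<^sub>M x) i = ?f b \<one>"
   then obtain b where b: "b : carrier R" "H (s *\<^sub>M x) i = ?f b \<one>" by blast
   have sc: "s : carrier R" "s' : carrier R" using s by auto
   have "H ((s' \<otimes> s) *\<^sub>M x) i = ?f s' \<one> \<otimes>\<^bsub>?B\<^esub> H (s *\<^sub>M x) i"
    using Hsm[OF sc(2), of "s *\<^sub>M x" i] sc x by (simp add: M.smult_assoc1)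
   also have "\<dots> = ?f (s' \<otimes> b) \<one>" using b sc one by (simp add: Bmult)
   finally show "EX b:carrier R. H ((s' \<otimes> s) *\<^sub>M x) i = ?f b \<one>" using b sc by blast
  qed simp
  then obtain d where d: "d : S" "ALL i:{..<r}. EX b:carrier R. H (d *\<^sub>M x) i = ?f b \<one>" by blast
  then obtain b where b: "!!i. i < r ==> b i : carrier R" "!!i. i < r ==> H (d *\<^sub>M x) i = ?f (b i) \<one>"
   by (metis lessThan_iff)
  have dc: "d : carrier R" using d by blast
  have bc: "b : {..<r} \<rightarrow> carrier R" using b(1) by auto
  \<comment> \<open>Equal coordinates mean equal fractions, hence equality in \<open>M\<close> after
    multiplication by some \<open>v\<close> outside \<open>P\<close>.\<close>
  have "EX v:S. v *\<^sub>M (\<sigma> *\<^sub>M (d *\<^sub>M x)) = v *\<^sub>M lc M {..<r} b u"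
  proof (rule Hinj)
   fix i assume i: "i < r"
   have "H (\<sigma> *\<^sub>M (d *\<^sub>M x)) i = ?f (\<sigma> \<otimes> b i) \<one>"
    using Hsm[OF \<sigma>c, of "d *\<^sub>M x" i] dc x b[OF i] one \<sigma>c by (simp add: Bmult)
   also have "\<dots> = H (lc M {..<r} b u) i"
    using Hlc[of "{..<r}" b i] bc i b(1)[OF i] \<sigma>c by (simp add: A.R.m_comm)
   finally show "H (\<sigma> *\<^sub>M (d *\<^sub>M x)) i = H (lc M {..<r} b u) i" .
  qed (use \<sigma>c dc x bc uc in auto)
  then obtain v where v: "v : S" "v *\<^sub>M (\<sigma> *\<^sub>M (d *\<^sub>M x)) = v *\<^sub>M lc M {..<r} b u" by blast
  have vc: "v : carrier R" using v by blast
  have "(v \<otimes> \<sigma> \<otimes> d) *\<^sub>M x = lc M {..<r} (%i. v \<otimes> b i) u"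
   using v(2) vc \<sigma>c dc x M.lc_smult[OF _ vc bc uc] by (simp add: M.smult_assoc1)
  moreover have "v \<otimes> \<sigma> \<otimes> d : S" by (intro mult v \<sigma> d)
  moreover have "(%i. v \<otimes> b i) : {..<r} \<rightarrow> carrier R" using vc b(1) by auto
  ultimately show "EX s:S. EX a:{..<r} \<rightarrow> carrier R. s *\<^sub>M x = lc M {..<r} a u" by blast
 next
  fix a assume a: "a : {..<r} \<rightarrow> carrier R" and 0: "lc M {..<r} a u = 0\<^sub>M"
  have "H 0\<^sub>M i = ?f \<zero> \<one>" for i using Hlc[of "{}" a i] by simp
  then have z: "?f (a i \<otimes> \<sigma>) \<one> = \<zero>\<^bsub>?B\<^esub>" if "i < r" for i
   using Hlc[of "{..<r}" a i] a that 0 by (simp add: Bz)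
  have "EX s:S. ALL i:{..<r}. s \<otimes> a i = \<zero>"
  proof (intro A.R.common_denominator[OF Pr])
   fix i assume i: "i : {..<r}"
   then have ai: "a i : carrier R" using a by auto
   then obtain v where v: "v : S" "v \<otimes> (a i \<otimes> \<sigma>) = \<zero>" using z[of i] Bzero[of "a i \<otimes> \<sigma>" \<one>] i one \<sigma>c by auto
   have "(v \<otimes> \<sigma>) \<otimes> a i = v \<otimes> (a i \<otimes> \<sigma>)" using v(1) ai \<sigma>c by (simp add: A.R.m_assoc A.R.m_comm[of \<sigma>])
   then have "(v \<otimes> \<sigma>) \<otimes> a i = \<zero>" using v(2) by simp
   then show "EX s:S. s \<otimes> a i = \<zero>" using mult[OF v(1) \<sigma>] by blast
  next
   fix i s s' assume "i : {..<r}" "s : S" "s' : S" "s \<otimes> a i = \<zero>"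
   then show "s' \<otimes> s \<otimes> a i = \<zero>" using a by (auto simp: A.R.m_assoc Pi_iff)
  qed simp
  then show "EX s:S. ALL i<r. s \<otimes> a i = \<zero>" by auto
 qed
qed

context noeth
begin

text \<open>Each of finitely many generators of \<open>I\<close> vanishes at \<open>P\<close>, so it
  is killed by an element outside \<open>P\<close>; a common such element kills
  \<open>I\<close>.\<close>

lemma loc_ideal_zero_imp_annihilator:
 assumes P: "primeideal P R" and I: "ideal I R" and loc: "loc_ideal R P I = Idl\<^bsub>loc_ring R P\<^esub> {}"
 shows "EX v:carrier R - P. ALL a:I. v \<otimes> a = \<zero>"
proof -
 let ?B = "loc_ring R P"
 \<comment> \<open>\<open>Idl {}\<close> is an intersection of ideals; were there none, it would be \<open>UNIV\<close> and contain \<open>{}\<close>.\<close>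
 have "EX J. ideal J ?B"
 proof (rule ccontr)
  assume "\<nexists>J. ideal J ?B"
  then have "{} : loc_ideal R P I" unfolding loc by (simp add: genideal_def)
  then obtain a s where a: "a : carrier R" "s : carrier R - P" "{} = frac R P rm a s"
   using ideal_carrier[OF I] unfolding loc_ideal_def by blast
  then show False using localized.frac_self[OF localized_ring_module[OF P], of a s] by simp
 qed
 then interpret B: ring ?B using ideal.axioms(2) by blast
 have "Idl\<^bsub>?B\<^esub> {} <= {\<zero>\<^bsub>?B\<^esub>}" by (rule B.genideal_minimal[OF B.zeroideal]) simp
 then have z: "frac R P rm a \<one> = \<zero>\<^bsub>?B\<^esub>" if "a : I" for a
  using that prime_one[OF P] unfolding loc[symmetric] loc_ideal_def by blast
 obtain ys where ys: "ys <= carrier R" "finite ys" "I = Idl ys" using finetely_gen[OF I] by blast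
 have ysI: "ys <= I" unfolding ys(3) by (rule genideal_self[OF ys(1)])
 have "EX v:carrier R - P. ALL a:ys. v \<otimes> a = \<zero>"
 proof (rule common_denominator[OF P ys(2)])
  fix a assume "a : ys"
  then show "EX v:carrier R - P. v \<otimes> a = \<zero>"
   using z[of a] loc_ring_frac_zero_iff[OF P, of a \<one>] ysI ys(1) prime_one[OF P] by blast
 next
  fix a s s' assume "a : ys" "s : carrier R - P" "s' : carrier R - P" "s \<otimes> a = \<zero>"
  then show "s' \<otimes> s \<otimes> a = \<zero>" using ys(1) by (auto simp: m_assoc subset_iff)
 qed
 then obtain v where v: "v : carrier R - P" "!!a. a : ys ==> v \<otimes> a = \<zero>" by blast
 have "I <= {a : carrier R. v \<otimes> a = \<zero>}" unfolding ys(3)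
 proof (rule genideal_minimal)
  show "ideal {a : carrier R. v \<otimes> a = \<zero>} R"
   using RM.ideal_colon[OF RM.submodule_singleton_zero, of v] v(1) m_comm
   by (simp add: colon_def cong: conj_cong)
  show "ys <= {a : carrier R. v \<otimes> a = \<zero>}" using v(2) ys(1) by blast
 qed
 then show ?thesis using v(1) by blast
qed

end

subsection \<open>The fiber cone of the zero ideal\<close>

lemma (in cring) ring_module_coset: "H +>\<^bsub>rm\<^esub> a = H +> a"
 by (simp add: a_r_coset_def')

context local_ring
begin

text \<open>For the zero ideal only degree 0 survives, and it is the residue field: every nonzero
  element is invertible, so zero is the only possible prime and the dimension is 0.\<close>

lemma fiber_cone_zero_dim: "krull_dim (fiber_cone R \<mm> {\<zero>}) ~= 1"
proof -
 let ?K = "fiber_cone R \<mm> {\<zero>}"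
 let ?Q = "fiber_piece R \<mm> {\<zero>}"
 let ?N = "rm\<lparr>carrier := {\<zero>}\<rparr>"
 have pow: "ideal_pow R {\<zero>} n = {\<zero>}" if "n ~= 0" for n
  using ideal_pow_subset[OF zeroideal, of n] ideal_zero[OF ideal_pow_ideal[OF zeroideal], of n] that by blast
 have m1: "\<mm> \<cdot> carrier R = \<mm>" by (rule ideal_prod_one[OF max_ideal])
 have m0: "\<mm> \<cdot> {\<zero>} = {\<zero>}"
  using ideal_prod_inter[OF max_ideal zeroideal] ideal_zero[OF ideal_prod_is_ideal[OF max_ideal zeroideal]] by blast
 have Q0: "?Q 0 = quot_module rm \<mm>"
 proof -
  have "rm\<lparr>carrier := carrier R\<rparr> = rm" by (simp add: ring_module_def mk_module_def)
  then show ?thesis by (simp only: fiber_piece_def ideal_pow_0 m1)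
 qed
 have Qn: "?Q n = quot_module ?N {\<zero>}" if "n ~= 0" for n
  by (simp only: fiber_piece_def pow[OF that] m0)
 interpret A: plain_module R rm by (intro plain_module.intro module_ring_module)
 have ms: "submodule \<mm> R rm" using max_ideal by (simp add: ideal_iff_submodule)
 interpret Q: plain_module R "quot_module rm \<mm>" by (intro plain_module.intro A.module_quot ms)
 have zs: "submodule {\<zero>} R rm" using zeroideal by (simp add: ideal_iff_submodule)
 interpret N: plain_module R ?N
  by (intro plain_module.intro submodule.submodule_is_module[OF zs module_ring_module])
 have QNc: "carrier (quot_module ?N {\<zero>}) = {{\<zero>}}"
  by (auto simp: N.quot_carrier a_r_coset_def')
 have Qz: "\<zero>\<^bsub>?Q n\<^esub> = (if n = 0 then \<mm> else {\<zero>})" for n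
  using Q0 Qn[of n] A.quot_zero[of \<mm>] N.quot_zero[of "{\<zero>}"] by (cases "n = 0") simp_all
 note Kdef = fiber_cone_def
 have Kc: "F : carrier ?K \<longleftrightarrow> F 0 : carrier (quot_module rm \<mm>) & (ALL n. n ~= 0 --> F n = {\<zero>})" for F
 proof
  assume F: "F : carrier ?K"
  have "F n : carrier (?Q n)" for n using F by (simp add: Kdef)
  then have "F 0 : carrier (?Q 0)" "!!n. n ~= 0 ==> F n : carrier (quot_module ?N {\<zero>})" using Qn by metis+
  then show "F 0 : carrier (quot_module rm \<mm>) & (ALL n. n ~= 0 --> F n = {\<zero>})"
   unfolding Q0 QNc by blast
 next
  assume F: "F 0 : carrier (quot_module rm \<mm>) & (ALL n. n ~= 0 --> F n = {\<zero>})"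
  have "F n : carrier (?Q n)" for n using F Q0 Qn[of n] QNc by (cases "n = 0") simp_all
  moreover have "finite {n. F n ~= \<zero>\<^bsub>?Q n\<^esub>}" by (rule finite_subset[of _ "{0}"]) (use F Qz in auto)
  ultimately show "F : carrier ?K" by (simp add: Kdef)
 qed
 have Kz: "\<zero>\<^bsub>?K\<^esub> = (%n. \<zero>\<^bsub>?Q n\<^esub>)" by (simp add: Kdef)
 have prime_zero: "C = {\<zero>\<^bsub>?K\<^esub>}" if C: "primeideal C ?K" for C
 proof -
  interpret C: primeideal C ?K by fact
  have "F = \<zero>\<^bsub>?K\<^esub>" if F: "F : C" for F
  proof (rule ccontr)
   assume nz: "F ~= \<zero>\<^bsub>?K\<^esub>"
   have FK: "F : carrier ?K" by (rule C.Icarr[OF F])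
   then have Fn: "!!n. n ~= 0 ==> F n = {\<zero>}" and F0: "F 0 : carrier (quot_module rm \<mm>)"
    using Kc[of F] by simp_all
   have "F 0 ~= \<mm>"
   proof
    assume "F 0 = \<mm>"
    then have "F n = \<zero>\<^bsub>?K\<^esub> n" for n using Fn[of n] Qz[of n] by (simp add: Kz)
    then show False using nz by blast
   qed
   obtain a where a: "a : carrier R" "F 0 = \<mm> +>\<^bsub>rm\<^esub> a" using F0 by (auto simp: A.quot_carrier)
   have am: "a ~: \<mm>" using \<open>F 0 ~= \<mm>\<close> A.coset_zero_iff[OF ms, of a] a by simp
   obtain b where b: "b : carrier R" "b \<otimes> a = \<one>" using inverse_exists[OF a(1) am] by blast
   \<comment> \<open>The inverse of \<open>F\<close>, concentrated in degree 0, where it is the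
     class of the inverse \<open>b\<close> of \<open>a\<close>.\<close>
   define G where "G = (%n::nat. if n = 0 then \<mm> +>\<^bsub>rm\<^esub> b else {\<zero>})"
   have GK: "G : carrier ?K" using b by (auto simp: Kc G_def A.quot_carrier)
   have GF: "(G \<otimes>\<^bsub>?K\<^esub> F) n = (\<Oplus>\<^bsub>?Q n\<^esub>i\<in>{..n}. \<Union>x\<in>G i. \<Union>y\<in>F (n - i). (\<mm> \<cdot> ideal_pow R {\<zero>} n) +> (x \<otimes> y))" for n
    by (simp add: Kdef)
   have "(G \<otimes>\<^bsub>?K\<^esub> F) n = \<one>\<^bsub>?K\<^esub> n" for n
   proof (cases "n = 0")
    case True
    have "\<mm> +> (x \<otimes> y) = \<mm> +>\<^bsub>rm\<^esub> \<one>" if x: "x : G 0" and y: "y : F 0" for x y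
    proof -
     have x': "x : carrier R" "x \<ominus> b : \<mm>"
      using A.coset_memD[OF ms, of b x] A.coset_eq_iff[OF ms, of x b] x b by (auto simp: G_def ring_module_minus)
     have y': "y : carrier R" "y \<ominus> a : \<mm>"
      using A.coset_memD[OF ms, of a y] A.coset_eq_iff[OF ms, of y a] y a by (auto simp: ring_module_minus)
     have "x \<otimes> y \<ominus> \<one> = (x \<ominus> b) \<otimes> y \<oplus> b \<otimes> (y \<ominus> a)"
      using x'(1) y'(1) a(1) b(1) unfolding b(2)[symmetric] by algebra
     also have "\<dots> : \<mm>"
      using x' y' b(1) by (intro ideal_add[OF max_ideal] ideal_rmult[OF max_ideal] ideal_lmult[OF max_ideal])
     finally show ?thesis
      using A.coset_eq_iff[OF ms, of "x \<otimes> y" \<one>] x'(1) y'(1) by (simp add: ring_module_minus ring_module_coset)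
    qed
    moreover have "b : G 0" "a : F 0" using A.coset_self[OF ms] a b by (simp_all add: G_def)
    ultimately have "(\<Union>x\<in>G 0. \<Union>y\<in>F 0. \<mm> +> (x \<otimes> y)) = \<mm> +>\<^bsub>rm\<^esub> \<one>" by blast
    moreover have "finsum (?Q 0) f {..0} = f 0" if "f 0 : carrier (quot_module rm \<mm>)" for f :: "nat => 'a set"
     unfolding Q0 using Q.M.finsum_insert[of "{}" 0 f] that by simp
    moreover have "\<mm> +>\<^bsub>rm\<^esub> \<one> : carrier (quot_module rm \<mm>)" by (auto simp: A.quot_carrier)
    moreover have "\<one>\<^bsub>?K\<^esub> 0 = (\<mm> \<cdot> ideal_pow R {\<zero>} 0) +> \<one>" by (simp add: Kdef)
    ultimately show ?thesis unfolding True GF by (simp only: ideal_pow_0 m1 diff_self_eq_0 ring_module_coset)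
   next
    case False
    have "G \<otimes>\<^bsub>?K\<^esub> F : carrier ?K" by (rule C.m_closed[OF GK FK])
    then have "(G \<otimes>\<^bsub>?K\<^esub> F) n = {\<zero>}" using False Kc[of "G \<otimes>\<^bsub>?K\<^esub> F"] by blast
    then show ?thesis using False Qz[of n] by (simp add: Kdef)
   qed
   then have "G \<otimes>\<^bsub>?K\<^esub> F = \<one>\<^bsub>?K\<^esub>" by blast
   then have "\<one>\<^bsub>?K\<^esub> : C" using C.I_l_closed[OF F GK] by simp
   then show False using C.one_imp_carrier C.I_notcarr by blast
  qed
  moreover have "\<zero>\<^bsub>?K\<^esub> : C"
   by (rule additive_subgroup.zero_closed[OF ideal.axioms(1)[OF primeideal.axioms(1)[OF that]]])
  ultimately show ?thesis by blast
 qed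
 have "krull_dim ?K <= 0"
  unfolding krull_dim_def
 proof (rule Sup_least)
  fix l assume "l : {enat n | n C. prime_chain ?K n C}"
  then obtain n C where l: "l = enat n" and C: "prime_chain ?K n C" by blast
  have "n = 0"
  proof (rule ccontr)
   assume "n ~= 0"
   then have "C 0 \<subset> C (Suc 0)" "primeideal (C 0) ?K" "primeideal (C (Suc 0)) ?K"
    using C by (auto simp: prime_chain_def)
   then show False using prime_zero by blast
  qed
  then show "l <= 0" by (simp add: l zero_enat_def)
 qed
 then show ?thesis by auto
qed

end

subsection \<open>Unpacking the hypotheses\<close>

text \<open>Depth 1 provides a nonempty regular sequence. Its first element acts injectively on
  \<open>M\<close> modulo the part of the sequence before it, which is empty, so that the quotient
  is \<open>M/0\<close>.\<close>

lemma (in plain_module) depth_one_regular_element: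
 assumes "depth R m M = 1"
 shows "EX x:m. ALL v:carrier M. x *\<^sub>M v = 0\<^sub>M --> v = 0\<^sub>M"
proof -
 have "EX xs. set xs <= m & regular_sequence R M xs & xs ~= []"
 proof (rule ccontr)
  assume "~ ?thesis"
  then have "depth R m M <= 0"
   unfolding depth_def by (intro Sup_least) (auto simp: zero_enat_def)
  then show False using assms by simp
 qed
 then obtain xs where xs: "set xs <= m" "regular_sequence R M xs" "xs ~= []" by blast
 define x where "x = xs ! 0"
 have "set xs <= carrier R" using xs(2) unfolding regular_sequence_def by blast
 moreover have "x : set xs" unfolding x_def using xs(3) by simp
 ultimately have x: "x : m" "x : carrier R" using xs(1) by auto
 have Z: "ideal_smult R (Idl {}) M = {0\<^sub>M}"
 proof
  have I: "Idl {} <= {\<zero>}" by (rule R.genideal_minimal[OF R.zeroideal]) simp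
  show "ideal_smult R (Idl {}) M <= {0\<^sub>M}"
   unfolding ideal_smult_def by (rule gen_submodule_least[OF submodule_singleton_zero]) (use I in auto)
  show "{0\<^sub>M} <= ideal_smult R (Idl {}) M"
   unfolding ideal_smult_def gen_submodule_def using submodule_zero by blast
 qed
 let ?Q = "quot_module M {0\<^sub>M}"
 have reg: "ALL y:carrier ?Q. x \<odot>\<^bsub>?Q\<^esub> y = \<zero>\<^bsub>?Q\<^esub> --> y = \<zero>\<^bsub>?Q\<^esub>"
 proof -
  have "0 < length xs" using xs(3) by simp
  moreover have "ALL i<length xs. let Q = quot_module M (ideal_smult R (Idl (set (take i xs))) M)
    in ALL y:carrier Q. (xs ! i) \<odot>\<^bsub>Q\<^esub> y = \<zero>\<^bsub>Q\<^esub> --> y = \<zero>\<^bsub>Q\<^esub>"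
   using xs(2) unfolding regular_sequence_def by blast
  ultimately have "let Q = quot_module M (ideal_smult R (Idl (set (take 0 xs))) M)
    in ALL y:carrier Q. (xs ! 0) \<odot>\<^bsub>Q\<^esub> y = \<zero>\<^bsub>Q\<^esub> --> y = \<zero>\<^bsub>Q\<^esub>" by blast
  then show ?thesis by (simp add: Z x_def Let_def)
 qed
 note s = submodule_singleton_zero
 have "v = 0\<^sub>M" if v: "v : carrier M" "x *\<^sub>M v = 0\<^sub>M" for v
 proof -
  have "{0\<^sub>M} +>\<^bsub>M\<^esub> v : carrier ?Q" using v by (auto simp: quot_carrier)
  moreover have "x \<odot>\<^bsub>?Q\<^esub> ({0\<^sub>M} +>\<^bsub>M\<^esub> v) = \<zero>\<^bsub>?Q\<^esub>"
   using quot_smult[OF s x(2) v(1)] coset_zero_iff[OF s, of "x *\<^sub>M v"] v x(2) by (simp add: quot_zero)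
  ultimately have "{0\<^sub>M} +>\<^bsub>M\<^esub> v = \<zero>\<^bsub>?Q\<^esub>" using reg by blast
  then show ?thesis using coset_zero_iff[OF s v(1)] by (simp add: quot_zero)
 qed
 then show ?thesis using x(1) by blast
qed

lemma (in plain_module) finitely_generated_comb:
 assumes "finitely_generated R M"
 shows "EX S. finite S & (%x. x) : S \<rightarrow> carrier M & comb (carrier R) S (%x. x) = carrier M"
proof -
 obtain S where S: "S <= carrier M" "finite S" "gen_submodule R M S = carrier M"
  using assms unfolding finitely_generated_def by blast
 have id: "(%x. x) : S \<rightarrow> carrier M" using S(1) by auto
 have c: "submodule (comb (carrier R) S (%x. x)) R M" by (rule submodule_comb[OF S(2) id R.oneideal])
 have "S <= comb (carrier R) S (%x. x)"
 proof
  fix x assume x: "x : S"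
  then have "x = lc M S (%j. if j = x then \<one> else \<zero>) (%x. x)"
   using lc_single[OF S(2) x R.one_closed id] S(1) by auto
  then show "x : comb (carrier R) S (%x. x)" unfolding comb_def by auto
 qed
 then have "gen_submodule R M S <= comb (carrier R) S (%x. x)" by (rule gen_submodule_least[OF c])
 then have "carrier M <= comb (carrier R) S (%x. x)" unfolding S(3) .
 then show ?thesis using S(2) id submoduleE(1)[OF c] by blast
qed

lemma krull_dim_one_dim:
 assumes "local_ring R m" and dim: "krull_dim R = 1"
  and P: "primeideal P R" "P ~= m" "primeideal Q R" "Q <= P"
 shows "Q = P"
proof (rule ccontr)
 interpret local_ring R m by fact
 assume "Q ~= P"
 define C where "C i = (if i = 0 then Q else if i = 1 then P else m)" for i :: nat
 have "prime_chain R 2 C"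
  using P \<open>Q ~= P\<close> max_prime prime_subset_max[OF P(1)]
  by (auto simp: prime_chain_def C_def less_2_cases_iff)
 then have "enat 2 <= krull_dim R" unfolding krull_dim_def by (intro Sup_upper) blast
 then show False using dim by (simp add: one_enat_def)
qed

lemma krull_dim_one_max_height:
 assumes "local_ring R m" and dim: "krull_dim R = 1"
 shows "prime_height R m ~= 0"
proof
 interpret local_ring R m by fact
 assume 0: "prime_height R m = 0"
 have "EX n C. prime_chain R n C & n ~= 0"
 proof (rule ccontr)
  assume "~ ?thesis"
  then have "krull_dim R <= 0" unfolding krull_dim_def by (intro Sup_least) (auto simp: zero_enat_def)
  then show False using dim by simp
 qed
 then obtain n C where C: "prime_chain R n C" "n ~= 0" by blast
 have c: "primeideal (C 0) R" "primeideal (C 1) R" "C 0 \<subset> C 1" using C by (auto simp: prime_chain_def)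
 have "prime_chain R 1 (%i. if i = 0 then C 0 else m)"
  using c max_prime prime_subset_max[OF c(2)] by (auto simp: prime_chain_def)
 then have "enat 1 <= prime_height R m" unfolding prime_height_def by (intro Sup_upper) fastforce
 then show False using 0 by (simp add: zero_enat_def)
qed

lemma prime_height_minimal:
 assumes P: "primeideal P R" and min: "!!Q. primeideal Q R ==> Q <= P ==> Q = P"
 shows "prime_height R P = 0"
proof -
 have "prime_height R P <= 0"
  unfolding prime_height_def
 proof (rule Sup_least)
  fix l assume "l : {enat n | n C. prime_chain R n C & C n = P}"
  then obtain n C where l: "l = enat n" and C: "prime_chain R n C" "C n = P" by blast
  have "n = 0"
  proof (cases n)
   case (Suc k)
   then have "C k \<subset> P" "primeideal (C k) R" using C by (auto simp: prime_chain_def)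
   then show ?thesis using min by blast
  qed
  then show "l <= 0" by (simp add: l zero_enat_def)
 qed
 then show ?thesis by simp
qed

text \<open>Outside the maximal ideal \<open>I\<close> is locally \<open>0\<close> or the unit ideal, so a power of the
 parameter splits into an element of \<open>I\<close> and one annihilating \<open>I\<close>.\<close>

lemma (in local_ring) parameter_power_splits:
 assumes dim: "!!P Q. primeideal P R ==> P ~= \<mm> ==> primeideal Q R ==> Q <= P ==> Q = P"
  and I: "ideal I R" and lci: "locally_complete_intersection R I"
  and t: "t : \<mm>"
 shows "EX (N::nat) z z'. z : I & z' : carrier R & (ALL a:I. z' \<otimes> a = \<zero>) & t [^] N = z \<oplus> z'"
proof (rule ccontr)
 assume contra: "~ ?thesis"
 note Ic = ideal_subset_carrier[OF I]
 have tc: "t : carrier R" by (rule ideal_carrier[OF max_ideal t])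
 define Ann where "Ann = {c : carrier R. ALL a:I. c \<otimes> a = \<zero>}"
 have Ann: "ideal Ann R"
 proof (rule idealI2)
  fix a b assume ab: "a : Ann" "b : Ann"
  then show "a \<oplus> b : Ann" using Ic by (auto simp: Ann_def l_distr subset_iff)
 next
  fix a b assume "a : carrier R" "b : Ann"
  then show "a \<otimes> b : Ann" using Ic by (auto simp: Ann_def m_assoc subset_iff)
 qed (use Ic in \<open>auto simp: Ann_def subset_iff\<close>)
 have E: "ideal (I <+>\<^bsub>R\<^esub> Ann) R" by (rule add_ideals[OF I Ann])
 have "t [^] (n::nat) ~: I <+>\<^bsub>R\<^esub> Ann" for n
  using contra unfolding mem_set_add Ann_def by blast
 then obtain P where P: "primeideal P R" "I <+>\<^bsub>R\<^esub> Ann <= P" "t ~: P"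
  using prime_avoiding_power[OF E tc] by blast
 have Pm: "P ~= \<mm>" using P(3) t by blast
 have IP: "I <= P" "Ann <= P"
  using set_add_upper1[OF I Ann] set_add_upper2[OF I Ann] P(2) by blast+
 \<comment> \<open>A nonmaximal prime over \<open>I\<close> has height 0, so the regular sequence
   there is empty and \<open>I\<close> vanishes at \<open>P\<close>. The annihilator of
   \<open>I\<close> obtained outside \<open>P\<close> contradicts
   \<open>Ann \<subseteq> P\<close>.\<close>
 have min: "minimal_prime_over R I P"
  unfolding minimal_prime_over_def using P(1) IP(1) dim[OF P(1) Pm] by blast
 then obtain xs where "enat (length xs) = prime_height R P" "loc_ideal R P I = Idl\<^bsub>loc_ring R P\<^esub> (set xs)"
  using lci unfolding locally_complete_intersection_def by blast
 then have "loc_ideal R P I = Idl\<^bsub>loc_ring R P\<^esub> {}"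
  using prime_height_minimal[OF P(1) dim[OF P(1) Pm]] by (simp add: zero_enat_def)
 then obtain v where "v : carrier R - P" "ALL a:I. v \<otimes> a = \<zero>"
  using loc_ideal_zero_imp_annihilator[OF P(1) I] by blast
 then show False using IP(2) by (auto simp: Ann_def)
qed

theorem proposition4p1:
  fixes A :: "('a, 'k) ring_scheme" and m I :: "'a set" and M :: "('a, 'm) module"
  assumes "hypersurface_ring TYPE('s) A m"
    and "krull_dim A = 1"
    and "maximal_cohen_macaulay A m M"
    and "constant_rank A M"
    and "ideal I A"
    and "locally_complete_intersection A I"
    and "ideal_height A I = 0"
    and "analytic_spread A m I = 1"
  shows "poly_deg (tor_polynomial A I M) < 0 \<longleftrightarrow> is_free_module A M"
proof -
 note hyp = assms(1) and dim1 = assms(2) and mcm = assms(3) and cr = assms(4) and I = assms(5)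
  and lci = assms(6) and ht = assms(7) and spread = assms(8)
 obtain S :: "'s ring" and \<nn> f where loc: "noetherian_local_ring A m"
  and S: "regular_local_ring S \<nn>" "f : \<nn>" "adic_completion A m \<simeq> S Quot (PIdl\<^bsub>S\<^esub> f)"
  using hyp unfolding hypersurface_ring_def by auto
 have lr: "local_ring A m" using loc local_ring_iff by blast
 interpret A: local_ring A m by fact
 have mod: "module A M" and fing: "finitely_generated A M" and nz: "carrier M ~= {\<zero>\<^bsub>M\<^esub>}"
  and depth: "depth A m M = 1"
  using mcm dim1 unfolding maximal_cohen_macaulay_def by auto
 interpret noeth_plain A M
  by (intro noeth_plain.intro A.noeth_axioms plain_module.intro mod)
 note dim = krull_dim_one_dim[OF lr dim1]
 obtain X where X: "finite X" "(%x. x) : X \<rightarrow> carrier M" "comb (carrier A) X (%x. x) = carrier M"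
  using finitely_generated_comb[OF fing] by blast
 have Mfg: "fg A M (carrier M)" using fg_comb[OF X(1,2)] X(3) by simp
 obtain x1 where x1: "x1 : m" "!!v. v : carrier M ==> x1 \<odot>\<^bsub>M\<^esub> v = \<zero>\<^bsub>M\<^esub> ==> v = \<zero>\<^bsub>M\<^esub>"
  using depth_one_regular_element[OF depth] by blast
 obtain r :: nat where r: "!!P. associated_prime A P ==>
   module_iso (loc_ring A P) (loc_module A P M) (free_module (loc_ring A P) {..<r})"
  using cr unfolding constant_rank_def by blast
 have "EX u. local_basis A M r P u" if P: "associated_prime A P" for P
 proof -
  have Pp: "primeideal P A" using P unfolding associated_prime_def by blast
  interpret localized_module A M P
   by (intro localized_module.intro A.localized_ring_module Pp localized.intro plain_module_axioms
     localized_axioms.intro)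
  show ?thesis by (rule free_localization_imp_local_basis[OF r[OF P]])
 qed
 then obtain u where u: "!!P. associated_prime A P ==> local_basis A M r P (u P)" by metis
 have nz': "EX v:carrier M. v ~= \<zero>\<^bsub>M\<^esub>" using nz M.zero_closed by blast
 interpret rank_curve A m M x1 r u
 proof (intro rank_curve.intro noeth_module.intro lr A.noeth_axioms mod)
  show "rank_curve_axioms A m M x1 r u"
   by (rule rank_curve_axioms.intro[OF Mfg dim x1 nz' u])
 qed
 \<comment> \<open>\<open>x1\<close> is a nonzerodivisor of the ring that lies in no nonmaximal
   prime, as the passage through \<open>S\<close> requires.\<close>
 obtain x y0 where xy0: "x : m" "y0 : m"
  "!!p. p : m ==> EX a:carrier A. EX b:carrier A. p = a \<otimes>\<^bsub>A\<^esub> x \<oplus>\<^bsub>A\<^esub> b \<otimes>\<^bsub>A\<^esub> y0"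
  using A.hypersurface_two_generators[OF S x1(1) regular_ring[OF x1_carrier only_max_x1] only_max_x1] by blast
 \<comment> \<open>\<open>x\<close> may lie in minimal primes; its modification \<open>t\<close> by
   a power of \<open>y0\<close> avoids them and still generates the maximal ideal together with
   \<open>y0\<close>.\<close>
 obtain t where t: "t : m" "!!P. primeideal P A ==> t : P ==> P = m"
  "!!p. p : m ==> EX a:carrier A. EX b:carrier A. p = a \<otimes>\<^bsub>A\<^esub> t \<oplus>\<^bsub>A\<^esub> b \<otimes>\<^bsub>A\<^esub> y0"
  using exists_parameter[OF xy0] by blast
 have tc: "t : carrier A" by (rule A.ideal_carrier[OF A.max_ideal t(1)])
 have t_ring: "a = \<zero>\<^bsub>A\<^esub>" if "a : carrier A" "t \<otimes>\<^bsub>A\<^esub> a = \<zero>\<^bsub>A\<^esub>" for a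
  using regular_ring[OF tc t(2)] that by blast
 have t_mod: "v = \<zero>\<^bsub>M\<^esub>" if "v : carrier M" "t \<odot>\<^bsub>M\<^esub> v = \<zero>\<^bsub>M\<^esub>" for v
  using regular_module[OF tc t(2)] that by blast
 interpret param_module A m t y0 M
 proof (intro param_module.intro param_ring.intro local_module.intro noeth_module.intro lr A.noeth_axioms mod)
  show "param_ring_axioms A m t y0" by (rule param_ring_axioms.intro[OF t(1) xy0(2) t(3) t_ring t(2)])
  show "param_module_axioms t M" by (rule param_module_axioms.intro[OF t_mod])
 qed
 obtain n N0 where n: "n : {..<r} \<rightarrow> carrier M"
  "!!a i. a : {..<r} \<rightarrow> carrier A ==> lc M {..<r} a n = \<zero>\<^bsub>M\<^esub> ==> i < r ==> a i = \<zero>\<^bsub>A\<^esub>"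
  "!!x. x : carrier M ==> EX a:{..<r} \<rightarrow> carrier A. t [^]\<^bsub>A\<^esub> (N0::nat) \<odot>\<^bsub>M\<^esub> x = lc M {..<r} a n"
  using global_basis[OF t(1)] by metis
 obtain N :: nat and z z' where z: "z : I" "z' : carrier A" "!!a. a : I ==> z' \<otimes>\<^bsub>A\<^esub> a = \<zero>\<^bsub>A\<^esub>"
  "t [^]\<^bsub>A\<^esub> N = z \<oplus>\<^bsub>A\<^esub> z'"
  using A.parameter_power_splits[OF dim I lci t(1)] by blast
 note Ic = ideal_subset_carrier[OF I] and Ip = A.ideal_pow_ideal[OF I]
 have zc: "z : carrier A" using z(1) Ic by blast
 have zt: "z \<otimes>\<^bsub>A\<^esub> a = t [^]\<^bsub>A\<^esub> N \<otimes>\<^bsub>A\<^esub> a" if a: "a : I" for a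
 proof -
  have "a : carrier A" using a Ic by blast
  then show ?thesis unfolding z(4) using zc z(2,3) a by (simp add: A.l_distr)
 qed
 \<comment> \<open>With \<open>z' = 0\<close> a power of \<open>t\<close> would lie in
   \<open>I\<close>, so the maximal ideal would be the only prime over \<open>I\<close>; its height
   is not 0.\<close>
 have z'_nz: "z' ~= \<zero>\<^bsub>A\<^esub>"
 proof
  assume "z' = \<zero>\<^bsub>A\<^esub>"
  then have tI: "t [^]\<^bsub>A\<^esub> N : I" using z(1,4) zc by simp
  have "EX P. primeideal P A & I <= P & prime_height A P = 0"
  proof (rule ccontr)
   assume c: "~ ?thesis"
   have "1 <= ideal_height A I"
    unfolding ideal_height_def
   proof (rule Inf_greatest)
    fix l assume "l : {prime_height A P | P. primeideal P A & I <= P}"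
    then have "l ~= 0" using c by auto
    then show "1 <= l" by (cases l) (auto simp: one_enat_def zero_enat_def)
   qed
   then show False using ht by simp
  qed
  then obtain P where P: "primeideal P A" "I <= P" "prime_height A P = 0" by blast
  have "t : P" using A.prime_pow[OF P(1) tc] tI P(2) by blast
  then have "P = m" by (rule t(2)[OF P(1)])
  then show False using krull_dim_one_max_height[OF lr dim1] P(3) by simp
 qed
 \<comment> \<open>If \<open>I\<close> were zero, its fiber cone would not have dimension 1.\<close>
 have "EX a:I. a ~= \<zero>\<^bsub>A\<^esub>"
 proof (rule ccontr)
  assume "~ ?thesis"
  then have "I = {\<zero>\<^bsub>A\<^esub>}" using A.ideal_zero[OF I] by blast
  then show False using spread A.fiber_cone_zero_dim by (simp add: analytic_spread_def)
 qed
 then obtain a where a: "a : I" "a ~= \<zero>\<^bsub>A\<^esub>" by blast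
 have ac: "a : carrier A" using a Ic by blast
 have tk: "b = \<zero>\<^bsub>A\<^esub>" if "b : carrier A" "t [^]\<^bsub>A\<^esub> (k::nat) \<otimes>\<^bsub>A\<^esub> b = \<zero>\<^bsub>A\<^esub>" for b k
  using that
 proof (induction k)
  case (Suc k)
  have "t \<otimes>\<^bsub>A\<^esub> (t [^]\<^bsub>A\<^esub> k \<otimes>\<^bsub>A\<^esub> b) = \<zero>\<^bsub>A\<^esub>"
   using Suc.prems tc by (simp add: A.m_ac)
  then have "t [^]\<^bsub>A\<^esub> k \<otimes>\<^bsub>A\<^esub> b = \<zero>\<^bsub>A\<^esub>" by (rule t_ring[rotated]) (use Suc.prems(1) tc in simp)
  then show ?case by (rule Suc.IH[OF Suc.prems(1)])
 qed simp
 \<comment> \<open>On \<open>I\<close> the element \<open>z\<close> acts as \<open>t^N\<close>, and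
   \<open>t\<close> is regular, so multiplying \<open>a\<close> by powers of \<open>z\<close> never
   gives zero.\<close>
 have pow_nz: "z [^]\<^bsub>A\<^esub> k \<otimes>\<^bsub>A\<^esub> a : ideal_pow A I (Suc k) & z [^]\<^bsub>A\<^esub> k \<otimes>\<^bsub>A\<^esub> a ~= \<zero>\<^bsub>A\<^esub>" for k :: nat
 proof
  show "z [^]\<^bsub>A\<^esub> k \<otimes>\<^bsub>A\<^esub> a : ideal_pow A I (Suc k)"
   unfolding A.ideal_pow_Suc by (rule ideal_prod.prod[OF A.pow_mem_ideal_pow[OF I z(1)] a(1)])
  show "z [^]\<^bsub>A\<^esub> k \<otimes>\<^bsub>A\<^esub> a ~= \<zero>\<^bsub>A\<^esub>"
  proof (induction k)
   case (Suc k)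
   have "z [^]\<^bsub>A\<^esub> Suc k \<otimes>\<^bsub>A\<^esub> a = z [^]\<^bsub>A\<^esub> k \<otimes>\<^bsub>A\<^esub> (z \<otimes>\<^bsub>A\<^esub> a)" using zc ac by (simp add: A.m_assoc)
   also have "\<dots> = t [^]\<^bsub>A\<^esub> N \<otimes>\<^bsub>A\<^esub> (z [^]\<^bsub>A\<^esub> k \<otimes>\<^bsub>A\<^esub> a)"
    unfolding zt[OF a(1)] using zc ac tc by (simp add: A.m_lcomm)
   finally show ?case using tk[of "z [^]\<^bsub>A\<^esub> k \<otimes>\<^bsub>A\<^esub> a" N] Suc.IH zc ac by auto
  qed (use a(2) ac in simp)
 qed
 obtain p where p: "numerical (%n. module_length A (Tor1 A M (quot_module (ring_module A) (ideal_pow A I n)))) p"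
  using Tor1_numerical[OF I X tc len_t_finite z(1) zt] by blast
 define q where "q = pcompose p [:1, 1:]"
 have q: "is_tor_polynomial A I M q" unfolding q_def by (rule numerical_imp_tor_polynomial[OF p])
 have "q = 0 \<longleftrightarrow> is_free_module A M"
 proof
  \<comment> \<open>Tor then vanishes for all large exponents. One such power of \<open>I\<close>
    serves as the ideal \<open>J\<close> of the counting argument, and \<open>z'\<close> annihilates
    it because \<open>J \<subseteq> I\<close>.\<close>
  assume "q = 0"
  then have "\<forall>\<^sub>F n in sequentially.
    module_length A (Tor1 A M (quot_module (ring_module A) (ideal_pow A I (n + 1)))) = 0"
   using q unfolding is_tor_polynomial_def by (auto elim: eventually_mono simp: zero_enat_def)
  then obtain k where L: "module_length A (Tor1 A M (quot_module (ring_module A) (ideal_pow A I (k + 1)))) = 0"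
   unfolding eventually_sequentially by blast
  define J where "J = ideal_pow A I (k + 1)"
  have J: "ideal J A" unfolding J_def by (rule Ip)
  have JI: "J <= I" unfolding J_def by (rule A.ideal_pow_subset[OF I]) simp
  have J_nz: "EX a:J. a ~= \<zero>\<^bsub>A\<^esub>" using pow_nz[of k] unfolding J_def Suc_eq_plus1 by blast
  have "EX T g. T <= X & g : T \<rightarrow> carrier M & comb (carrier A) T g = carrier M &
    (ALL d:T \<rightarrow> carrier A. lc M T d g = \<zero>\<^bsub>M\<^esub> --> (ALL i:T. d i = \<zero>\<^bsub>A\<^esub>))"
  proof (rule free_of_tor_condition[where S = X and ?g0.0 = "%x. x" and n = n and r = r and
     N = N0 and J = J and z = z', OF X n(1) _ n(3) J J_nz z(2) z'_nz])
   show "a i = \<zero>\<^bsub>A\<^esub>" if "a : {..<r} \<rightarrow> carrier A" "lc M {..<r} a n = \<zero>\<^bsub>M\<^esub>" "i < r" for a i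
    by (rule n(2)[OF that])
   show "z' \<otimes>\<^bsub>A\<^esub> a = \<zero>\<^bsub>A\<^esub>" if "a : J" for a using z(3) that JI by blast
   fix g b D i assume "g : X \<rightarrow> carrier M" "comb (carrier A) X g = carrier M"
    "b : X \<rightarrow> J" "lc M X b g = \<zero>\<^bsub>M\<^esub>" "!!i. i : X ==> ideal (D i) A"
    "!!d i. d : X \<rightarrow> carrier A ==> lc M X d g = \<zero>\<^bsub>M\<^esub> ==> i : X ==> d i : D i" "i : X"
   then show "b i : J \<cdot>\<^bsub>A\<^esub> D i"
    using Tor1_zero_coefficients[OF X(1) _ _ J L[folded J_def], of g b "D i" i] by blast
  qed
  then obtain T g where T: "T <= X" "g : T \<rightarrow> carrier M" "comb (carrier A) T g = carrier M"
   "!!d i. d : T \<rightarrow> carrier A ==> lc M T d g = \<zero>\<^bsub>M\<^esub> ==> i : T ==> d i = \<zero>\<^bsub>A\<^esub>" by blast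
  have one: "\<one>\<^bsub>A\<^esub> ~= \<zero>\<^bsub>A\<^esub>" using A.prime_one[OF A.max_prime] A.ideal_zero[OF A.max_ideal] by metis
  show "is_free_module A M"
  proof (rule free_of_independent[OF one finite_subset[OF T(1) X(1)] T(2,3)])
   show "d i = \<zero>\<^bsub>A\<^esub>" if "d : T \<rightarrow> carrier A" "lc M T d g = \<zero>\<^bsub>M\<^esub>" "i : T" for d i
    by (rule T(4)[OF that])
  qed
 next
  assume "is_free_module A M"
  then have "module_length A (Tor1 A M (quot_module (ring_module A) (ideal_pow A I (k + 1)))) = enat 0" for k
   using free_imp_Tor1_zero[OF Ip] unfolding zero_enat_def by blast
  then have "is_tor_polynomial A I M 0"
   unfolding is_tor_polynomial_def by (intro always_eventually allI exI[of _ 0] conjI) simp_all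
  then show "q = 0" by (rule is_tor_polynomial_unique[OF q])
 qed
 then show ?thesis by (simp add: tor_polynomial_eq[OF q] poly_deg_less_0_iff)
qed

end
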